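(* Let $\mathcal B$ be a pivotal bicategory (with ${}^\dagger X=X^\dagger$ for all 1-morphisms $X$) whose categories of 1-morphisms are idempotent complete. Then its equivariant completion $\mathcal B_{\mathrm{eq}}$ has adjoints. The left and right adjoints of $X\in\mathcal B_{\mathrm{eq}}((a,A),(b,B))$ are $${}^\star X:={}_{\gamma_A^{-1}}({}^\dagger X)\qquad\text{and}\qquad X^\star:=(X^\dagger)_{\gamma_B},$$ respectively, where $\gamma_A,\gamma_B$ are the Nakayama automorphisms of $A$ and $B$.
   Context: Conventions: in a bicategory $\mathcal B$ the composite of $X\in\mathcal B(a,b)$ and $Y\in\mathcal B(b,c)$ is $Y\otimes X\in\mathcal B(a,c)$; $I_a$ is the unit 1-morphism; associators and unitors are suppressed. "Has adjoints" means every 1-morphism has a left and a right adjoint. Pivotal bicategory: every $X\in\mathcal B(a,b)$ comes with a chosen $X^\dagger={}^\dagger X\in\mathcal B(b,a)$ and adjunction maps $\mathrm{ev}_X:X^\dagger\otimes X\to I_a$, $\mathrm{coev}_X:I_b\to X\otimes X^\dagger$ (for $X^\dagger\dashv X$) and $\widetilde{\mathrm{ev}}_X:X\otimes X^\dagger\to I_b$, $\widetilde{\mathrm{coev}}_X:I_a\to X^\dagger\otimes X$ (for $X\dashv X^\dagger$), such that for all $\phi:Z\to X$ one has $(1_{Z^\dagger}\otimes\widetilde{\mathrm{ev}}_X)(1\otimes\phi\otimes1)(\widetilde{\mathrm{coev}}_Z\otimes1_{X^\dagger})=(\mathrm{ev}_X\otimes1_{Z^\dagger})(1\otimes\phi\otimes1)(1_{X^\dagger}\otimes\mathrm{coev}_Z)$,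 and for all composable $X,Y$ the two maps $(Y\otimes X)^\dagger\to X^\dagger\otimes Y^\dagger$ obtained from $(\widetilde{\mathrm{coev}}_X,\widetilde{\mathrm{coev}}_Y,\widetilde{\mathrm{ev}}_{Y\otimes X})$ and from $(\mathrm{coev}_X,\mathrm{coev}_Y,\mathrm{ev}_{Y\otimes X})$ agree. Algebras: an algebra in $\mathcal B(a,a)$ is $A$ with associative $\mu:A\otimes A\to A$ and unit $\eta:I_a\to A$; a coalgebra dually has $\Delta,\varepsilon$. $A$ with both is Frobenius if $(1_A\otimes\mu)(\Delta\otimes 1_A)=\Delta\mu=(\mu\otimes 1_A)(1_A\otimes\Delta)$, separable if $\mu\Delta=1_A$. The Nakayama automorphism of a Frobenius algebra $A$ is $\gamma_A=(\mathrm{ev}_A\otimes1_A)\circ(1_{A^\dagger}\otimes\Delta\eta)\circ(1_{A^\dagger}\otimes\varepsilon\mu)\circ(\widetilde{\mathrm{coev}}_A\otimes1_A)$, with inverse $\gamma_A^{-1}=(1_A\otimes\widetilde{\mathrm{ev}}_A)\circ(\Delta\eta\otimes1_{A^\dagger})\circ(\varepsilon\mu\otimes1_{A^\dagger})\circ(1_A\otimes\mathrm{coev}_A)$. Equivariant completion $\mathcal B_{\mathrm{eq}}$: objects are pairs $(a,A)$ with $A\in\mathcal B(a,a)$ a separable Frobenius algebra; 1-morphisms $(a,A)\to(b,B)$ are $B$-$A$-bimodules in $\mathcal B(a,b)$; 2-morphisms are bimodule maps; composition of $X:(a,A)\to(b,B)$ and $Y:(b,B)\to(c,C)$ is the relative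 tensor product $Y\otimes_BX$ (coequaliser of $Y\otimes B\otimes X\rightrightarrows Y\otimes X$); the unit of $(a,A)$ is $A$. Bimodule structure on ${}^\dagger X=X^\dagger$ for a $B$-$A$-bimodule $X$ with actions $\rho^l:B\otimes X\to X$, $\rho^r:X\otimes A\to X$: left $A$-action $(1_{X^\dagger}\otimes\widetilde{\mathrm{ev}}_X)(1\otimes\rho^r\otimes1)(\widetilde{\mathrm{coev}}_X\otimes1_A\otimes1_{X^\dagger})$ and right $B$-action $(\mathrm{ev}_X\otimes1_{X^\dagger})(1\otimes\rho^l\otimes1)(1_{X^\dagger}\otimes1_B\otimes\mathrm{coev}_X)$. For algebra automorphisms $\alpha,\beta$, the notation ${}_\beta M$ (resp. $M_\alpha$) denotes the same 1-morphism $M$ with the left (resp. right) action precomposed with $\beta$ (resp. $\alpha$) on the algebra factor. *)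

theory Defs
  imports Main
begin

section \<open>Bicategories\<close>

text \<open>
  Bicategories are weak: associators and unitors are data and are written out in all
  formulas. Composition of 1-cells is \<open>Y \<otimes> X : a \<rightarrow> c\<close> for \<open>X : a \<rightarrow> b\<close> and \<open>Y : b \<rightarrow> c\<close>; the
  corresponding horizontal composition of 2-cells is \<open>\<psi> \<star> \<phi>\<close>, vertical composition is
  \<open>g \<cdot> f\<close> (first \<open>f\<close>), \<open>\<one> X\<close> is the identity 2-cell of the 1-cell \<open>X\<close>, and \<open>I a\<close> is the
  unit 1-cell of the object \<open>a\<close>. The operations are only meaningful on composable arguments.
\<close>

record ('o, 'm, 'c) bicat =
  Obj :: "'o set"
  Mor1 :: "'m set"
  src :: "'m \<Rightarrow> 'o"
  tgt :: "'m \<Rightarrow> 'o"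
  Mor2 :: "'c set"
  dom2 :: "'c \<Rightarrow> 'm"
  cod2 :: "'c \<Rightarrow> 'm"
  vcomp :: "'c \<Rightarrow> 'c \<Rightarrow> 'c" (infixr "\<cdot>\<index>" 55)
  id2 :: "'m \<Rightarrow> 'c" ("\<one>\<index>")
  hcomp1 :: "'m \<Rightarrow> 'm \<Rightarrow> 'm" (infix "\<otimes>\<index>" 70)
  hcomp2 :: "'c \<Rightarrow> 'c \<Rightarrow> 'c" (infix "\<star>\<index>" 70)
  unit1 :: "'o \<Rightarrow> 'm" ("I\<index>")
  assoc :: "'m \<Rightarrow> 'm \<Rightarrow> 'm \<Rightarrow> 'c" ("\<a>\<index>")
  lunit :: "'m \<Rightarrow> 'c" ("\<l>\<index>")
  runit :: "'m \<Rightarrow> 'c" ("\<r>\<index>")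

definition hom1 :: "('o, 'm, 'c, 'z) bicat_scheme \<Rightarrow> 'o \<Rightarrow> 'o \<Rightarrow> 'm set" where
  "hom1 B a b = {X \<in> Mor1 B. src B X = a \<and> tgt B X = b}"

definition hom2 :: "('o, 'm, 'c, 'z) bicat_scheme \<Rightarrow> 'm \<Rightarrow> 'm \<Rightarrow> 'c set" where
  "hom2 B X Y = {f \<in> Mor2 B. dom2 B f = X \<and> cod2 B f = Y}"

definition inverse2 :: "('o, 'm, 'c, 'z) bicat_scheme \<Rightarrow> 'c \<Rightarrow> 'c \<Rightarrow> bool" where
  "inverse2 B f g \<longleftrightarrow> f \<in> Mor2 B \<and> g \<in> hom2 B (cod2 B f) (dom2 B f) \<and>
     g \<cdot>\<^bsub>B\<^esub> f = \<one>\<^bsub>B\<^esub> (dom2 B f) \<and> f \<cdot>\<^bsub>B\<^esub> g = \<one>\<^bsub>B\<^esub> (cod2 B f)"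

definition iso2 :: "('o, 'm, 'c, 'z) bicat_scheme \<Rightarrow> 'c \<Rightarrow> bool" where
  "iso2 B f \<longleftrightarrow> (\<exists>g. inverse2 B f g)"

definition inv2 :: "('o, 'm, 'c, 'z) bicat_scheme \<Rightarrow> 'c \<Rightarrow> 'c" where
  "inv2 B f = (THE g. inverse2 B f g)"

definition assoc_inv :: "('o, 'm, 'c, 'z) bicat_scheme \<Rightarrow> 'm \<Rightarrow> 'm \<Rightarrow> 'm \<Rightarrow> 'c" ("\<a>\<^sup>-\<index>") where
  "assoc_inv B Z Y X = inv2 B (assoc B Z Y X)"

definition lunit_inv :: "('o, 'm, 'c, 'z) bicat_scheme \<Rightarrow> 'm \<Rightarrow> 'c" ("\<l>\<^sup>-\<index>") where
  "lunit_inv B X = inv2 B (lunit B X)"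

definition runit_inv :: "('o, 'm, 'c, 'z) bicat_scheme \<Rightarrow> 'm \<Rightarrow> 'c" ("\<r>\<^sup>-\<index>") where
  "runit_inv B X = inv2 B (runit B X)"

locale bicategory =
  fixes B :: "('o, 'm, 'c, 'z) bicat_scheme" (structure)
  assumes src_Obj: "X \<in> Mor1 B \<Longrightarrow> src B X \<in> Obj B"
    and tgt_Obj: "X \<in> Mor1 B \<Longrightarrow> tgt B X \<in> Obj B"
    and dom2_Mor1: "f \<in> Mor2 B \<Longrightarrow> dom2 B f \<in> Mor1 B"
    and cod2_parallel: "f \<in> Mor2 B \<Longrightarrow> cod2 B f \<in> hom1 B (src B (dom2 B f)) (tgt B (dom2 B f))"
    and id2_hom2: "X \<in> Mor1 B \<Longrightarrow> \<one> X \<in> hom2 B X X"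
    and vcomp_hom2: "\<lbrakk>f \<in> hom2 B X Y; g \<in> hom2 B Y Z\<rbrakk> \<Longrightarrow> g \<cdot> f \<in> hom2 B X Z"
    and vcomp_id_right: "f \<in> hom2 B X Y \<Longrightarrow> f \<cdot> \<one> X = f"
    and vcomp_id_left: "f \<in> hom2 B X Y \<Longrightarrow> \<one> Y \<cdot> f = f"
    and vcomp_assoc: "\<lbrakk>f \<in> hom2 B W X; g \<in> hom2 B X Y; h \<in> hom2 B Y Z\<rbrakk>
          \<Longrightarrow> (h \<cdot> g) \<cdot> f = h \<cdot> (g \<cdot> f)"
    and unit1_hom1: "a \<in> Obj B \<Longrightarrow> I a \<in> hom1 B a a"
    and hcomp1_hom1: "\<lbrakk>X \<in> hom1 B a b; Y \<in> hom1 B b c\<rbrakk> \<Longrightarrow> Y \<otimes> X \<in> hom1 B a c"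
    and hcomp2_hom2: "\<lbrakk>X \<in> hom1 B a b; Y \<in> hom1 B b c; \<phi> \<in> hom2 B X X'; \<psi> \<in> hom2 B Y Y'\<rbrakk>
          \<Longrightarrow> \<psi> \<star> \<phi> \<in> hom2 B (Y \<otimes> X) (Y' \<otimes> X')"
    and hcomp2_id: "\<lbrakk>X \<in> hom1 B a b; Y \<in> hom1 B b c\<rbrakk> \<Longrightarrow> \<one> Y \<star> \<one> X = \<one> (Y \<otimes> X)"
    and interchange: "\<lbrakk>X \<in> hom1 B a b; Y \<in> hom1 B b c;
           \<phi> \<in> hom2 B X X'; \<phi>' \<in> hom2 B X' X''; \<psi> \<in> hom2 B Y Y'; \<psi>' \<in> hom2 B Y' Y''\<rbrakk>
          \<Longrightarrow> (\<psi>' \<cdot> \<psi>) \<star> (\<phi>' \<cdot> \<phi>) = (\<psi>' \<star> \<phi>') \<cdot> (\<psi> \<star> \<phi>)"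
    and assoc_hom2: "\<lbrakk>X \<in> hom1 B a b; Y \<in> hom1 B b c; Z \<in> hom1 B c d\<rbrakk>
          \<Longrightarrow> \<a> Z Y X \<in> hom2 B ((Z \<otimes> Y) \<otimes> X) (Z \<otimes> (Y \<otimes> X))"
    and assoc_iso: "\<lbrakk>X \<in> hom1 B a b; Y \<in> hom1 B b c; Z \<in> hom1 B c d\<rbrakk> \<Longrightarrow> iso2 B (\<a> Z Y X)"
    and assoc_natural: "\<lbrakk>X \<in> hom1 B a b; Y \<in> hom1 B b c; Z \<in> hom1 B c d;
           \<phi> \<in> hom2 B X X'; \<psi> \<in> hom2 B Y Y'; \<chi> \<in> hom2 B Z Z'\<rbrakk>
          \<Longrightarrow> \<a> Z' Y' X' \<cdot> ((\<chi> \<star> \<psi>) \<star> \<phi>) = (\<chi> \<star> (\<psi> \<star> \<phi>)) \<cdot> \<a> Z Y X"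
    and lunit_hom2: "X \<in> hom1 B a b \<Longrightarrow> \<l> X \<in> hom2 B (I b \<otimes> X) X"
    and lunit_iso: "X \<in> hom1 B a b \<Longrightarrow> iso2 B (\<l> X)"
    and lunit_natural: "\<lbrakk>X \<in> hom1 B a b; \<phi> \<in> hom2 B X X'\<rbrakk>
          \<Longrightarrow> \<l> X' \<cdot> (\<one> (I b) \<star> \<phi>) = \<phi> \<cdot> \<l> X"
    and runit_hom2: "X \<in> hom1 B a b \<Longrightarrow> \<r> X \<in> hom2 B (X \<otimes> I a) X"
    and runit_iso: "X \<in> hom1 B a b \<Longrightarrow> iso2 B (\<r> X)"
    and runit_natural: "\<lbrakk>X \<in> hom1 B a b; \<phi> \<in> hom2 B X X'\<rbrakk>
          \<Longrightarrow> \<r> X' \<cdot> (\<phi> \<star> \<one> (I a)) = \<phi> \<cdot> \<r> X"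
    and pentagon: "\<lbrakk>X \<in> hom1 B a b; Y \<in> hom1 B b c; Z \<in> hom1 B c d; W \<in> hom1 B d e\<rbrakk>
          \<Longrightarrow> (\<one> W \<star> \<a> Z Y X) \<cdot> \<a> W (Z \<otimes> Y) X \<cdot> (\<a> W Z Y \<star> \<one> X)
              = \<a> W Z (Y \<otimes> X) \<cdot> \<a> (W \<otimes> Z) Y X"
    and triangle: "\<lbrakk>X \<in> hom1 B a b; Y \<in> hom1 B b c\<rbrakk>
          \<Longrightarrow> (\<one> Y \<star> \<l> X) \<cdot> \<a> Y (I b) X = \<r> Y \<star> \<one> X"

definition idempotent_complete_homs :: "('o, 'm, 'c, 'z) bicat_scheme \<Rightarrow> bool" where
  "idempotent_complete_homs B \<longleftrightarrow>
     (\<forall>a\<in>Obj B. \<forall>b\<in>Obj B. \<forall>X\<in>hom1 B a b. \<forall>p\<in>hom2 B X X. p \<cdot>\<^bsub>B\<^esub> p = p \<longrightarrow>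
       (\<exists>Y\<in>hom1 B a b. \<exists>r\<in>hom2 B X Y. \<exists>s\<in>hom2 B Y X.
          s \<cdot>\<^bsub>B\<^esub> r = p \<and> r \<cdot>\<^bsub>B\<^esub> s = \<one>\<^bsub>B\<^esub> Y))"

definition is_coequaliser ::
    "('o, 'm, 'c, 'z) bicat_scheme \<Rightarrow> 'c \<Rightarrow> 'c \<Rightarrow> 'c \<Rightarrow> bool" where
  "is_coequaliser B f g q \<longleftrightarrow>
     f \<in> Mor2 B \<and> g \<in> hom2 B (dom2 B f) (cod2 B f) \<and>
     q \<in> Mor2 B \<and> dom2 B q = cod2 B f \<and> q \<cdot>\<^bsub>B\<^esub> f = q \<cdot>\<^bsub>B\<^esub> g \<and>
     (\<forall>h\<in>Mor2 B. dom2 B h = cod2 B f \<and> h \<cdot>\<^bsub>B\<^esub> f = h \<cdot>\<^bsub>B\<^esub> g \<longrightarrow>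
        (\<exists>!u. u \<in> hom2 B (cod2 B q) (cod2 B h) \<and> u \<cdot>\<^bsub>B\<^esub> q = h))"


section \<open>Adjunctions\<close>

text \<open>\<open>L \<stileturn> R\<close> for \<open>R : a \<rightarrow> b\<close>, with counit \<open>e : L \<otimes> R \<rightarrow> I a\<close> and unit \<open>c : I b \<rightarrow> R \<otimes> L\<close>.\<close>

definition is_adjunction ::
    "('o, 'm, 'c, 'z) bicat_scheme \<Rightarrow> 'm \<Rightarrow> 'm \<Rightarrow> 'c \<Rightarrow> 'c \<Rightarrow> bool" where
  "is_adjunction B L R e c \<longleftrightarrow>
     R \<in> Mor1 B \<and> L \<in> hom1 B (tgt B R) (src B R) \<and>
     e \<in> hom2 B (L \<otimes>\<^bsub>B\<^esub> R) (I\<^bsub>B\<^esub> (src B R)) \<and>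
     c \<in> hom2 B (I\<^bsub>B\<^esub> (tgt B R)) (R \<otimes>\<^bsub>B\<^esub> L) \<and>
     \<r> R \<cdot> (\<one> R \<star> e) \<cdot> \<a> R L R \<cdot> (c \<star> \<one> R) \<cdot> \<l>\<^sup>- R = \<one> R \<and>
     \<l> L \<cdot> (e \<star> \<one> L) \<cdot> \<a>\<^sup>- L R L \<cdot> (\<one> L \<star> c) \<cdot> \<r>\<^sup>- L = \<one> L"
  for B (structure)

definition is_left_adjoint_of :: "('o, 'm, 'c, 'z) bicat_scheme \<Rightarrow> 'm \<Rightarrow> 'm \<Rightarrow> bool" where
  "is_left_adjoint_of B L X \<longleftrightarrow> (\<exists>e c. is_adjunction B L X e c)"

definition is_right_adjoint_of :: "('o, 'm, 'c, 'z) bicat_scheme \<Rightarrow> 'm \<Rightarrow> 'm \<Rightarrow> bool" where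
  "is_right_adjoint_of B R X \<longleftrightarrow> (\<exists>e c. is_adjunction B X R e c)"

definition has_adjoints :: "('o, 'm, 'c, 'z) bicat_scheme \<Rightarrow> bool" where
  "has_adjoints B \<longleftrightarrow>
     (\<forall>X\<in>Mor1 B. (\<exists>L. is_left_adjoint_of B L X) \<and> (\<exists>R. is_right_adjoint_of B R X))"


section \<open>Pivotal bicategories\<close>

text \<open>\<open>evt\<close> and \<open>coevt\<close> are the maps usually written with a tilde.\<close>

record ('o, 'm, 'c) pivotal_bicat = "('o, 'm, 'c) bicat" +
  dagger :: "'m \<Rightarrow> 'm" ("_\<^sup>\<dagger>\<index>" [1000] 999)
  ev :: "'m \<Rightarrow> 'c"
  coev :: "'m \<Rightarrow> 'c"
  evt :: "'m \<Rightarrow> 'c"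
  coevt :: "'m \<Rightarrow> 'c"

text \<open>
  For \<open>c : I \<rightarrow> W \<otimes> Z\<close>, \<open>\<phi> : Z \<rightarrow> X\<close> and \<open>e : X \<otimes> V \<rightarrow> I\<close> the map
  \<open>(1 \<otimes> e) (1 \<otimes> \<phi> \<otimes> 1) (c \<otimes> 1) : V \<rightarrow> W\<close>; dually
  for \<open>e : V \<otimes> X \<rightarrow> I\<close> and \<open>c : I \<rightarrow> Z \<otimes> W\<close> the map \<open>(e \<otimes> 1) (1 \<otimes> \<phi> \<otimes> 1) (1 \<otimes> c) : V \<rightarrow> W\<close>.
\<close>

definition transpose_right ::
    "('o, 'm, 'c, 'z) bicat_scheme \<Rightarrow> 'm \<Rightarrow> 'm \<Rightarrow> 'c \<Rightarrow> 'c \<Rightarrow> 'c \<Rightarrow> 'c" where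
  "transpose_right B V W c \<phi> e =
     \<r> W \<cdot> (\<one> W \<star> e) \<cdot> (\<one> W \<star> (\<phi> \<star> \<one> V)) \<cdot> \<a> W (dom2 B \<phi>) V \<cdot> (c \<star> \<one> V) \<cdot> \<l>\<^sup>- V"
  for B (structure)

definition transpose_left ::
    "('o, 'm, 'c, 'z) bicat_scheme \<Rightarrow> 'm \<Rightarrow> 'm \<Rightarrow> 'c \<Rightarrow> 'c \<Rightarrow> 'c \<Rightarrow> 'c" where
  "transpose_left B V W c \<phi> e =
     \<l> W \<cdot> (e \<star> \<one> W) \<cdot> \<a>\<^sup>- V (cod2 B \<phi>) W \<cdot> (\<one> V \<star> (\<phi> \<star> \<one> W)) \<cdot> (\<one> V \<star> c) \<cdot> \<r>\<^sup>- V"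
  for B (structure)

text \<open>
  For \<open>p : I u \<rightarrow> P \<otimes> Q\<close> and \<open>q : I v \<rightarrow> R \<otimes> S\<close> with \<open>Q : u \<rightarrow> v\<close>, \<open>P : v \<rightarrow> u\<close>: the map
  \<open>I u \<rightarrow> P \<otimes> Q \<rightarrow> (P \<otimes> R) \<otimes> (S \<otimes> Q)\<close> inserting \<open>q\<close> between \<open>P\<close> and \<open>Q\<close>.
\<close>

definition nest_units ::
    "('o, 'm, 'c, 'z) bicat_scheme \<Rightarrow> 'm \<Rightarrow> 'm \<Rightarrow> 'c \<Rightarrow> 'm \<Rightarrow> 'm \<Rightarrow> 'c \<Rightarrow> 'c" where
  "nest_units B P Q p R S q =
     \<a>\<^sup>- P R (S \<otimes> Q) \<cdot> (\<one> P \<star> \<a> R S Q) \<cdot> (\<one> P \<star> (q \<star> \<one> Q)) \<cdot> (\<one> P \<star> \<l>\<^sup>- Q) \<cdot> p"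
  for B (structure)

locale pivotal_bicategory = bicategory B
  for B :: "('o, 'm, 'c, 'z) pivotal_bicat_scheme" (structure) +
  assumes dagger_left_adjoint: "X \<in> Mor1 B \<Longrightarrow> is_adjunction B (X\<^sup>\<dagger>) X (ev B X) (coev B X)"
    and dagger_right_adjoint: "X \<in> Mor1 B \<Longrightarrow> is_adjunction B X (X\<^sup>\<dagger>) (evt B X) (coevt B X)"
    and pivotal_2cell: "\<lbrakk>Z \<in> Mor1 B; \<phi> \<in> hom2 B Z X\<rbrakk>
          \<Longrightarrow> transpose_right B (X\<^sup>\<dagger>) (Z\<^sup>\<dagger>) (coevt B Z) \<phi> (evt B X)
              = transpose_left B (X\<^sup>\<dagger>) (Z\<^sup>\<dagger>) (coev B Z) \<phi> (ev B X)"
    and pivotal_hcomp: "\<lbrakk>X \<in> hom1 B a b; Y \<in> hom1 B b c\<rbrakk>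
          \<Longrightarrow> transpose_right B ((Y \<otimes> X)\<^sup>\<dagger>) (X\<^sup>\<dagger> \<otimes> Y\<^sup>\<dagger>)
                (nest_units B (X\<^sup>\<dagger>) X (coevt B X) (Y\<^sup>\<dagger>) Y (coevt B Y)) (\<one> (Y \<otimes> X)) (evt B (Y \<otimes> X))
              = transpose_left B ((Y \<otimes> X)\<^sup>\<dagger>) (X\<^sup>\<dagger> \<otimes> Y\<^sup>\<dagger>)
                (nest_units B Y (Y\<^sup>\<dagger>) (coev B Y) X (X\<^sup>\<dagger>) (coev B X)) (\<one> (Y \<otimes> X)) (ev B (Y \<otimes> X))"


section \<open>Separable Frobenius algebras and bimodules\<close>

record ('m, 'c) frob =
  carr :: "'m"
  mult :: "'c"
  unt :: "'c"
  comult :: "'c"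
  counit :: "'c"

definition is_algebra ::
    "('o, 'm, 'c, 'z) bicat_scheme \<Rightarrow> 'o \<Rightarrow> 'm \<Rightarrow> 'c \<Rightarrow> 'c \<Rightarrow> bool" where
  "is_algebra B a A \<mu> \<eta> \<longleftrightarrow>
     a \<in> Obj B \<and> A \<in> hom1 B a a \<and> \<mu> \<in> hom2 B (A \<otimes> A) A \<and> \<eta> \<in> hom2 B (I a) A \<and>
     \<mu> \<cdot> (\<mu> \<star> \<one> A) = \<mu> \<cdot> (\<one> A \<star> \<mu>) \<cdot> \<a> A A A \<and>
     \<mu> \<cdot> (\<eta> \<star> \<one> A) = \<l> A \<and> \<mu> \<cdot> (\<one> A \<star> \<eta>) = \<r> A"
  for B (structure)

definition is_coalgebra ::
    "('o, 'm, 'c, 'z) bicat_scheme \<Rightarrow> 'o \<Rightarrow> 'm \<Rightarrow> 'c \<Rightarrow> 'c \<Rightarrow> bool" where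
  "is_coalgebra B a A \<Delta> \<epsilon> \<longleftrightarrow>
     a \<in> Obj B \<and> A \<in> hom1 B a a \<and> \<Delta> \<in> hom2 B A (A \<otimes> A) \<and> \<epsilon> \<in> hom2 B A (I a) \<and>
     \<a> A A A \<cdot> (\<Delta> \<star> \<one> A) \<cdot> \<Delta> = (\<one> A \<star> \<Delta>) \<cdot> \<Delta> \<and>
     \<l> A \<cdot> (\<epsilon> \<star> \<one> A) \<cdot> \<Delta> = \<one> A \<and> \<r> A \<cdot> (\<one> A \<star> \<epsilon>) \<cdot> \<Delta> = \<one> A"
  for B (structure)

definition is_frobenius ::
    "('o, 'm, 'c, 'z) bicat_scheme \<Rightarrow> 'o \<Rightarrow> ('m, 'c) frob \<Rightarrow> bool" where
  "is_frobenius B a F \<longleftrightarrow>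
     (let A = carr F; \<mu> = mult F; \<Delta> = comult F in
       is_algebra B a A \<mu> (unt F) \<and> is_coalgebra B a A \<Delta> (counit F) \<and>
       (\<one> A \<star> \<mu>) \<cdot> \<a> A A A \<cdot> (\<Delta> \<star> \<one> A) = \<Delta> \<cdot> \<mu> \<and>
       \<Delta> \<cdot> \<mu> = (\<mu> \<star> \<one> A) \<cdot> \<a>\<^sup>- A A A \<cdot> (\<one> A \<star> \<Delta>))"
  for B (structure)

definition is_separable :: "('o, 'm, 'c, 'z) bicat_scheme \<Rightarrow> ('m, 'c) frob \<Rightarrow> bool" where
  "is_separable B F \<longleftrightarrow> mult F \<cdot>\<^bsub>B\<^esub> comult F = \<one>\<^bsub>B\<^esub> (carr F)"

definition nakayama :: "('o, 'm, 'c, 'z) pivotal_bicat_scheme \<Rightarrow> ('m, 'c) frob \<Rightarrow> 'c" where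
  "nakayama B F =
     (let A = carr F in
       \<l> A \<cdot> (ev B A \<star> \<one> A) \<cdot> \<a>\<^sup>- (A\<^sup>\<dagger>) A A \<cdot> (\<one> (A\<^sup>\<dagger>) \<star> (comult F \<cdot> unt F)) \<cdot>
       (\<one> (A\<^sup>\<dagger>) \<star> (counit F \<cdot> mult F)) \<cdot> \<a> (A\<^sup>\<dagger>) A A \<cdot> (coevt B A \<star> \<one> A) \<cdot> \<l>\<^sup>- A)"
  for B (structure)

definition nakayama_inv :: "('o, 'm, 'c, 'z) pivotal_bicat_scheme \<Rightarrow> ('m, 'c) frob \<Rightarrow> 'c" where
  "nakayama_inv B F =
     (let A = carr F in
       \<r> A \<cdot> (\<one> A \<star> evt B A) \<cdot> \<a> A A (A\<^sup>\<dagger>) \<cdot> ((comult F \<cdot> unt F) \<star> \<one> (A\<^sup>\<dagger>)) \<cdot>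
       ((counit F \<cdot> mult F) \<star> \<one> (A\<^sup>\<dagger>)) \<cdot> \<a>\<^sup>- A A (A\<^sup>\<dagger>) \<cdot> (\<one> A \<star> coev B A) \<cdot> \<r>\<^sup>- A)"
  for B (structure)

text \<open>
  A bimodule \<open>(a, A) \<rightarrow> (b, B)\<close> carries its source \<open>(a, A)\<close> and target \<open>(b, B)\<close>; \<open>lact\<close> is the
  action of \<open>B\<close> and \<open>ract\<close> the action of \<open>A\<close>.
\<close>

record ('o, 'm, 'c) bimod =
  bsrc :: "'o \<times> ('m, 'c) frob"
  btgt :: "'o \<times> ('m, 'c) frob"
  bcarr :: "'m"
  lact :: "'c"
  ract :: "'c"

abbreviation src_alg :: "('o, 'm, 'c) bimod \<Rightarrow> ('m, 'c) frob" where
  "src_alg X \<equiv> snd (bsrc X)"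

abbreviation tgt_alg :: "('o, 'm, 'c) bimod \<Rightarrow> ('m, 'c) frob" where
  "tgt_alg X \<equiv> snd (btgt X)"

definition is_bimodule :: "('o, 'm, 'c, 'z) bicat_scheme \<Rightarrow> ('o, 'm, 'c) bimod \<Rightarrow> bool" where
  "is_bimodule B M \<longleftrightarrow>
     (let X = bcarr M; \<rho>l = lact M; \<rho>r = ract M;
          S = carr (src_alg M); T = carr (tgt_alg M) in
       X \<in> hom1 B (fst (bsrc M)) (fst (btgt M)) \<and>
       \<rho>l \<in> hom2 B (T \<otimes> X) X \<and> \<rho>r \<in> hom2 B (X \<otimes> S) X \<and>
       \<rho>l \<cdot> (mult (tgt_alg M) \<star> \<one> X) = \<rho>l \<cdot> (\<one> T \<star> \<rho>l) \<cdot> \<a> T T X \<and>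
       \<rho>l \<cdot> (unt (tgt_alg M) \<star> \<one> X) = \<l> X \<and>
       \<rho>r \<cdot> (\<rho>r \<star> \<one> S) = \<rho>r \<cdot> (\<one> X \<star> mult (src_alg M)) \<cdot> \<a> X S S \<and>
       \<rho>r \<cdot> (\<one> X \<star> unt (src_alg M)) = \<r> X \<and>
       \<rho>r \<cdot> (\<rho>l \<star> \<one> S) = \<rho>l \<cdot> (\<one> T \<star> \<rho>r) \<cdot> \<a> T X S)"
  for B (structure)

record ('o, 'm, 'c) bimod_map =
  bdom :: "('o, 'm, 'c) bimod"
  bcod :: "('o, 'm, 'c) bimod"
  bmap :: "'c"

definition is_bimodule_map ::
    "('o, 'm, 'c, 'z) bicat_scheme \<Rightarrow> ('o, 'm, 'c) bimod_map \<Rightarrow> bool" where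
  "is_bimodule_map B h \<longleftrightarrow>
     (let X = bdom h; Y = bcod h; f = bmap h in
       bsrc X = bsrc Y \<and> btgt X = btgt Y \<and>
       f \<in> hom2 B (bcarr X) (bcarr Y) \<and>
       f \<cdot> lact X = lact Y \<cdot> (\<one> (carr (tgt_alg X)) \<star> f) \<and>
       f \<cdot> ract X = ract Y \<cdot> (f \<star> \<one> (carr (src_alg X))))"
  for B (structure)

definition dual_bimod ::
    "('o, 'm, 'c, 'z) pivotal_bicat_scheme \<Rightarrow> ('o, 'm, 'c) bimod \<Rightarrow> ('o, 'm, 'c) bimod" where
  "dual_bimod B M =
     (let X = bcarr M; S = carr (src_alg M); T = carr (tgt_alg M) in
       \<lparr> bsrc = btgt M, btgt = bsrc M, bcarr = X\<^sup>\<dagger>,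
         lact = \<r> (X\<^sup>\<dagger>) \<cdot> (\<one> (X\<^sup>\<dagger>) \<star> evt B X) \<cdot> (\<one> (X\<^sup>\<dagger>) \<star> (ract M \<star> \<one> (X\<^sup>\<dagger>))) \<cdot>
                (\<one> (X\<^sup>\<dagger>) \<star> \<a>\<^sup>- X S (X\<^sup>\<dagger>)) \<cdot> \<a> (X\<^sup>\<dagger>) X (S \<otimes> X\<^sup>\<dagger>) \<cdot>
                (coevt B X \<star> \<one> (S \<otimes> X\<^sup>\<dagger>)) \<cdot> \<l>\<^sup>- (S \<otimes> X\<^sup>\<dagger>),
         ract = \<l> (X\<^sup>\<dagger>) \<cdot> (ev B X \<star> \<one> (X\<^sup>\<dagger>)) \<cdot> \<a>\<^sup>- (X\<^sup>\<dagger>) X (X\<^sup>\<dagger>) \<cdot>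
                (\<one> (X\<^sup>\<dagger>) \<star> (lact M \<star> \<one> (X\<^sup>\<dagger>))) \<cdot> (\<one> (X\<^sup>\<dagger>) \<star> \<a>\<^sup>- T X (X\<^sup>\<dagger>)) \<cdot>
                \<a> (X\<^sup>\<dagger>) T (X \<otimes> X\<^sup>\<dagger>) \<cdot> (\<one> (X\<^sup>\<dagger> \<otimes> T) \<star> coev B X) \<cdot> \<r>\<^sup>- (X\<^sup>\<dagger> \<otimes> T) \<rparr>)"
  for B (structure)

definition twist_left ::
    "('o, 'm, 'c, 'z) bicat_scheme \<Rightarrow> 'c \<Rightarrow> ('o, 'm, 'c) bimod \<Rightarrow> ('o, 'm, 'c) bimod" where
  "twist_left B \<beta> M = M \<lparr> lact := lact M \<cdot>\<^bsub>B\<^esub> (\<beta> \<star>\<^bsub>B\<^esub> \<one>\<^bsub>B\<^esub> (bcarr M)) \<rparr>"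

definition twist_right ::
    "('o, 'm, 'c, 'z) bicat_scheme \<Rightarrow> 'c \<Rightarrow> ('o, 'm, 'c) bimod \<Rightarrow> ('o, 'm, 'c) bimod" where
  "twist_right B \<alpha> M = M \<lparr> ract := ract M \<cdot>\<^bsub>B\<^esub> (\<one>\<^bsub>B\<^esub> (bcarr M) \<star>\<^bsub>B\<^esub> \<alpha>) \<rparr>"

definition left_star ::
    "('o, 'm, 'c, 'z) pivotal_bicat_scheme \<Rightarrow> ('o, 'm, 'c) bimod \<Rightarrow> ('o, 'm, 'c) bimod" where
  "left_star B X = twist_left B (nakayama_inv B (src_alg X)) (dual_bimod B X)"

definition right_star ::
    "('o, 'm, 'c, 'z) pivotal_bicat_scheme \<Rightarrow> ('o, 'm, 'c) bimod \<Rightarrow> ('o, 'm, 'c) bimod" where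
  "right_star B X = twist_right B (nakayama B (tgt_alg X)) (dual_bimod B X)"


section \<open>The equivariant completion\<close>

text \<open>
  \<open>rt_proj B Y X\<close> is a chosen coequaliser \<open>Y \<otimes> X \<rightarrow> Y \<otimes>\<^sub>B X\<close> of the two actions
  \<open>(Y \<otimes> B) \<otimes> X \<rightarrow> Y \<otimes> X\<close> of the middle algebra; its codomain is the relative tensor product.
\<close>

definition rt_proj ::
    "('o, 'm, 'c, 'z) bicat_scheme \<Rightarrow> ('o, 'm, 'c) bimod \<Rightarrow> ('o, 'm, 'c) bimod \<Rightarrow> 'c" where
  "rt_proj B Y X =
     (SOME q. is_coequaliser B (ract Y \<star> \<one> (bcarr X))
        ((\<one> (bcarr Y) \<star> lact X) \<cdot> \<a> (bcarr Y) (carr (tgt_alg X)) (bcarr X)) q)"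
  for B (structure)

text \<open>The unique \<open>u\<close> with \<open>u \<cdot> q = h\<close>.\<close>

definition factor2 :: "('o, 'm, 'c, 'z) bicat_scheme \<Rightarrow> 'c \<Rightarrow> 'c \<Rightarrow> 'c" where
  "factor2 B q h = (THE u. u \<in> hom2 B (cod2 B q) (cod2 B h) \<and> u \<cdot>\<^bsub>B\<^esub> q = h)"

text \<open>
  The actions on \<open>Y \<otimes>\<^sub>B X\<close> are induced by the left action on \<open>Y\<close> and the right action on \<open>X\<close>.
\<close>

definition rel_tensor ::
    "('o, 'm, 'c, 'z) bicat_scheme \<Rightarrow> ('o, 'm, 'c) bimod \<Rightarrow> ('o, 'm, 'c) bimod \<Rightarrow> ('o, 'm, 'c) bimod"
  where
  "rel_tensor B Y X =
     (let q = rt_proj B Y X; S = carr (src_alg X); T = carr (tgt_alg Y) in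
       \<lparr> bsrc = bsrc X, btgt = btgt Y, bcarr = cod2 B q,
         lact = factor2 B (\<one> T \<star> q) (q \<cdot> (lact Y \<star> \<one> (bcarr X)) \<cdot> \<a>\<^sup>- T (bcarr Y) (bcarr X)),
         ract = factor2 B (q \<star> \<one> S) (q \<cdot> (\<one> (bcarr Y) \<star> ract X) \<cdot> \<a> (bcarr Y) (bcarr X) S) \<rparr>)"
  for B (structure)

definition rel_tensor_map ::
    "('o, 'm, 'c, 'z) bicat_scheme \<Rightarrow> ('o, 'm, 'c) bimod_map \<Rightarrow> ('o, 'm, 'c) bimod_map
      \<Rightarrow> ('o, 'm, 'c) bimod_map" where
  "rel_tensor_map B \<psi> \<phi> =
     \<lparr> bdom = rel_tensor B (bdom \<psi>) (bdom \<phi>), bcod = rel_tensor B (bcod \<psi>) (bcod \<phi>),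
       bmap = factor2 B (rt_proj B (bdom \<psi>) (bdom \<phi>))
                (rt_proj B (bcod \<psi>) (bcod \<phi>) \<cdot> (bmap \<psi> \<star> bmap \<phi>)) \<rparr>"
  for B (structure)

definition unit_bimod :: "'o \<times> ('m, 'c) frob \<Rightarrow> ('o, 'm, 'c) bimod" where
  "unit_bimod A =
     \<lparr> bsrc = A, btgt = A, bcarr = carr (snd A), lact = mult (snd A), ract = mult (snd A) \<rparr>"

definition rel_assoc ::
    "('o, 'm, 'c, 'z) bicat_scheme \<Rightarrow> ('o, 'm, 'c) bimod \<Rightarrow> ('o, 'm, 'c) bimod \<Rightarrow> ('o, 'm, 'c) bimod
      \<Rightarrow> ('o, 'm, 'c) bimod_map" where
  "rel_assoc B Z Y X =
     \<lparr> bdom = rel_tensor B (rel_tensor B Z Y) X, bcod = rel_tensor B Z (rel_tensor B Y X),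
       bmap = factor2 B (rt_proj B (rel_tensor B Z Y) X \<cdot> (rt_proj B Z Y \<star> \<one> (bcarr X)))
                (rt_proj B Z (rel_tensor B Y X) \<cdot> (\<one> (bcarr Z) \<star> rt_proj B Y X) \<cdot>
                 \<a> (bcarr Z) (bcarr Y) (bcarr X)) \<rparr>"
  for B (structure)

definition rel_lunit ::
    "('o, 'm, 'c, 'z) bicat_scheme \<Rightarrow> ('o, 'm, 'c) bimod \<Rightarrow> ('o, 'm, 'c) bimod_map" where
  "rel_lunit B X =
     \<lparr> bdom = rel_tensor B (unit_bimod (btgt X)) X, bcod = X,
       bmap = factor2 B (rt_proj B (unit_bimod (btgt X)) X) (lact X) \<rparr>"

definition rel_runit ::
    "('o, 'm, 'c, 'z) bicat_scheme \<Rightarrow> ('o, 'm, 'c) bimod \<Rightarrow> ('o, 'm, 'c) bimod_map" where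
  "rel_runit B X =
     \<lparr> bdom = rel_tensor B X (unit_bimod (bsrc X)), bcod = X,
       bmap = factor2 B (rt_proj B X (unit_bimod (bsrc X))) (ract X) \<rparr>"

definition equivariant_completion ::
    "('o, 'm, 'c, 'z) bicat_scheme \<Rightarrow>
     ('o \<times> ('m, 'c) frob, ('o, 'm, 'c) bimod, ('o, 'm, 'c) bimod_map) bicat" where
  "equivariant_completion B =
     (let Ob = {(a, A). is_frobenius B a A \<and> is_separable B A};
          Bim = {X. bsrc X \<in> Ob \<and> btgt X \<in> Ob \<and> is_bimodule B X} in
     \<lparr> Obj = Ob,
       Mor1 = Bim,
       src = bsrc,
       tgt = btgt,
       Mor2 = {f. bdom f \<in> Bim \<and> bcod f \<in> Bim \<and> is_bimodule_map B f},
       dom2 = bdom,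
       cod2 = bcod,
       vcomp = (\<lambda>g f. \<lparr> bdom = bdom f, bcod = bcod g, bmap = bmap g \<cdot>\<^bsub>B\<^esub> bmap f \<rparr>),
       id2 = (\<lambda>X. \<lparr> bdom = X, bcod = X, bmap = \<one>\<^bsub>B\<^esub> (bcarr X) \<rparr>),
       hcomp1 = rel_tensor B,
       hcomp2 = rel_tensor_map B,
       unit1 = unit_bimod,
       assoc = rel_assoc B,
       lunit = rel_lunit B,
       runit = rel_runit B \<rparr>)"

end

theory Submission
  imports Defs
begin

text \<open>
  Separability makes \<open>y \<otimes> x \<mapsto> y \<cdot> \<Delta>\<eta> \<cdot> x\<close> an idempotent on \<open>Y \<otimes> X\<close> that splits the coequaliser
  \<open>Y \<otimes>\<^sub>B X\<close>. Let \<open>L \<stileturn> R\<close> be an adjunction in \<open>\<B>\<close> between the carriers of an \<open>A\<close>-\<open>B\<close>-bimodule \<open>L\<close> and a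
  \<open>B\<close>-\<open>A\<close>-bimodule \<open>R\<close> whose actions are mates of each other, where \<open>A\<close> is identified with its dual by
  the Frobenius pairing \<open>\<epsilon>\<mu>\<close>. Then the evaluation precomposed with the coaction \<open>R \<rightarrow> R \<otimes> A\<close> descends
  to a bimodule map \<open>L \<otimes>\<^sub>B R \<rightarrow> A\<close>, acting on the coevaluation gives a bimodule map
  \<open>B \<rightarrow> R \<otimes>\<^sub>A L\<close>, and separability yields the zigzag identities.

  On \<open>X\<^sup>\<dagger>\<close> one of the two actions is the mate for the adjunction at hand, but the other one is
  formed with the opposite adjunction. The pivotal axioms compare it with the mate: applied to the
  action of \<open>A\<close> on \<open>X\<close> they trade duals of \<open>X\<close> for duals of \<open>A\<close>, and applied to \<open>\<epsilon>\<mu> : A \<otimes> A \<rightarrow> I\<close>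
  they show that what remains is the Nakayama automorphism.
\<close>

section \<open>Whiskering and coherence\<close>

text \<open>Coherence is the first obstacle: in a weak bicategory every step of a string diagram
  carries associators and unitors. Each 2-cell is therefore traded for a natural family of 2-cells
  between right-nested composites ending in an arbitrary 1-cell \<open>W\<close>. On families the
  diagrammatic identities hold verbatim, and taking a unit 1-cell for \<open>W\<close> gives the
  2-cell back. The second obstacle is that \<epsilon>\<mu> need not be symmetric. It identifies
  \<open>A\<close> with its dual in two ways, one for each adjunction between them, and the Nakayama
  automorphism measures the difference. The pairing takes values in a unit 1-cell, whose dual then
  enters the pivotal axioms as an extra factor, so the two trivialisations of that dual have to be
  compared first. The bimodule laws of the twisted dual come out of the adjunction itself: an
  equation is tested after evaluation, where it turns into a law of the given bimodule. Finally,
  inverses in the completion are definite descriptions, so explicit inverses of its unitors and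
  associators are constructed before the zigzag identities can be computed.\<close>

lemma hom1_iff: "X \<in> hom1 B a b \<longleftrightarrow> X \<in> Mor1 B \<and> src B X = a \<and> tgt B X = b"
  by (simp add: hom1_def)

lemma hom2_iff: "f \<in> hom2 B X Y \<longleftrightarrow> f \<in> Mor2 B \<and> dom2 B f = X \<and> cod2 B f = Y"
  by (simp add: hom2_def)

context bicategory
begin

text \<open>One-sided composites with an identity get constants of their own, so that formulas have
  a normal form: right-nested vertical composites of whiskered generators.\<close>

definition lwhisker :: "'m \<Rightarrow> 'c \<Rightarrow> 'c" (infixr "\<rhd>" 75) where
  "X \<rhd> f = \<one> X \<star> f"

definition rwhisker :: "'c \<Rightarrow> 'm \<Rightarrow> 'c" (infixl "\<lhd>" 75) where
  "f \<lhd> W = f \<star> \<one> W"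

text \<open>Typing is restated with \<open>src\<close>, \<open>tgt\<close>, \<open>dom2\<close> and
  \<open>cod2\<close> as functions. Composability then becomes an equation that rewriting can
  decide, with no intermediate objects or 1-cells to guess.\<close>

lemma cell1 [simp]:
  "X \<in> Mor1 B \<Longrightarrow> src B X \<in> Obj B"
  "X \<in> Mor1 B \<Longrightarrow> tgt B X \<in> Obj B"
  "a \<in> Obj B \<Longrightarrow> I a \<in> Mor1 B"
  "a \<in> Obj B \<Longrightarrow> src B (I a) = a"
  "a \<in> Obj B \<Longrightarrow> tgt B (I a) = a"
  "\<lbrakk>X \<in> Mor1 B; Y \<in> Mor1 B; src B Y = tgt B X\<rbrakk> \<Longrightarrow> Y \<otimes> X \<in> Mor1 B"
  "\<lbrakk>X \<in> Mor1 B; Y \<in> Mor1 B; src B Y = tgt B X\<rbrakk> \<Longrightarrow> src B (Y \<otimes> X) = src B X"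
  "\<lbrakk>X \<in> Mor1 B; Y \<in> Mor1 B; src B Y = tgt B X\<rbrakk> \<Longrightarrow> tgt B (Y \<otimes> X) = tgt B Y"
  "f \<in> Mor2 B \<Longrightarrow> dom2 B f \<in> Mor1 B"
  "f \<in> Mor2 B \<Longrightarrow> cod2 B f \<in> Mor1 B"
  "f \<in> Mor2 B \<Longrightarrow> src B (cod2 B f) = src B (dom2 B f)"
  "f \<in> Mor2 B \<Longrightarrow> tgt B (cod2 B f) = tgt B (dom2 B f)"
  using src_Obj tgt_Obj unit1_hom1 hcomp1_hom1[of X "src B X" "tgt B X" Y "tgt B Y"]
    dom2_Mor1 cod2_parallel
  by (auto simp: hom1_iff)

lemma cell2 [simp]:
  "X \<in> Mor1 B \<Longrightarrow> \<one> X \<in> Mor2 B"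
  "X \<in> Mor1 B \<Longrightarrow> dom2 B (\<one> X) = X"
  "X \<in> Mor1 B \<Longrightarrow> cod2 B (\<one> X) = X"
  "\<lbrakk>f \<in> Mor2 B; g \<in> Mor2 B; dom2 B g = cod2 B f\<rbrakk> \<Longrightarrow> g \<cdot> f \<in> Mor2 B"
  "\<lbrakk>f \<in> Mor2 B; g \<in> Mor2 B; dom2 B g = cod2 B f\<rbrakk> \<Longrightarrow> dom2 B (g \<cdot> f) = dom2 B f"
  "\<lbrakk>f \<in> Mor2 B; g \<in> Mor2 B; dom2 B g = cod2 B f\<rbrakk> \<Longrightarrow> cod2 B (g \<cdot> f) = cod2 B g"
  "\<lbrakk>f \<in> Mor2 B; g \<in> Mor2 B; src B (dom2 B g) = tgt B (dom2 B f)\<rbrakk> \<Longrightarrow> g \<star> f \<in> Mor2 B"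
  "\<lbrakk>f \<in> Mor2 B; g \<in> Mor2 B; src B (dom2 B g) = tgt B (dom2 B f)\<rbrakk>
    \<Longrightarrow> dom2 B (g \<star> f) = dom2 B g \<otimes> dom2 B f"
  "\<lbrakk>f \<in> Mor2 B; g \<in> Mor2 B; src B (dom2 B g) = tgt B (dom2 B f)\<rbrakk>
    \<Longrightarrow> cod2 B (g \<star> f) = cod2 B g \<otimes> cod2 B f"
  using id2_hom2 vcomp_hom2[of f "dom2 B f" "cod2 B f" g "cod2 B g"]
    hcomp2_hom2[of "dom2 B f" "src B (dom2 B f)" "tgt B (dom2 B f)" "dom2 B g" "tgt B (dom2 B g)"
      f "cod2 B f" g "cod2 B g"]
  by (auto simp: hom1_iff hom2_iff)

lemma vcomp_laws [simp]:
  "\<lbrakk>f \<in> Mor2 B; dom2 B f = X\<rbrakk> \<Longrightarrow> f \<cdot> \<one> X = f"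
  "\<lbrakk>f \<in> Mor2 B; cod2 B f = X\<rbrakk> \<Longrightarrow> \<one> X \<cdot> f = f"
  "\<lbrakk>f \<in> Mor2 B; g \<in> Mor2 B; h \<in> Mor2 B; dom2 B g = cod2 B f; dom2 B h = cod2 B g\<rbrakk>
    \<Longrightarrow> (h \<cdot> g) \<cdot> f = h \<cdot> (g \<cdot> f)"
  using vcomp_id_right[of f "dom2 B f" "cod2 B f"] vcomp_id_left[of f "dom2 B f" "cod2 B f"]
    vcomp_assoc[of f "dom2 B f" "cod2 B f" g "cod2 B g" h "cod2 B h"]
  by (auto simp: hom2_iff)

text \<open>Composites are normalised to the right, so an equation for \<open>g \<cdot> f\<close>
  does not match when something stands after \<open>f\<close>. This form lets it be applied in the
  middle of a composite.\<close>

lemma vcomp_reassoc: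
  assumes "g \<cdot> f = h"
    and "f \<in> Mor2 B" "g \<in> Mor2 B" "k \<in> Mor2 B" "dom2 B f = cod2 B k" "dom2 B g = cod2 B f"
  shows "g \<cdot> (f \<cdot> k) = h \<cdot> k"
  using assms vcomp_laws(3)[of k f g] by simp

lemma interchange':
  "\<lbrakk>f \<in> Mor2 B; g \<in> Mor2 B; f' \<in> Mor2 B; g' \<in> Mor2 B; dom2 B f' = cod2 B f; dom2 B g' = cod2 B g;
    src B (dom2 B g) = tgt B (dom2 B f)\<rbrakk>
    \<Longrightarrow> (g' \<cdot> g) \<star> (f' \<cdot> f) = (g' \<star> f') \<cdot> (g \<star> f)"
  using interchange[of "dom2 B f" "src B (dom2 B f)" "tgt B (dom2 B f)" "dom2 B g"
      "tgt B (dom2 B g)" f "cod2 B f" f' "cod2 B f'" g "cod2 B g" g' "cod2 B g'"]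
  by (auto simp: hom1_iff hom2_iff)

lemma lwhisker_cell [simp]:
  "\<lbrakk>f \<in> Mor2 B; X \<in> Mor1 B; src B X = tgt B (dom2 B f)\<rbrakk> \<Longrightarrow> X \<rhd> f \<in> Mor2 B"
  "\<lbrakk>f \<in> Mor2 B; X \<in> Mor1 B; src B X = tgt B (dom2 B f)\<rbrakk> \<Longrightarrow> dom2 B (X \<rhd> f) = X \<otimes> dom2 B f"
  "\<lbrakk>f \<in> Mor2 B; X \<in> Mor1 B; src B X = tgt B (dom2 B f)\<rbrakk> \<Longrightarrow> cod2 B (X \<rhd> f) = X \<otimes> cod2 B f"
  by (auto simp: lwhisker_def)

lemma rwhisker_cell [simp]:
  "\<lbrakk>f \<in> Mor2 B; W \<in> Mor1 B; src B (dom2 B f) = tgt B W\<rbrakk> \<Longrightarrow> f \<lhd> W \<in> Mor2 B"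
  "\<lbrakk>f \<in> Mor2 B; W \<in> Mor1 B; src B (dom2 B f) = tgt B W\<rbrakk> \<Longrightarrow> dom2 B (f \<lhd> W) = dom2 B f \<otimes> W"
  "\<lbrakk>f \<in> Mor2 B; W \<in> Mor1 B; src B (dom2 B f) = tgt B W\<rbrakk> \<Longrightarrow> cod2 B (f \<lhd> W) = cod2 B f \<otimes> W"
  by (auto simp: rwhisker_def)

lemma whisker_id [simp]:
  "\<lbrakk>X \<in> Mor1 B; Y \<in> Mor1 B; src B Y = tgt B X\<rbrakk> \<Longrightarrow> Y \<rhd> \<one> X = \<one> (Y \<otimes> X)"
  "\<lbrakk>X \<in> Mor1 B; Y \<in> Mor1 B; src B Y = tgt B X\<rbrakk> \<Longrightarrow> \<one> Y \<lhd> X = \<one> (Y \<otimes> X)"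
  using hcomp2_id[of X "src B X" "tgt B X" Y "tgt B Y"]
  by (auto simp: lwhisker_def rwhisker_def hom1_iff)

lemma lwhisker_vcomp [simp]:
  "\<lbrakk>f \<in> Mor2 B; g \<in> Mor2 B; dom2 B g = cod2 B f; X \<in> Mor1 B; src B X = tgt B (dom2 B f)\<rbrakk>
    \<Longrightarrow> X \<rhd> (g \<cdot> f) = X \<rhd> g \<cdot> X \<rhd> f"
  using interchange'[of f "\<one> X" g "\<one> X"] by (simp add: lwhisker_def)

lemma rwhisker_vcomp:
  "\<lbrakk>f \<in> Mor2 B; g \<in> Mor2 B; dom2 B g = cod2 B f; W \<in> Mor1 B; src B (dom2 B f) = tgt B W\<rbrakk>
    \<Longrightarrow> (g \<cdot> f) \<lhd> W = g \<lhd> W \<cdot> f \<lhd> W"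
  using interchange'[of "\<one> W" f "\<one> W" g] by (simp add: rwhisker_def)

lemma hcomp2_rl:
  "\<lbrakk>f \<in> Mor2 B; g \<in> Mor2 B; src B (dom2 B f) = tgt B (dom2 B g)\<rbrakk>
    \<Longrightarrow> f \<star> g = f \<lhd> cod2 B g \<cdot> dom2 B f \<rhd> g"
  using interchange'[of g "\<one> (dom2 B f)" "\<one> (cod2 B g)" f] by (simp add: lwhisker_def rwhisker_def)

lemma hcomp2_lr:
  "\<lbrakk>f \<in> Mor2 B; g \<in> Mor2 B; src B (dom2 B f) = tgt B (dom2 B g)\<rbrakk>
    \<Longrightarrow> f \<star> g = cod2 B f \<rhd> g \<cdot> f \<lhd> dom2 B g"
  using interchange'[of "\<one> (dom2 B g)" f g "\<one> (cod2 B f)"] by (simp add: lwhisker_def rwhisker_def)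

lemma exchange:
  "\<lbrakk>f \<in> Mor2 B; g \<in> Mor2 B; src B (dom2 B f) = tgt B (dom2 B g); cod2 B g = Y'; dom2 B f = X\<rbrakk>
    \<Longrightarrow> f \<lhd> Y' \<cdot> X \<rhd> g = cod2 B f \<rhd> g \<cdot> f \<lhd> dom2 B g"
  using hcomp2_rl hcomp2_lr by metis

section \<open>Inverses of 2-cells and the structural isomorphisms\<close>

lemma inverse2_unique:
  assumes "inverse2 B f g" "inverse2 B f g'"
  shows "g' = g"
proof -
  have "(g' \<cdot> f) \<cdot> g = g' \<cdot> (f \<cdot> g)"
    using assms by (intro vcomp_laws(3)) (auto simp: inverse2_def hom2_iff)
  then show ?thesis
    using assms by (auto simp: inverse2_def hom2_iff simp del: vcomp_laws(3))
qed

lemma inv2_eqI: "inverse2 B f g \<Longrightarrow> inv2 B f = g"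
  unfolding inv2_def using inverse2_unique by blast

lemma inverse2_inv2: "iso2 B f \<Longrightarrow> inverse2 B f (inv2 B f)"
  using inv2_eqI by (auto simp: iso2_def)

lemma assoc_cell [simp]:
  assumes "X \<in> Mor1 B" "Y \<in> Mor1 B" "Z \<in> Mor1 B" "src B Y = tgt B X" "src B Z = tgt B Y"
  shows "\<a> Z Y X \<in> Mor2 B" "dom2 B (\<a> Z Y X) = (Z \<otimes> Y) \<otimes> X" "cod2 B (\<a> Z Y X) = Z \<otimes> (Y \<otimes> X)"
    "\<a>\<^sup>- Z Y X \<in> Mor2 B" "dom2 B (\<a>\<^sup>- Z Y X) = Z \<otimes> (Y \<otimes> X)" "cod2 B (\<a>\<^sup>- Z Y X) = (Z \<otimes> Y) \<otimes> X"
    "\<a> Z Y X \<cdot> \<a>\<^sup>- Z Y X = \<one> (Z \<otimes> (Y \<otimes> X))" "\<a>\<^sup>- Z Y X \<cdot> \<a> Z Y X = \<one> ((Z \<otimes> Y) \<otimes> X)"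
  using assms assoc_hom2[of X "src B X" "tgt B X" Y "tgt B Y" Z "tgt B Z"]
    inverse2_inv2[OF assoc_iso[of X "src B X" "tgt B X" Y "tgt B Y" Z "tgt B Z"]]
  by (auto simp: hom1_iff hom2_iff assoc_inv_def inverse2_def)

lemma lunit_cell [simp]:
  assumes "X \<in> Mor1 B"
  shows "\<l> X \<in> Mor2 B" "dom2 B (\<l> X) = I (tgt B X) \<otimes> X" "cod2 B (\<l> X) = X"
    "\<l>\<^sup>- X \<in> Mor2 B" "dom2 B (\<l>\<^sup>- X) = X" "cod2 B (\<l>\<^sup>- X) = I (tgt B X) \<otimes> X"
    "\<l> X \<cdot> \<l>\<^sup>- X = \<one> X" "\<l>\<^sup>- X \<cdot> \<l> X = \<one> (I (tgt B X) \<otimes> X)"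
  using assms lunit_hom2[of X "src B X" "tgt B X"]
    inverse2_inv2[OF lunit_iso[of X "src B X" "tgt B X"]]
  by (auto simp: hom1_iff hom2_iff lunit_inv_def inverse2_def)

lemma runit_cell [simp]:
  assumes "X \<in> Mor1 B"
  shows "\<r> X \<in> Mor2 B" "dom2 B (\<r> X) = X \<otimes> I (src B X)" "cod2 B (\<r> X) = X"
    "\<r>\<^sup>- X \<in> Mor2 B" "dom2 B (\<r>\<^sup>- X) = X" "cod2 B (\<r>\<^sup>- X) = X \<otimes> I (src B X)"
    "\<r> X \<cdot> \<r>\<^sup>- X = \<one> X" "\<r>\<^sup>- X \<cdot> \<r> X = \<one> (X \<otimes> I (src B X))"
  using assms runit_hom2[of X "src B X" "tgt B X"]
    inverse2_inv2[OF runit_iso[of X "src B X" "tgt B X"]]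
  by (auto simp: hom1_iff hom2_iff runit_inv_def inverse2_def)

lemma inv_cancel [simp]:
  assumes "X \<in> Mor1 B" "k \<in> Mor2 B" "cod2 B k = X"
  shows "\<l> X \<cdot> (\<l>\<^sup>- X \<cdot> k) = k" "\<r> X \<cdot> (\<r>\<^sup>- X \<cdot> k) = k"
  using assms vcomp_laws(3)[of k "\<l>\<^sup>- X" "\<l> X"] vcomp_laws(3)[of k "\<r>\<^sup>- X" "\<r> X"] by auto

lemma inv_cancel' [simp]:
  assumes "X \<in> Mor1 B" "k \<in> Mor2 B"
  shows "cod2 B k = I (tgt B X) \<otimes> X \<Longrightarrow> \<l>\<^sup>- X \<cdot> (\<l> X \<cdot> k) = k"
    "cod2 B k = X \<otimes> I (src B X) \<Longrightarrow> \<r>\<^sup>- X \<cdot> (\<r> X \<cdot> k) = k"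
  using assms vcomp_laws(3)[of k "\<l> X" "\<l>\<^sup>- X"] vcomp_laws(3)[of k "\<r> X" "\<r>\<^sup>- X"] by auto

lemma assoc_cancel [simp]:
  assumes "X \<in> Mor1 B" "Y \<in> Mor1 B" "Z \<in> Mor1 B" "src B Y = tgt B X" "src B Z = tgt B Y" "k \<in> Mor2 B"
  shows "cod2 B k = Z \<otimes> (Y \<otimes> X) \<Longrightarrow> \<a> Z Y X \<cdot> (\<a>\<^sup>- Z Y X \<cdot> k) = k"
    "cod2 B k = (Z \<otimes> Y) \<otimes> X \<Longrightarrow> \<a>\<^sup>- Z Y X \<cdot> (\<a> Z Y X \<cdot> k) = k"
  using assms vcomp_laws(3)[of k "\<a>\<^sup>- Z Y X" "\<a> Z Y X"] vcomp_laws(3)[of k "\<a> Z Y X" "\<a>\<^sup>- Z Y X"]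
  by auto

lemma whisker_cancel:
  assumes "g \<cdot> f = \<one> (dom2 B f)" "f \<in> Mor2 B" "g \<in> Mor2 B" "dom2 B g = cod2 B f"
    "X \<in> Mor1 B" "src B X = tgt B (dom2 B f)"
  shows "X \<rhd> g \<cdot> X \<rhd> f = \<one> (X \<otimes> dom2 B f)"
    "\<lbrakk>k \<in> Mor2 B; cod2 B k = X \<otimes> dom2 B f\<rbrakk> \<Longrightarrow> X \<rhd> g \<cdot> (X \<rhd> f \<cdot> k) = k"
proof -
  show *: "X \<rhd> g \<cdot> X \<rhd> f = \<one> (X \<otimes> dom2 B f)"
    using assms lwhisker_vcomp[of f g X] by simp
  show "X \<rhd> g \<cdot> (X \<rhd> f \<cdot> k) = k" if "k \<in> Mor2 B" "cod2 B k = X \<otimes> dom2 B f"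
    using that assms vcomp_laws(3)[of k "X \<rhd> f" "X \<rhd> g"] * by simp
qed

section \<open>Naturality of associators and unitors\<close>

lemma assoc_naturality:
  "\<lbrakk>f \<in> Mor2 B; g \<in> Mor2 B; h \<in> Mor2 B; src B (dom2 B g) = tgt B (dom2 B f);
    src B (dom2 B h) = tgt B (dom2 B g)\<rbrakk>
    \<Longrightarrow> \<a> (cod2 B h) (cod2 B g) (cod2 B f) \<cdot> ((h \<star> g) \<star> f)
      = (h \<star> (g \<star> f)) \<cdot> \<a> (dom2 B h) (dom2 B g) (dom2 B f)"
  using assoc_natural[of "dom2 B f" "src B (dom2 B f)" "tgt B (dom2 B f)" "dom2 B g"
      "tgt B (dom2 B g)" "dom2 B h" "tgt B (dom2 B h)" f "cod2 B f" g "cod2 B g" h "cod2 B h"]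
  by (auto simp: hom1_iff hom2_iff)

lemma lunit_naturality:
  "\<lbrakk>f \<in> Mor2 B; cod2 B f = X; tgt B (dom2 B f) = a\<rbrakk> \<Longrightarrow> \<l> X \<cdot> I a \<rhd> f = f \<cdot> \<l> (dom2 B f)"
  using lunit_natural[of "dom2 B f" "src B (dom2 B f)" "tgt B (dom2 B f)" f "cod2 B f"]
  by (auto simp: hom1_iff hom2_iff lwhisker_def)

lemma runit_naturality:
  "\<lbrakk>f \<in> Mor2 B; cod2 B f = X; src B (dom2 B f) = a\<rbrakk> \<Longrightarrow> \<r> X \<cdot> f \<lhd> I a = f \<cdot> \<r> (dom2 B f)"
  using runit_natural[of "dom2 B f" "src B (dom2 B f)" "tgt B (dom2 B f)" f "cod2 B f"]
  by (auto simp: hom1_iff hom2_iff rwhisker_def)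

text \<open>Naturality of the right unitor makes \<open>f\<close> a conjugate of its whiskering with
  the unit 1-cell by invertible 2-cells.\<close>

lemma rwhisker_unit_faithful:
  assumes "f \<in> Mor2 B" "g \<in> Mor2 B" "dom2 B f = dom2 B g" "cod2 B f = cod2 B g"
    and eq: "f \<lhd> I (src B (dom2 B g)) = g \<lhd> I (src B (dom2 B g))"
  shows "f = g"
proof -
  have "f = f \<cdot> \<r> (dom2 B f) \<cdot> \<r>\<^sup>- (dom2 B f)" using assms by simp
  also have "\<dots> = \<r> (cod2 B f) \<cdot> f \<lhd> I (src B (dom2 B f)) \<cdot> \<r>\<^sup>- (dom2 B f)"
    using assms vcomp_reassoc[OF runit_naturality[of f "cod2 B f" "src B (dom2 B f)"], of "\<r>\<^sup>- (dom2 B f)"] by simp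
  also have "\<dots> = \<r> (cod2 B g) \<cdot> g \<lhd> I (src B (dom2 B g)) \<cdot> \<r>\<^sup>- (dom2 B g)"
    using assms by simp
  also have "\<dots> = g \<cdot> \<r> (dom2 B g) \<cdot> \<r>\<^sup>- (dom2 B g)"
    using assms vcomp_reassoc[OF runit_naturality[of g "cod2 B g" "src B (dom2 B g)"], of "\<r>\<^sup>- (dom2 B g)"] by simp
  also have "\<dots> = g" using assms by simp
  finally show ?thesis .
qed

lemma lwhisker_unit_faithful:
  assumes "f \<in> Mor2 B" "g \<in> Mor2 B" "dom2 B f = dom2 B g" "cod2 B f = cod2 B g"
    and eq: "I (tgt B (dom2 B g)) \<rhd> f = I (tgt B (dom2 B g)) \<rhd> g"
  shows "f = g"
proof -
  have "f = f \<cdot> \<l> (dom2 B f) \<cdot> \<l>\<^sup>- (dom2 B f)" using assms by simp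
  also have "\<dots> = \<l> (cod2 B f) \<cdot> I (tgt B (dom2 B f)) \<rhd> f \<cdot> \<l>\<^sup>- (dom2 B f)"
    using assms vcomp_reassoc[OF lunit_naturality[of f "cod2 B f" "tgt B (dom2 B f)"], of "\<l>\<^sup>- (dom2 B f)"] by simp
  also have "\<dots> = \<l> (cod2 B g) \<cdot> I (tgt B (dom2 B g)) \<rhd> g \<cdot> \<l>\<^sup>- (dom2 B g)"
    using assms by simp
  also have "\<dots> = g \<cdot> \<l> (dom2 B g) \<cdot> \<l>\<^sup>- (dom2 B g)"
    using assms vcomp_reassoc[OF lunit_naturality[of g "cod2 B g" "tgt B (dom2 B g)"], of "\<l>\<^sup>- (dom2 B g)"] by simp
  also have "\<dots> = g" using assms by simp
  finally show ?thesis .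
qed

text \<open>Naturality is solved here for the doubly whiskered cell: rewriting pushes a trailing
  \<open>W\<close> inwards and leaves associators that cancel against their neighbours. The next two
  lemmas serve the same purpose.\<close>

lemma assoc_natural_left:
  "\<lbrakk>f \<in> Mor2 B; Y \<in> Mor1 B; W \<in> Mor1 B; src B Y = tgt B W; src B (dom2 B f) = tgt B Y\<rbrakk>
    \<Longrightarrow> (f \<lhd> Y) \<lhd> W = \<a>\<^sup>- (cod2 B f) Y W \<cdot> f \<lhd> (Y \<otimes> W) \<cdot> \<a> (dom2 B f) Y W"
  using assoc_naturality[of "\<one> W" "\<one> Y" f] hcomp2_id[of W "src B W" "tgt B W" Y "tgt B Y"]
    assoc_cancel(2)[of W Y "cod2 B f" "(f \<lhd> Y) \<lhd> W"]
  by (simp add: rwhisker_def hom1_iff)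

lemma assoc_natural_mid:
  "\<lbrakk>f \<in> Mor2 B; Y \<in> Mor1 B; W \<in> Mor1 B; src B (dom2 B f) = tgt B W; src B Y = tgt B (dom2 B f)\<rbrakk>
    \<Longrightarrow> (Y \<rhd> f) \<lhd> W = \<a>\<^sup>- Y (cod2 B f) W \<cdot> Y \<rhd> (f \<lhd> W) \<cdot> \<a> Y (dom2 B f) W"
  using assoc_naturality[of "\<one> W" f "\<one> Y"]
    assoc_cancel(2)[of W "cod2 B f" Y "(Y \<rhd> f) \<lhd> W"]
  by (simp add: rwhisker_def lwhisker_def)

lemma assoc_natural_right:
  "\<lbrakk>f \<in> Mor2 B; Y \<in> Mor1 B; X \<in> Mor1 B; src B X = tgt B (dom2 B f); src B Y = tgt B X\<rbrakk>
    \<Longrightarrow> (Y \<otimes> X) \<rhd> f = \<a>\<^sup>- Y X (cod2 B f) \<cdot> Y \<rhd> (X \<rhd> f) \<cdot> \<a> Y X (dom2 B f)"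
  using assoc_naturality[of f "\<one> X" "\<one> Y"] hcomp2_id[of X "src B X" "tgt B X" Y "tgt B Y"]
    assoc_cancel(2)[of "cod2 B f" X Y "(Y \<otimes> X) \<rhd> f"]
  by (simp add: lwhisker_def hom1_iff)

lemma hcomp2_rwhisker:
  assumes "f \<in> Mor2 B" "g \<in> Mor2 B" "W \<in> Mor1 B"
    "src B (dom2 B f) = tgt B (dom2 B g)" "src B (dom2 B g) = tgt B W"
  shows "(f \<star> g) \<lhd> W = \<a>\<^sup>- (cod2 B f) (cod2 B g) W \<cdot> f \<lhd> (cod2 B g \<otimes> W)
    \<cdot> dom2 B f \<rhd> (g \<lhd> W) \<cdot> \<a> (dom2 B f) (dom2 B g) W"
  using assms
  by (simp add: hcomp2_rl rwhisker_vcomp assoc_natural_left assoc_natural_mid)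

section \<open>Whiskered associators and unitors\<close>

lemma pentagon':
  "\<lbrakk>X \<in> Mor1 B; Y \<in> Mor1 B; Z \<in> Mor1 B; W \<in> Mor1 B; src B Y = tgt B X; src B Z = tgt B Y;
     src B W = tgt B Z\<rbrakk>
    \<Longrightarrow> W \<rhd> \<a> Z Y X \<cdot> \<a> W (Z \<otimes> Y) X \<cdot> \<a> W Z Y \<lhd> X = \<a> W Z (Y \<otimes> X) \<cdot> \<a> (W \<otimes> Z) Y X"
  using pentagon[of X "src B X" "tgt B X" Y "tgt B Y" Z "tgt B Z" W "tgt B W"]
  by (simp add: lwhisker_def rwhisker_def hom1_iff)

lemma triangle':
  "\<lbrakk>X \<in> Mor1 B; Y \<in> Mor1 B; src B Y = tgt B X\<rbrakk> \<Longrightarrow> Y \<rhd> \<l> X \<cdot> \<a> Y (I (tgt B X)) X = \<r> Y \<lhd> X"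
  using triangle[of X "src B X" "tgt B X" Y "tgt B Y"]
  by (simp add: lwhisker_def rwhisker_def hom1_iff)

text \<open>The pentagon, solved for the associator that is whiskered with \<open>W\<close>. The
  formulas for whiskered inverses that follow are obtained from such formulas by uniqueness of
  inverses.\<close>

lemma assoc_rwhisker:
  assumes "X \<in> Mor1 B" "Y \<in> Mor1 B" "Z \<in> Mor1 B" "W \<in> Mor1 B" "src B Y = tgt B X"
    "src B Z = tgt B Y" "src B X = tgt B W"
  shows "\<a> Z Y X \<lhd> W
    = \<a>\<^sup>- Z (Y \<otimes> X) W \<cdot> Z \<rhd> \<a>\<^sup>- Y X W \<cdot> \<a> Z Y (X \<otimes> W) \<cdot> \<a> (Z \<otimes> Y) X W"
proof -
  have "\<a>\<^sup>- Z (Y \<otimes> X) W \<cdot> Z \<rhd> \<a>\<^sup>- Y X W \<cdot> (\<a> Z Y (X \<otimes> W) \<cdot> \<a> (Z \<otimes> Y) X W)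
    = \<a>\<^sup>- Z (Y \<otimes> X) W \<cdot> Z \<rhd> \<a>\<^sup>- Y X W \<cdot>
        (Z \<rhd> \<a> Y X W \<cdot> \<a> Z (Y \<otimes> X) W \<cdot> \<a> Z Y X \<lhd> W)"
    using assms by (simp add: pentagon')
  also have "\<dots> = \<a> Z Y X \<lhd> W"
    using assms by (simp add: whisker_cancel)
  finally show ?thesis ..
qed

lemma assoc_inv_rwhisker:
  assumes "X \<in> Mor1 B" "Y \<in> Mor1 B" "Z \<in> Mor1 B" "W \<in> Mor1 B" "src B Y = tgt B X"
    "src B Z = tgt B Y" "src B X = tgt B W"
  shows "\<a>\<^sup>- Z Y X \<lhd> W
    = \<a>\<^sup>- (Z \<otimes> Y) X W \<cdot> \<a>\<^sup>- Z Y (X \<otimes> W) \<cdot> Z \<rhd> \<a> Y X W \<cdot> \<a> Z (Y \<otimes> X) W"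
proof -
  let ?g = "\<a>\<^sup>- (Z \<otimes> Y) X W \<cdot> \<a>\<^sup>- Z Y (X \<otimes> W) \<cdot> Z \<rhd> \<a> Y X W \<cdot> \<a> Z (Y \<otimes> X) W"
  have "inverse2 B (\<a> Z Y X \<lhd> W) (\<a>\<^sup>- Z Y X \<lhd> W)"
    using assms by (simp add: inverse2_def hom2_iff flip: rwhisker_vcomp)
  moreover have "inverse2 B (\<a> Z Y X \<lhd> W) ?g"
    using assms by (simp add: assoc_rwhisker inverse2_def hom2_iff whisker_cancel)
  ultimately show ?thesis by (rule inverse2_unique[rotated])
qed

text \<open>Kelly's argument.\<close>

lemma lunit_rwhisker:
  assumes X: "X \<in> Mor1 B" "W \<in> Mor1 B" "src B X = tgt B W"
  shows "\<l> X \<lhd> W = \<l> (X \<otimes> W) \<cdot> \<a> (I (tgt B X)) X W"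
proof -
  define J where "J = I (tgt B X)"
  have J: "J \<in> Mor1 B" "src B J = tgt B X" "tgt B J = tgt B X" using X by (auto simp: J_def)
  have t: "\<r> J \<lhd> V = J \<rhd> \<l> V \<cdot> \<a> J J V" if "V \<in> Mor1 B" "tgt B V = tgt B X" for V
    using triangle'[of V J] that J by (simp add: J_def)
  \<comment> \<open>Whiskered with the unit \<open>J\<close>, the two sides agree once two
    associators are precomposed: both reduce to the whiskered right unitor by pentagon, triangle and
    naturality.\<close>
  have "J \<rhd> (\<l> (X \<otimes> W) \<cdot> \<a> J X W) \<cdot> \<a> J (J \<otimes> X) W \<cdot> \<a> J J X \<lhd> W
      = J \<rhd> \<l> (X \<otimes> W) \<cdot> (J \<rhd> \<a> J X W \<cdot> \<a> J (J \<otimes> X) W \<cdot> \<a> J J X \<lhd> W)"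
    using X J by (simp add: J_def)
  also have "\<dots> = \<r> J \<lhd> (X \<otimes> W) \<cdot> \<a> (J \<otimes> J) X W"
    using X J by (simp add: t pentagon' J_def[symmetric])
  also have "\<dots> = \<a> J X W \<cdot> (\<r> J \<lhd> X) \<lhd> W"
    using X J by (subst assoc_natural_left) (simp_all add: J_def)
  also have "\<dots> = J \<rhd> (\<l> X \<lhd> W) \<cdot> \<a> J (J \<otimes> X) W \<cdot> \<a> J J X \<lhd> W"
    using X J by (simp add: t rwhisker_vcomp assoc_natural_mid J_def[symmetric])
  finally have eq: "J \<rhd> (\<l> (X \<otimes> W) \<cdot> \<a> J X W) \<cdot> (\<a> J (J \<otimes> X) W \<cdot> \<a> J J X \<lhd> W)
      = J \<rhd> (\<l> X \<lhd> W) \<cdot> (\<a> J (J \<otimes> X) W \<cdot> \<a> J J X \<lhd> W)" .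
  \<comment> \<open>The two precomposed associators have a right inverse, so they can be removed;
    faithfulness of whiskering with \<open>J\<close> then removes \<open>J\<close>.\<close>
  have c: "(\<a> J (J \<otimes> X) W \<cdot> \<a> J J X \<lhd> W) \<cdot> (\<a>\<^sup>- J J X \<lhd> W \<cdot> \<a>\<^sup>- J (J \<otimes> X) W)
    = \<one> (J \<otimes> ((J \<otimes> X) \<otimes> W))"
    using X J by (simp add: assoc_rwhisker assoc_inv_rwhisker whisker_cancel)
  have cancel: "f = (f \<cdot> (\<a> J (J \<otimes> X) W \<cdot> \<a> J J X \<lhd> W)) \<cdot> (\<a>\<^sup>- J J X \<lhd> W \<cdot> \<a>\<^sup>- J (J \<otimes> X) W)"
    if f: "f \<in> Mor2 B" "dom2 B f = J \<otimes> ((J \<otimes> X) \<otimes> W)" for f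
  proof -
    have "(f \<cdot> (\<a> J (J \<otimes> X) W \<cdot> \<a> J J X \<lhd> W)) \<cdot> (\<a>\<^sup>- J J X \<lhd> W \<cdot> \<a>\<^sup>- J (J \<otimes> X) W)
      = f \<cdot> ((\<a> J (J \<otimes> X) W \<cdot> \<a> J J X \<lhd> W) \<cdot> (\<a>\<^sup>- J J X \<lhd> W \<cdot> \<a>\<^sup>- J (J \<otimes> X) W))"
      using f X J by (intro vcomp_laws(3)) auto
    then show ?thesis using f c by simp
  qed
  have "J \<rhd> (\<l> (X \<otimes> W) \<cdot> \<a> J X W)
    = (J \<rhd> (\<l> (X \<otimes> W) \<cdot> \<a> J X W) \<cdot> (\<a> J (J \<otimes> X) W \<cdot> \<a> J J X \<lhd> W)) \<cdot> (\<a>\<^sup>- J J X \<lhd> W \<cdot> \<a>\<^sup>- J (J \<otimes> X) W)"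
    using X J by (intro cancel) (simp_all add: J_def)
  also have "\<dots> = J \<rhd> (\<l> X \<lhd> W)"
    unfolding eq using X J by (intro cancel[symmetric]) (simp_all add: J_def)
  finally have "J \<rhd> (\<l> (X \<otimes> W) \<cdot> \<a> J X W) = J \<rhd> (\<l> X \<lhd> W)" .
  then show ?thesis
    unfolding J_def using X by - (rule lwhisker_unit_faithful, simp_all)
qed

lemma lunit_inv_rwhisker:
  assumes "X \<in> Mor1 B" "W \<in> Mor1 B" "src B X = tgt B W"
  shows "\<l>\<^sup>- X \<lhd> W = \<a>\<^sup>- (I (tgt B X)) X W \<cdot> \<l>\<^sup>- (X \<otimes> W)"
proof -
  have "inverse2 B (\<l> X \<lhd> W) (\<l>\<^sup>- X \<lhd> W)"
    using assms by (simp add: inverse2_def hom2_iff flip: rwhisker_vcomp)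
  moreover have "inverse2 B (\<l> X \<lhd> W) (\<a>\<^sup>- (I (tgt B X)) X W \<cdot> \<l>\<^sup>- (X \<otimes> W))"
    using assms inv_cancel'(1)[of "X \<otimes> W"] by (simp add: lunit_rwhisker inverse2_def hom2_iff)
  ultimately show ?thesis by (rule inverse2_unique[rotated])
qed

lemma runit_rwhisker:
  assumes "X \<in> Mor1 B" "W \<in> Mor1 B" "src B X = tgt B W"
  shows "\<r> X \<lhd> W = X \<rhd> \<l> W \<cdot> \<a> X (I (tgt B W)) W"
  using assms triangle'[of W X] by simp

lemma runit_inv_rwhisker:
  assumes "X \<in> Mor1 B" "W \<in> Mor1 B" "src B X = tgt B W"
  shows "\<r>\<^sup>- X \<lhd> W = \<a>\<^sup>- X (I (tgt B W)) W \<cdot> X \<rhd> \<l>\<^sup>- W"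
proof -
  have "inverse2 B (\<r> X \<lhd> W) (\<r>\<^sup>- X \<lhd> W)"
    using assms by (simp add: inverse2_def hom2_iff flip: rwhisker_vcomp)
  moreover have "inverse2 B (\<r> X \<lhd> W) (\<a>\<^sup>- X (I (tgt B W)) W \<cdot> X \<rhd> \<l>\<^sup>- W)"
    using assms by (simp add: runit_rwhisker inverse2_def hom2_iff whisker_cancel)
  ultimately show ?thesis by (rule inverse2_unique[rotated])
qed

section \<open>Evaluating 2-cells on 1-cells\<close>

text \<open>The unit 1-cell is an admissible \<open>W\<close>, and whiskering with it is
  faithful.\<close>

lemma cell_eqI:
  assumes "f \<in> Mor2 B" "g \<in> Mor2 B" "dom2 B f = dom2 B g" "cod2 B f = cod2 B g"
    and "\<And>W. \<lbrakk>W \<in> Mor1 B; tgt B W = src B (dom2 B g)\<rbrakk> \<Longrightarrow> f \<lhd> W = g \<lhd> W"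
  shows "f = g"
  by (rule rwhisker_unit_faithful) (use assms in auto)

lemma lwhisker_assoc_cancel [simp]:
  assumes "T \<in> Mor1 B" "src B T = tgt B Z"
    and "X \<in> Mor1 B" "Y \<in> Mor1 B" "Z \<in> Mor1 B" "src B Y = tgt B X" "src B Z = tgt B Y"
  shows "T \<rhd> \<a> Z Y X \<cdot> T \<rhd> \<a>\<^sup>- Z Y X = \<one> (T \<otimes> (Z \<otimes> (Y \<otimes> X)))"
    and "T \<rhd> \<a>\<^sup>- Z Y X \<cdot> T \<rhd> \<a> Z Y X = \<one> (T \<otimes> ((Z \<otimes> Y) \<otimes> X))"
    and "\<lbrakk>k \<in> Mor2 B; cod2 B k = T \<otimes> (Z \<otimes> (Y \<otimes> X))\<rbrakk>
      \<Longrightarrow> T \<rhd> \<a> Z Y X \<cdot> (T \<rhd> \<a>\<^sup>- Z Y X \<cdot> k) = k"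
    and "\<lbrakk>k \<in> Mor2 B; cod2 B k = T \<otimes> ((Z \<otimes> Y) \<otimes> X)\<rbrakk>
      \<Longrightarrow> T \<rhd> \<a>\<^sup>- Z Y X \<cdot> (T \<rhd> \<a> Z Y X \<cdot> k) = k"
  using assms by (simp_all add: whisker_cancel)

lemma lwhisker_lunit_cancel [simp]:
  assumes "T \<in> Mor1 B" "src B T = tgt B Z" "Z \<in> Mor1 B"
  shows "T \<rhd> \<l> Z \<cdot> T \<rhd> \<l>\<^sup>- Z = \<one> (T \<otimes> Z)"
    and "T \<rhd> \<l>\<^sup>- Z \<cdot> T \<rhd> \<l> Z = \<one> (T \<otimes> (I (tgt B Z) \<otimes> Z))"
    and "\<lbrakk>k \<in> Mor2 B; cod2 B k = T \<otimes> Z\<rbrakk> \<Longrightarrow> T \<rhd> \<l> Z \<cdot> (T \<rhd> \<l>\<^sup>- Z \<cdot> k) = k"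
    and "\<lbrakk>k \<in> Mor2 B; cod2 B k = T \<otimes> (I (tgt B Z) \<otimes> Z)\<rbrakk>
      \<Longrightarrow> T \<rhd> \<l>\<^sup>- Z \<cdot> (T \<rhd> \<l> Z \<cdot> k) = k"
  using assms by (simp_all add: whisker_cancel)

lemma lwhisker2_assoc_cancel [simp]:
  assumes "S \<in> Mor1 B" "src B S = tgt B T" "T \<in> Mor1 B" "src B T = tgt B Z"
    and "X \<in> Mor1 B" "Y \<in> Mor1 B" "Z \<in> Mor1 B" "src B Y = tgt B X" "src B Z = tgt B Y"
  shows "S \<rhd> T \<rhd> \<a> Z Y X \<cdot> S \<rhd> T \<rhd> \<a>\<^sup>- Z Y X = \<one> (S \<otimes> (T \<otimes> (Z \<otimes> (Y \<otimes> X))))"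
    and "S \<rhd> T \<rhd> \<a>\<^sup>- Z Y X \<cdot> S \<rhd> T \<rhd> \<a> Z Y X = \<one> (S \<otimes> (T \<otimes> ((Z \<otimes> Y) \<otimes> X)))"
    and "\<lbrakk>k \<in> Mor2 B; cod2 B k = S \<otimes> (T \<otimes> (Z \<otimes> (Y \<otimes> X)))\<rbrakk>
      \<Longrightarrow> S \<rhd> T \<rhd> \<a> Z Y X \<cdot> (S \<rhd> T \<rhd> \<a>\<^sup>- Z Y X \<cdot> k) = k"
    and "\<lbrakk>k \<in> Mor2 B; cod2 B k = S \<otimes> (T \<otimes> ((Z \<otimes> Y) \<otimes> X))\<rbrakk>
      \<Longrightarrow> S \<rhd> T \<rhd> \<a>\<^sup>- Z Y X \<cdot> (S \<rhd> T \<rhd> \<a> Z Y X \<cdot> k) = k"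
  using assms by (simp_all add: whisker_cancel)

lemma lwhisker2_lunit_cancel [simp]:
  assumes "S \<in> Mor1 B" "src B S = tgt B T" "T \<in> Mor1 B" "src B T = tgt B Z" "Z \<in> Mor1 B"
  shows "S \<rhd> T \<rhd> \<l> Z \<cdot> S \<rhd> T \<rhd> \<l>\<^sup>- Z = \<one> (S \<otimes> (T \<otimes> Z))"
    and "S \<rhd> T \<rhd> \<l>\<^sup>- Z \<cdot> S \<rhd> T \<rhd> \<l> Z = \<one> (S \<otimes> (T \<otimes> (I (tgt B Z) \<otimes> Z)))"
    and "\<lbrakk>k \<in> Mor2 B; cod2 B k = S \<otimes> (T \<otimes> Z)\<rbrakk>
      \<Longrightarrow> S \<rhd> T \<rhd> \<l> Z \<cdot> (S \<rhd> T \<rhd> \<l>\<^sup>- Z \<cdot> k) = k"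
    and "\<lbrakk>k \<in> Mor2 B; cod2 B k = S \<otimes> (T \<otimes> (I (tgt B Z) \<otimes> Z))\<rbrakk>
      \<Longrightarrow> S \<rhd> T \<rhd> \<l>\<^sup>- Z \<cdot> (S \<rhd> T \<rhd> \<l> Z \<cdot> k) = k"
  using assms by (simp_all add: whisker_cancel)

text \<open>
  Whiskering a 2-cell with a 1-cell \<open>W\<close> and conjugating with associators and unitors turns, say,
  \<open>m : X \<otimes> Y \<rightarrow> Z\<close> into a family \<open>X \<otimes> (Y \<otimes> W) \<rightarrow> Z \<otimes> W\<close> that is natural in \<open>W\<close>. No
  coherence cells are needed to compose such families, and they determine \<open>m\<close> by \<open>cell_eqI\<close>.
  In \<open>hatmn\<close> the digits count the tensor factors of domain and codomain, \<open>0\<close> standing for \<open>I\<close>.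
\<close>

definition hat21 :: "'m \<Rightarrow> 'm \<Rightarrow> 'c \<Rightarrow> 'm \<Rightarrow> 'c" where
  "hat21 X Y m W = m \<lhd> W \<cdot> \<a>\<^sup>- X Y W"

definition hat12 :: "'m \<Rightarrow> 'm \<Rightarrow> 'c \<Rightarrow> 'm \<Rightarrow> 'c" where
  "hat12 X Y d W = \<a> X Y W \<cdot> d \<lhd> W"

definition hat20 :: "'m \<Rightarrow> 'm \<Rightarrow> 'c \<Rightarrow> 'm \<Rightarrow> 'c" where
  "hat20 X Y e W = \<l> W \<cdot> e \<lhd> W \<cdot> \<a>\<^sup>- X Y W"

definition hat02 :: "'m \<Rightarrow> 'm \<Rightarrow> 'c \<Rightarrow> 'm \<Rightarrow> 'c" where
  "hat02 X Y c W = \<a> X Y W \<cdot> c \<lhd> W \<cdot> \<l>\<^sup>- W"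

definition hat10 :: "'c \<Rightarrow> 'm \<Rightarrow> 'c" where
  "hat10 e W = \<l> W \<cdot> e \<lhd> W"

definition hat01 :: "'c \<Rightarrow> 'm \<Rightarrow> 'c" where
  "hat01 c W = c \<lhd> W \<cdot> \<l>\<^sup>- W"

lemma hat21:
  assumes "m \<in> Mor2 B" "dom2 B m = X \<otimes> Y" "X \<in> Mor1 B" "Y \<in> Mor1 B" "W \<in> Mor1 B"
    "src B X = tgt B Y" "src B Y = tgt B W"
  shows hat21_cell: "hat21 X Y m W \<in> Mor2 B" "dom2 B (hat21 X Y m W) = X \<otimes> (Y \<otimes> W)"
      "cod2 B (hat21 X Y m W) = cod2 B m \<otimes> W"
    and hat21_unfold: "m \<lhd> W = hat21 X Y m W \<cdot> \<a> X Y W"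
  using assms by (auto simp: hat21_def)

text \<open>Naturality in \<open>W\<close> is the exchange law: \<open>m\<close> acts on the leading
  factors and \<open>g\<close> on the trailing one. The families with a unit 1-cell at one end
  combine this with naturality of the unitor.\<close>

lemma hat21_natural:
  assumes "m \<in> Mor2 B" "dom2 B m = X \<otimes> Y" "X \<in> Mor1 B" "Y \<in> Mor1 B" "g \<in> Mor2 B"
    "src B X = tgt B Y" "src B Y = tgt B (dom2 B g)"
  shows "hat21 X Y m (cod2 B g) \<cdot> X \<rhd> Y \<rhd> g = cod2 B m \<rhd> g \<cdot> hat21 X Y m (dom2 B g)"
proof -
  have *: "m \<lhd> cod2 B g \<cdot> (X \<otimes> Y) \<rhd> g = cod2 B m \<rhd> g \<cdot> m \<lhd> dom2 B g"
    using assms by (intro exchange) auto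
  have "X \<rhd> Y \<rhd> g = \<a> X Y (cod2 B g) \<cdot> (X \<otimes> Y) \<rhd> g \<cdot> \<a>\<^sup>- X Y (dom2 B g)"
    using assms by (simp add: assoc_natural_right)
  then show ?thesis
    using assms by (simp add: hat21_def vcomp_reassoc[OF *])
qed

lemma hat12:
  assumes "d \<in> Mor2 B" "cod2 B d = X \<otimes> Y" "X \<in> Mor1 B" "Y \<in> Mor1 B" "W \<in> Mor1 B"
    "src B X = tgt B Y" "src B Y = tgt B W"
  shows hat12_cell: "hat12 X Y d W \<in> Mor2 B" "dom2 B (hat12 X Y d W) = dom2 B d \<otimes> W"
      "cod2 B (hat12 X Y d W) = X \<otimes> (Y \<otimes> W)"
    and hat12_unfold: "d \<lhd> W = \<a>\<^sup>- X Y W \<cdot> hat12 X Y d W"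
proof -
  \<comment> \<open>The hypotheses describe only the codomain of \<open>d\<close>; the source of its
    domain is read off from there because the two 1-cells are parallel.\<close>
  have "src B (cod2 B d) = src B Y" using assms(2-) by simp
  then have "src B (dom2 B d) = tgt B W" using assms(1,7) by (simp del: assms(2))
  then show "hat12 X Y d W \<in> Mor2 B" "dom2 B (hat12 X Y d W) = dom2 B d \<otimes> W"
    "cod2 B (hat12 X Y d W) = X \<otimes> (Y \<otimes> W)" "d \<lhd> W = \<a>\<^sup>- X Y W \<cdot> hat12 X Y d W"
  using assms by (auto simp: hat12_def)
qed

lemma hat12_natural:
  assumes "d \<in> Mor2 B" "cod2 B d = X \<otimes> Y" "X \<in> Mor1 B" "Y \<in> Mor1 B" "g \<in> Mor2 B"
    "src B X = tgt B Y" "src B Y = tgt B (dom2 B g)"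
  shows "X \<rhd> Y \<rhd> g \<cdot> hat12 X Y d (dom2 B g) = hat12 X Y d (cod2 B g) \<cdot> dom2 B d \<rhd> g"
proof -
  have s: "src B (dom2 B d) = tgt B (dom2 B g)"
    using assms cell1(11)[of d] by simp
  then have *: "(X \<otimes> Y) \<rhd> g \<cdot> d \<lhd> dom2 B g = d \<lhd> cod2 B g \<cdot> dom2 B d \<rhd> g"
    using assms exchange[of d g "cod2 B g" "dom2 B d"] by simp
  have "X \<rhd> Y \<rhd> g = \<a> X Y (cod2 B g) \<cdot> (X \<otimes> Y) \<rhd> g \<cdot> \<a>\<^sup>- X Y (dom2 B g)"
    using assms by (simp add: assoc_natural_right)
  then show ?thesis
    using assms s * by (simp add: hat12_def)
qed

lemma hat20:
  assumes "m \<in> Mor2 B" "dom2 B m = X \<otimes> Y" "cod2 B m = I (tgt B W)"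
    "X \<in> Mor1 B" "Y \<in> Mor1 B" "W \<in> Mor1 B" "src B X = tgt B Y" "src B Y = tgt B W"
  shows hat20_cell: "hat20 X Y m W \<in> Mor2 B" "dom2 B (hat20 X Y m W) = X \<otimes> (Y \<otimes> W)"
      "cod2 B (hat20 X Y m W) = W"
    and hat20_unfold: "m \<lhd> W = \<l>\<^sup>- W \<cdot> hat20 X Y m W \<cdot> \<a> X Y W"
  using assms by (auto simp: hat20_def)

lemma hat20_natural:
  assumes "m \<in> Mor2 B" "dom2 B m = X \<otimes> Y" "cod2 B m = I (tgt B (dom2 B g))"
    "X \<in> Mor1 B" "Y \<in> Mor1 B" "g \<in> Mor2 B"
    "src B X = tgt B Y" "src B Y = tgt B (dom2 B g)"
  shows "hat20 X Y m (cod2 B g) \<cdot> X \<rhd> Y \<rhd> g = g \<cdot> hat20 X Y m (dom2 B g)"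
proof -
  have "hat20 X Y m (cod2 B g) \<cdot> X \<rhd> Y \<rhd> g = \<l> (cod2 B g) \<cdot> (hat21 X Y m (cod2 B g) \<cdot> X \<rhd> Y \<rhd> g)"
    using assms by (simp add: hat20_def hat21_def)
  also have "\<dots> = (\<l> (cod2 B g) \<cdot> cod2 B m \<rhd> g) \<cdot> hat21 X Y m (dom2 B g)"
    using assms by (simp add: hat21_natural hat21_cell)
  also have "\<dots> = g \<cdot> hat20 X Y m (dom2 B g)"
    using assms by (simp add: lunit_naturality hat21_cell) (simp add: hat20_def hat21_def)
  finally show ?thesis .
qed

lemma hat02:
  assumes "m \<in> Mor2 B" "cod2 B m = X \<otimes> Y" "dom2 B m = I (tgt B W)"
    "X \<in> Mor1 B" "Y \<in> Mor1 B" "W \<in> Mor1 B" "src B X = tgt B Y" "src B Y = tgt B W"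
  shows hat02_cell: "hat02 X Y m W \<in> Mor2 B" "cod2 B (hat02 X Y m W) = X \<otimes> (Y \<otimes> W)"
      "dom2 B (hat02 X Y m W) = W"
    and hat02_unfold: "m \<lhd> W = \<a>\<^sup>- X Y W \<cdot> hat02 X Y m W \<cdot> \<l> W"
  using assms by (auto simp: hat02_def)

lemma lunit_inv_naturality:
  assumes "f \<in> Mor2 B"
  shows "I (tgt B (dom2 B f)) \<rhd> f \<cdot> \<l>\<^sup>- (dom2 B f) = \<l>\<^sup>- (cod2 B f) \<cdot> f"
proof -
  have "\<l>\<^sup>- (cod2 B f) \<cdot> ((\<l> (cod2 B f) \<cdot> I (tgt B (dom2 B f)) \<rhd> f) \<cdot> \<l>\<^sup>- (dom2 B f)) =
    \<l>\<^sup>- (cod2 B f) \<cdot> ((f \<cdot> \<l> (dom2 B f)) \<cdot> \<l>\<^sup>- (dom2 B f))"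
    using lunit_naturality[OF assms refl refl] by simp
  then show ?thesis
    using assms inv_cancel'(1)[of "cod2 B f" "I (tgt B (dom2 B f)) \<rhd> f \<cdot> \<l>\<^sup>- (dom2 B f)"]
    by simp
qed

lemma hat02_natural:
  assumes "m \<in> Mor2 B" "cod2 B m = X \<otimes> Y" "dom2 B m = I (tgt B (dom2 B g))"
    "X \<in> Mor1 B" "Y \<in> Mor1 B" "g \<in> Mor2 B"
    "src B X = tgt B Y" "src B Y = tgt B (dom2 B g)"
  shows "X \<rhd> Y \<rhd> g \<cdot> hat02 X Y m (dom2 B g) = hat02 X Y m (cod2 B g) \<cdot> g"
proof -
  have "X \<rhd> Y \<rhd> g \<cdot> hat02 X Y m (dom2 B g) = (X \<rhd> Y \<rhd> g \<cdot> hat12 X Y m (dom2 B g)) \<cdot> \<l>\<^sup>- (dom2 B g)"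
    using assms by (simp add: hat02_def hat12_def)
  also have "\<dots> = hat12 X Y m (cod2 B g) \<cdot> (I (tgt B (dom2 B g)) \<rhd> g \<cdot> \<l>\<^sup>- (dom2 B g))"
    using assms by (simp add: hat12_natural hat12_cell)
  also have "\<dots> = hat02 X Y m (cod2 B g) \<cdot> g"
    using assms by (simp add: lunit_inv_naturality) (simp add: hat02_def hat12_def)
  finally show ?thesis .
qed

lemma hat10:
  assumes "m \<in> Mor2 B" "cod2 B m = I (tgt B W)" "W \<in> Mor1 B" "src B (dom2 B m) = tgt B W"
  shows hat10_cell: "hat10 m W \<in> Mor2 B" "dom2 B (hat10 m W) = dom2 B m \<otimes> W" "cod2 B (hat10 m W) = W"
    and hat10_unfold: "m \<lhd> W = \<l>\<^sup>- W \<cdot> hat10 m W"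
  using assms by (auto simp: hat10_def)

lemma hat10_natural:
  assumes "m \<in> Mor2 B" "cod2 B m = I (tgt B (dom2 B g))" "g \<in> Mor2 B"
    "src B (dom2 B m) = tgt B (dom2 B g)"
  shows "hat10 m (cod2 B g) \<cdot> dom2 B m \<rhd> g = g \<cdot> hat10 m (dom2 B g)"
proof -
  have *: "m \<lhd> cod2 B g \<cdot> dom2 B m \<rhd> g = cod2 B m \<rhd> g \<cdot> m \<lhd> dom2 B g"
    using assms by (intro exchange) auto
  have "hat10 m (cod2 B g) \<cdot> dom2 B m \<rhd> g = \<l> (cod2 B g) \<cdot> (m \<lhd> cod2 B g \<cdot> dom2 B m \<rhd> g)"
    using assms by (simp add: hat10_def)
  also have "\<dots> = (\<l> (cod2 B g) \<cdot> cod2 B m \<rhd> g) \<cdot> m \<lhd> dom2 B g"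
    using assms unfolding * by simp
  also have "\<dots> = g \<cdot> hat10 m (dom2 B g)"
    using assms by (simp add: lunit_naturality hat10_def)
  finally show ?thesis .
qed

lemma hat01:
  assumes "m \<in> Mor2 B" "dom2 B m = I (tgt B W)" "W \<in> Mor1 B"
  shows hat01_cell: "hat01 m W \<in> Mor2 B" "dom2 B (hat01 m W) = W" "cod2 B (hat01 m W) = cod2 B m \<otimes> W"
    and hat01_unfold: "m \<lhd> W = hat01 m W \<cdot> \<l> W"
  using assms by (auto simp: hat01_def)

lemma hat01_natural:
  assumes "m \<in> Mor2 B" "dom2 B m = I (tgt B (dom2 B g))" "g \<in> Mor2 B"
  shows "cod2 B m \<rhd> g \<cdot> hat01 m (dom2 B g) = hat01 m (cod2 B g) \<cdot> g"
proof -
  have *: "m \<lhd> cod2 B g \<cdot> dom2 B m \<rhd> g = cod2 B m \<rhd> g \<cdot> m \<lhd> dom2 B g"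
    using assms by (intro exchange) auto
  have "cod2 B m \<rhd> g \<cdot> hat01 m (dom2 B g) = (cod2 B m \<rhd> g \<cdot> m \<lhd> dom2 B g) \<cdot> \<l>\<^sup>- (dom2 B g)"
    using assms by (simp add: hat01_def)
  also have "\<dots> = m \<lhd> cod2 B g \<cdot> (dom2 B m \<rhd> g \<cdot> \<l>\<^sup>- (dom2 B g))"
    using assms unfolding *[symmetric] by simp
  also have "\<dots> = hat01 m (cod2 B g) \<cdot> g"
    using assms by (simp add: lunit_inv_naturality) (simp add: hat01_def)
  finally show ?thesis .
qed

text \<open>These rules carry a whisker with \<open>W\<close> through a formula down to its
  generators, where the respective unfolding rules replace each generator by its family.\<close>

lemmas unwhisker = rwhisker_vcomp hcomp2_rwhisker assoc_natural_mid assoc_rwhisker assoc_inv_rwhisker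
  lunit_rwhisker lunit_inv_rwhisker runit_rwhisker runit_inv_rwhisker lwhisker_def[symmetric]

section \<open>Frobenius algebras and bimodules\<close>

abbreviation alg :: "'o \<times> ('m, 'c) frob \<Rightarrow> 'm" where
  "alg p \<equiv> carr (snd p)"

definition frob_obj :: "'o \<times> ('m, 'c) frob \<Rightarrow> bool" where
  "frob_obj p \<longleftrightarrow> is_frobenius B (fst p) (snd p) \<and> is_separable B (snd p)"

definition bim :: "('o, 'm, 'c) bimod \<Rightarrow> bool" where
  "bim M \<longleftrightarrow> frob_obj (bsrc M) \<and> frob_obj (btgt M) \<and> is_bimodule B M"

lemma frob_obj_cell [simp]:
  assumes "frob_obj p"
  shows "alg p \<in> Mor1 B" "src B (alg p) = fst p" "tgt B (alg p) = fst p" "fst p \<in> Obj B"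
    "mult (snd p) \<in> Mor2 B" "dom2 B (mult (snd p)) = alg p \<otimes> alg p" "cod2 B (mult (snd p)) = alg p"
    "unt (snd p) \<in> Mor2 B" "dom2 B (unt (snd p)) = I (fst p)" "cod2 B (unt (snd p)) = alg p"
    "comult (snd p) \<in> Mor2 B" "dom2 B (comult (snd p)) = alg p"
      "cod2 B (comult (snd p)) = alg p \<otimes> alg p"
    "counit (snd p) \<in> Mor2 B" "dom2 B (counit (snd p)) = alg p" "cod2 B (counit (snd p)) = I (fst p)"
  using assms
  by (auto simp: frob_obj_def is_frobenius_def is_algebra_def is_coalgebra_def Let_def hom1_iff hom2_iff)

text \<open>\<open>mu\<close>, \<open>eta\<close>, \<open>delta\<close>, \<open>eps\<close> are the families of the structure maps of an algebra, and
  \<open>la\<close>, \<open>ra\<close> below those of the actions of a bimodule.\<close>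

definition mu :: "'o \<times> ('m, 'c) frob \<Rightarrow> 'm \<Rightarrow> 'c" where
  "mu p = hat21 (alg p) (alg p) (mult (snd p))"

definition eta :: "'o \<times> ('m, 'c) frob \<Rightarrow> 'm \<Rightarrow> 'c" where
  "eta p = hat01 (unt (snd p))"

definition delta :: "'o \<times> ('m, 'c) frob \<Rightarrow> 'm \<Rightarrow> 'c" where
  "delta p = hat12 (alg p) (alg p) (comult (snd p))"

definition eps :: "'o \<times> ('m, 'c) frob \<Rightarrow> 'm \<Rightarrow> 'c" where
  "eps p = hat10 (counit (snd p))"

lemma frob_hat_cell [simp]:
  assumes "frob_obj p" "W \<in> Mor1 B" "tgt B W = fst p"
  shows "mu p W \<in> Mor2 B" "dom2 B (mu p W) = alg p \<otimes> (alg p \<otimes> W)" "cod2 B (mu p W) = alg p \<otimes> W"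
    "eta p W \<in> Mor2 B" "dom2 B (eta p W) = W" "cod2 B (eta p W) = alg p \<otimes> W"
    "delta p W \<in> Mor2 B" "dom2 B (delta p W) = alg p \<otimes> W" "cod2 B (delta p W) = alg p \<otimes> (alg p \<otimes> W)"
    "eps p W \<in> Mor2 B" "dom2 B (eps p W) = alg p \<otimes> W" "cod2 B (eps p W) = W"
  using assms by (simp_all add: mu_def eta_def delta_def eps_def hat21_cell hat01_cell hat12_cell hat10_cell)

lemma frob_hat_unfold:
  assumes "frob_obj p" "W \<in> Mor1 B" "tgt B W = fst p"
  shows "mult (snd p) \<lhd> W = mu p W \<cdot> \<a> (alg p) (alg p) W"
    "unt (snd p) \<lhd> W = eta p W \<cdot> \<l> W"
    "comult (snd p) \<lhd> W = \<a>\<^sup>- (alg p) (alg p) W \<cdot> delta p W"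
    "counit (snd p) \<lhd> W = \<l>\<^sup>- W \<cdot> eps p W"
  using assms
  by (simp_all add: mu_def eta_def delta_def eps_def hat21_unfold hat01_unfold hat12_unfold hat10_unfold)

lemma frob_hat_natural:
  assumes "frob_obj p" "g \<in> Mor2 B" "cod2 B g = V" "tgt B (dom2 B g) = fst p"
  shows mu_natural: "mu p V \<cdot> alg p \<rhd> alg p \<rhd> g = alg p \<rhd> g \<cdot> mu p (dom2 B g)"
    and eta_natural: "eta p V \<cdot> g = alg p \<rhd> g \<cdot> eta p (dom2 B g)"
    and dl_natural: "delta p V \<cdot> alg p \<rhd> g = alg p \<rhd> alg p \<rhd> g \<cdot> delta p (dom2 B g)"
    and ep_natural: "eps p V \<cdot> alg p \<rhd> g = g \<cdot> eps p (dom2 B g)"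
  using assms hat21_natural[of "mult (snd p)" "alg p" "alg p" g] hat01_natural[of "unt (snd p)" g]
    hat12_natural[of "comult (snd p)" "alg p" "alg p" g] hat10_natural[of "counit (snd p)" g]
  by (simp_all add: mu_def eta_def delta_def eps_def)

lemma frob_hat_laws:
  assumes p: "frob_obj p" and W: "W \<in> Mor1 B" "tgt B W = fst p"
  shows mu_assoc: "mu p W \<cdot> alg p \<rhd> mu p W = mu p W \<cdot> mu p (alg p \<otimes> W)"
    and mu_eta: "mu p W \<cdot> eta p (alg p \<otimes> W) = \<one> (alg p \<otimes> W)"
      "mu p W \<cdot> alg p \<rhd> eta p W = \<one> (alg p \<otimes> W)"
    and dl_coassoc: "alg p \<rhd> delta p W \<cdot> delta p W = delta p (alg p \<otimes> W) \<cdot> delta p W"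
    and ep_dl: "eps p (alg p \<otimes> W) \<cdot> delta p W = \<one> (alg p \<otimes> W)"
      "alg p \<rhd> eps p W \<cdot> delta p W = \<one> (alg p \<otimes> W)"
    and dl_mu: "delta p W \<cdot> mu p W = alg p \<rhd> mu p W \<cdot> delta p (alg p \<otimes> W)"
      "delta p W \<cdot> mu p W = mu p (alg p \<otimes> W) \<cdot> alg p \<rhd> delta p W"
    and mu_dl: "mu p W \<cdot> delta p W = \<one> (alg p \<otimes> W)"
proof -
  let ?A = "alg p" and ?\<mu> = "mult (snd p)" and ?\<eta> = "unt (snd p)"
    and ?\<Delta> = "comult (snd p)" and ?\<epsilon> = "counit (snd p)"
  have laws:
    "?\<mu> \<cdot> (?\<mu> \<star> \<one> ?A) = ?\<mu> \<cdot> (\<one> ?A \<star> ?\<mu>) \<cdot> \<a> ?A ?A ?A"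
    "?\<mu> \<cdot> (?\<eta> \<star> \<one> ?A) = \<l> ?A" "?\<mu> \<cdot> (\<one> ?A \<star> ?\<eta>) = \<r> ?A"
    "\<a> ?A ?A ?A \<cdot> (?\<Delta> \<star> \<one> ?A) \<cdot> ?\<Delta> = (\<one> ?A \<star> ?\<Delta>) \<cdot> ?\<Delta>"
    "\<l> ?A \<cdot> (?\<epsilon> \<star> \<one> ?A) \<cdot> ?\<Delta> = \<one> ?A" "\<r> ?A \<cdot> (\<one> ?A \<star> ?\<epsilon>) \<cdot> ?\<Delta> = \<one> ?A"
    "(\<one> ?A \<star> ?\<mu>) \<cdot> \<a> ?A ?A ?A \<cdot> (?\<Delta> \<star> \<one> ?A) = ?\<Delta> \<cdot> ?\<mu>"
    "?\<Delta> \<cdot> ?\<mu> = (?\<mu> \<star> \<one> ?A) \<cdot> \<a>\<^sup>- ?A ?A ?A \<cdot> (\<one> ?A \<star> ?\<Delta>)"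
    "?\<mu> \<cdot> ?\<Delta> = \<one> ?A"
    using p unfolding frob_obj_def is_frobenius_def is_algebra_def is_coalgebra_def
      is_separable_def Let_def by blast+
  \<comment> \<open>\<open>L\<close> and \<open>R\<close> stand for the associators and unitors that
    bring codomain and domain into right-nested form; after unfolding, all coherence cells
    cancel.\<close>
  have whisker: "L \<cdot> f \<lhd> W \<cdot> R = L \<cdot> g \<lhd> W \<cdot> R" if "f = g" for f g L R
    using that by simp
  note s = unwhisker frob_hat_unfold
  let ?R3 = "\<a>\<^sup>- (?A \<otimes> ?A) ?A W \<cdot> \<a>\<^sup>- ?A ?A (?A \<otimes> W)"
  let ?L3 = "?A \<rhd> \<a> ?A ?A W \<cdot> \<a> ?A (?A \<otimes> ?A) W"
  show "mu p W \<cdot> ?A \<rhd> mu p W = mu p W \<cdot> mu p (?A \<otimes> W)"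
    using p W whisker[OF laws(1), of "\<one> (?A \<otimes> W)" ?R3] by (simp add: s)
  show "mu p W \<cdot> eta p (?A \<otimes> W) = \<one> (?A \<otimes> W)"
    using p W whisker[OF laws(2), of "\<one> (?A \<otimes> W)" "\<a>\<^sup>- (I (fst p)) ?A W \<cdot> \<l>\<^sup>- (?A \<otimes> W)"] by (simp add: s)
  show "mu p W \<cdot> ?A \<rhd> eta p W = \<one> (?A \<otimes> W)"
    using p W whisker[OF laws(3), of "\<one> (?A \<otimes> W)" "\<a>\<^sup>- ?A (I (fst p)) W \<cdot> ?A \<rhd> \<l>\<^sup>- W"] by (simp add: s)
  show "?A \<rhd> delta p W \<cdot> delta p W = delta p (?A \<otimes> W) \<cdot> delta p W"
    using p W whisker[OF laws(4), of ?L3 "\<one> (?A \<otimes> W)"] by (simp add: s)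
  show "eps p (?A \<otimes> W) \<cdot> delta p W = \<one> (?A \<otimes> W)"
    using p W whisker[OF laws(5), of "\<one> (?A \<otimes> W)" "\<one> (?A \<otimes> W)"] by (simp add: s)
  show "?A \<rhd> eps p W \<cdot> delta p W = \<one> (?A \<otimes> W)"
    using p W whisker[OF laws(6), of "\<one> (?A \<otimes> W)" "\<one> (?A \<otimes> W)"] by (simp add: s)
  show "delta p W \<cdot> mu p W = ?A \<rhd> mu p W \<cdot> delta p (?A \<otimes> W)"
    using p W whisker[OF laws(7), of "\<a> ?A ?A W" "\<a>\<^sup>- ?A ?A W"] by (simp add: s)
  show "delta p W \<cdot> mu p W = mu p (?A \<otimes> W) \<cdot> ?A \<rhd> delta p W"
    using p W whisker[OF laws(8), of "\<a> ?A ?A W" "\<a>\<^sup>- ?A ?A W"] by (simp add: s)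
  show "mu p W \<cdot> delta p W = \<one> (?A \<otimes> W)"
    using p W whisker[OF laws(9), of "\<one> (?A \<otimes> W)" "\<one> (?A \<otimes> W)"] by (simp add: s)
qed

section \<open>The Frobenius pairing and copairing\<close>

definition copairing :: "'o \<times> ('m, 'c) frob \<Rightarrow> 'm \<Rightarrow> 'c" where
  "copairing p W = delta p W \<cdot> eta p W"

definition pairing :: "'o \<times> ('m, 'c) frob \<Rightarrow> 'm \<Rightarrow> 'c" where
  "pairing p W = eps p W \<cdot> mu p W"

lemma cp_pr_cell [simp]:
  assumes "frob_obj p" "W \<in> Mor1 B" "tgt B W = fst p"
  shows "copairing p W \<in> Mor2 B" "dom2 B (copairing p W) = W" "cod2 B (copairing p W) = alg p \<otimes> (alg p \<otimes> W)"
    "pairing p W \<in> Mor2 B" "dom2 B (pairing p W) = alg p \<otimes> (alg p \<otimes> W)" "cod2 B (pairing p W) = W"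
  using assms by (simp_all add: copairing_def pairing_def)

lemmas frob_hat_natural' = frob_hat_natural[THEN vcomp_reassoc]

lemma cp_natural:
  assumes "frob_obj p" "g \<in> Mor2 B" "cod2 B g = V" "tgt B (dom2 B g) = fst p"
  shows "copairing p V \<cdot> g = alg p \<rhd> alg p \<rhd> g \<cdot> copairing p (dom2 B g)"
  using assms by (auto simp: copairing_def eta_natural frob_hat_natural')

lemma pr_natural:
  assumes "frob_obj p" "g \<in> Mor2 B" "cod2 B g = V" "tgt B (dom2 B g) = fst p"
  shows "pairing p V \<cdot> alg p \<rhd> alg p \<rhd> g = g \<cdot> pairing p (dom2 B g)"
  using assms by (auto simp: pairing_def mu_natural frob_hat_natural')

text \<open>Insert the unit or the counit into the Frobenius relations. The rules
  \<open>pr_cp\<close> are the snake identities that make the algebra dual to itself, and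
  \<open>mu_cp_id\<close> is where separability enters.\<close>

lemma cp_laws:
  assumes p: "frob_obj p" and W: "W \<in> Mor1 B" "tgt B W = fst p"
  shows mu_cp: "mu p (alg p \<otimes> W) \<cdot> alg p \<rhd> copairing p W = delta p W"
      "alg p \<rhd> mu p W \<cdot> copairing p (alg p \<otimes> W) = delta p W"
    and dl_cp: "alg p \<rhd> delta p W \<cdot> copairing p W = delta p (alg p \<otimes> W) \<cdot> copairing p W"
    and pr_cp: "pairing p (alg p \<otimes> W) \<cdot> alg p \<rhd> copairing p W = \<one> (alg p \<otimes> W)"
      "alg p \<rhd> pairing p W \<cdot> copairing p (alg p \<otimes> W) = \<one> (alg p \<otimes> W)"
    and pr_dl: "pairing p (alg p \<otimes> W) \<cdot> alg p \<rhd> delta p W = mu p W"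
      "alg p \<rhd> pairing p W \<cdot> delta p (alg p \<otimes> W) = mu p W"
    and mu_cp_id: "mu p W \<cdot> copairing p W = eta p W"
    and pr_mu: "pairing p W \<cdot> alg p \<rhd> mu p W = pairing p W \<cdot> mu p (alg p \<otimes> W)"
    and pr_eta: "pairing p W \<cdot> eta p (alg p \<otimes> W) = eps p W" "pairing p W \<cdot> alg p \<rhd> eta p W = eps p W"
    and ep_cp: "eps p (alg p \<otimes> W) \<cdot> copairing p W = eta p W" "alg p \<rhd> eps p W \<cdot> copairing p W = eta p W"
proof -
  note [simp] = p W
  have [simp]: "mu p (alg p \<otimes> W) \<cdot> alg p \<rhd> delta p W = delta p W \<cdot> mu p W"
    "alg p \<rhd> mu p W \<cdot> delta p (alg p \<otimes> W) = delta p W \<cdot> mu p W"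
    using dl_mu[OF p W] by simp_all
  note [simp] = this[THEN vcomp_reassoc]
    mu_eta mu_dl ep_dl mu_eta[THEN vcomp_reassoc] mu_dl[THEN vcomp_reassoc] ep_dl[THEN vcomp_reassoc]
  show [simp]: "mu p (alg p \<otimes> W) \<cdot> alg p \<rhd> copairing p W = delta p W"
    "alg p \<rhd> mu p W \<cdot> copairing p (alg p \<otimes> W) = delta p W"
    by (simp_all add: copairing_def)
  show "alg p \<rhd> delta p W \<cdot> copairing p W = delta p (alg p \<otimes> W) \<cdot> copairing p W"
    using p by (simp add: copairing_def dl_coassoc dl_coassoc[THEN vcomp_reassoc])
  show "pairing p (alg p \<otimes> W) \<cdot> alg p \<rhd> copairing p W = \<one> (alg p \<otimes> W)"
    "alg p \<rhd> pairing p W \<cdot> copairing p (alg p \<otimes> W) = \<one> (alg p \<otimes> W)"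
    "pairing p (alg p \<otimes> W) \<cdot> alg p \<rhd> delta p W = mu p W"
    "alg p \<rhd> pairing p W \<cdot> delta p (alg p \<otimes> W) = mu p W"
    by (simp_all add: pairing_def)
  show "mu p W \<cdot> copairing p W = eta p W"
    by (simp add: copairing_def)
  show "pairing p W \<cdot> alg p \<rhd> mu p W = pairing p W \<cdot> mu p (alg p \<otimes> W)"
    by (simp add: pairing_def mu_assoc)
  show "pairing p W \<cdot> eta p (alg p \<otimes> W) = eps p W" "pairing p W \<cdot> alg p \<rhd> eta p W = eps p W"
    by (simp_all add: pairing_def)
  show "eps p (alg p \<otimes> W) \<cdot> copairing p W = eta p W" "alg p \<rhd> eps p W \<cdot> copairing p W = eta p W"
    by (simp_all add: copairing_def)
qed

text \<open>Well-typed data of a bimodule without the action axioms. The dual of a bimodule and its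
  twists are at first known only in this form.\<close>

definition prebim :: "('o, 'm, 'c) bimod \<Rightarrow> bool" where
  "prebim M \<longleftrightarrow> frob_obj (bsrc M) \<and> frob_obj (btgt M)
    \<and> bcarr M \<in> hom1 B (fst (bsrc M)) (fst (btgt M))
    \<and> lact M \<in> hom2 B (alg (btgt M) \<otimes> bcarr M) (bcarr M)
    \<and> ract M \<in> hom2 B (bcarr M \<otimes> alg (bsrc M)) (bcarr M)"

lemma prebim_cell [simp]:
  assumes "prebim M"
  shows "frob_obj (bsrc M)" "frob_obj (btgt M)"
    "bcarr M \<in> Mor1 B" "src B (bcarr M) = fst (bsrc M)" "tgt B (bcarr M) = fst (btgt M)"
    "lact M \<in> Mor2 B" "dom2 B (lact M) = alg (btgt M) \<otimes> bcarr M" "cod2 B (lact M) = bcarr M"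
    "ract M \<in> Mor2 B" "dom2 B (ract M) = bcarr M \<otimes> alg (bsrc M)" "cod2 B (ract M) = bcarr M"
  using assms by (auto simp: prebim_def hom1_iff hom2_iff)

lemma bim_prebim [simp]: "bim M \<Longrightarrow> prebim M"
  unfolding bim_def prebim_def is_bimodule_def Let_def by blast

definition la :: "('o, 'm, 'c) bimod \<Rightarrow> 'm \<Rightarrow> 'c" where
  "la M = hat21 (alg (btgt M)) (bcarr M) (lact M)"

definition ra :: "('o, 'm, 'c) bimod \<Rightarrow> 'm \<Rightarrow> 'c" where
  "ra M = hat21 (bcarr M) (alg (bsrc M)) (ract M)"

lemma act_cell [simp]:
  assumes "prebim M" "W \<in> Mor1 B" "tgt B W = fst (bsrc M)"
  shows "la M W \<in> Mor2 B" "dom2 B (la M W) = alg (btgt M) \<otimes> (bcarr M \<otimes> W)"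
      "cod2 B (la M W) = bcarr M \<otimes> W"
    "ra M W \<in> Mor2 B" "dom2 B (ra M W) = bcarr M \<otimes> (alg (bsrc M) \<otimes> W)"
      "cod2 B (ra M W) = bcarr M \<otimes> W"
  using assms by (simp_all add: la_def ra_def hat21_cell)

lemma act_unfold:
  assumes "prebim M" "W \<in> Mor1 B" "tgt B W = fst (bsrc M)"
  shows "lact M \<lhd> W = la M W \<cdot> \<a> (alg (btgt M)) (bcarr M) W"
    "ract M \<lhd> W = ra M W \<cdot> \<a> (bcarr M) (alg (bsrc M)) W"
  using assms by (simp_all add: la_def ra_def hat21_unfold)

lemma act_natural:
  assumes "prebim M" "g \<in> Mor2 B" "cod2 B g = V" "tgt B (dom2 B g) = fst (bsrc M)"
  shows la_natural: "la M V \<cdot> alg (btgt M) \<rhd> bcarr M \<rhd> g = bcarr M \<rhd> g \<cdot> la M (dom2 B g)"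
    and ra_natural: "ra M V \<cdot> bcarr M \<rhd> alg (bsrc M) \<rhd> g = bcarr M \<rhd> g \<cdot> ra M (dom2 B g)"
  using assms hat21_natural[of "lact M" "alg (btgt M)" "bcarr M" g]
    hat21_natural[of "ract M" "bcarr M" "alg (bsrc M)" g]
  by (simp_all add: la_def ra_def)

lemma bim_laws:
  assumes M: "bim M" and W: "W \<in> Mor1 B" "tgt B W = fst (bsrc M)"
  shows la_la: "la M W \<cdot> alg (btgt M) \<rhd> la M W = la M W \<cdot> mu (btgt M) (bcarr M \<otimes> W)"
    and la_eta: "la M W \<cdot> eta (btgt M) (bcarr M \<otimes> W) = \<one> (bcarr M \<otimes> W)"
    and ra_ra: "ra M W \<cdot> ra M (alg (bsrc M) \<otimes> W) = ra M W \<cdot> bcarr M \<rhd> mu (bsrc M) W"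
    and ra_eta: "ra M W \<cdot> bcarr M \<rhd> eta (bsrc M) W = \<one> (bcarr M \<otimes> W)"
    and la_ra: "la M W \<cdot> alg (btgt M) \<rhd> ra M W = ra M W \<cdot> la M (alg (bsrc M) \<otimes> W)"
proof -
  let ?X = "bcarr M" and ?S = "alg (bsrc M)" and ?T = "alg (btgt M)"
    and ?l = "lact M" and ?r = "ract M"
  have laws:
    "?l \<cdot> (mult (tgt_alg M) \<star> \<one> ?X) = ?l \<cdot> (\<one> ?T \<star> ?l) \<cdot> \<a> ?T ?T ?X"
    "?l \<cdot> (unt (tgt_alg M) \<star> \<one> ?X) = \<l> ?X"
    "?r \<cdot> (?r \<star> \<one> ?S) = ?r \<cdot> (\<one> ?X \<star> mult (src_alg M)) \<cdot> \<a> ?X ?S ?S"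
    "?r \<cdot> (\<one> ?X \<star> unt (src_alg M)) = \<r> ?X"
    "?r \<cdot> (?l \<star> \<one> ?S) = ?l \<cdot> (\<one> ?T \<star> ?r) \<cdot> \<a> ?T ?X ?S"
    using M unfolding bim_def is_bimodule_def Let_def by blast+
  have whisker: "f \<lhd> W \<cdot> R = g \<lhd> W \<cdot> R" if "f = g" for f g R
    using that by simp
  note s = unwhisker frob_hat_unfold act_unfold
  show "la M W \<cdot> ?T \<rhd> la M W = la M W \<cdot> mu (btgt M) (?X \<otimes> W)"
    using M W whisker[OF laws(1), of "\<a>\<^sup>- (?T \<otimes> ?T) ?X W \<cdot> \<a>\<^sup>- ?T ?T (?X \<otimes> W)"] by (simp add: s)
  show "la M W \<cdot> eta (btgt M) (?X \<otimes> W) = \<one> (?X \<otimes> W)"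
    using M W whisker[OF laws(2), of "\<a>\<^sup>- (I (fst (btgt M))) ?X W \<cdot> \<l>\<^sup>- (?X \<otimes> W)"] by (simp add: s)
  show "ra M W \<cdot> ra M (?S \<otimes> W) = ra M W \<cdot> ?X \<rhd> mu (bsrc M) W"
    using M W whisker[OF laws(3), of "\<a>\<^sup>- (?X \<otimes> ?S) ?S W \<cdot> \<a>\<^sup>- ?X ?S (?S \<otimes> W)"] by (simp add: s)
  show "ra M W \<cdot> ?X \<rhd> eta (bsrc M) W = \<one> (?X \<otimes> W)"
    using M W whisker[OF laws(4), of "\<a>\<^sup>- ?X (I (fst (bsrc M))) W \<cdot> ?X \<rhd> \<l>\<^sup>- W"] by (simp add: s)
  show "la M W \<cdot> ?T \<rhd> ra M W = ra M W \<cdot> la M (?S \<otimes> W)"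
    using M W whisker[OF laws(5), of "\<a>\<^sup>- (?T \<otimes> ?X) ?S W \<cdot> \<a>\<^sup>- ?T ?X (?S \<otimes> W)"] by (simp add: s)
qed

lemmas bim_laws' = bim_laws[THEN vcomp_reassoc]

lemma bimI:
  assumes M: "prebim M"
    and laws: "\<And>W. \<lbrakk>W \<in> Mor1 B; tgt B W = fst (bsrc M)\<rbrakk> \<Longrightarrow>
        la M W \<cdot> alg (btgt M) \<rhd> la M W = la M W \<cdot> mu (btgt M) (bcarr M \<otimes> W)"
      "\<And>W. \<lbrakk>W \<in> Mor1 B; tgt B W = fst (bsrc M)\<rbrakk> \<Longrightarrow>
        la M W \<cdot> eta (btgt M) (bcarr M \<otimes> W) = \<one> (bcarr M \<otimes> W)"
      "\<And>W. \<lbrakk>W \<in> Mor1 B; tgt B W = fst (bsrc M)\<rbrakk> \<Longrightarrow>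
        ra M W \<cdot> ra M (alg (bsrc M) \<otimes> W) = ra M W \<cdot> bcarr M \<rhd> mu (bsrc M) W"
      "\<And>W. \<lbrakk>W \<in> Mor1 B; tgt B W = fst (bsrc M)\<rbrakk> \<Longrightarrow>
        ra M W \<cdot> bcarr M \<rhd> eta (bsrc M) W = \<one> (bcarr M \<otimes> W)"
      "\<And>W. \<lbrakk>W \<in> Mor1 B; tgt B W = fst (bsrc M)\<rbrakk> \<Longrightarrow>
        la M W \<cdot> alg (btgt M) \<rhd> ra M W = ra M W \<cdot> la M (alg (bsrc M) \<otimes> W)"
  shows "bim M"
proof -
  let ?X = "bcarr M" and ?S = "alg (bsrc M)" and ?T = "alg (btgt M)"
    and ?l = "lact M" and ?r = "ract M"
  note [simp] = M
  note s = unwhisker frob_hat_unfold act_unfold laws laws[THEN vcomp_reassoc]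
  have "?l \<cdot> (mult (tgt_alg M) \<star> \<one> ?X) = ?l \<cdot> (\<one> ?T \<star> ?l) \<cdot> \<a> ?T ?T ?X"
    by (rule cell_eqI) (simp_all add: s)
  moreover have "?l \<cdot> (unt (tgt_alg M) \<star> \<one> ?X) = \<l> ?X"
    by (rule cell_eqI) (simp_all add: s)
  moreover have "?r \<cdot> (?r \<star> \<one> ?S) = ?r \<cdot> (\<one> ?X \<star> mult (src_alg M)) \<cdot> \<a> ?X ?S ?S"
    by (rule cell_eqI) (simp_all add: s)
  moreover have "?r \<cdot> (\<one> ?X \<star> unt (src_alg M)) = \<r> ?X"
    by (rule cell_eqI) (simp_all add: s)
  moreover have "?r \<cdot> (?l \<star> \<one> ?S) = ?l \<cdot> (\<one> ?T \<star> ?r) \<cdot> \<a> ?T ?X ?S"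
    by (rule cell_eqI) (simp_all add: s)
  ultimately show ?thesis
    unfolding bim_def is_bimodule_def Let_def using M[unfolded prebim_def] by blast
qed

lemma lwhisker_eq:
  assumes "g \<cdot> f = h" "f \<in> Mor2 B" "g \<in> Mor2 B" "dom2 B g = cod2 B f" "X \<in> Mor1 B"
    "src B X = tgt B (dom2 B f)"
  shows "X \<rhd> g \<cdot> X \<rhd> f = X \<rhd> h"
  using assms lwhisker_vcomp[of f g X] by simp

text \<open>The naturality squares read in the opposite direction, so that each computation can
  choose which way a 2-cell moves past a structure map.\<close>

lemma frob_hat_push:
  assumes "frob_obj p" "g \<in> Mor2 B" "dom2 B g = W" "tgt B W = fst p"
  shows mu_push: "alg p \<rhd> g \<cdot> mu p W = mu p (cod2 B g) \<cdot> alg p \<rhd> alg p \<rhd> g"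
    and eta_push: "alg p \<rhd> g \<cdot> eta p W = eta p (cod2 B g) \<cdot> g"
    and delta_push: "alg p \<rhd> alg p \<rhd> g \<cdot> delta p W = delta p (cod2 B g) \<cdot> alg p \<rhd> g"
  using assms frob_hat_natural[of p g "cod2 B g"] by simp_all

lemma act_push:
  assumes "prebim M" "g \<in> Mor2 B" "dom2 B g = W" "tgt B W = fst (bsrc M)"
  shows la_push: "bcarr M \<rhd> g \<cdot> la M W = la M (cod2 B g) \<cdot> alg (btgt M) \<rhd> bcarr M \<rhd> g"
    and ra_push: "bcarr M \<rhd> g \<cdot> ra M W = ra M (cod2 B g) \<cdot> bcarr M \<rhd> alg (bsrc M) \<rhd> g"
  using assms act_natural[of M g "cod2 B g"] by simp_all

lemmas act_push' = act_push[THEN vcomp_reassoc]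

text \<open>\<open>cr\<close> and \<open>cl\<close> are the coactions \<open>x \<mapsto> x \<cdot> \<Delta>\<eta>\<close> and \<open>x \<mapsto> \<Delta>\<eta> \<cdot> x\<close>.\<close>

definition cr :: "('o, 'm, 'c) bimod \<Rightarrow> 'm \<Rightarrow> 'c" where
  "cr M W = ra M (alg (bsrc M) \<otimes> W) \<cdot> bcarr M \<rhd> copairing (bsrc M) W"

definition cl :: "('o, 'm, 'c) bimod \<Rightarrow> 'm \<Rightarrow> 'c" where
  "cl M W = alg (btgt M) \<rhd> la M W \<cdot> copairing (btgt M) (bcarr M \<otimes> W)"

lemma coact_cell [simp]:
  assumes "prebim M" "W \<in> Mor1 B" "tgt B W = fst (bsrc M)"
  shows "cr M W \<in> Mor2 B" "dom2 B (cr M W) = bcarr M \<otimes> W"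
      "cod2 B (cr M W) = bcarr M \<otimes> (alg (bsrc M) \<otimes> W)"
    "cl M W \<in> Mor2 B" "dom2 B (cl M W) = bcarr M \<otimes> W"
      "cod2 B (cl M W) = alg (btgt M) \<otimes> (bcarr M \<otimes> W)"
  using assms by (simp_all add: cr_def cl_def)

lemma coact_natural:
  assumes M: "prebim M" "g \<in> Mor2 B" "cod2 B g = V" "tgt B (dom2 B g) = fst (bsrc M)"
  shows cr_natural: "cr M V \<cdot> bcarr M \<rhd> g = bcarr M \<rhd> alg (bsrc M) \<rhd> g \<cdot> cr M (dom2 B g)"
    and cl_natural: "cl M V \<cdot> bcarr M \<rhd> g = alg (btgt M) \<rhd> bcarr M \<rhd> g \<cdot> cl M (dom2 B g)"
proof -
  have V: "V \<in> Mor1 B" "tgt B V = fst (bsrc M)" using M by auto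
  note [simp] = M(1,2,4) V
  have "bcarr M \<rhd> copairing (bsrc M) V \<cdot> bcarr M \<rhd> g
    = bcarr M \<rhd> (alg (bsrc M) \<rhd> alg (bsrc M) \<rhd> g \<cdot> copairing (bsrc M) (dom2 B g))"
    using M by (intro lwhisker_eq cp_natural) auto
  then show "cr M V \<cdot> bcarr M \<rhd> g = bcarr M \<rhd> alg (bsrc M) \<rhd> g \<cdot> cr M (dom2 B g)"
    using M(3) by (simp add: cr_def act_push')
  have "alg (btgt M) \<rhd> la M V \<cdot> alg (btgt M) \<rhd> alg (btgt M) \<rhd> bcarr M \<rhd> g
    = alg (btgt M) \<rhd> (bcarr M \<rhd> g \<cdot> la M (dom2 B g))"
    using M by (intro lwhisker_eq la_natural) auto
  then show "cl M V \<cdot> bcarr M \<rhd> g = alg (btgt M) \<rhd> bcarr M \<rhd> g \<cdot> cl M (dom2 B g)"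
    using M(3) by (simp add: cl_def cp_natural vcomp_reassoc[of "alg (btgt M) \<rhd> la M V"])
qed

lemma cr_push:
  assumes "prebim M" "g \<in> Mor2 B" "dom2 B g = W" "tgt B W = fst (bsrc M)"
  shows "bcarr M \<rhd> alg (bsrc M) \<rhd> g \<cdot> cr M W = cr M (cod2 B g) \<cdot> bcarr M \<rhd> g"
  using assms coact_natural[of M g "cod2 B g"] by simp

text \<open>Multiplying with \<Delta>\<eta> turns a module over a Frobenius algebra into a comodule,
  and every law reduces to one of \<open>cp_laws\<close>. The action undoes the coaction because
  \<mu>\<Delta>\<eta> = \<eta>, a consequence of separability.\<close>

lemma coact_laws:
  assumes M: "bim M" and W: "W \<in> Mor1 B" "tgt B W = fst (bsrc M)"
  shows ra_cr: "ra M W \<cdot> cr M W = \<one> (bcarr M \<otimes> W)"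
    and cr_ra: "cr M W \<cdot> ra M W = ra M (alg (bsrc M) \<otimes> W) \<cdot> bcarr M \<rhd> delta (bsrc M) W"
    and mu_cr: "bcarr M \<rhd> mu (bsrc M) W \<cdot> cr M (alg (bsrc M) \<otimes> W)
      = ra M (alg (bsrc M) \<otimes> W) \<cdot> bcarr M \<rhd> delta (bsrc M) W"
    and cr_cr: "cr M (alg (bsrc M) \<otimes> W) \<cdot> cr M W = bcarr M \<rhd> delta (bsrc M) W \<cdot> cr M W"
    and cr_la: "cr M W \<cdot> la M W = la M (alg (bsrc M) \<otimes> W) \<cdot> alg (btgt M) \<rhd> cr M W"
    and ep_cr: "bcarr M \<rhd> eps (bsrc M) W \<cdot> cr M W = \<one> (bcarr M \<otimes> W)"
    and la_cl: "la M W \<cdot> cl M W = \<one> (bcarr M \<otimes> W)"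
    and cl_la: "cl M W \<cdot> la M W = alg (btgt M) \<rhd> la M W \<cdot> delta (btgt M) (bcarr M \<otimes> W)"
    and mu_cl: "mu (btgt M) (bcarr M \<otimes> W) \<cdot> alg (btgt M) \<rhd> cl M W
      = alg (btgt M) \<rhd> la M W \<cdot> delta (btgt M) (bcarr M \<otimes> W)"
    and cl_cl: "alg (btgt M) \<rhd> cl M W \<cdot> cl M W = delta (btgt M) (bcarr M \<otimes> W) \<cdot> cl M W"
    and cl_ra: "cl M W \<cdot> ra M W = alg (btgt M) \<rhd> ra M W \<cdot> cl M (alg (bsrc M) \<otimes> W)"
    and ep_cl: "eps (btgt M) (bcarr M \<otimes> W) \<cdot> cl M W = \<one> (bcarr M \<otimes> W)"
proof -
  let ?X = "bcarr M" and ?S = "alg (bsrc M)" and ?T = "alg (btgt M)"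
  note [simp] = M W
  note s = cr_def cl_def act_push' bim_laws bim_laws'
  note l = lwhisker_eq[OF mu_cp_id] lwhisker_eq[OF mu_cp(1)] lwhisker_eq[OF mu_cp(2)]
    lwhisker_eq[OF mu_cp(1), THEN vcomp_reassoc] lwhisker_eq[OF mu_cp(2), THEN vcomp_reassoc]
    lwhisker_eq[OF dl_cp] lwhisker_eq[OF ep_cp(1)] lwhisker_eq[OF ep_cp(2)]
    lwhisker_eq[OF la_la] lwhisker_eq[OF la_la, THEN vcomp_reassoc]
    lwhisker_eq[OF la_ra] lwhisker_eq[OF la_ra, THEN vcomp_reassoc]
    cp_natural cp_natural[THEN vcomp_reassoc]
  show "ra M W \<cdot> cr M W = \<one> (?X \<otimes> W)"
    by (simp add: s l)
  show 1: "cr M W \<cdot> ra M W = ra M (?S \<otimes> W) \<cdot> ?X \<rhd> delta (bsrc M) W"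
    by (simp add: s l act_push)
  show "?X \<rhd> mu (bsrc M) W \<cdot> cr M (?S \<otimes> W) = ra M (?S \<otimes> W) \<cdot> ?X \<rhd> delta (bsrc M) W"
    by (simp add: cr_def act_push' l)
  show "cr M (?S \<otimes> W) \<cdot> cr M W = ?X \<rhd> delta (bsrc M) W \<cdot> cr M W"
    by (simp add: s l)
  show "cr M W \<cdot> la M W = la M (?S \<otimes> W) \<cdot> ?T \<rhd> cr M W"
    by (simp add: s l act_push)
  show "?X \<rhd> eps (bsrc M) W \<cdot> cr M W = \<one> (?X \<otimes> W)"
    by (simp add: s l)
  show "la M W \<cdot> cl M W = \<one> (?X \<otimes> W)"
    by (simp add: s l mu_cp_id)
  show c: "cl M W \<cdot> la M W = ?T \<rhd> la M W \<cdot> delta (btgt M) (?X \<otimes> W)"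
    by (simp add: s l mu_cp)
  show "mu (btgt M) (?X \<otimes> W) \<cdot> ?T \<rhd> cl M W = ?T \<rhd> la M W \<cdot> delta (btgt M) (?X \<otimes> W)"
    by (simp add: cl_def mu_natural mu_natural[THEN vcomp_reassoc] mu_cp)
  have "?T \<rhd> cl M W \<cdot> cl M W = ?T \<rhd> cl M W \<cdot> (?T \<rhd> la M W \<cdot> copairing (btgt M) (?X \<otimes> W))"
    by (simp add: cl_def)
  also have "\<dots> = ?T \<rhd> (?T \<rhd> la M W \<cdot> delta (btgt M) (?X \<otimes> W)) \<cdot> copairing (btgt M) (?X \<otimes> W)"
    by (rule vcomp_reassoc[OF lwhisker_eq[OF c]]) simp_all
  also have "\<dots> = delta (btgt M) (?X \<otimes> W) \<cdot> cl M W"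
    by (simp add: cl_def dl_cp dl_natural[THEN vcomp_reassoc])
  finally show "?T \<rhd> cl M W \<cdot> cl M W = delta (btgt M) (?X \<otimes> W) \<cdot> cl M W" .
  show "cl M W \<cdot> ra M W = ?T \<rhd> ra M W \<cdot> cl M (?S \<otimes> W)"
    by (simp add: cl_def l)
  show "eps (btgt M) (?X \<otimes> W) \<cdot> cl M W = \<one> (?X \<otimes> W)"
    by (simp add: cl_def ep_natural ep_natural[THEN vcomp_reassoc] ep_cp la_eta)
qed

section \<open>Relative tensor products\<close>

lemma split_epi_cancel:
  assumes "f \<cdot> e = g \<cdot> e" "e \<cdot> s = \<one> (cod2 B e)"
    and "f \<in> Mor2 B" "g \<in> Mor2 B" "e \<in> Mor2 B" "s \<in> Mor2 B" "dom2 B e = cod2 B s"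
    "dom2 B f = cod2 B e" "dom2 B g = cod2 B e"
  shows "f = g"
proof -
  have "f = (f \<cdot> e) \<cdot> s" using assms(2-) by simp
  also have "\<dots> = g" unfolding assms(1) using assms(2-) by simp
  finally show ?thesis .
qed

text \<open>The factorisation is \<open>h \<cdot> s\<close>, and it exists once \<open>h\<close> is
  invariant under the idempotent \<open>s \<cdot> e\<close>. Whiskering preserves a splitting,
  whereas it need not preserve a coequaliser; this is how the factorisations through whiskered
  projections in \<open>rel_tensor\<close> are controlled.\<close>

lemma factor2_split:
  assumes "e \<in> Mor2 B" "s \<in> Mor2 B" "h \<in> Mor2 B" "dom2 B e = cod2 B s" "dom2 B h = dom2 B e"
    and s: "dom2 B s = cod2 B e" and es: "e \<cdot> s = \<one> (cod2 B e)" and hse: "h \<cdot> s \<cdot> e = h"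
  shows "factor2 B e h \<in> Mor2 B" "dom2 B (factor2 B e h) = cod2 B e"
    "cod2 B (factor2 B e h) = cod2 B h" "factor2 B e h \<cdot> e = h"
proof -
  have "\<exists>!u. u \<in> hom2 B (cod2 B e) (cod2 B h) \<and> u \<cdot> e = h"
  proof (rule ex1I[of _ "h \<cdot> s"])
    show "h \<cdot> s \<in> hom2 B (cod2 B e) (cod2 B h) \<and> (h \<cdot> s) \<cdot> e = h"
      using assms s by (simp add: hom2_iff)
    show "u = h \<cdot> s" if "u \<in> hom2 B (cod2 B e) (cod2 B h) \<and> u \<cdot> e = h" for u
    proof -
      have "u \<cdot> (e \<cdot> s) = h \<cdot> s"
        using that assms s by (intro vcomp_reassoc) (auto simp: hom2_iff)
      then show ?thesis using that es s by (simp add: hom2_iff)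
    qed
  qed
  from theI'[OF this, folded factor2_def]
  show "factor2 B e h \<in> Mor2 B" "dom2 B (factor2 B e h) = cod2 B e"
    "cod2 B (factor2 B e h) = cod2 B h" "factor2 B e h \<cdot> e = h"
    by (auto simp: hom2_iff)
qed

text \<open>The idempotent on \<open>Y \<otimes> X\<close> whose splitting is the relative tensor product.\<close>

definition pp :: "('o, 'm, 'c) bimod \<Rightarrow> ('o, 'm, 'c) bimod \<Rightarrow> 'm \<Rightarrow> 'c" where
  "pp Y X W = bcarr Y \<rhd> la X W \<cdot> cr Y (bcarr X \<otimes> W)"

lemma pp_cell [simp]:
  assumes "prebim Y" "prebim X" "bsrc Y = btgt X" "W \<in> Mor1 B" "tgt B W = fst (bsrc X)"
  shows "pp Y X W \<in> Mor2 B" "dom2 B (pp Y X W) = bcarr Y \<otimes> (bcarr X \<otimes> W)"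
    "cod2 B (pp Y X W) = bcarr Y \<otimes> (bcarr X \<otimes> W)"
  using assms by (simp_all add: pp_def)

text \<open>The element \<Delta>\<eta> is central: multiplying its left factor from the left or its
  right factor from the right by \<open>a\<close> gives \<Delta>(a) in both cases. Hence
  \<open>pp\<close> is balanced; the outer actions commute with it since they do not touch the
  middle algebra.\<close>

lemma pp_laws:
  assumes "bim Y" "bim X" "bsrc Y = btgt X" "W \<in> Mor1 B" "tgt B W = fst (bsrc X)"
  shows pp_balanced: "pp Y X W \<cdot> ra Y (bcarr X \<otimes> W) = pp Y X W \<cdot> bcarr Y \<rhd> la X W"
    and pp_la: "pp Y X W \<cdot> la Y (bcarr X \<otimes> W) = la Y (bcarr X \<otimes> W) \<cdot> alg (btgt Y) \<rhd> pp Y X W"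
    and pp_ra: "pp Y X W \<cdot> bcarr Y \<rhd> ra X W = bcarr Y \<rhd> ra X W \<cdot> pp Y X (alg (bsrc X) \<otimes> W)"
proof -
  note [simp] = assms
  have n: "cr Y V \<cdot> bcarr Y \<rhd> g = bcarr Y \<rhd> alg (btgt X) \<rhd> g \<cdot> cr Y (dom2 B g)"
    if "g \<in> Mor2 B" "cod2 B g = V" "tgt B (dom2 B g) = fst (btgt X)" for g V
    using cr_natural[of Y g V] that by simp
  note s = pp_def mu_cr[of Y, simplified] cr_ra[of Y, simplified] n cr_la[of Y, simplified]
    la_la la_ra lwhisker_eq[OF la_la] lwhisker_eq[OF la_la, THEN vcomp_reassoc]
    lwhisker_eq[OF la_ra] lwhisker_eq[OF la_ra, THEN vcomp_reassoc]
    act_push'[of Y, simplified]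
  show "pp Y X W \<cdot> ra Y (bcarr X \<otimes> W) = pp Y X W \<cdot> bcarr Y \<rhd> la X W"
    by (simp add: s)
  show "pp Y X W \<cdot> la Y (bcarr X \<otimes> W) = la Y (bcarr X \<otimes> W) \<cdot> alg (btgt Y) \<rhd> pp Y X W"
    by (simp add: s)
  show "pp Y X W \<cdot> bcarr Y \<rhd> ra X W = bcarr Y \<rhd> ra X W \<cdot> pp Y X (alg (bsrc X) \<otimes> W)"
    by (simp add: s)
qed

text \<open>The 2-cell whose family is \<open>pp\<close>, as \<open>pcell_unfold\<close> shows.
  Idempotent completeness speaks of 2-cells, so the family alone does not suffice.\<close>

definition pcell :: "('o, 'm, 'c) bimod \<Rightarrow> ('o, 'm, 'c) bimod \<Rightarrow> 'c" where
  "pcell Y X = (let T = alg (btgt X) in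
     (\<one> (bcarr Y) \<star> lact X) \<cdot> \<a> (bcarr Y) T (bcarr X) \<cdot>
     (((ract Y \<star> \<one> T) \<cdot> \<a>\<^sup>- (bcarr Y) T T \<cdot>
        (\<one> (bcarr Y) \<star> (comult (snd (btgt X)) \<cdot> unt (snd (btgt X)))) \<cdot> \<r>\<^sup>- (bcarr Y)) \<star> \<one> (bcarr X)))"

lemma pcell [simp]:
  assumes "prebim Y" "prebim X" "bsrc Y = btgt X"
  shows "pcell Y X \<in> Mor2 B" "dom2 B (pcell Y X) = bcarr Y \<otimes> bcarr X"
    "cod2 B (pcell Y X) = bcarr Y \<otimes> bcarr X"
  using assms by (simp_all add: pcell_def Let_def)

lemma pcell_unfold:
  assumes "prebim Y" "prebim X" "bsrc Y = btgt X" "W \<in> Mor1 B" "tgt B W = fst (bsrc X)"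
  shows "pcell Y X \<lhd> W = \<a>\<^sup>- (bcarr Y) (bcarr X) W \<cdot> pp Y X W \<cdot> \<a> (bcarr Y) (bcarr X) W"
  using assms act_unfold[of Y]
  by (simp add: pcell_def Let_def unwhisker frob_hat_unfold act_unfold pp_def cr_def copairing_def)

text \<open>Lets the defining condition of the coequaliser be checked without associators.\<close>

lemma balanced_iff:
  assumes "prebim Y" "prebim X" "bsrc Y = btgt X"
    and "h \<in> Mor2 B" "dom2 B h = bcarr Y \<otimes> bcarr X"
  shows "h \<cdot> (ract Y \<star> \<one> (bcarr X))
      = h \<cdot> ((\<one> (bcarr Y) \<star> lact X) \<cdot> \<a> (bcarr Y) (alg (btgt X)) (bcarr X))
    \<longleftrightarrow> (\<forall>W. W \<in> Mor1 B \<longrightarrow> tgt B W = fst (bsrc X) \<longrightarrow>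
      hat21 (bcarr Y) (bcarr X) h W \<cdot> ra Y (bcarr X \<otimes> W)
      = hat21 (bcarr Y) (bcarr X) h W \<cdot> bcarr Y \<rhd> la X W)" (is "?l = ?r \<longleftrightarrow> ?P")
proof
  note [simp] = assms hat21_cell
  note s = unwhisker act_unfold act_unfold[of Y, simplified] hat21_unfold[of h "bcarr Y" "bcarr X"]
  assume eq: "?l = ?r"
  show ?P
  proof (intro allI impI)
    fix W assume W: "W \<in> Mor1 B" "tgt B W = fst (bsrc X)"
    have "?l \<lhd> W \<cdot> \<a>\<^sup>- (bcarr Y \<otimes> alg (btgt X)) (bcarr X) W \<cdot> \<a>\<^sup>- (bcarr Y) (alg (btgt X)) (bcarr X \<otimes> W)
      = ?r \<lhd> W \<cdot> \<a>\<^sup>- (bcarr Y \<otimes> alg (btgt X)) (bcarr X) W \<cdot> \<a>\<^sup>- (bcarr Y) (alg (btgt X)) (bcarr X \<otimes> W)"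
      unfolding eq ..
    then show "hat21 (bcarr Y) (bcarr X) h W \<cdot> ra Y (bcarr X \<otimes> W)
      = hat21 (bcarr Y) (bcarr X) h W \<cdot> bcarr Y \<rhd> la X W"
      using W by (simp add: s)
  qed
next
  note [simp] = assms hat21_cell
  note s = unwhisker act_unfold act_unfold[of Y, simplified] hat21_unfold[of h "bcarr Y" "bcarr X"]
  assume eq: ?P
  have eq': "hat21 (bcarr Y) (bcarr X) h W \<cdot> ra Y (bcarr X \<otimes> W)
      = hat21 (bcarr Y) (bcarr X) h W \<cdot> bcarr Y \<rhd> la X W"
    if "W \<in> Mor1 B" "tgt B W = fst (bsrc X)" for W
    using eq that by blast
  show "?l = ?r"
    by (rule cell_eqI) (simp_all add: s eq' eq'[THEN vcomp_reassoc])
qed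

text \<open>In a balanced map the action on \<open>X\<close> can be replaced by the action on
  \<open>Y\<close>; there it meets the coaction and the two cancel by separability.\<close>

lemma balanced_pcell:
  assumes "bim Y" "bim X" "bsrc Y = btgt X"
    and "h \<in> Mor2 B" "dom2 B h = bcarr Y \<otimes> bcarr X"
    and "h \<cdot> (ract Y \<star> \<one> (bcarr X))
      = h \<cdot> ((\<one> (bcarr Y) \<star> lact X) \<cdot> \<a> (bcarr Y) (alg (btgt X)) (bcarr X))"
  shows "h \<cdot> pcell Y X = h"
proof (rule cell_eqI)
  note [simp] = assms(1-5) hat21_cell
  fix W assume [simp]: "W \<in> Mor1 B" and "tgt B W = src B (dom2 B h)"
  then have [simp]: "tgt B W = fst (bsrc X)" by simp
  have "hat21 (bcarr Y) (bcarr X) h W \<cdot> bcarr Y \<rhd> la X W = hat21 (bcarr Y) (bcarr X) h W \<cdot> ra Y (bcarr X \<otimes> W)"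
    using assms(6) balanced_iff[of Y X h] by simp
  then have "hat21 (bcarr Y) (bcarr X) h W \<cdot> pp Y X W = hat21 (bcarr Y) (bcarr X) h W"
    using vcomp_reassoc[of "hat21 (bcarr Y) (bcarr X) h W" "bcarr Y \<rhd> la X W" _ "cr Y (bcarr X \<otimes> W)"]
    by (simp add: pp_def ra_cr[of Y, simplified])
  then show "(h \<cdot> pcell Y X) \<lhd> W = h \<lhd> W"
    using vcomp_reassoc[of "hat21 (bcarr Y) (bcarr X) h W" "pp Y X W" _ "\<a> (bcarr Y) (bcarr X) W"]
    by (simp add: rwhisker_vcomp pcell_unfold hat21_unfold[of h "bcarr Y" "bcarr X"])
qed (use assms in simp_all)

lemma pcell_balanced:
  assumes "bim Y" "bim X" "bsrc Y = btgt X"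
  shows "pcell Y X \<cdot> (ract Y \<star> \<one> (bcarr X))
      = pcell Y X \<cdot> ((\<one> (bcarr Y) \<star> lact X) \<cdot> \<a> (bcarr Y) (alg (btgt X)) (bcarr X))"
proof -
  note [simp] = assms
  note s = unwhisker act_unfold act_unfold[of Y, simplified] pcell_unfold
    pp_balanced pp_balanced[THEN vcomp_reassoc]
  show ?thesis
    by (rule cell_eqI) (simp_all add: s)
qed

end

section \<open>Existence of relative tensor products\<close>

locale idempotent_complete_bicategory = bicategory B
  for B :: "('o, 'm, 'c, 'z) bicat_scheme" (structure) +
  assumes idempotent_complete: "idempotent_complete_homs B"
begin

text \<open>\<open>pcell\<close> is balanced and is absorbed by balanced maps, hence it is
  idempotent. The retraction \<open>r\<close> of any splitting is a coequaliser with mediating map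
  \<open>h \<cdot> s\<close>, so the choice in \<open>rt_proj\<close> is not vacuous.\<close>

lemma rt_proj_coequaliser:
  assumes "bim Y" "bim X" "bsrc Y = btgt X"
  shows "is_coequaliser B (ract Y \<star> \<one> (bcarr X))
    ((\<one> (bcarr Y) \<star> lact X) \<cdot> \<a> (bcarr Y) (alg (btgt X)) (bcarr X)) (rt_proj B Y X)"
proof -
  note [simp] = assms
  let ?f = "ract Y \<star> \<one> (bcarr X)"
    and ?g = "(\<one> (bcarr Y) \<star> lact X) \<cdot> \<a> (bcarr Y) (alg (btgt X)) (bcarr X)"
  have "bcarr Y \<otimes> bcarr X \<in> hom1 B (fst (bsrc X)) (fst (btgt Y))"
    "pcell Y X \<in> hom2 B (bcarr Y \<otimes> bcarr X) (bcarr Y \<otimes> bcarr X)"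
    "pcell Y X \<cdot> pcell Y X = pcell Y X" "fst (bsrc X) \<in> Obj B" "fst (btgt Y) \<in> Obj B"
    using balanced_pcell[of Y X "pcell Y X"] pcell_balanced[of Y X] by (simp_all add: hom1_iff hom2_iff)
  then obtain Q r s where
    "r \<in> hom2 B (bcarr Y \<otimes> bcarr X) Q" "s \<in> hom2 B Q (bcarr Y \<otimes> bcarr X)"
    "s \<cdot> r = pcell Y X" "r \<cdot> s = \<one> Q"
    using idempotent_complete unfolding idempotent_complete_homs_def by metis
  then have r [simp]: "r \<in> Mor2 B" "dom2 B r = bcarr Y \<otimes> bcarr X" "cod2 B r = Q"
    "s \<in> Mor2 B" "dom2 B s = Q" "cod2 B s = bcarr Y \<otimes> bcarr X" "Q \<in> Mor1 B"
    and sr: "s \<cdot> r = pcell Y X" and rs: "r \<cdot> s = \<one> Q"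
    using cell1(10)[of r] by (auto simp: hom2_iff)
  \<comment> \<open>\<open>r\<close> inherits balancedness from \<open>pcell\<close>, since
    \<open>r\<close> equals \<open>r \<cdot> s \<cdot> r\<close> and \<open>s \<cdot> r\<close> is
    \<open>pcell\<close>.\<close>
  have "r \<cdot> ?f = (r \<cdot> s) \<cdot> (r \<cdot> ?f)" unfolding rs by simp
  also have "\<dots> = r \<cdot> ((s \<cdot> r) \<cdot> ?f)" by simp
  also have "\<dots> = r \<cdot> ((s \<cdot> r) \<cdot> ?g)" unfolding sr pcell_balanced[OF assms] ..
  also have "\<dots> = (r \<cdot> s) \<cdot> (r \<cdot> ?g)" by simp
  also have "\<dots> = r \<cdot> ?g" unfolding rs by simp
  finally have rfg: "r \<cdot> ?f = r \<cdot> ?g" .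
  have "\<exists>!u. u \<in> hom2 B (cod2 B r) (cod2 B h) \<and> u \<cdot> r = h"
    if h: "h \<in> Mor2 B" "dom2 B h = cod2 B ?f" and eq: "h \<cdot> ?f = h \<cdot> ?g" for h
  proof (rule ex1I[of _ "h \<cdot> s"])
    have [simp]: "dom2 B h = bcarr Y \<otimes> bcarr X" using h by simp
    show "h \<cdot> s \<in> hom2 B (cod2 B r) (cod2 B h) \<and> (h \<cdot> s) \<cdot> r = h"
      using h(1) sr balanced_pcell[OF assms h(1) _ eq] by (simp add: hom2_iff)
    show "u = h \<cdot> s" if "u \<in> hom2 B (cod2 B r) (cod2 B h) \<and> u \<cdot> r = h" for u
    proof -
      have "u \<cdot> (r \<cdot> s) = h \<cdot> s"
        using that h by (intro vcomp_reassoc) (auto simp: hom2_iff)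
      then show ?thesis using that rs by (simp add: hom2_iff)
    qed
  qed
  then have "is_coequaliser B ?f ?g r"
    using rfg unfolding is_coequaliser_def by (simp add: hom2_iff)
  then show ?thesis unfolding rt_proj_def by (rule someI)
qed

text \<open>\<open>rt_proj\<close> is an arbitrary chosen coequaliser rather than the splitting just
  constructed. Factoring the balanced map \<open>pcell\<close> through it yields a section, and
  uniqueness of factorisations gives the remaining equation.\<close>

lemma rt_proj_split:
  assumes "bim Y" "bim X" "bsrc Y = btgt X"
  shows "\<exists>s. s \<in> hom2 B (cod2 B (rt_proj B Y X)) (bcarr Y \<otimes> bcarr X)
    \<and> rt_proj B Y X \<cdot> s = \<one> (cod2 B (rt_proj B Y X)) \<and> s \<cdot> rt_proj B Y X = pcell Y X"
proof -
  note [simp] = assms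
  let ?f = "ract Y \<star> \<one> (bcarr X)" and ?q = "rt_proj B Y X"
    and ?g = "(\<one> (bcarr Y) \<star> lact X) \<cdot> \<a> (bcarr Y) (alg (btgt X)) (bcarr X)"
  note co = rt_proj_coequaliser[OF assms, unfolded is_coequaliser_def]
  have [simp]: "?q \<in> Mor2 B" "dom2 B ?q = bcarr Y \<otimes> bcarr X"
    and qfg: "?q \<cdot> ?f = ?q \<cdot> ?g"
    using co by simp_all
  have univ: "\<exists>!u. u \<in> hom2 B (cod2 B ?q) (cod2 B h) \<and> u \<cdot> ?q = h"
    if "h \<in> Mor2 B" "dom2 B h = bcarr Y \<otimes> bcarr X" "h \<cdot> ?f = h \<cdot> ?g" for h
    using co that by simp
  obtain s where s: "s \<in> hom2 B (cod2 B ?q) (bcarr Y \<otimes> bcarr X)" "s \<cdot> ?q = pcell Y X"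
    using univ[of "pcell Y X"] pcell_balanced[OF assms] by auto
  have "(?q \<cdot> s) \<cdot> ?q = ?q"
    using s balanced_pcell[OF assms _ _ qfg] by (simp add: hom2_iff)
  moreover have "\<one> (cod2 B ?q) \<cdot> ?q = ?q" by simp
  moreover have "?q \<cdot> s \<in> hom2 B (cod2 B ?q) (cod2 B ?q)" "\<one> (cod2 B ?q) \<in> hom2 B (cod2 B ?q) (cod2 B ?q)"
    using s(1) by (simp_all add: hom2_iff)
  moreover have "\<exists>!u. u \<in> hom2 B (cod2 B ?q) (cod2 B ?q) \<and> u \<cdot> ?q = ?q"
    by (rule univ[OF _ _ qfg]) simp_all
  ultimately have "?q \<cdot> s = \<one> (cod2 B ?q)" by blast
  then show ?thesis using s by blast
qed

abbreviation rtens (infix "\<boxtimes>" 70) where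
  "Y \<boxtimes> X \<equiv> rel_tensor B Y X"

definition rt_sec :: "('o, 'm, 'c) bimod \<Rightarrow> ('o, 'm, 'c) bimod \<Rightarrow> 'c" where
  "rt_sec Y X = (SOME s. s \<in> hom2 B (cod2 B (rt_proj B Y X)) (bcarr Y \<otimes> bcarr X)
    \<and> rt_proj B Y X \<cdot> s = \<one> (cod2 B (rt_proj B Y X)) \<and> s \<cdot> rt_proj B Y X = pcell Y X)"

lemma rel_tensor_sel [simp]:
  "bsrc (Y \<boxtimes> X) = bsrc X" "btgt (Y \<boxtimes> X) = btgt Y" "cod2 B (rt_proj B Y X) = bcarr (Y \<boxtimes> X)"
  by (simp_all add: rel_tensor_def Let_def)

lemma rt_proj_cell [simp]:
  assumes "bim Y" "bim X" "bsrc Y = btgt X"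
  shows "rt_proj B Y X \<in> Mor2 B" "dom2 B (rt_proj B Y X) = bcarr Y \<otimes> bcarr X"
    "rt_sec Y X \<in> Mor2 B" "dom2 B (rt_sec Y X) = bcarr (Y \<boxtimes> X)"
    "cod2 B (rt_sec Y X) = bcarr Y \<otimes> bcarr X"
    "rt_proj B Y X \<cdot> rt_sec Y X = \<one> (bcarr (Y \<boxtimes> X))"
    "rt_sec Y X \<cdot> rt_proj B Y X = pcell Y X"
  using rt_proj_coequaliser[OF assms] someI_ex[OF rt_proj_split[OF assms], folded rt_sec_def] assms
  by (simp_all add: is_coequaliser_def hom2_iff)

lemma rt_proj_balanced:
  assumes "bim Y" "bim X" "bsrc Y = btgt X"
  shows "rt_proj B Y X \<cdot> (ract Y \<star> \<one> (bcarr X)) =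
    rt_proj B Y X \<cdot> ((\<one> (bcarr Y) \<star> lact X) \<cdot> \<a> (bcarr Y) (alg (btgt X)) (bcarr X))"
  using rt_proj_coequaliser[OF assms] unfolding is_coequaliser_def by blast

lemma rt_carr [simp]:
  assumes "bim Y" "bim X" "bsrc Y = btgt X"
  shows "bcarr (Y \<boxtimes> X) \<in> Mor1 B" "src B (bcarr (Y \<boxtimes> X)) = fst (bsrc X)"
    "tgt B (bcarr (Y \<boxtimes> X)) = fst (btgt Y)"
proof -
  note [simp] = assms
  have "cod2 B (rt_proj B Y X) \<in> Mor1 B" "src B (cod2 B (rt_proj B Y X)) = fst (bsrc X)"
    "tgt B (cod2 B (rt_proj B Y X)) = fst (btgt Y)"
    by (simp_all del: rel_tensor_sel)
  then show "bcarr (Y \<boxtimes> X) \<in> Mor1 B" "src B (bcarr (Y \<boxtimes> X)) = fst (bsrc X)"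
    "tgt B (bcarr (Y \<boxtimes> X)) = fst (btgt Y)" by simp_all
qed

text \<open>\<open>qq\<close> and \<open>ss\<close> are the families of the projection onto the relative tensor product and of
  its section.\<close>

definition qq :: "('o, 'm, 'c) bimod \<Rightarrow> ('o, 'm, 'c) bimod \<Rightarrow> 'm \<Rightarrow> 'c" where
  "qq Y X = hat21 (bcarr Y) (bcarr X) (rt_proj B Y X)"

definition ss :: "('o, 'm, 'c) bimod \<Rightarrow> ('o, 'm, 'c) bimod \<Rightarrow> 'm \<Rightarrow> 'c" where
  "ss Y X = hat12 (bcarr Y) (bcarr X) (rt_sec Y X)"

lemma rt_hat_cell [simp]:
  assumes "bim Y" "bim X" "bsrc Y = btgt X" "W \<in> Mor1 B" "tgt B W = fst (bsrc X)"
  shows "qq Y X W \<in> Mor2 B" "dom2 B (qq Y X W) = bcarr Y \<otimes> (bcarr X \<otimes> W)"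
      "cod2 B (qq Y X W) = bcarr (Y \<boxtimes> X) \<otimes> W"
    "ss Y X W \<in> Mor2 B" "dom2 B (ss Y X W) = bcarr (Y \<boxtimes> X) \<otimes> W"
      "cod2 B (ss Y X W) = bcarr Y \<otimes> (bcarr X \<otimes> W)"
  using assms by (simp_all add: qq_def ss_def hat21_cell hat12_cell)

lemma rt_hat_unfold:
  assumes "bim Y" "bim X" "bsrc Y = btgt X" "W \<in> Mor1 B" "tgt B W = fst (bsrc X)"
  shows "rt_proj B Y X \<lhd> W = qq Y X W \<cdot> \<a> (bcarr Y) (bcarr X) W"
    "rt_sec Y X \<lhd> W = \<a>\<^sup>- (bcarr Y) (bcarr X) W \<cdot> ss Y X W"
  using assms by (simp_all add: qq_def ss_def hat21_unfold hat12_unfold)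

lemma qq_push:
  assumes "bim Y" "bim X" "bsrc Y = btgt X" "g \<in> Mor2 B" "dom2 B g = W" "tgt B W = fst (bsrc X)"
  shows "bcarr (Y \<boxtimes> X) \<rhd> g \<cdot> qq Y X W = qq Y X (cod2 B g) \<cdot> bcarr Y \<rhd> bcarr X \<rhd> g"
  using assms hat21_natural[of "rt_proj B Y X" "bcarr Y" "bcarr X" g] by (simp add: qq_def)

lemma rt_hat_laws:
  assumes "bim Y" "bim X" "bsrc Y = btgt X" "W \<in> Mor1 B" "tgt B W = fst (bsrc X)"
  shows qq_ss: "qq Y X W \<cdot> ss Y X W = \<one> (bcarr (Y \<boxtimes> X) \<otimes> W)"
    and ss_qq: "ss Y X W \<cdot> qq Y X W = pp Y X W"
    and qq_ra: "qq Y X W \<cdot> ra Y (bcarr X \<otimes> W) = qq Y X W \<cdot> bcarr Y \<rhd> la X W"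
    and qq_pp: "qq Y X W \<cdot> pp Y X W = qq Y X W"
proof -
  note [simp] = assms
  have "(rt_proj B Y X \<cdot> rt_sec Y X) \<lhd> W = \<one> (bcarr (Y \<boxtimes> X)) \<lhd> W" by simp
  then show 1: "qq Y X W \<cdot> ss Y X W = \<one> (bcarr (Y \<boxtimes> X) \<otimes> W)"
    by (simp add: unwhisker rt_hat_unfold del: rt_proj_cell(6))
  have "\<a> (bcarr Y) (bcarr X) W \<cdot> (rt_sec Y X \<cdot> rt_proj B Y X) \<lhd> W \<cdot> \<a>\<^sup>- (bcarr Y) (bcarr X) W
    = \<a> (bcarr Y) (bcarr X) W \<cdot> pcell Y X \<lhd> W \<cdot> \<a>\<^sup>- (bcarr Y) (bcarr X) W" by simp
  then show 2: "ss Y X W \<cdot> qq Y X W = pp Y X W"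
    by (simp add: unwhisker rt_hat_unfold pcell_unfold del: rt_proj_cell(7))
  show "qq Y X W \<cdot> ra Y (bcarr X \<otimes> W) = qq Y X W \<cdot> bcarr Y \<rhd> la X W"
    unfolding qq_def using assms
    by (intro iffD1[OF balanced_iff rt_proj_balanced, rule_format]) simp_all
  show "qq Y X W \<cdot> pp Y X W = qq Y X W"
    unfolding 2[symmetric] using vcomp_reassoc[OF 1, of "qq Y X W"] by simp
qed

lemmas rt_hat_laws' = rt_hat_laws[THEN vcomp_reassoc]

text \<open>The whiskered projections are again split, and the outer actions followed by the
  projection are invariant under the resulting idempotents because \<open>pp\<close> commutes with
  these actions.\<close>

lemma rt_act_B:
  assumes "bim Y" "bim X" "bsrc Y = btgt X"
  defines "T \<equiv> alg (btgt Y)" and "S \<equiv> alg (bsrc X)"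
  shows "lact (Y \<boxtimes> X) \<in> Mor2 B" "dom2 B (lact (Y \<boxtimes> X)) = T \<otimes> bcarr (Y \<boxtimes> X)"
    "cod2 B (lact (Y \<boxtimes> X)) = bcarr (Y \<boxtimes> X)"
    "lact (Y \<boxtimes> X) \<cdot> (\<one> T \<star> rt_proj B Y X)
      = rt_proj B Y X \<cdot> (lact Y \<star> \<one> (bcarr X)) \<cdot> \<a>\<^sup>- T (bcarr Y) (bcarr X)"
    "ract (Y \<boxtimes> X) \<in> Mor2 B" "dom2 B (ract (Y \<boxtimes> X)) = bcarr (Y \<boxtimes> X) \<otimes> S"
    "cod2 B (ract (Y \<boxtimes> X)) = bcarr (Y \<boxtimes> X)"
    "ract (Y \<boxtimes> X) \<cdot> (rt_proj B Y X \<star> \<one> S)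
      = rt_proj B Y X \<cdot> (\<one> (bcarr Y) \<star> ract X) \<cdot> \<a> (bcarr Y) (bcarr X) S"
proof -
  note [simp] = assms(1-3)
  let ?q = "rt_proj B Y X" and ?s = "rt_sec Y X"
  let ?hl = "?q \<cdot> (lact Y \<star> \<one> (bcarr X)) \<cdot> \<a>\<^sup>- T (bcarr Y) (bcarr X)"
    and ?hr = "?q \<cdot> (\<one> (bcarr Y) \<star> ract X) \<cdot> \<a> (bcarr Y) (bcarr X) S"
  have l: "lact (Y \<boxtimes> X) = factor2 B (\<one> T \<star> ?q) ?hl"
    and r: "ract (Y \<boxtimes> X) = factor2 B (?q \<star> \<one> S) ?hr"
    by (simp_all add: rel_tensor_def Let_def T_def S_def del: rel_tensor_sel(3))
  have [simp]: "T \<in> Mor1 B" "src B T = fst (btgt Y)" "tgt B T = fst (btgt Y)"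
    "S \<in> Mor1 B" "src B S = fst (bsrc X)" "tgt B S = fst (bsrc X)"
    by (simp_all add: T_def S_def)
  note [simp] = T_def[symmetric] S_def[symmetric]
  note u = unwhisker rt_hat_unfold act_unfold act_unfold[of Y, simplified]
  have "(\<one> T \<star> ?q) \<cdot> (\<one> T \<star> ?s) = \<one> (T \<otimes> bcarr (Y \<boxtimes> X))"
    "(?q \<star> \<one> S) \<cdot> (?s \<star> \<one> S) = \<one> (bcarr (Y \<boxtimes> X) \<otimes> S)"
    using interchange'[of ?s "\<one> T" ?q "\<one> T"] interchange'[of "\<one> S" ?s "\<one> S" ?q]
      whisker_id(1)[of "bcarr (Y \<boxtimes> X)" T] whisker_id(2)[of S "bcarr (Y \<boxtimes> X)"]
    by (simp_all add: lwhisker_def rwhisker_def)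
  moreover have "?hl \<cdot> (\<one> T \<star> ?s) \<cdot> (\<one> T \<star> ?q) = ?hl"
  proof (rule cell_eqI)
    fix W assume [simp]: "W \<in> Mor1 B" and "tgt B W = src B (dom2 B ?hl)"
    then have [simp]: "tgt B W = fst (bsrc X)" by simp
    show "(?hl \<cdot> (\<one> T \<star> ?s) \<cdot> (\<one> T \<star> ?q)) \<lhd> W = ?hl \<lhd> W"
      using lwhisker_eq[OF ss_qq[of Y X W], of T, THEN vcomp_reassoc]
        pp_la[of Y X W, simplified, symmetric, THEN vcomp_reassoc] rt_hat_laws'[of Y X W]
      by (simp add: u)
  qed simp_all
  moreover have "?hr \<cdot> (?s \<star> \<one> S) \<cdot> (?q \<star> \<one> S) = ?hr"
  proof (rule cell_eqI)
    fix W assume [simp]: "W \<in> Mor1 B" and "tgt B W = src B (dom2 B ?hr)"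
    then have [simp]: "tgt B W = fst (bsrc X)" by simp
    show "(?hr \<cdot> (?s \<star> \<one> S) \<cdot> (?q \<star> \<one> S)) \<lhd> W = ?hr \<lhd> W"
      using rt_hat_laws'[of Y X "S \<otimes> W"]
        pp_ra[of Y X W, simplified, symmetric, THEN vcomp_reassoc] rt_hat_laws'[of Y X W]
      by (simp add: u)
  qed simp_all
  ultimately show "lact (Y \<boxtimes> X) \<in> Mor2 B" "dom2 B (lact (Y \<boxtimes> X)) = T \<otimes> bcarr (Y \<boxtimes> X)"
    "cod2 B (lact (Y \<boxtimes> X)) = bcarr (Y \<boxtimes> X)" "lact (Y \<boxtimes> X) \<cdot> (\<one> T \<star> ?q) = ?hl"
    "ract (Y \<boxtimes> X) \<in> Mor2 B" "dom2 B (ract (Y \<boxtimes> X)) = bcarr (Y \<boxtimes> X) \<otimes> S"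
    "cod2 B (ract (Y \<boxtimes> X)) = bcarr (Y \<boxtimes> X)" "ract (Y \<boxtimes> X) \<cdot> (?q \<star> \<one> S) = ?hr"
    unfolding l r
    using factor2_split[of "\<one> T \<star> ?q" "\<one> T \<star> ?s" ?hl] factor2_split[of "?q \<star> \<one> S" "?s \<star> \<one> S" ?hr]
    by simp_all
qed

lemma rt_prebim [simp]:
  assumes "bim Y" "bim X" "bsrc Y = btgt X"
  shows "prebim (Y \<boxtimes> X)"
  unfolding prebim_def using rt_act_B(1-3,5-7)[OF assms] assms by (auto simp: hom1_iff hom2_iff)

lemma rt_act:
  assumes "bim Y" "bim X" "bsrc Y = btgt X" "W \<in> Mor1 B" "tgt B W = fst (bsrc X)"
  shows la_rt: "la (Y \<boxtimes> X) W \<cdot> alg (btgt Y) \<rhd> qq Y X W = qq Y X W \<cdot> la Y (bcarr X \<otimes> W)"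
    and ra_rt: "ra (Y \<boxtimes> X) W \<cdot> qq Y X (alg (bsrc X) \<otimes> W) = qq Y X W \<cdot> bcarr Y \<rhd> ra X W"
proof -
  note [simp] = assms
  let ?T = "alg (btgt Y)" and ?S = "alg (bsrc X)"
  note s = unwhisker rt_hat_unfold act_unfold act_unfold[of Y, simplified]
    act_unfold[of "Y \<boxtimes> X", simplified]
  have w: "f \<lhd> W \<cdot> R = g \<lhd> W \<cdot> R" if "f = g" for f g R
    using that by simp
  show "la (Y \<boxtimes> X) W \<cdot> ?T \<rhd> qq Y X W = qq Y X W \<cdot> la Y (bcarr X \<otimes> W)"
    using w[OF rt_act_B(4)[OF assms(1-3)], of "\<a>\<^sup>- ?T (bcarr Y \<otimes> bcarr X) W \<cdot> ?T \<rhd> \<a>\<^sup>- (bcarr Y) (bcarr X) W"]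
    by (simp add: s)
  show "ra (Y \<boxtimes> X) W \<cdot> qq Y X (?S \<otimes> W) = qq Y X W \<cdot> bcarr Y \<rhd> ra X W"
    using w[OF rt_act_B(8)[OF assms(1-3)], of "\<a>\<^sup>- (bcarr Y \<otimes> bcarr X) ?S W \<cdot> \<a>\<^sup>- (bcarr Y) (bcarr X) (?S \<otimes> W)"]
    by (simp add: s)
qed

lemmas rt_act' = rt_act[THEN vcomp_reassoc]

text \<open>A split epimorphism stays one under whiskering. An equation out of
  \<open>Y \<boxtimes> X\<close>, even below left whiskers, may thus be tested on
  \<open>Y \<otimes> X\<close>; the next two lemmas cover one and two whiskers.\<close>

lemma qq_cancel:
  assumes "bim Y" "bim X" "bsrc Y = btgt X" "W \<in> Mor1 B" "tgt B W = fst (bsrc X)"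
    and "f \<cdot> qq Y X W = g \<cdot> qq Y X W"
    and "f \<in> Mor2 B" "g \<in> Mor2 B" "dom2 B f = bcarr (Y \<boxtimes> X) \<otimes> W" "dom2 B g = bcarr (Y \<boxtimes> X) \<otimes> W"
  shows "f = g"
  using assms qq_ss[of Y X W] by (intro split_epi_cancel[of f "qq Y X W" g "ss Y X W"]) simp_all

lemma lwhisker_qq_cancel:
  assumes "bim Y" "bim X" "bsrc Y = btgt X" "W \<in> Mor1 B" "tgt B W = fst (bsrc X)"
    and "T \<in> Mor1 B" "src B T = fst (btgt Y)"
    and "f \<cdot> T \<rhd> qq Y X W = g \<cdot> T \<rhd> qq Y X W"
    and "f \<in> Mor2 B" "g \<in> Mor2 B" "dom2 B f = T \<otimes> (bcarr (Y \<boxtimes> X) \<otimes> W)"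
      "dom2 B g = T \<otimes> (bcarr (Y \<boxtimes> X) \<otimes> W)"
  shows "f = g"
  using assms lwhisker_eq[OF qq_ss[of Y X W], of T]
  by (intro split_epi_cancel[of f "T \<rhd> qq Y X W" g "T \<rhd> ss Y X W"]) simp_all

lemma lwhisker2_qq_cancel:
  assumes "bim Y" "bim X" "bsrc Y = btgt X" "W \<in> Mor1 B" "tgt B W = fst (bsrc X)"
    and "T \<in> Mor1 B" "src B T = fst (btgt Y)" "S \<in> Mor1 B" "src B S = tgt B T"
    and "f \<cdot> S \<rhd> T \<rhd> qq Y X W = g \<cdot> S \<rhd> T \<rhd> qq Y X W"
    and "f \<in> Mor2 B" "g \<in> Mor2 B" "dom2 B f = S \<otimes> (T \<otimes> (bcarr (Y \<boxtimes> X) \<otimes> W))"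
      "dom2 B g = S \<otimes> (T \<otimes> (bcarr (Y \<boxtimes> X) \<otimes> W))"
  shows "f = g"
  using assms lwhisker_eq[OF lwhisker_eq[OF qq_ss[of Y X W], of T], of S]
  by (intro split_epi_cancel[of f "S \<rhd> T \<rhd> qq Y X W" g "S \<rhd> T \<rhd> ss Y X W"]) simp_all

text \<open>After the projections are cancelled, every law becomes a law of \<open>Y\<close> for the
  left action, a law of \<open>X\<close> for the right action, or naturality when both
  occur.\<close>

lemma rt_bim [simp]:
  assumes "bim Y" "bim X" "bsrc Y = btgt X"
  shows "bim (Y \<boxtimes> X)"
proof (rule bimI)
  note [simp] = assms
  show "prebim (Y \<boxtimes> X)" by simp
  fix W assume W: "W \<in> Mor1 B" "tgt B W = fst (bsrc (Y \<boxtimes> X))"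
  note [simp] = W(1) W(2)[simplified]
  let ?Q = "Y \<boxtimes> X" and ?S = "alg (bsrc X)" and ?T = "alg (btgt Y)"
  note s = rt_act rt_act' lwhisker_eq[OF la_rt] lwhisker_eq[OF ra_rt] bim_laws[of Y, simplified]
    lwhisker_eq[OF bim_laws(3)] lwhisker_eq[OF bim_laws(4)] lwhisker_eq[OF bim_laws(5)]
    mu_natural eta_natural
  have "la ?Q W \<cdot> ?T \<rhd> la ?Q W = la ?Q W \<cdot> mu (btgt Y) (bcarr ?Q \<otimes> W)"
    by (rule lwhisker2_qq_cancel[of Y X W ?T ?T]) (simp_all add: s)
  then show "la ?Q W \<cdot> alg (btgt ?Q) \<rhd> la ?Q W = la ?Q W \<cdot> mu (btgt ?Q) (bcarr ?Q \<otimes> W)"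
    by simp
  have "la ?Q W \<cdot> eta (btgt Y) (bcarr ?Q \<otimes> W) = \<one> (bcarr ?Q \<otimes> W)"
    by (rule qq_cancel[of Y X W]) (simp_all add: s)
  then show "la ?Q W \<cdot> eta (btgt ?Q) (bcarr ?Q \<otimes> W) = \<one> (bcarr ?Q \<otimes> W)"
    by simp
  have "ra ?Q W \<cdot> ra ?Q (?S \<otimes> W) = ra ?Q W \<cdot> bcarr ?Q \<rhd> mu (bsrc X) W"
    by (rule qq_cancel[of Y X "?S \<otimes> (?S \<otimes> W)"]) (simp_all add: s qq_push)
  then show "ra ?Q W \<cdot> ra ?Q (alg (bsrc ?Q) \<otimes> W) = ra ?Q W \<cdot> bcarr ?Q \<rhd> mu (bsrc ?Q) W"
    by simp
  have "ra ?Q W \<cdot> bcarr ?Q \<rhd> eta (bsrc X) W = \<one> (bcarr ?Q \<otimes> W)"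
    by (rule qq_cancel[of Y X W]) (simp_all add: s qq_push)
  then show "ra ?Q W \<cdot> bcarr ?Q \<rhd> eta (bsrc ?Q) W = \<one> (bcarr ?Q \<otimes> W)"
    by simp
  have "la ?Q W \<cdot> ?T \<rhd> ra ?Q W = ra ?Q W \<cdot> la ?Q (?S \<otimes> W)"
    by (rule lwhisker_qq_cancel[of Y X "?S \<otimes> W" ?T])
      (simp_all add: s act_natural[of Y, simplified])
  then show "la ?Q W \<cdot> alg (btgt ?Q) \<rhd> ra ?Q W = ra ?Q W \<cdot> la ?Q (alg (bsrc ?Q) \<otimes> W)"
    by simp
qed

text \<open>The counterpart of \<open>balanced_pcell\<close> for a map that is given at a single
  \<open>W\<close> only, as needed for iterated tensor products.\<close>

lemma pp_absorb:
  assumes "bim Y" "bim X" "bsrc Y = btgt X" "W \<in> Mor1 B" "tgt B W = fst (bsrc X)"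
    and "h \<in> Mor2 B" "dom2 B h = bcarr Y \<otimes> (bcarr X \<otimes> W)"
    and bal: "h \<cdot> ra Y (bcarr X \<otimes> W) = h \<cdot> bcarr Y \<rhd> la X W"
  shows "h \<cdot> pp Y X W = h"
  using assms(1-7) vcomp_reassoc[OF bal[symmetric], of "cr Y (bcarr X \<otimes> W)"]
  by (simp add: pp_def ra_cr[of Y, simplified])

section \<open>Unitors and associators of the equivariant completion\<close>

abbreviation Beq :: "('o \<times> ('m, 'c) frob, ('o, 'm, 'c) bimod, ('o, 'm, 'c) bimod_map) bicat" where
  "Beq \<equiv> equivariant_completion B"

lemma Beq_sel [simp]:
  "p \<in> Obj Beq \<longleftrightarrow> frob_obj p"
  "X \<in> Mor1 Beq \<longleftrightarrow> bim X"
  "src Beq = bsrc" "tgt Beq = btgt"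
  "f \<in> Mor2 Beq \<longleftrightarrow> bim (bdom f) \<and> bim (bcod f) \<and> is_bimodule_map B f"
  "dom2 Beq = bdom" "cod2 Beq = bcod"
  "vcomp Beq g f = \<lparr>bdom = bdom f, bcod = bcod g, bmap = bmap g \<cdot> bmap f\<rparr>"
  "id2 Beq X = \<lparr>bdom = X, bcod = X, bmap = \<one> (bcarr X)\<rparr>"
  "hcomp1 Beq = rel_tensor B" "hcomp2 Beq = rel_tensor_map B" "unit1 Beq = unit_bimod"
  "assoc Beq = rel_assoc B" "lunit Beq = rel_lunit B" "runit Beq = rel_runit B"
  by (auto simp: equivariant_completion_def Let_def frob_obj_def bim_def)

section \<open>Bimodule maps and their inverses\<close>

lemma bimodule_mapI:
  assumes "prebim X" "prebim Y" "bsrc X = bsrc Y" "btgt X = btgt Y"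
    and f: "f \<in> Mor2 B" "dom2 B f = bcarr X" "cod2 B f = bcarr Y"
    and l: "\<And>W. \<lbrakk>W \<in> Mor1 B; tgt B W = fst (bsrc Y)\<rbrakk> \<Longrightarrow>
      f \<lhd> W \<cdot> la X W = la Y W \<cdot> alg (btgt Y) \<rhd> (f \<lhd> W)"
    and r: "\<And>W. \<lbrakk>W \<in> Mor1 B; tgt B W = fst (bsrc Y)\<rbrakk> \<Longrightarrow>
      f \<lhd> W \<cdot> ra X W = ra Y W \<cdot> f \<lhd> (alg (bsrc Y) \<otimes> W)"
  shows "is_bimodule_map B \<lparr>bdom = X, bcod = Y, bmap = f\<rparr>"
proof -
  note [simp] = assms(1-7)
  note s = unwhisker act_unfold act_unfold[of X, simplified] l l[THEN vcomp_reassoc]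
    r r[THEN vcomp_reassoc] act_cell[of X, simplified]
  have [simp]: "src B (bcarr X) = fst (bsrc Y)" "tgt B (bcarr X) = fst (btgt Y)"
    using prebim_cell(4,5)[of X] by simp_all
  have "f \<cdot> lact X = lact Y \<cdot> (\<one> (alg (btgt Y)) \<star> f)"
    by (rule cell_eqI) (simp_all add: s)
  moreover have "f \<cdot> ract X = ract Y \<cdot> (f \<star> \<one> (alg (bsrc Y)))"
    by (rule cell_eqI) (simp_all add: s)
  ultimately show ?thesis
    by (simp add: is_bimodule_map_def Let_def hom2_iff)
qed

lemma bimodule_mapD:
  assumes "is_bimodule_map B h" "prebim (bdom h)" "prebim (bcod h)"
  shows "bsrc (bdom h) = bsrc (bcod h)" "btgt (bdom h) = btgt (bcod h)"
    "bmap h \<in> Mor2 B" "dom2 B (bmap h) = bcarr (bdom h)" "cod2 B (bmap h) = bcarr (bcod h)"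
    "bmap h \<cdot> lact (bdom h) = lact (bcod h) \<cdot> (\<one> (alg (btgt (bcod h))) \<star> bmap h)"
    "bmap h \<cdot> ract (bdom h) = ract (bcod h) \<cdot> (bmap h \<star> \<one> (alg (bsrc (bcod h))))"
  using assms unfolding is_bimodule_map_def Let_def hom2_iff by auto

lemma bimodule_map_inverse:
  assumes h: "is_bimodule_map B h" "prebim (bdom h)" "prebim (bcod h)"
    and g: "inverse2 B (bmap h) g"
  shows "is_bimodule_map B \<lparr>bdom = bcod h, bcod = bdom h, bmap = g\<rparr>"
proof -
  let ?f = "bmap h" and ?X = "bdom h" and ?Y = "bcod h"
  note D = bimodule_mapD[OF h]
  note [simp] = h(2,3) D(1-5)
  let ?T = "alg (btgt ?Y)" and ?S = "alg (bsrc ?Y)"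
  have [simp]: "src B (bcarr ?X) = fst (bsrc ?Y)" "tgt B (bcarr ?X) = fst (btgt ?Y)"
    using prebim_cell(4,5)[of ?X] by simp_all
  have [simp]: "g \<in> Mor2 B" "dom2 B g = bcarr ?Y" "cod2 B g = bcarr ?X"
    "g \<cdot> ?f = \<one> (bcarr ?X)" "?f \<cdot> g = \<one> (bcarr ?Y)"
    using g by (auto simp: inverse2_def hom2_iff)
  have [simp]: "g \<cdot> (?f \<cdot> k) = k" if "k \<in> Mor2 B" "cod2 B k = bcarr ?X" for k
    using that vcomp_reassoc[of g ?f "\<one> (bcarr ?X)" k] by simp
  have [simp]: "lact ?X \<in> Mor2 B" "dom2 B (lact ?X) = ?T \<otimes> bcarr ?X"
    "ract ?X \<in> Mor2 B" "dom2 B (ract ?X) = bcarr ?X \<otimes> ?S"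
    using prebim_cell[of ?X] by simp_all
  have "(\<one> ?T \<star> ?f) \<cdot> (\<one> ?T \<star> g) = \<one> (?T \<otimes> bcarr ?Y)"
    using lwhisker_eq[of ?f g _ ?T] by (simp add: lwhisker_def[symmetric])
  then have "g \<cdot> lact ?Y = g \<cdot> (lact ?Y \<cdot> ((\<one> ?T \<star> ?f) \<cdot> (\<one> ?T \<star> g)))"
    by simp
  also have "\<dots> = g \<cdot> ((lact ?Y \<cdot> (\<one> ?T \<star> ?f)) \<cdot> (\<one> ?T \<star> g))"
    by simp
  also have "\<dots> = lact ?X \<cdot> (\<one> ?T \<star> g)"
    unfolding D(6)[symmetric] by simp
  finally have l: "g \<cdot> lact ?Y = lact ?X \<cdot> (\<one> ?T \<star> g)" .
  have "(?f \<star> \<one> ?S) \<cdot> (g \<star> \<one> ?S) = \<one> (bcarr ?Y \<otimes> ?S)"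
    using rwhisker_vcomp[of g ?f ?S] by (simp add: rwhisker_def[symmetric])
  then have "g \<cdot> ract ?Y = g \<cdot> (ract ?Y \<cdot> ((?f \<star> \<one> ?S) \<cdot> (g \<star> \<one> ?S)))"
    by simp
  also have "\<dots> = g \<cdot> ((ract ?Y \<cdot> (?f \<star> \<one> ?S)) \<cdot> (g \<star> \<one> ?S))"
    by simp
  also have "\<dots> = ract ?X \<cdot> (g \<star> \<one> ?S)"
    unfolding D(7)[symmetric] by simp
  finally have "g \<cdot> ract ?Y = ract ?X \<cdot> (g \<star> \<one> ?S)" .
  then show ?thesis using l
    by (simp add: is_bimodule_map_def Let_def hom2_iff)
qed

text \<open>\<open>inv2\<close> is a definite description. A 2-cell of the completion records its
  domain and codomain bimodules besides the underlying 2-cell, so uniqueness in \<B> settles the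
  matter.\<close>

lemma Beq_inverse2_unique:
  assumes "inverse2 Beq f g" "inverse2 Beq f g'"
  shows "g' = g"
proof -
  have f: "is_bimodule_map B f" "bim (bdom f)" "bim (bcod f)"
    using assms by (auto simp: inverse2_def hom2_def)
  have "bmap g \<in> Mor2 B" "bmap g' \<in> Mor2 B" "dom2 B (bmap g) = bcarr (bcod f)"
    "dom2 B (bmap g') = bcarr (bcod f)" "cod2 B (bmap g) = bcarr (bdom f)"
    "cod2 B (bmap g') = bcarr (bdom f)"
    using assms bimodule_mapD(3-5)[of g] bimodule_mapD(3-5)[of g']
    by (auto simp: inverse2_def hom2_def)
  moreover have "bmap f \<in> Mor2 B" "dom2 B (bmap f) = bcarr (bdom f)" "cod2 B (bmap f) = bcarr (bcod f)"
    using bimodule_mapD(3-5)[of f] f by auto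
  ultimately have "inverse2 B (bmap f) (bmap g)" "inverse2 B (bmap f) (bmap g')"
    using assms by (auto simp: inverse2_def hom2_def)
  then have "bmap g' = bmap g" by (rule inverse2_unique)
  moreover have "bdom g = bcod f" "bcod g = bdom f" "bdom g' = bcod f" "bcod g' = bdom f"
    using assms by (auto simp: inverse2_def hom2_def)
  ultimately show ?thesis by simp
qed

lemma Beq_inv2_eqI:
  assumes "is_bimodule_map B h" "bim (bdom h)" "bim (bcod h)" "inverse2 B (bmap h) g"
  shows "inv2 Beq h = \<lparr>bdom = bcod h, bcod = bdom h, bmap = g\<rparr>"
proof -
  note D = bimodule_mapD[OF assms(1)]
  have "inverse2 Beq h \<lparr>bdom = bcod h, bcod = bdom h, bmap = g\<rparr>"
    using assms bimodule_map_inverse[of h g] D(3-5) by (auto simp: inverse2_def hom2_def)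
  then show ?thesis
    unfolding inv2_def using Beq_inverse2_unique by blast
qed

section \<open>Unit bimodules and unitors\<close>

lemma unit_bimod_sel [simp]:
  "bsrc (unit_bimod p) = p" "btgt (unit_bimod p) = p" "bcarr (unit_bimod p) = alg p"
  "lact (unit_bimod p) = mult (snd p)" "ract (unit_bimod p) = mult (snd p)"
  by (simp_all add: unit_bimod_def)

lemma unit_bimod_act [simp]: "la (unit_bimod p) W = mu p W" "ra (unit_bimod p) W = mu p W"
  by (simp_all add: la_def ra_def mu_def)

lemma unit_bimod_bim [simp]:
  assumes "frob_obj p"
  shows "bim (unit_bimod p)"
proof (rule bimI)
  show "prebim (unit_bimod p)" using assms by (simp add: prebim_def hom1_iff hom2_iff)
qed (use assms in \<open>simp_all add: mu_assoc mu_eta\<close>)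

text \<open>The left action is balanced by associativity and so descends to the relative tensor
  product. Its inverse inserts the unit of the algebra.\<close>

lemma rel_lunit:
  assumes "bim X"
  defines "U \<equiv> unit_bimod (btgt X)"
  shows "is_bimodule_map B (rel_lunit B X)"
    "bmap (rel_lunit B X) \<cdot> rt_proj B U X = lact X"
    "inverse2 B (bmap (rel_lunit B X))
      (rt_proj B U X \<cdot> (unt (tgt_alg X) \<star> \<one> (bcarr X)) \<cdot> \<l>\<^sup>- (bcarr X))"
proof -
  note [simp] = assms(1)
  have U [simp]: "bim U" "bsrc U = btgt X" "btgt U = btgt X" "bcarr U = alg (btgt X)"
    "\<And>W. la U W = mu (btgt X) W" "\<And>W. ra U W = mu (btgt X) W" "ract U = mult (tgt_alg X)"
    by (simp_all add: U_def)
  let ?T = "alg (btgt X)" and ?q = "rt_proj B U X" and ?s = "rt_sec U X"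
  let ?v = "?q \<cdot> (unt (tgt_alg X) \<star> \<one> (bcarr X)) \<cdot> \<l>\<^sup>- (bcarr X)"
  define u where "u = bmap (rel_lunit B X)"
  note s = unwhisker act_unfold rt_hat_unfold frob_hat_unfold
  have "lact X \<cdot> pcell U X = lact X"
  proof (rule balanced_pcell)
    show "lact X \<cdot> (ract U \<star> \<one> (bcarr X)) =
      lact X \<cdot> (\<one> (bcarr U) \<star> lact X) \<cdot> \<a> (bcarr U) ?T (bcarr X)"
      by (rule iffD2[OF balanced_iff]) (simp_all add: la_def[symmetric] la_la)
  qed simp_all
  then have u [simp]: "u \<in> Mor2 B" "dom2 B u = bcarr (U \<boxtimes> X)" "cod2 B u = bcarr X"
    and uq: "u \<cdot> ?q = lact X"
    using factor2_split[of ?q ?s "lact X"] by (simp_all add: u_def rel_lunit_def U_def[symmetric])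
  have uqW: "u \<lhd> W \<cdot> qq U X W = la X W" if "W \<in> Mor1 B" "tgt B W = fst (bsrc X)" for W
  proof -
    have "(u \<cdot> ?q) \<lhd> W \<cdot> \<a>\<^sup>- ?T (bcarr X) W = lact X \<lhd> W \<cdot> \<a>\<^sup>- ?T (bcarr X) W"
      by (simp add: uq)
    then show ?thesis using that by (simp add: s)
  qed
  show "bmap (rel_lunit B X) \<cdot> rt_proj B U X = lact X"
    using uq by (simp add: u_def)
  have "u \<cdot> ?v = \<one> (bcarr X)"
    by (rule cell_eqI) (simp_all add: s uqW uqW[THEN vcomp_reassoc] la_eta la_eta[THEN vcomp_reassoc])
  moreover have "?v \<cdot> u = \<one> (bcarr (U \<boxtimes> X))"
  proof (rule split_epi_cancel[of _ ?q _ ?s])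
    \<comment> \<open>In the quotient the tensor of 1 with tx equals the tensor of t with x: move t
      across, then absorb the unit.\<close>
    have *: "qq U X W \<cdot> (eta (btgt X) (bcarr X \<otimes> W) \<cdot> (la X W \<cdot> k)) = qq U X W \<cdot> k"
      if "W \<in> Mor1 B" "tgt B W = fst (bsrc X)" "k \<in> Mor2 B" "cod2 B k = ?T \<otimes> (bcarr X \<otimes> W)"
      for W k
      using that rt_hat_laws'(3)[of U X W, symmetric]
      by (simp add: eta_natural[THEN vcomp_reassoc] mu_eta[THEN vcomp_reassoc])
    show "(?v \<cdot> u) \<cdot> ?q = \<one> (bcarr (U \<boxtimes> X)) \<cdot> ?q"
      by (rule cell_eqI) (simp_all add: uq s *)
  qed simp_all
  ultimately show "inverse2 B (bmap (rel_lunit B X)) ?v"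
    by (simp add: inverse2_def hom2_iff u_def[symmetric])
  have "is_bimodule_map B \<lparr>bdom = U \<boxtimes> X, bcod = X, bmap = u\<rparr>"
  proof (rule bimodule_mapI)
    fix W assume [simp]: "W \<in> Mor1 B" "tgt B W = fst (bsrc X)"
    note a = rt_act[of U X, simplified] rt_act'[of U X, simplified] uqW uqW[THEN vcomp_reassoc]
      lwhisker_eq[OF uqW] bim_laws
    show "u \<lhd> W \<cdot> la (U \<boxtimes> X) W = la X W \<cdot> ?T \<rhd> (u \<lhd> W)"
      by (rule lwhisker_qq_cancel[of U X W ?T]) (simp_all add: a)
    show "u \<lhd> W \<cdot> ra (U \<boxtimes> X) W = ra X W \<cdot> u \<lhd> (alg (bsrc X) \<otimes> W)"
      by (rule qq_cancel[of U X "alg (bsrc X) \<otimes> W"]) (simp_all add: a)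
  qed simp_all
  then show "is_bimodule_map B (rel_lunit B X)"
    by (simp add: u_def rel_lunit_def U_def)
qed

lemma rel_runit:
  assumes "bim X"
  defines "U \<equiv> unit_bimod (bsrc X)"
  shows "is_bimodule_map B (rel_runit B X)"
    "bmap (rel_runit B X) \<cdot> rt_proj B X U = ract X"
    "inverse2 B (bmap (rel_runit B X))
      (rt_proj B X U \<cdot> (\<one> (bcarr X) \<star> unt (src_alg X)) \<cdot> \<r>\<^sup>- (bcarr X))"
proof -
  note [simp] = assms(1)
  have U [simp]: "bim U" "bsrc U = bsrc X" "btgt U = bsrc X" "bcarr U = alg (bsrc X)"
    "\<And>W. la U W = mu (bsrc X) W" "\<And>W. ra U W = mu (bsrc X) W" "lact U = mult (src_alg X)"
    by (simp_all add: U_def)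
  let ?S = "alg (bsrc X)" and ?q = "rt_proj B X U" and ?s = "rt_sec X U"
  let ?v = "?q \<cdot> (\<one> (bcarr X) \<star> unt (src_alg X)) \<cdot> \<r>\<^sup>- (bcarr X)"
  define u where "u = bmap (rel_runit B X)"
  note s = unwhisker act_unfold rt_hat_unfold frob_hat_unfold
  have "ract X \<cdot> pcell X U = ract X"
  proof (rule balanced_pcell)
    show "ract X \<cdot> (ract X \<star> \<one> (bcarr U)) =
      ract X \<cdot> (\<one> (bcarr X) \<star> lact U) \<cdot> \<a> (bcarr X) (alg (btgt U)) (bcarr U)"
      by (rule iffD2[OF balanced_iff]) (simp_all add: ra_def[symmetric] ra_ra)
  qed simp_all
  then have u [simp]: "u \<in> Mor2 B" "dom2 B u = bcarr (X \<boxtimes> U)" "cod2 B u = bcarr X"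
    and uq: "u \<cdot> ?q = ract X"
    using factor2_split[of ?q ?s "ract X"] by (simp_all add: u_def rel_runit_def U_def[symmetric])
  have uqW: "u \<lhd> W \<cdot> qq X U W = ra X W" if "W \<in> Mor1 B" "tgt B W = fst (bsrc X)" for W
  proof -
    have "(u \<cdot> ?q) \<lhd> W \<cdot> \<a>\<^sup>- (bcarr X) ?S W = ract X \<lhd> W \<cdot> \<a>\<^sup>- (bcarr X) ?S W"
      by (simp add: uq)
    then show ?thesis using that by (simp add: s)
  qed
  show "bmap (rel_runit B X) \<cdot> rt_proj B X U = ract X"
    using uq by (simp add: u_def)
  have "u \<cdot> ?v = \<one> (bcarr X)"
    by (rule cell_eqI) (simp_all add: s uqW uqW[THEN vcomp_reassoc] ra_eta ra_eta[THEN vcomp_reassoc])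
  moreover have "?v \<cdot> u = \<one> (bcarr (X \<boxtimes> U))"
  proof (rule split_epi_cancel[of _ ?q _ ?s])
    have *: "qq X U W \<cdot> (bcarr X \<rhd> eta (bsrc X) W \<cdot> (ra X W \<cdot> k)) = qq X U W \<cdot> k"
      if "W \<in> Mor1 B" "tgt B W = fst (bsrc X)" "k \<in> Mor2 B" "cod2 B k = bcarr X \<otimes> (?S \<otimes> W)"
      for W k
      using that rt_hat_laws'(3)[of X U W, simplified]
      by (simp add: act_push' lwhisker_eq[OF mu_eta(2), THEN vcomp_reassoc])
    show "(?v \<cdot> u) \<cdot> ?q = \<one> (bcarr (X \<boxtimes> U)) \<cdot> ?q"
      by (rule cell_eqI) (simp_all add: uq s *)
  qed simp_all
  ultimately show "inverse2 B (bmap (rel_runit B X)) ?v"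
    by (simp add: inverse2_def hom2_iff u_def[symmetric])
  have "is_bimodule_map B \<lparr>bdom = X \<boxtimes> U, bcod = X, bmap = u\<rparr>"
  proof (rule bimodule_mapI)
    fix W assume [simp]: "W \<in> Mor1 B" "tgt B W = fst (bsrc X)"
    note a = rt_act[of X U, simplified] rt_act'[of X U, simplified] uqW uqW[THEN vcomp_reassoc]
      lwhisker_eq[OF uqW] bim_laws
    show "u \<lhd> W \<cdot> la (X \<boxtimes> U) W = la X W \<cdot> alg (btgt X) \<rhd> (u \<lhd> W)"
      by (rule lwhisker_qq_cancel[of X U W "alg (btgt X)"]) (simp_all add: a)
    show "u \<lhd> W \<cdot> ra (X \<boxtimes> U) W = ra X W \<cdot> u \<lhd> (?S \<otimes> W)"
      by (rule qq_cancel[of X U "?S \<otimes> W"]) (simp_all add: a)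
  qed simp_all
  then show "is_bimodule_map B (rel_runit B X)"
    by (simp add: u_def rel_runit_def U_def)
qed

text \<open>Both iterated projections out of the triple product are split epimorphisms,
  \<open>e\<close> with section \<open>s\<close> and \<open>e'\<close> with section
  \<open>s'\<close>. The associator of \<B> and its inverse induce mutually inverse maps as soon as
  \<open>h\<close> and \<open>h'\<close> are invariant under \<open>s \<cdot> e\<close> and
  \<open>s' \<cdot> e'\<close>. This invariance is the actual content.\<close>

lemma rel_assoc:
  assumes "bim X" "bim Y" "bim Z" "bsrc Y = btgt X" "bsrc Z = btgt Y"
  shows "is_bimodule_map B (rel_assoc B Z Y X)"
    "bmap (rel_assoc B Z Y X) \<cdot> (rt_proj B (Z \<boxtimes> Y) X \<cdot> (rt_proj B Z Y \<star> \<one> (bcarr X)))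
      = rt_proj B Z (Y \<boxtimes> X) \<cdot> (\<one> (bcarr Z) \<star> rt_proj B Y X) \<cdot> \<a> (bcarr Z) (bcarr Y) (bcarr X)"
    "\<exists>v. inverse2 B (bmap (rel_assoc B Z Y X)) v
      \<and> v \<cdot> (rt_proj B Z (Y \<boxtimes> X) \<cdot> (\<one> (bcarr Z) \<star> rt_proj B Y X))
       = rt_proj B (Z \<boxtimes> Y) X \<cdot> (rt_proj B Z Y \<star> \<one> (bcarr X)) \<cdot> \<a>\<^sup>- (bcarr Z) (bcarr Y) (bcarr X)"
proof -
  note [simp] = assms
  let ?x = "bcarr X" and ?y = "bcarr Y" and ?z = "bcarr Z"
  let ?S = "alg (btgt X)" and ?T = "alg (btgt Y)"
  let ?qz = "rt_proj B Z Y" and ?qy = "rt_proj B Y X"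
    and ?sz = "rt_sec Z Y" and ?sy = "rt_sec Y X"
    and ?qzx = "rt_proj B (Z \<boxtimes> Y) X" and ?qzy = "rt_proj B Z (Y \<boxtimes> X)"
    and ?szx = "rt_sec (Z \<boxtimes> Y) X" and ?szy = "rt_sec Z (Y \<boxtimes> X)"
  define e where "e = ?qzx \<cdot> (?qz \<star> \<one> ?x)"
  define s where "s = (?sz \<star> \<one> ?x) \<cdot> ?szx"
  define h where "h = ?qzy \<cdot> (\<one> ?z \<star> ?qy) \<cdot> \<a> ?z ?y ?x"
  define e' where "e' = ?qzy \<cdot> (\<one> ?z \<star> ?qy)"
  define s' where "s' = (\<one> ?z \<star> ?sy) \<cdot> ?szy"
  define h' where "h' = ?qzx \<cdot> (?qz \<star> \<one> ?x) \<cdot> \<a>\<^sup>- ?z ?y ?x"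
  have cells [simp]: "e \<in> Mor2 B" "dom2 B e = (?z \<otimes> ?y) \<otimes> ?x" "cod2 B e = bcarr ((Z \<boxtimes> Y) \<boxtimes> X)"
    "s \<in> Mor2 B" "cod2 B s = (?z \<otimes> ?y) \<otimes> ?x" "dom2 B s = bcarr ((Z \<boxtimes> Y) \<boxtimes> X)"
    "h \<in> Mor2 B" "dom2 B h = (?z \<otimes> ?y) \<otimes> ?x" "cod2 B h = bcarr (Z \<boxtimes> (Y \<boxtimes> X))"
    "e' \<in> Mor2 B" "dom2 B e' = ?z \<otimes> (?y \<otimes> ?x)" "cod2 B e' = bcarr (Z \<boxtimes> (Y \<boxtimes> X))"
    "s' \<in> Mor2 B" "cod2 B s' = ?z \<otimes> (?y \<otimes> ?x)" "dom2 B s' = bcarr (Z \<boxtimes> (Y \<boxtimes> X))"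
    "h' \<in> Mor2 B" "dom2 B h' = ?z \<otimes> (?y \<otimes> ?x)" "cod2 B h' = bcarr ((Z \<boxtimes> Y) \<boxtimes> X)"
    by (simp_all add: e_def s_def h_def e'_def s'_def h'_def)
  have "(?qz \<star> \<one> ?x) \<cdot> (?sz \<star> \<one> ?x) = \<one> (bcarr (Z \<boxtimes> Y) \<otimes> ?x)"
    using rwhisker_vcomp[of ?sz ?qz ?x] by (simp add: rwhisker_def[symmetric])
  from vcomp_reassoc[OF this, of ?szx] have es: "e \<cdot> s = \<one> (bcarr ((Z \<boxtimes> Y) \<boxtimes> X))"
    by (simp add: e_def s_def)
  have "(\<one> ?z \<star> ?qy) \<cdot> (\<one> ?z \<star> ?sy) = \<one> (?z \<otimes> bcarr (Y \<boxtimes> X))"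
    using lwhisker_eq[of ?qy ?sy _ ?z] by (simp add: lwhisker_def[symmetric])
  from vcomp_reassoc[OF this, of ?szy] have es': "e' \<cdot> s' = \<one> (bcarr (Z \<boxtimes> (Y \<boxtimes> X)))"
    by (simp add: e'_def s'_def)
  have lw: "?z \<rhd> la (Y \<boxtimes> X) W \<cdot> ?z \<rhd> ?T \<rhd> qq Y X W = ?z \<rhd> qq Y X W \<cdot> ?z \<rhd> la Y (?x \<otimes> W)"
    "?z \<rhd> qq Y X W \<cdot> ?z \<rhd> ra Y (?x \<otimes> W) = ?z \<rhd> qq Y X W \<cdot> ?z \<rhd> ?y \<rhd> la X W"
    if "W \<in> Mor1 B" "tgt B W = fst (bsrc X)" for W
    using that lwhisker_eq[OF la_rt[of Y X W], of ?z] lwhisker_eq[OF qq_ra[of Y X W], of ?z] by simp_all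
  have eW: "e \<lhd> W = qq (Z \<boxtimes> Y) X W \<cdot> qq Z Y (?x \<otimes> W) \<cdot> \<a> ?z ?y (?x \<otimes> W) \<cdot> \<a> (?z \<otimes> ?y) ?x W"
    "s \<lhd> W = \<a>\<^sup>- (?z \<otimes> ?y) ?x W \<cdot> \<a>\<^sup>- ?z ?y (?x \<otimes> W) \<cdot> ss Z Y (?x \<otimes> W) \<cdot> ss (Z \<boxtimes> Y) X W"
    "h \<lhd> W = qq Z (Y \<boxtimes> X) W \<cdot> ?z \<rhd> qq Y X W \<cdot> \<a> ?z ?y (?x \<otimes> W) \<cdot> \<a> (?z \<otimes> ?y) ?x W"
    "e' \<lhd> W = qq Z (Y \<boxtimes> X) W \<cdot> ?z \<rhd> qq Y X W \<cdot> ?z \<rhd> \<a> ?y ?x W \<cdot> \<a> ?z (?y \<otimes> ?x) W"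
    "s' \<lhd> W = \<a>\<^sup>- ?z (?y \<otimes> ?x) W \<cdot> ?z \<rhd> \<a>\<^sup>- ?y ?x W \<cdot> ?z \<rhd> ss Y X W \<cdot> ss Z (Y \<boxtimes> X) W"
    "h' \<lhd> W = qq (Z \<boxtimes> Y) X W \<cdot> qq Z Y (?x \<otimes> W) \<cdot> ?z \<rhd> \<a> ?y ?x W \<cdot> \<a> ?z (?y \<otimes> ?x) W"
    if "W \<in> Mor1 B" "tgt B W = fst (bsrc X)" for W
    using that
    by (simp_all add: e_def s_def h_def e'_def s'_def h'_def unwhisker rt_hat_unfold)
  have hse: "h \<cdot> s \<cdot> e = h"
  proof (rule cell_eqI)
    fix W assume [simp]: "W \<in> Mor1 B" and "tgt B W = src B (dom2 B h)"
    then have [simp]: "tgt B W = fst (bsrc X)" by simp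
    \<comment> \<open>\<open>k\<close> is the iterated projection onto the right-nested product. It
      is balanced over the algebra between \<open>Z\<close> and \<open>Y\<close>, so it factors as
      \<open>k1\<close> through the projection onto \<open>Z \<boxtimes> Y\<close>; then
      \<open>k1\<close> is balanced over the algebra between \<open>Y\<close> and
      \<open>X\<close>.\<close>
    define k where "k = qq Z (Y \<boxtimes> X) W \<cdot> ?z \<rhd> qq Y X W"
    define k1 where "k1 = k \<cdot> ss Z Y (?x \<otimes> W)"
    have [simp]: "k \<in> Mor2 B" "dom2 B k = ?z \<otimes> (?y \<otimes> (?x \<otimes> W))"
      "k1 \<in> Mor2 B" "dom2 B k1 = bcarr (Z \<boxtimes> Y) \<otimes> (?x \<otimes> W)"
      by (simp_all add: k_def k1_def)
    have "k \<cdot> ra Z (?y \<otimes> (?x \<otimes> W)) = k \<cdot> ?z \<rhd> la Y (?x \<otimes> W)"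
      using rt_hat_laws'(3)[of Z "Y \<boxtimes> X" W, simplified] lw(1)[of W]
      by (simp add: k_def act_push[of Z, simplified])
    then have "k \<cdot> pp Z Y (?x \<otimes> W) = k" by (intro pp_absorb) simp_all
    then have k: "k1 \<cdot> qq Z Y (?x \<otimes> W) = k" by (simp add: k1_def ss_qq)
    have "k1 \<cdot> ra (Z \<boxtimes> Y) (?x \<otimes> W) = k1 \<cdot> bcarr (Z \<boxtimes> Y) \<rhd> la X W"
    proof (rule qq_cancel[of Z Y "?S \<otimes> (?x \<otimes> W)"])
      have 1: "k1 \<cdot> (qq Z Y (?x \<otimes> W) \<cdot> g) = k \<cdot> g"
        if "g \<in> Mor2 B" "cod2 B g = ?z \<otimes> (?y \<otimes> (?x \<otimes> W))" for g
        using vcomp_reassoc[OF k, of g] that by simp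
      show "(k1 \<cdot> ra (Z \<boxtimes> Y) (?x \<otimes> W)) \<cdot> qq Z Y (?S \<otimes> (?x \<otimes> W))
        = (k1 \<cdot> bcarr (Z \<boxtimes> Y) \<rhd> la X W) \<cdot> qq Z Y (?S \<otimes> (?x \<otimes> W))"
        using rt_act(2)[of Z Y "?x \<otimes> W"] lw(2)[of W] by (simp add: 1 qq_push) (simp add: k_def)
    qed simp_all
    then have "k1 \<cdot> pp (Z \<boxtimes> Y) X W = k1" by (intro pp_absorb) simp_all
    then have "k \<cdot> ss Z Y (?x \<otimes> W) \<cdot> pp (Z \<boxtimes> Y) X W = k1" by (simp add: k1_def)
    then have "k \<cdot> (ss Z Y (?x \<otimes> W) \<cdot> pp (Z \<boxtimes> Y) X W) \<cdot> (qq Z Y (?x \<otimes> W) \<cdot> r) = k \<cdot> r"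
      if "r \<in> Mor2 B" "cod2 B r = ?z \<otimes> (?y \<otimes> (?x \<otimes> W))" for r
      using that vcomp_reassoc[OF k, of r]
        vcomp_reassoc[of k "ss Z Y (?x \<otimes> W) \<cdot> pp (Z \<boxtimes> Y) X W" k1 "qq Z Y (?x \<otimes> W) \<cdot> r"]
      by simp
    then show "(h \<cdot> s \<cdot> e) \<lhd> W = h \<lhd> W"
      using rt_hat_laws'(2)[of "Z \<boxtimes> Y" X W]
      by (simp add: rwhisker_vcomp eW k_def)
  qed simp_all
  have hse': "h' \<cdot> s' \<cdot> e' = h'"
  proof (rule cell_eqI)
    fix W assume [simp]: "W \<in> Mor1 B" and "tgt B W = src B (dom2 B h')"
    then have [simp]: "tgt B W = fst (bsrc X)" by simp
    \<comment> \<open>The mirror image: the inner quotient is now \<open>Y \<boxtimes> X\<close>,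
      and the balancing over the algebra between \<open>Z\<close> and \<open>Y\<close> comes
      second.\<close>
    define k where "k = qq (Z \<boxtimes> Y) X W \<cdot> qq Z Y (?x \<otimes> W)"
    define k1 where "k1 = k \<cdot> ?z \<rhd> ss Y X W"
    have [simp]: "k \<in> Mor2 B" "dom2 B k = ?z \<otimes> (?y \<otimes> (?x \<otimes> W))"
      "k1 \<in> Mor2 B" "dom2 B k1 = ?z \<otimes> (bcarr (Y \<boxtimes> X) \<otimes> W)"
      by (simp_all add: k_def k1_def)
    have "k \<cdot> ?z \<rhd> ra Y (?x \<otimes> W) = k \<cdot> ?z \<rhd> ?y \<rhd> la X W"
      using rt_hat_laws'(3)[of "Z \<boxtimes> Y" X W "qq Z Y (?S \<otimes> (?x \<otimes> W))", simplified]
        rt_act(2)[of Z Y "?x \<otimes> W"]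
      by (simp add: k_def qq_push)
    from vcomp_reassoc[OF this[symmetric], of "?z \<rhd> cr Y (?x \<otimes> W)"]
    have "k \<cdot> ?z \<rhd> pp Y X W = k"
      using lwhisker_eq[OF ra_cr[of Y "?x \<otimes> W"], of ?z]
      by (simp add: pp_def)
    then have k: "k1 \<cdot> ?z \<rhd> qq Y X W = k"
      using lwhisker_eq[OF ss_qq[of Y X W], of ?z] by (simp add: k1_def)
    have "k1 \<cdot> ra Z (bcarr (Y \<boxtimes> X) \<otimes> W) = k1 \<cdot> ?z \<rhd> la (Y \<boxtimes> X) W"
    proof (rule lwhisker2_qq_cancel[of Y X W ?T ?z])
      have 1: "k1 \<cdot> (?z \<rhd> qq Y X W \<cdot> g) = k \<cdot> g"
        if "g \<in> Mor2 B" "cod2 B g = ?z \<otimes> (?y \<otimes> (?x \<otimes> W))" for g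
        using vcomp_reassoc[OF k, of g] that by simp
      show "(k1 \<cdot> ra Z (bcarr (Y \<boxtimes> X) \<otimes> W)) \<cdot> ?z \<rhd> ?T \<rhd> qq Y X W
        = (k1 \<cdot> ?z \<rhd> la (Y \<boxtimes> X) W) \<cdot> ?z \<rhd> ?T \<rhd> qq Y X W"
        using lw(1)[of W] act_natural(2)[of Z "qq Y X W", simplified]
        by (simp add: 1) (simp add: k_def qq_ra)
    qed simp_all
    then have "k1 \<cdot> pp Z (Y \<boxtimes> X) W = k1" by (intro pp_absorb) simp_all
    then have "k \<cdot> ?z \<rhd> ss Y X W \<cdot> pp Z (Y \<boxtimes> X) W = k1" by (simp add: k1_def)
    then have "k \<cdot> (?z \<rhd> ss Y X W \<cdot> pp Z (Y \<boxtimes> X) W) \<cdot> (?z \<rhd> qq Y X W \<cdot> r) = k \<cdot> r"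
      if "r \<in> Mor2 B" "cod2 B r = ?z \<otimes> (?y \<otimes> (?x \<otimes> W))" for r
      using that vcomp_reassoc[OF k, of r]
        vcomp_reassoc[of k "?z \<rhd> ss Y X W \<cdot> pp Z (Y \<boxtimes> X) W" k1 "?z \<rhd> qq Y X W \<cdot> r"]
      by simp
    then show "(h' \<cdot> s' \<cdot> e') \<lhd> W = h' \<lhd> W"
      using rt_hat_laws'(2)[of Z "Y \<boxtimes> X" W]
      by (simp add: rwhisker_vcomp eW k_def)
  qed simp_all
  define u where "u = bmap (rel_assoc B Z Y X)"
  define v where "v = factor2 B e' h'"
  have "u = factor2 B e h"
    by (simp add: u_def rel_assoc_def e_def h_def)
  then have u [simp]: "u \<in> Mor2 B" "dom2 B u = bcarr ((Z \<boxtimes> Y) \<boxtimes> X)" "cod2 B u = bcarr (Z \<boxtimes> (Y \<boxtimes> X))"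
    and ue: "u \<cdot> e = h"
    using factor2_split[OF _ _ _ _ _ _ _ hse] es by simp_all
  have v [simp]: "v \<in> Mor2 B" "cod2 B v = bcarr ((Z \<boxtimes> Y) \<boxtimes> X)" "dom2 B v = bcarr (Z \<boxtimes> (Y \<boxtimes> X))"
    and ve: "v \<cdot> e' = h'"
    using factor2_split[OF _ _ _ _ _ _ _ hse'] es' by (simp_all add: v_def)
  show "u \<cdot> (?qzx \<cdot> (?qz \<star> \<one> ?x)) = ?qzy \<cdot> (\<one> ?z \<star> ?qy) \<cdot> \<a> ?z ?y ?x"
    using ue by (simp only: e_def h_def)
  have h: "h = e' \<cdot> \<a> ?z ?y ?x" "h' = e \<cdot> \<a>\<^sup>- ?z ?y ?x"
    by (simp_all add: h_def h'_def e_def e'_def)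
  have "v \<cdot> u = \<one> (bcarr ((Z \<boxtimes> Y) \<boxtimes> X))"
    by (rule split_epi_cancel[of _ e _ s]) (simp_all add: es ue h vcomp_reassoc[OF ve])
  moreover have "u \<cdot> v = \<one> (bcarr (Z \<boxtimes> (Y \<boxtimes> X)))"
    by (rule split_epi_cancel[of _ e' _ s']) (simp_all add: es' ve h vcomp_reassoc[OF ue])
  ultimately have "inverse2 B u v"
    by (simp add: inverse2_def hom2_iff)
  moreover have "v \<cdot> (?qzy \<cdot> (\<one> ?z \<star> ?qy)) = ?qzx \<cdot> (?qz \<star> \<one> ?x) \<cdot> \<a>\<^sup>- ?z ?y ?x"
    using ve by (simp only: e'_def h'_def)
  ultimately show "\<exists>v. inverse2 B u v \<and>
      v \<cdot> (?qzy \<cdot> (\<one> ?z \<star> ?qy)) = ?qzx \<cdot> (?qz \<star> \<one> ?x) \<cdot> \<a>\<^sup>- ?z ?y ?x" by blast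
  have uW: "u \<lhd> W \<cdot> (qq (Z \<boxtimes> Y) X W \<cdot> qq Z Y (?x \<otimes> W)) = qq Z (Y \<boxtimes> X) W \<cdot> ?z \<rhd> qq Y X W"
    if "W \<in> Mor1 B" "tgt B W = fst (bsrc X)" for W
  proof -
    have "(u \<cdot> e) \<lhd> W \<cdot> \<a>\<^sup>- (?z \<otimes> ?y) ?x W \<cdot> \<a>\<^sup>- ?z ?y (?x \<otimes> W)
      = h \<lhd> W \<cdot> \<a>\<^sup>- (?z \<otimes> ?y) ?x W \<cdot> \<a>\<^sup>- ?z ?y (?x \<otimes> W)"
      by (simp add: ue)
    then show ?thesis using that by (simp add: rwhisker_vcomp eW)
  qed
  have uW': "u \<lhd> W \<cdot> (qq (Z \<boxtimes> Y) X W \<cdot> (qq Z Y (?x \<otimes> W) \<cdot> r)) = qq Z (Y \<boxtimes> X) W \<cdot> ?z \<rhd> qq Y X W \<cdot> r"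
    if "W \<in> Mor1 B" "tgt B W = fst (bsrc X)" "r \<in> Mor2 B" "cod2 B r = ?z \<otimes> (?y \<otimes> (?x \<otimes> W))" for W r
    using that vcomp_reassoc[OF uW[OF that(1,2)], of r] by simp
  have "is_bimodule_map B \<lparr>bdom = (Z \<boxtimes> Y) \<boxtimes> X, bcod = Z \<boxtimes> (Y \<boxtimes> X), bmap = u\<rparr>"
  proof (rule bimodule_mapI)
    fix W assume "W \<in> Mor1 B" "tgt B W = fst (bsrc (Z \<boxtimes> (Y \<boxtimes> X)))"
    then have [simp]: "W \<in> Mor1 B" "tgt B W = fst (bsrc X)" by simp_all
    let ?C = "alg (btgt Z)" and ?A = "alg (bsrc X)"
    have "?C \<rhd> (u \<lhd> W) \<cdot> (?C \<rhd> qq (Z \<boxtimes> Y) X W \<cdot> ?C \<rhd> qq Z Y (?x \<otimes> W))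
      = ?C \<rhd> qq Z (Y \<boxtimes> X) W \<cdot> ?C \<rhd> ?z \<rhd> qq Y X W"
      using lwhisker_eq[OF uW[of W], of ?C] by simp
    note a = rt_act rt_act' rt_act[of "Z \<boxtimes> Y" X, simplified] rt_act'[of "Z \<boxtimes> Y" X, simplified]
      rt_act[of Z "Y \<boxtimes> X", simplified] rt_act'[of Z "Y \<boxtimes> X", simplified]
      uW uW' this
    have "u \<lhd> W \<cdot> la ((Z \<boxtimes> Y) \<boxtimes> X) W = la (Z \<boxtimes> (Y \<boxtimes> X)) W \<cdot> ?C \<rhd> (u \<lhd> W)"
    proof (rule lwhisker_qq_cancel[of "Z \<boxtimes> Y" X W ?C], simp_all, rule lwhisker_qq_cancel[of Z Y "?x \<otimes> W" ?C])
      show "(u \<lhd> W \<cdot> la ((Z \<boxtimes> Y) \<boxtimes> X) W \<cdot> ?C \<rhd> qq (Z \<boxtimes> Y) X W) \<cdot> ?C \<rhd> qq Z Y (?x \<otimes> W)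
        = (la (Z \<boxtimes> (Y \<boxtimes> X)) W \<cdot> ?C \<rhd> (u \<lhd> W) \<cdot> ?C \<rhd> qq (Z \<boxtimes> Y) X W) \<cdot> ?C \<rhd> qq Z Y (?x \<otimes> W)"
        by (simp add: a act_push[of Z, simplified])
    qed simp_all
    then show "u \<lhd> W \<cdot> la ((Z \<boxtimes> Y) \<boxtimes> X) W
      = la (Z \<boxtimes> (Y \<boxtimes> X)) W \<cdot> alg (btgt (Z \<boxtimes> (Y \<boxtimes> X))) \<rhd> (u \<lhd> W)" by simp
    have "u \<lhd> W \<cdot> ra ((Z \<boxtimes> Y) \<boxtimes> X) W = ra (Z \<boxtimes> (Y \<boxtimes> X)) W \<cdot> u \<lhd> (?A \<otimes> W)"
    proof (rule qq_cancel[of "Z \<boxtimes> Y" X "?A \<otimes> W"], simp_all, rule qq_cancel[of Z Y "?x \<otimes> (?A \<otimes> W)"])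
      show "(u \<lhd> W \<cdot> ra ((Z \<boxtimes> Y) \<boxtimes> X) W \<cdot> qq (Z \<boxtimes> Y) X (?A \<otimes> W)) \<cdot> qq Z Y (?x \<otimes> (?A \<otimes> W))
        = (ra (Z \<boxtimes> (Y \<boxtimes> X)) W \<cdot> u \<lhd> (?A \<otimes> W) \<cdot> qq (Z \<boxtimes> Y) X (?A \<otimes> W)) \<cdot> qq Z Y (?x \<otimes> (?A \<otimes> W))"
        using lwhisker_eq[OF ra_rt[of Y X W], of ?z] by (simp add: a qq_push)
    qed simp_all
    then show "u \<lhd> W \<cdot> ra ((Z \<boxtimes> Y) \<boxtimes> X) W
      = ra (Z \<boxtimes> (Y \<boxtimes> X)) W \<cdot> u \<lhd> (alg (bsrc (Z \<boxtimes> (Y \<boxtimes> X))) \<otimes> W)" by simp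
  qed simp_all
  then show "is_bimodule_map B (rel_assoc B Z Y X)"
    by (simp add: u_def rel_assoc_def)
qed

end

section \<open>Adjunctions between bimodules\<close>

context bicategory
begin

lemma adjunction_hats:
  assumes adj: "is_adjunction B L R e c" and L: "src B L = tgt B R" "tgt B L = src B R"
  shows "L \<in> Mor1 B" "R \<in> Mor1 B"
    "e \<in> Mor2 B" "dom2 B e = L \<otimes> R" "cod2 B e = I (src B R)"
    "c \<in> Mor2 B" "dom2 B c = I (tgt B R)" "cod2 B c = R \<otimes> L"
    "\<lbrakk>W \<in> Mor1 B; tgt B W = src B R\<rbrakk>
      \<Longrightarrow> R \<rhd> hat20 L R e W \<cdot> hat02 R L c (R \<otimes> W) = \<one> (R \<otimes> W)"
    "\<lbrakk>W \<in> Mor1 B; tgt B W = tgt B R\<rbrakk>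
      \<Longrightarrow> hat20 L R e (L \<otimes> W) \<cdot> L \<rhd> hat02 R L c W = \<one> (L \<otimes> W)"
proof -
  show [simp]: "L \<in> Mor1 B" "R \<in> Mor1 B"
    "e \<in> Mor2 B" "dom2 B e = L \<otimes> R" "cod2 B e = I (src B R)"
    "c \<in> Mor2 B" "dom2 B c = I (tgt B R)" "cod2 B c = R \<otimes> L"
    using adj by (auto simp: is_adjunction_def hom1_iff hom2_iff)
  have z: "\<r> R \<cdot> (\<one> R \<star> e) \<cdot> \<a> R L R \<cdot> (c \<star> \<one> R) \<cdot> \<l>\<^sup>- R = \<one> R"
    "\<l> L \<cdot> (e \<star> \<one> L) \<cdot> \<a>\<^sup>- L R L \<cdot> (\<one> L \<star> c) \<cdot> \<r>\<^sup>- L = \<one> L"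
    using adj unfolding is_adjunction_def by blast+
  note s = unwhisker hat20_unfold[of e L R] hat02_unfold[of c R L] hat20_cell hat02_cell
  show "R \<rhd> hat20 L R e W \<cdot> hat02 R L c (R \<otimes> W) = \<one> (R \<otimes> W)"
    if "W \<in> Mor1 B" "tgt B W = src B R"
    using arg_cong[OF z(1), of "\<lambda>f. f \<lhd> W"] that L by (simp add: s)
  show "hat20 L R e (L \<otimes> W) \<cdot> L \<rhd> hat02 R L c W = \<one> (L \<otimes> W)"
    if "W \<in> Mor1 B" "tgt B W = tgt B R"
    using arg_cong[OF z(2), of "\<lambda>f. f \<lhd> W"] that L by (simp add: s)
qed

lemma rwhisker_push:
  "\<lbrakk>f \<in> Mor2 B; g \<in> Mor2 B; src B (dom2 B f) = tgt B V; dom2 B g = V\<rbrakk>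
    \<Longrightarrow> cod2 B f \<rhd> g \<cdot> f \<lhd> V = f \<lhd> cod2 B g \<cdot> dom2 B f \<rhd> g"
  using exchange[of f g] by simp

end

section \<open>Relative tensor products of bimodule maps\<close>

context idempotent_complete_bicategory
begin

lemma bimodule_map_hats:
  assumes "is_bimodule_map B h" "prebim (bdom h)" "prebim (bcod h)"
    and W: "W \<in> Mor1 B" "tgt B W = fst (bsrc (bcod h))"
  shows "bmap h \<lhd> W \<cdot> la (bdom h) W = la (bcod h) W \<cdot> alg (btgt (bcod h)) \<rhd> (bmap h \<lhd> W)"
    "bmap h \<lhd> W \<cdot> ra (bdom h) W = ra (bcod h) W \<cdot> bmap h \<lhd> (alg (bsrc (bcod h)) \<otimes> W)"
proof -
  note D = bimodule_mapD[OF assms(1-3)]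
  note [simp] = assms(2-) D(1-5)
  have [simp]: "src B (bcarr (bdom h)) = fst (bsrc (bcod h))" "tgt B (bcarr (bdom h)) = fst (btgt (bcod h))"
    using prebim_cell(4,5)[OF assms(2)] by simp_all
  note s = unwhisker act_unfold act_unfold[of "bdom h", simplified] act_cell[of "bdom h", simplified]
    prebim_cell[of "bdom h", simplified]
  let ?X = "bcarr (bdom h)" and ?T = "alg (btgt (bcod h))" and ?S = "alg (bsrc (bcod h))"
  show "bmap h \<lhd> W \<cdot> la (bdom h) W = la (bcod h) W \<cdot> ?T \<rhd> (bmap h \<lhd> W)"
    using arg_cong[OF D(6), of "\<lambda>f. f \<lhd> W \<cdot> \<a>\<^sup>- ?T ?X W"] by (simp add: s)
  show "bmap h \<lhd> W \<cdot> ra (bdom h) W = ra (bcod h) W \<cdot> bmap h \<lhd> (?S \<otimes> W)"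
    using arg_cong[OF D(7), of "\<lambda>f. f \<lhd> W \<cdot> \<a>\<^sup>- ?X ?S W"] by (simp add: s)
qed

text \<open>The projected horizontal composite is balanced: right linearity of \<psi> and left
  linearity of \<phi> bring both actions of the middle algebra next to the projection.\<close>

lemma rel_tensor_map:
  assumes "is_bimodule_map B \<psi>" "bim (bdom \<psi>)" "bim (bcod \<psi>)"
    and "is_bimodule_map B \<phi>" "bim (bdom \<phi>)" "bim (bcod \<phi>)"
    and "bsrc (bcod \<psi>) = btgt (bcod \<phi>)"
  shows "bmap (rel_tensor_map B \<psi> \<phi>) \<in> Mor2 B"
    "dom2 B (bmap (rel_tensor_map B \<psi> \<phi>)) = bcarr (bdom \<psi> \<boxtimes> bdom \<phi>)"
    "cod2 B (bmap (rel_tensor_map B \<psi> \<phi>)) = bcarr (bcod \<psi> \<boxtimes> bcod \<phi>)"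
    "bmap (rel_tensor_map B \<psi> \<phi>) \<cdot> rt_proj B (bdom \<psi>) (bdom \<phi>)
      = rt_proj B (bcod \<psi>) (bcod \<phi>) \<cdot> (bmap \<psi> \<star> bmap \<phi>)"
proof -
  note D\<psi> = bimodule_mapD[OF assms(1) bim_prebim bim_prebim, OF assms(2,3)]
    and D\<phi> = bimodule_mapD[OF assms(4) bim_prebim bim_prebim, OF assms(5,6)]
  note [simp] = assms D\<psi>(1-5) D\<phi>(1-5)
  note [simp] = prebim_cell(4,5)[of "bdom \<psi>", simplified] prebim_cell(4,5)[of "bdom \<phi>", simplified]
  let ?h = "rt_proj B (bcod \<psi>) (bcod \<phi>) \<cdot> (bmap \<psi> \<star> bmap \<phi>)"
  have "?h \<cdot> pcell (bdom \<psi>) (bdom \<phi>) = ?h"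
  proof (intro balanced_pcell iffD2[OF balanced_iff] allI impI)
    fix W assume "W \<in> Mor1 B" "tgt B W = fst (bsrc (bdom \<phi>))"
    then have [simp]: "W \<in> Mor1 B" "tgt B W = fst (bsrc (bcod \<phi>))" by simp_all
    have h: "hat21 (bcarr (bdom \<psi>)) (bcarr (bdom \<phi>)) ?h W =
      qq (bcod \<psi>) (bcod \<phi>) W \<cdot> bmap \<psi> \<lhd> (bcarr (bcod \<phi>) \<otimes> W) \<cdot> bcarr (bdom \<psi>) \<rhd> (bmap \<phi> \<lhd> W)"
      by (simp add: hat21_def unwhisker rt_hat_unfold)
    let ?S = "alg (btgt (bcod \<phi>))"
    note b\<psi> = bimodule_map_hats[of \<psi>, simplified] and b\<phi> = bimodule_map_hats[of \<phi>, simplified]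
    show "hat21 (bcarr (bdom \<psi>)) (bcarr (bdom \<phi>)) ?h W \<cdot> ra (bdom \<psi>) (bcarr (bdom \<phi>) \<otimes> W)
      = hat21 (bcarr (bdom \<psi>)) (bcarr (bdom \<phi>)) ?h W \<cdot> bcarr (bdom \<psi>) \<rhd> la (bdom \<phi>) W"
      using lwhisker_eq[OF b\<phi>(1)[of W], of "bcarr (bdom \<psi>)"]
        rwhisker_push[of "bmap \<psi>" "la (bcod \<phi>) W" "?S \<otimes> (bcarr (bcod \<phi>) \<otimes> W)",
          symmetric, simplified, THEN vcomp_reassoc]
        b\<psi>(2)[THEN vcomp_reassoc, of "bcarr (bcod \<phi>) \<otimes> W"]
        rt_hat_laws'(3)[of "bcod \<psi>" "bcod \<phi>" W, simplified]
        act_push[of "bdom \<psi>" "bmap \<phi> \<lhd> W", simplified]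
        act_cell[of "bdom \<psi>", simplified] act_cell[of "bdom \<phi>", simplified]
      by (simp add: h)
  qed simp_all
  then show "bmap (rel_tensor_map B \<psi> \<phi>) \<in> Mor2 B"
    "dom2 B (bmap (rel_tensor_map B \<psi> \<phi>)) = bcarr (bdom \<psi> \<boxtimes> bdom \<phi>)"
    "cod2 B (bmap (rel_tensor_map B \<psi> \<phi>)) = bcarr (bcod \<psi> \<boxtimes> bcod \<phi>)"
    "bmap (rel_tensor_map B \<psi> \<phi>) \<cdot> rt_proj B (bdom \<psi>) (bdom \<phi>) = ?h"
    using factor2_split[of "rt_proj B (bdom \<psi>) (bdom \<phi>)" "rt_sec (bdom \<psi>) (bdom \<phi>)" ?h]
    by (simp_all add: rel_tensor_map_def)
qed

end

text \<open>Only the carriers are adjoint, and neither side is required to satisfy the bimodule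
  laws. For the twisted dual, these laws are deduced inside this locale.\<close>

locale prebimodule_adjunction = bicategory B
  for B :: "('o, 'm, 'c, 'z) bicat_scheme" (structure) +
  fixes L R :: "('o, 'm, 'c) bimod" and e c :: 'c
  assumes prebim_L [simp]: "prebim L" and prebim_R [simp]: "prebim R"
    and bsrc_L [simp]: "bsrc L = btgt R" and btgt_L [simp]: "btgt L = bsrc R"
    and adjunction: "is_adjunction B (bcarr L) (bcarr R) e c"
begin

abbreviation (input) "l \<equiv> bcarr L"
abbreviation (input) "r \<equiv> bcarr R"
abbreviation (input) "A \<equiv> alg (bsrc R)"
abbreviation (input) "T \<equiv> alg (btgt R)"
abbreviation (input) "evW \<equiv> hat20 l r e"
abbreviation (input) "coW \<equiv> hat02 r l c"

lemma l_cell [simp]: "src B l = fst (btgt R)" "tgt B l = fst (bsrc R)"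
  "\<lbrakk>W \<in> Mor1 B; tgt B W = fst (btgt R)\<rbrakk> \<Longrightarrow> dom2 B (la L W) = A \<otimes> (l \<otimes> W)"
  "\<lbrakk>W \<in> Mor1 B; tgt B W = fst (btgt R)\<rbrakk> \<Longrightarrow> dom2 B (ra L W) = l \<otimes> (T \<otimes> W)"
  "\<lbrakk>W \<in> Mor1 B; tgt B W = fst (btgt R)\<rbrakk> \<Longrightarrow> cod2 B (cl L W) = A \<otimes> (l \<otimes> W)"
  "\<lbrakk>W \<in> Mor1 B; tgt B W = fst (btgt R)\<rbrakk> \<Longrightarrow> cod2 B (cr L W) = l \<otimes> (T \<otimes> W)"
  using prebim_cell[of L] act_cell[of L] coact_cell[of L] by simp_all

lemmas ad = adjunction_hats[OF adjunction, simplified]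
lemmas [simp] = ad(3-8)

lemma evW_cell [simp]:
  assumes "W \<in> Mor1 B" "tgt B W = fst (bsrc R)"
  shows "evW W \<in> Mor2 B" "dom2 B (evW W) = l \<otimes> (r \<otimes> W)" "cod2 B (evW W) = W"
  using assms by (simp_all add: hat20_cell)

lemma coW_cell [simp]:
  assumes "W \<in> Mor1 B" "tgt B W = fst (btgt R)"
  shows "coW W \<in> Mor2 B" "dom2 B (coW W) = W" "cod2 B (coW W) = r \<otimes> (l \<otimes> W)"
  using assms by (simp_all add: hat02_cell)

lemma evW_natural:
  assumes "g \<in> Mor2 B" "cod2 B g = V" "tgt B (dom2 B g) = fst (bsrc R)"
  shows "evW V \<cdot> l \<rhd> r \<rhd> g = g \<cdot> evW (dom2 B g)"
  using assms hat20_natural[of e l r g] by simp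

lemma coW_natural:
  assumes "g \<in> Mor2 B" "cod2 B g = V" "tgt B (dom2 B g) = fst (btgt R)"
  shows "coW V \<cdot> g = r \<rhd> l \<rhd> g \<cdot> coW (dom2 B g)"
  using assms hat02_natural[of c r l g] by simp

lemma zigzag:
  shows "\<lbrakk>W \<in> Mor1 B; tgt B W = fst (bsrc R)\<rbrakk> \<Longrightarrow> r \<rhd> evW W \<cdot> coW (r \<otimes> W) = \<one> (r \<otimes> W)"
    and "\<lbrakk>W \<in> Mor1 B; tgt B W = fst (btgt R)\<rbrakk> \<Longrightarrow> evW (l \<otimes> W) \<cdot> l \<rhd> coW W = \<one> (l \<otimes> W)"
  using ad(9,10) by simp_all

lemma coW_push:
  "\<lbrakk>g \<in> Mor2 B; dom2 B g = W; tgt B W = fst (btgt R)\<rbrakk>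
    \<Longrightarrow> r \<rhd> l \<rhd> g \<cdot> coW W = coW (cod2 B g) \<cdot> g"
  using coW_natural[of g "cod2 B g"] by simp

end

text \<open>\<open>balanced\<close> says that the actions of the algebra of \<open>btgt R\<close> on
  the two sides are mates. \<open>coactions\<close> says the same for the algebra of
  \<open>bsrc R\<close>, whose actions are first turned into coactions by the copairing.\<close>

locale bimodule_adjunction = idempotent_complete_bicategory B + prebimodule_adjunction B L R e c
  for B :: "('o, 'm, 'c, 'z) bicat_scheme" (structure)
    and L R :: "('o, 'm, 'c) bimod" and e c :: 'c +
  assumes bim_L [simp]: "bim L" and bim_R [simp]: "bim R"
    and balanced: "\<lbrakk>W \<in> Mor1 B; tgt B W = fst (bsrc R)\<rbrakk> \<Longrightarrow>
      evW W \<cdot> l \<rhd> la R W = evW W \<cdot> ra L (r \<otimes> W)"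
    and coactions: "\<lbrakk>W \<in> Mor1 B; tgt B W = fst (bsrc R)\<rbrakk> \<Longrightarrow>
      evW (A \<otimes> W) \<cdot> l \<rhd> cr R W = A \<rhd> evW W \<cdot> cl L (r \<otimes> W)"
begin

text \<open>The counit before passing to the relative tensor product. The first form is right linear and
  balanced, the second one left linear.\<close>

definition e0 :: "'m \<Rightarrow> 'c" where
  "e0 W = evW (A \<otimes> W) \<cdot> l \<rhd> cr R W"

lemma e0_eq:
  assumes "W \<in> Mor1 B" "tgt B W = fst (bsrc R)"
  shows "e0 W = A \<rhd> evW W \<cdot> cl L (r \<otimes> W)"
  using coactions[OF assms] by (simp add: e0_def)

lemma e0_cell [simp]:
  assumes "W \<in> Mor1 B" "tgt B W = fst (bsrc R)"
  shows "e0 W \<in> Mor2 B" "dom2 B (e0 W) = l \<otimes> (r \<otimes> W)" "cod2 B (e0 W) = A \<otimes> W"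
  using assms by (simp_all add: e0_def)

lemma e0_laws:
  assumes [simp]: "W \<in> Mor1 B" "tgt B W = fst (bsrc R)"
  shows "e0 W \<cdot> la L (r \<otimes> W) = mu (bsrc R) W \<cdot> A \<rhd> e0 W"
    "e0 W \<cdot> l \<rhd> ra R W = mu (bsrc R) W \<cdot> e0 (A \<otimes> W)"
    "e0 W \<cdot> ra L (r \<otimes> W) = e0 W \<cdot> l \<rhd> la R W"
proof -
  have "e0 W \<cdot> la L (r \<otimes> W) = A \<rhd> evW W \<cdot> mu (bsrc R) (l \<otimes> (r \<otimes> W)) \<cdot> A \<rhd> cl L (r \<otimes> W)"
    using cl_la[of L "r \<otimes> W"] mu_cl[of L "r \<otimes> W"] by (simp add: e0_eq)
  also have "\<dots> = mu (bsrc R) W \<cdot> A \<rhd> e0 W"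
    by (simp add: e0_eq mu_push[THEN vcomp_reassoc])
  finally show "e0 W \<cdot> la L (r \<otimes> W) = mu (bsrc R) W \<cdot> A \<rhd> e0 W" .
  have "l \<rhd> cr R W \<cdot> l \<rhd> ra R W = l \<rhd> r \<rhd> mu (bsrc R) W \<cdot> l \<rhd> cr R (A \<otimes> W)"
    using lwhisker_eq[OF cr_ra[of R W], of l] lwhisker_eq[OF mu_cr[of R W], of l] by simp
  then show "e0 W \<cdot> l \<rhd> ra R W = mu (bsrc R) W \<cdot> e0 (A \<otimes> W)"
    by (simp add: e0_def evW_natural evW_natural[THEN vcomp_reassoc])
  have "e0 W \<cdot> l \<rhd> la R W = evW (A \<otimes> W) \<cdot> l \<rhd> la R (A \<otimes> W) \<cdot> l \<rhd> T \<rhd> cr R W"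
    using lwhisker_eq[OF cr_la[of R W], of l] by (simp add: e0_def)
  also have "\<dots> = e0 W \<cdot> ra L (r \<otimes> W)"
    by (simp add: e0_def balanced[THEN vcomp_reassoc] act_push[of L, simplified])
  finally show "e0 W \<cdot> ra L (r \<otimes> W) = e0 W \<cdot> l \<rhd> la R W" ..
qed

text \<open>The transpose of \<open>balanced\<close>: insert a zigzag in front of the left action,
  move the action across the evaluation, and contract the other zigzag.\<close>

lemma coW_central:
  assumes [simp]: "W \<in> Mor1 B" "tgt B W = fst (btgt R)"
  shows "r \<rhd> ra L W \<cdot> coW (T \<otimes> W) = la R (l \<otimes> W) \<cdot> T \<rhd> coW W"
proof -
  let ?x = "la R (l \<otimes> W) \<cdot> T \<rhd> coW W"
  have "?x = (r \<rhd> evW (l \<otimes> W) \<cdot> coW (r \<otimes> (l \<otimes> W))) \<cdot> ?x"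
    by (simp add: zigzag)
  also have "\<dots> = r \<rhd> (evW (l \<otimes> W) \<cdot> l \<rhd> ?x) \<cdot> coW (T \<otimes> W)"
    by (simp add: coW_natural coW_natural[THEN vcomp_reassoc])
  also have "evW (l \<otimes> W) \<cdot> l \<rhd> ?x = ra L W"
    by (simp add: balanced[THEN vcomp_reassoc] zigzag(2)[THEN vcomp_reassoc] act_natural[of L, simplified])
  finally show ?thesis ..
qed

section \<open>Counit and unit in the equivariant completion\<close>

definition counit_cell :: 'c where
  "counit_cell = \<l> A \<cdot> (e \<star> \<one> A) \<cdot> \<a>\<^sup>- l r A \<cdot> (\<one> l \<star> ((ract R \<star> \<one> A) \<cdot> \<a>\<^sup>- r A A \<cdot>
        (\<one> r \<star> (comult (src_alg R) \<cdot> unt (src_alg R))) \<cdot> \<r>\<^sup>- r))"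

lemma counit_cell [simp]:
  "counit_cell \<in> Mor2 B" "dom2 B counit_cell = l \<otimes> r" "cod2 B counit_cell = A"
  by (simp_all add: counit_cell_def)

lemma counit_cell_unfold:
  "\<lbrakk>W \<in> Mor1 B; tgt B W = fst (bsrc R)\<rbrakk> \<Longrightarrow> counit_cell \<lhd> W = e0 W \<cdot> \<a> l r W"
  by (simp add: counit_cell_def e0_def cr_def copairing_def unwhisker act_unfold frob_hat_unfold
      hat20_unfold[of e l r])

definition counit_map :: "('o, 'm, 'c) bimod_map" where
  "counit_map = \<lparr>bdom = L \<boxtimes> R, bcod = unit_bimod (bsrc R), bmap = factor2 B (rt_proj B L R) counit_cell\<rparr>"

definition unit_map :: "('o, 'm, 'c) bimod_map" where
  "unit_map = \<lparr>bdom = unit_bimod (btgt R), bcod = R \<boxtimes> L,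
     bmap = rt_proj B R L \<cdot> (lact R \<star> \<one> l) \<cdot> \<a>\<^sup>- T r l \<cdot> (\<one> T \<star> c) \<cdot> \<r>\<^sup>- T\<rparr>"

lemma map_sel [simp]:
  "bdom counit_map = L \<boxtimes> R" "bcod counit_map = unit_bimod (bsrc R)"
  "bdom unit_map = unit_bimod (btgt R)" "bcod unit_map = R \<boxtimes> L"
  by (simp_all add: counit_map_def unit_map_def)

lemma
  shows counit_map_cell [simp]: "bmap counit_map \<in> Mor2 B" "dom2 B (bmap counit_map) = bcarr (L \<boxtimes> R)"
    "cod2 B (bmap counit_map) = A"
    and counit_map_proj: "bmap counit_map \<cdot> rt_proj B L R = counit_cell"
proof -
  have h: "hat21 l r counit_cell W = e0 W" if "W \<in> Mor1 B" "tgt B W = fst (bsrc R)" for W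
    using that by (simp add: hat21_def counit_cell_unfold)
  have "counit_cell \<cdot> pcell L R = counit_cell"
    by (intro balanced_pcell iffD2[OF balanced_iff] allI impI) (simp_all add: h e0_laws)
  then show "bmap counit_map \<in> Mor2 B" "dom2 B (bmap counit_map) = bcarr (L \<boxtimes> R)"
    "cod2 B (bmap counit_map) = A" "bmap counit_map \<cdot> rt_proj B L R = counit_cell"
    using factor2_split[of "rt_proj B L R" "rt_sec L R" counit_cell]
    by (simp_all add: counit_map_def)
qed

lemma unit_map_cell [simp]:
  "bmap unit_map \<in> Mor2 B" "dom2 B (bmap unit_map) = T"
    "cod2 B (bmap unit_map) = bcarr (R \<boxtimes> L)"
  by (simp_all add: unit_map_def)

lemma counit_map_proj_hat:
  assumes "W \<in> Mor1 B" "tgt B W = fst (bsrc R)"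
  shows "bmap counit_map \<lhd> W \<cdot> qq L R W = e0 W"
  using assms arg_cong[OF counit_map_proj, of "\<lambda>f. f \<lhd> W \<cdot> \<a>\<^sup>- l r W"]
  by (simp add: unwhisker counit_cell_unfold rt_hat_unfold)

lemma unit_map_unfold:
  assumes "W \<in> Mor1 B" "tgt B W = fst (btgt R)"
  shows "bmap unit_map \<lhd> W = qq R L W \<cdot> la R (l \<otimes> W) \<cdot> T \<rhd> coW W"
  using assms by (simp add: unit_map_def unwhisker act_unfold rt_hat_unfold hat02_unfold[of c r l])

lemma counit_bimodule_map: "is_bimodule_map B counit_map"
proof -
  note a = rt_act[of L R, simplified] rt_act'[of L R, simplified] counit_map_proj_hat
    counit_map_proj_hat[THEN vcomp_reassoc] lwhisker_eq[OF counit_map_proj_hat] e0_laws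
  have "is_bimodule_map B \<lparr>bdom = L \<boxtimes> R, bcod = unit_bimod (bsrc R), bmap = bmap counit_map\<rparr>"
  proof (rule bimodule_mapI)
    fix W assume "W \<in> Mor1 B" "tgt B W = fst (bsrc (unit_bimod (bsrc R)))"
    then have [simp]: "W \<in> Mor1 B" "tgt B W = fst (bsrc R)" by simp_all
    have "bmap counit_map \<lhd> W \<cdot> la (L \<boxtimes> R) W = mu (bsrc R) W \<cdot> A \<rhd> (bmap counit_map \<lhd> W)"
      by (rule lwhisker_qq_cancel[of L R W A]) (simp_all add: a)
    then show "bmap counit_map \<lhd> W \<cdot> la (L \<boxtimes> R) W
      = la (unit_bimod (bsrc R)) W \<cdot> alg (btgt (unit_bimod (bsrc R))) \<rhd> (bmap counit_map \<lhd> W)" by simp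
    have "bmap counit_map \<lhd> W \<cdot> ra (L \<boxtimes> R) W = mu (bsrc R) W \<cdot> bmap counit_map \<lhd> (A \<otimes> W)"
      by (rule qq_cancel[of L R "A \<otimes> W"]) (simp_all add: a)
    then show "bmap counit_map \<lhd> W \<cdot> ra (L \<boxtimes> R) W
      = ra (unit_bimod (bsrc R)) W \<cdot> bmap counit_map \<lhd> (alg (bsrc (unit_bimod (bsrc R))) \<otimes> W)" by simp
  qed simp_all
  then show ?thesis by (simp add: counit_map_def)
qed

text \<open>Left linearity is associativity of the action on \<open>R\<close>; right linearity is
  \<open>coW_central\<close> seen through the balanced projection.\<close>

lemma unit_bimodule_map: "is_bimodule_map B unit_map"
proof -
  note a = rt_act[of R L, simplified] rt_act'[of R L, simplified] unit_map_unfold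
  have "is_bimodule_map B \<lparr>bdom = unit_bimod (btgt R), bcod = R \<boxtimes> L, bmap = bmap unit_map\<rparr>"
  proof (rule bimodule_mapI)
    fix W assume "W \<in> Mor1 B" "tgt B W = fst (bsrc (R \<boxtimes> L))"
    then have [simp]: "W \<in> Mor1 B" "tgt B W = fst (btgt R)" by simp_all
    have *: "bmap unit_map \<lhd> W \<cdot> mu (btgt R) W
      = qq R L W \<cdot> la R (l \<otimes> W) \<cdot> T \<rhd> la R (l \<otimes> W) \<cdot> T \<rhd> T \<rhd> coW W"
      by (simp add: unit_map_unfold mu_push la_la[THEN vcomp_reassoc])
    then show "bmap unit_map \<lhd> W \<cdot> la (unit_bimod (btgt R)) W
      = la (R \<boxtimes> L) W \<cdot> alg (btgt (R \<boxtimes> L)) \<rhd> (bmap unit_map \<lhd> W)" by (simp add: a)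
    have "ra (R \<boxtimes> L) W \<cdot> bmap unit_map \<lhd> (T \<otimes> W)
      = qq R L W \<cdot> la R (l \<otimes> W) \<cdot> T \<rhd> (r \<rhd> ra L W \<cdot> coW (T \<otimes> W))"
      by (simp add: a act_push')
    then show "bmap unit_map \<lhd> W \<cdot> ra (unit_bimod (btgt R)) W
      = ra (R \<boxtimes> L) W \<cdot> bmap unit_map \<lhd> (alg (bsrc (R \<boxtimes> L)) \<otimes> W)"
      unfolding coW_central[of W, simplified] using * by simp
  qed simp_all
  then show ?thesis by (simp add: unit_map_def)
qed

end

context idempotent_complete_bicategory
begin

abbreviation (input) id_map :: "('o, 'm, 'c) bimod \<Rightarrow> ('o, 'm, 'c) bimod_map" where
  "id_map X \<equiv> \<lparr>bdom = X, bcod = X, bmap = \<one> (bcarr X)\<rparr>"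

lemma id_bimodule_map: "prebim X \<Longrightarrow> is_bimodule_map B (id_map X)"
  by (rule bimodule_mapI) simp_all

end

section \<open>The zigzag identities in the equivariant completion\<close>

context bimodule_adjunction
begin

text \<open>The algebra unit acts trivially. The inverse unitors of the completion insert exactly
  this unit, so the zigzags start from \<open>c\<close>.\<close>

lemma unit_map_unt: "bmap unit_map \<cdot> unt (tgt_alg R) = rt_proj B R L \<cdot> c"
  by (rule cell_eqI) (simp_all add: rwhisker_vcomp unit_map_unfold frob_hat_unfold rt_hat_unfold
      hat02_unfold[of c r l] eta_push[THEN vcomp_reassoc] la_eta[THEN vcomp_reassoc])

text \<open>What remains of the zigzag once all projections are stripped off. The zigzag in \<B>
  contracts and leaves the coaction followed by the action, which is the identity by
  separability.\<close>

lemma zigzag_R_cell: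
  "ract R \<cdot> ((\<one> r \<star> counit_cell) \<cdot> (\<a> r l r \<cdot> ((c \<star> \<one> r) \<cdot> \<l>\<^sup>- r))) = \<one> r"
proof (rule cell_eqI)
  fix W assume "W \<in> Mor1 B" "tgt B W = src B (dom2 B (\<one> r))"
  then have [simp]: "W \<in> Mor1 B" "tgt B W = fst (bsrc R)" by simp_all
  have "ra R W \<cdot> r \<rhd> e0 W \<cdot> coW (r \<otimes> W) = \<one> (r \<otimes> W)"
    by (simp add: e0_def coW_push zigzag(1)[THEN vcomp_reassoc] ra_cr)
  then show "(ract R \<cdot> ((\<one> r \<star> counit_cell) \<cdot> (\<a> r l r \<cdot> ((c \<star> \<one> r) \<cdot> \<l>\<^sup>- r)))) \<lhd> W = \<one> r \<lhd> W"
    by (simp add: unwhisker act_unfold counit_cell_unfold hat02_unfold[of c r l])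
qed simp_all

text \<open>The same with the second form of \<open>e0\<close>: the coaction now sits on
  \<open>L\<close>, so that it meets the left action of \<open>L\<close> after the
  contraction.\<close>

lemma zigzag_L_cell:
  "lact L \<cdot> ((counit_cell \<star> \<one> l) \<cdot> (\<a>\<^sup>- l r l \<cdot> ((\<one> l \<star> c) \<cdot> \<r>\<^sup>- l))) = \<one> l"
proof (rule cell_eqI)
  fix W assume "W \<in> Mor1 B" "tgt B W = src B (dom2 B (\<one> l))"
  then have [simp]: "W \<in> Mor1 B" "tgt B W = fst (btgt R)" by simp_all
  have "A \<rhd> evW (l \<otimes> W) \<cdot> A \<rhd> l \<rhd> coW W = \<one> (A \<otimes> (l \<otimes> W))"
    using lwhisker_eq[OF zigzag(2)[of W], of A] by simp
  then have "la L W \<cdot> e0 (l \<otimes> W) \<cdot> l \<rhd> coW W = \<one> (l \<otimes> W)"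
    using la_cl[of L W] cl_natural[of L "coW W"] by (simp add: e0_eq vcomp_reassoc[of "A \<rhd> evW (l \<otimes> W)" "A \<rhd> l \<rhd> coW W"])
  then show "(lact L \<cdot> ((counit_cell \<star> \<one> l) \<cdot> (\<a>\<^sup>- l r l \<cdot> ((\<one> l \<star> c) \<cdot> \<r>\<^sup>- l)))) \<lhd> W = \<one> l \<lhd> W"
    using act_unfold[of L] by (simp add: unwhisker counit_cell_unfold hat02_unfold[of c r l])
qed simp_all

text \<open>The zigzag of the completion with its inverse unitor written out. The projections are
  carried from right to left through the factors, each of which is known only by its composite with
  a projection.\<close>

lemma zigzag_R: "bmap (rel_runit B R) \<cdot> (bmap (rel_tensor_map B (id_map R) counit_map) \<cdot>
    (bmap (rel_assoc B R L R) \<cdot> (bmap (rel_tensor_map B unit_map (id_map R)) \<cdot>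
      (rt_proj B (unit_bimod (btgt R)) R \<cdot> ((unt (tgt_alg R) \<star> \<one> r) \<cdot> \<l>\<^sup>- r))))) = \<one> r"
proof -
  let ?U = "unit_bimod (btgt R)" and ?V = "unit_bimod (bsrc R)"
  let ?F1 = "bmap (rel_tensor_map B (id_map R) counit_map)"
    and ?F2 = "bmap (rel_tensor_map B unit_map (id_map R))"
    and ?as = "bmap (rel_assoc B R L R)" and ?ru = "bmap (rel_runit B R)"
  note F1 = rel_tensor_map[of "id_map R" counit_map, simplified, OF id_bimodule_map, simplified, OF counit_bimodule_map]
  note F2 = rel_tensor_map[of unit_map "id_map R", simplified, OF unit_bimodule_map id_bimodule_map, simplified]
  have as: "?as \<in> Mor2 B" "dom2 B ?as = bcarr ((R \<boxtimes> L) \<boxtimes> R)" "cod2 B ?as = bcarr (R \<boxtimes> (L \<boxtimes> R))"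
    using bimodule_mapD(3-5)[OF rel_assoc(1)[of R L R]] by (simp_all add: rel_assoc_def)
  have ru: "?ru \<in> Mor2 B" "dom2 B ?ru = bcarr (R \<boxtimes> ?V)" "cod2 B ?ru = r"
    using bimodule_mapD(3-5)[OF rel_runit(1)[of R]] by (simp_all add: rel_runit_def)
  note [simp] = F1(1-3) F2(1-3) as ru
  have 1: "(bmap unit_map \<star> \<one> r) \<cdot> (unt (tgt_alg R) \<star> \<one> r) = (rt_proj B R L \<star> \<one> r) \<cdot> (c \<star> \<one> r)"
    using arg_cong[OF unit_map_unt, of "\<lambda>f. f \<lhd> r"] by (simp add: rwhisker_vcomp flip: rwhisker_def)
  have 2: "(\<one> r \<star> bmap counit_map) \<cdot> (\<one> r \<star> rt_proj B L R) = \<one> r \<star> counit_cell"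
    using lwhisker_eq[OF counit_map_proj, of r] by (simp add: lwhisker_def)
  have 3: "?as \<cdot> (rt_proj B (R \<boxtimes> L) R \<cdot> ((rt_proj B R L \<star> \<one> r) \<cdot> k))
    = rt_proj B R (L \<boxtimes> R) \<cdot> ((\<one> r \<star> rt_proj B L R) \<cdot> (\<a> r l r \<cdot> k))"
    if "k \<in> Mor2 B" "cod2 B k = (r \<otimes> l) \<otimes> r" for k
    using that vcomp_reassoc[OF rel_assoc(2)[of R L R, simplified], of k] by simp
  show ?thesis
    by (simp add: F2(4)[THEN vcomp_reassoc] 1[THEN vcomp_reassoc] 3 F1(4)[THEN vcomp_reassoc]
        2[THEN vcomp_reassoc] rel_runit(2)[THEN vcomp_reassoc] zigzag_R_cell)
qed

text \<open>The inverse associator enters as a variable \<open>v\<close>, because all that is known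
  about it besides invertibility is its composite with the iterated projection.\<close>

lemma zigzag_L:
  assumes v: "inverse2 B (bmap (rel_assoc B L R L)) v"
    "v \<cdot> (rt_proj B L (R \<boxtimes> L) \<cdot> (\<one> l \<star> rt_proj B R L))
      = rt_proj B (L \<boxtimes> R) L \<cdot> (rt_proj B L R \<star> \<one> l) \<cdot> \<a>\<^sup>- l r l"
  shows "bmap (rel_lunit B L) \<cdot> (bmap (rel_tensor_map B counit_map (id_map L)) \<cdot>
    (v \<cdot> (bmap (rel_tensor_map B (id_map L) unit_map) \<cdot>
      (rt_proj B L (unit_bimod (btgt R)) \<cdot> ((\<one> l \<star> unt (tgt_alg R)) \<cdot> \<r>\<^sup>- l))))) = \<one> l"
proof -
  let ?U = "unit_bimod (btgt R)" and ?V = "unit_bimod (bsrc R)"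
  let ?F1 = "bmap (rel_tensor_map B counit_map (id_map L))"
    and ?F2 = "bmap (rel_tensor_map B (id_map L) unit_map)"
    and ?as = "bmap (rel_assoc B L R L)" and ?lu = "bmap (rel_lunit B L)"
  note F1 = rel_tensor_map[of counit_map "id_map L", simplified, OF counit_bimodule_map id_bimodule_map, simplified]
  note F2 = rel_tensor_map[of "id_map L" unit_map, simplified, OF id_bimodule_map, simplified, OF unit_bimodule_map]
  have "?as \<in> Mor2 B" "dom2 B ?as = bcarr ((L \<boxtimes> R) \<boxtimes> L)" "cod2 B ?as = bcarr (L \<boxtimes> (R \<boxtimes> L))"
    using bimodule_mapD(3-5)[OF rel_assoc(1)[of L R L]] by (simp_all add: rel_assoc_def)
  then have as: "v \<in> Mor2 B" "cod2 B v = bcarr ((L \<boxtimes> R) \<boxtimes> L)" "dom2 B v = bcarr (L \<boxtimes> (R \<boxtimes> L))"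
    using v(1) by (simp_all add: inverse2_def hom2_iff)
  have lu: "?lu \<in> Mor2 B" "dom2 B ?lu = bcarr (?V \<boxtimes> L)" "cod2 B ?lu = l"
    using bimodule_mapD(3-5)[OF rel_lunit(1)[of L]] by (simp_all add: rel_lunit_def)
  note [simp] = F1(1-3) F2(1-3) as lu
  have 1: "(\<one> l \<star> bmap unit_map) \<cdot> (\<one> l \<star> unt (tgt_alg R)) = (\<one> l \<star> rt_proj B R L) \<cdot> (\<one> l \<star> c)"
    using arg_cong[OF unit_map_unt, of "\<lambda>f. l \<rhd> f"] by (simp flip: lwhisker_def)
  have 2: "(bmap counit_map \<star> \<one> l) \<cdot> (rt_proj B L R \<star> \<one> l) = counit_cell \<star> \<one> l"
    using arg_cong[OF counit_map_proj, of "\<lambda>f. f \<lhd> l"] by (simp add: rwhisker_vcomp flip: rwhisker_def)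
  have 3: "v \<cdot> (rt_proj B L (R \<boxtimes> L) \<cdot> ((\<one> l \<star> rt_proj B R L) \<cdot> k))
    = rt_proj B (L \<boxtimes> R) L \<cdot> ((rt_proj B L R \<star> \<one> l) \<cdot> (\<a>\<^sup>- l r l \<cdot> k))"
    if "k \<in> Mor2 B" "cod2 B k = l \<otimes> (r \<otimes> l)" for k
    using that vcomp_reassoc[OF v(2), of k] by simp
  show ?thesis
    by (simp add: F2(4)[THEN vcomp_reassoc] 1[THEN vcomp_reassoc] 3 F1(4)[THEN vcomp_reassoc]
        2[THEN vcomp_reassoc] rel_lunit(2)[of L, simplified, THEN vcomp_reassoc] zigzag_L_cell)
qed

theorem Beq_adjunction: "is_adjunction Beq L R counit_map unit_map"
proof -
  obtain v where v: "inverse2 B (bmap (rel_assoc B L R L)) v"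
    "v \<cdot> (rt_proj B L (R \<boxtimes> L) \<cdot> (\<one> l \<star> rt_proj B R L))
      = rt_proj B (L \<boxtimes> R) L \<cdot> (rt_proj B L R \<star> \<one> l) \<cdot> \<a>\<^sup>- l r l"
    using rel_assoc(3)[of L R L] by auto
  \<comment> \<open>The inverses occurring in \<open>is_adjunction\<close> are descriptions; they
    are replaced by the explicit inverses found for the unitors and the associator.\<close>
  have lu: "lunit_inv Beq R = \<lparr>bdom = R, bcod = unit_bimod (btgt R) \<boxtimes> R,
      bmap = rt_proj B (unit_bimod (btgt R)) R \<cdot> (unt (tgt_alg R) \<star> \<one> r) \<cdot> \<l>\<^sup>- r\<rparr>"
    using Beq_inv2_eqI[OF rel_lunit(1) _ _ rel_lunit(3), of R] by (simp add: lunit_inv_def) (simp add: rel_lunit_def)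
  have ru: "runit_inv Beq L = \<lparr>bdom = L, bcod = L \<boxtimes> unit_bimod (btgt R),
      bmap = rt_proj B L (unit_bimod (btgt R)) \<cdot> (\<one> l \<star> unt (tgt_alg R)) \<cdot> \<r>\<^sup>- l\<rparr>"
    using Beq_inv2_eqI[OF rel_runit(1) _ _ rel_runit(3), of L] by (simp add: runit_inv_def) (simp add: rel_runit_def)
  have as: "assoc_inv Beq L R L = \<lparr>bdom = L \<boxtimes> (R \<boxtimes> L), bcod = (L \<boxtimes> R) \<boxtimes> L, bmap = v\<rparr>"
    using Beq_inv2_eqI[OF rel_assoc(1) _ _ v(1)] by (simp add: assoc_inv_def) (simp add: rel_assoc_def)
  show ?thesis
    unfolding is_adjunction_def lu ru as
    using counit_bimodule_map unit_bimodule_map zigzag_R zigzag_L[OF v]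
    by (simp add: hom1_def hom2_def) (simp add: rel_runit_def rel_lunit_def rel_tensor_map_def)
qed

end

section \<open>Bimodule structures from mates\<close>

context prebimodule_adjunction
begin

text \<open>A 2-cell into \<open>l \<otimes> W\<close> is recovered from its evaluation against
  \<open>r\<close>. In applications \<open>f'\<close> and \<open>g'\<close> are the operations
  \<open>f\<close> and \<open>g\<close> at the 1-cell \<open>r \<otimes> (l \<otimes> W)\<close> and
  \<open>n\<close> is a whiskered \<open>coW W\<close>, so that \<open>nat\<close> expresses
  naturality.\<close>

lemma mate_cancel_L:
  assumes W: "W \<in> Mor1 B" "tgt B W = fst (btgt R)"
    and cells: "f \<in> Mor2 B" "g \<in> Mor2 B" "f' \<in> Mor2 B" "g' \<in> Mor2 B" "n \<in> Mor2 B"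
      "cod2 B f = l \<otimes> W" "cod2 B g = l \<otimes> W" "cod2 B f' = l \<otimes> (r \<otimes> (l \<otimes> W))"
      "cod2 B g' = l \<otimes> (r \<otimes> (l \<otimes> W))" "dom2 B f' = cod2 B n" "dom2 B g' = cod2 B n"
    and nat: "l \<rhd> coW W \<cdot> f = f' \<cdot> n" "l \<rhd> coW W \<cdot> g = g' \<cdot> n"
    and eq: "evW (l \<otimes> W) \<cdot> f' = evW (l \<otimes> W) \<cdot> g'"
  shows "f = g"
proof -
  have "f = evW (l \<otimes> W) \<cdot> (l \<rhd> coW W \<cdot> f)"
    using W cells by (simp add: zigzag(2)[THEN vcomp_reassoc])
  also have "\<dots> = (evW (l \<otimes> W) \<cdot> f') \<cdot> n"
    unfolding nat(1) using W cells by simp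
  also have "\<dots> = evW (l \<otimes> W) \<cdot> (l \<rhd> coW W \<cdot> g)"
    unfolding nat(2) eq using W cells by simp
  also have "\<dots> = g"
    using W cells by (simp add: zigzag(2)[THEN vcomp_reassoc])
  finally show ?thesis .
qed

text \<open>A 2-cell into \<open>r \<otimes> W\<close> is determined by its transpose. Here
  whiskering with \<open>l\<close> already produces something that can be evaluated, so no
  naturality squares are required.\<close>

lemma mate_cancel_R:
  assumes W: "W \<in> Mor1 B" "tgt B W = fst (bsrc R)"
    and cells: "f \<in> Mor2 B" "g \<in> Mor2 B" "cod2 B f = r \<otimes> W" "cod2 B g = r \<otimes> W"
      "dom2 B f = dom2 B g" "tgt B (dom2 B g) = fst (btgt R)"
    and eq: "evW W \<cdot> l \<rhd> f = evW W \<cdot> l \<rhd> g"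
  shows "f = g"
proof -
  have *: "f = r \<rhd> (evW W \<cdot> l \<rhd> f) \<cdot> coW (dom2 B f)"
    if "f \<in> Mor2 B" "cod2 B f = r \<otimes> W" "tgt B (dom2 B f) = fst (btgt R)" for f
  proof -
    have "f = (r \<rhd> evW W \<cdot> coW (r \<otimes> W)) \<cdot> f" using that W by (simp add: zigzag(1))
    also have "\<dots> = r \<rhd> (evW W \<cdot> l \<rhd> f) \<cdot> coW (dom2 B f)" using that W by (simp add: coW_push)
    finally show ?thesis .
  qed
  have "f = r \<rhd> (evW W \<cdot> l \<rhd> f) \<cdot> coW (dom2 B f)" by (rule *) (use cells in simp_all)
  also have "\<dots> = r \<rhd> (evW W \<cdot> l \<rhd> g) \<cdot> coW (dom2 B g)" unfolding eq cells(5) ..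
  also have "\<dots> = g" by (rule *[symmetric]) (use cells in simp_all)
  finally show ?thesis .
qed

text \<open>Each law of \<open>L\<close> is tested after evaluation. There the hypotheses exchange
  the actions on \<open>L\<close> for the action and the coaction of the known bimodule
  \<open>R\<close>, and the law reduces to one for \<open>R\<close> or for the pairing.\<close>

lemma mate_bimodule_L:
  assumes R [simp]: "bim R"
    and balanced: "\<And>W. \<lbrakk>W \<in> Mor1 B; tgt B W = fst (bsrc R)\<rbrakk> \<Longrightarrow>
      evW W \<cdot> l \<rhd> la R W = evW W \<cdot> ra L (r \<otimes> W)"
    and left_mate: "\<And>W. \<lbrakk>W \<in> Mor1 B; tgt B W = fst (bsrc R)\<rbrakk> \<Longrightarrow>
      evW W \<cdot> la L (r \<otimes> W) = pairing (bsrc R) W \<cdot> A \<rhd> evW (A \<otimes> W) \<cdot> A \<rhd> l \<rhd> cr R W"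
  shows "bim L"
    and "\<And>W. \<lbrakk>W \<in> Mor1 B; tgt B W = fst (bsrc R)\<rbrakk> \<Longrightarrow>
      evW (A \<otimes> W) \<cdot> l \<rhd> cr R W = A \<rhd> evW W \<cdot> cl L (r \<otimes> W)"
proof -
  \<comment> \<open>The counit of the locale \<open>bimodule_adjunction\<close> before descent,
    introduced afresh because that locale presupposes that \<open>L\<close> is a bimodule.\<close>
  define e0 where "e0 W = evW (A \<otimes> W) \<cdot> l \<rhd> cr R W" for W
  have e0_cell [simp]: "e0 W \<in> Mor2 B" "dom2 B (e0 W) = l \<otimes> (r \<otimes> W)" "cod2 B (e0 W) = A \<otimes> W"
    if "W \<in> Mor1 B" "tgt B W = fst (bsrc R)" for W
    using that by (simp_all add: e0_def)
  have mate: "evW W \<cdot> la L (r \<otimes> W) = pairing (bsrc R) W \<cdot> A \<rhd> e0 W"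
    if "W \<in> Mor1 B" "tgt B W = fst (bsrc R)" for W
    using that left_mate by (simp add: e0_def)
  note naturals = act_push[of L, simplified] act_push'[of L, simplified]
  have dl_e0: "e0 (A \<otimes> W) \<cdot> l \<rhd> cr R W = delta (bsrc R) W \<cdot> e0 W"
    if [simp]: "W \<in> Mor1 B" "tgt B W = fst (bsrc R)" for W
    using lwhisker_eq[OF cr_cr[of R W], of l]
    by (simp add: e0_def evW_natural[THEN vcomp_reassoc])
  have e0_la: "e0 W \<cdot> la L (r \<otimes> W) = mu (bsrc R) W \<cdot> A \<rhd> e0 W"
    if [simp]: "W \<in> Mor1 B" "tgt B W = fst (bsrc R)" for W
  proof -
    have "e0 W \<cdot> la L (r \<otimes> W) = (evW (A \<otimes> W) \<cdot> la L (r \<otimes> (A \<otimes> W))) \<cdot> A \<rhd> l \<rhd> cr R W"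
      by (simp add: e0_def naturals)
    also have "\<dots> = pairing (bsrc R) (A \<otimes> W) \<cdot> A \<rhd> (e0 (A \<otimes> W) \<cdot> l \<rhd> cr R W)"
      by (simp add: mate)
    also have "\<dots> = mu (bsrc R) W \<cdot> A \<rhd> e0 W"
      unfolding dl_e0[OF that] by (simp add: pr_dl(1)[THEN vcomp_reassoc])
    finally show ?thesis .
  qed
  have e0_ra: "e0 W \<cdot> ra L (r \<otimes> W) = e0 W \<cdot> l \<rhd> la R W"
    if [simp]: "W \<in> Mor1 B" "tgt B W = fst (bsrc R)" for W
  proof -
    have "e0 W \<cdot> l \<rhd> la R W = evW (A \<otimes> W) \<cdot> l \<rhd> la R (A \<otimes> W) \<cdot> l \<rhd> T \<rhd> cr R W"
      using lwhisker_eq[OF cr_la[of R W], of l] by (simp add: e0_def)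
    also have "\<dots> = e0 W \<cdot> ra L (r \<otimes> W)"
      by (simp add: e0_def balanced[THEN vcomp_reassoc] naturals)
    finally show ?thesis ..
  qed
  \<comment> \<open>Through \<open>mate\<close> the coaction of \<open>L\<close> becomes the
    copairing followed by the pairing, and the snake identity contracts these.\<close>
  have coact: "e0 W = A \<rhd> evW W \<cdot> cl L (r \<otimes> W)"
    if [simp]: "W \<in> Mor1 B" "tgt B W = fst (bsrc R)" for W
  proof -
    have "A \<rhd> evW W \<cdot> cl L (r \<otimes> W) = A \<rhd> (evW W \<cdot> la L (r \<otimes> W)) \<cdot> copairing (bsrc R) (l \<otimes> (r \<otimes> W))"
      by (simp add: cl_def)
    also have "\<dots> = A \<rhd> pairing (bsrc R) W \<cdot> copairing (bsrc R) (A \<otimes> W) \<cdot> e0 W"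
      by (simp add: mate cp_natural)
    also have "\<dots> = e0 W" by (simp add: pr_cp(2)[THEN vcomp_reassoc])
    finally show ?thesis ..
  qed
  show "evW (A \<otimes> W) \<cdot> l \<rhd> cr R W = A \<rhd> evW W \<cdot> cl L (r \<otimes> W)"
    if "W \<in> Mor1 B" "tgt B W = fst (bsrc R)" for W
    using coact[OF that] by (simp add: e0_def)
  have ep_e0: "eps (bsrc R) W \<cdot> e0 W = evW W"
    if [simp]: "W \<in> Mor1 B" "tgt B W = fst (bsrc R)" for W
    using lwhisker_eq[OF ep_cr[of R W], of l]
    by (simp add: e0_def evW_natural[symmetric, of "eps (bsrc R) W", simplified, THEN vcomp_reassoc])
  note m = mate mate[THEN vcomp_reassoc] balanced[symmetric] balanced[symmetric, THEN vcomp_reassoc]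
  show "bim L"
  proof (rule bimI, simp_all)
    fix W assume [simp]: "W \<in> Mor1 B" "tgt B W = fst (btgt R)"
    show "la L W \<cdot> A \<rhd> la L W = la L W \<cdot> mu (bsrc R) (l \<otimes> W)"
    proof (rule mate_cancel_L)
      show "evW (l \<otimes> W) \<cdot> (la L (r \<otimes> (l \<otimes> W)) \<cdot> A \<rhd> la L (r \<otimes> (l \<otimes> W)))
        = evW (l \<otimes> W) \<cdot> (la L (r \<otimes> (l \<otimes> W)) \<cdot> mu (bsrc R) (l \<otimes> (r \<otimes> (l \<otimes> W))))"
        using lwhisker_eq[OF e0_la[of "l \<otimes> W"], of A]
        by (simp add: m mu_push pr_mu[THEN vcomp_reassoc])
      show "l \<rhd> coW W \<cdot> (la L W \<cdot> A \<rhd> la L W)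
        = (la L (r \<otimes> (l \<otimes> W)) \<cdot> A \<rhd> la L (r \<otimes> (l \<otimes> W))) \<cdot> A \<rhd> A \<rhd> l \<rhd> coW W"
        using lwhisker_eq[OF la_push[of L "coW W" W], of A] by (simp add: naturals)
      show "l \<rhd> coW W \<cdot> (la L W \<cdot> mu (bsrc R) (l \<otimes> W))
        = (la L (r \<otimes> (l \<otimes> W)) \<cdot> mu (bsrc R) (l \<otimes> (r \<otimes> (l \<otimes> W)))) \<cdot> A \<rhd> A \<rhd> l \<rhd> coW W"
        by (simp add: naturals mu_push)
    qed simp_all
    show "la L W \<cdot> eta (bsrc R) (l \<otimes> W) = \<one> (l \<otimes> W)"
    proof (rule mate_cancel_L)
      show "evW (l \<otimes> W) \<cdot> (la L (r \<otimes> (l \<otimes> W)) \<cdot> eta (bsrc R) (l \<otimes> (r \<otimes> (l \<otimes> W))))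
        = evW (l \<otimes> W) \<cdot> \<one> (l \<otimes> (r \<otimes> (l \<otimes> W)))"
        by (simp add: m eta_push pr_eta[THEN vcomp_reassoc] ep_e0)
      show "l \<rhd> coW W \<cdot> (la L W \<cdot> eta (bsrc R) (l \<otimes> W))
        = (la L (r \<otimes> (l \<otimes> W)) \<cdot> eta (bsrc R) (l \<otimes> (r \<otimes> (l \<otimes> W)))) \<cdot> l \<rhd> coW W"
        by (simp add: naturals eta_push)
    qed simp_all
    show "ra L W \<cdot> ra L (T \<otimes> W) = ra L W \<cdot> l \<rhd> mu (btgt R) W"
    proof (rule mate_cancel_L)
      show "evW (l \<otimes> W) \<cdot> (ra L (r \<otimes> (l \<otimes> W)) \<cdot> ra L (T \<otimes> (r \<otimes> (l \<otimes> W))))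
        = evW (l \<otimes> W) \<cdot> (ra L (r \<otimes> (l \<otimes> W)) \<cdot> l \<rhd> mu (btgt R) (r \<otimes> (l \<otimes> W)))"
      proof -
        let ?V = "l \<otimes> W"
        have "evW ?V \<cdot> (ra L (r \<otimes> ?V) \<cdot> ra L (T \<otimes> (r \<otimes> ?V)))
          = evW ?V \<cdot> (l \<rhd> la R ?V \<cdot> ra L (T \<otimes> (r \<otimes> ?V)))"
          by (simp add: m)
        also have "\<dots> = (evW ?V \<cdot> ra L (r \<otimes> ?V)) \<cdot> l \<rhd> T \<rhd> la R ?V"
          by (simp add: naturals)
        also have "\<dots> = evW ?V \<cdot> l \<rhd> (la R ?V \<cdot> T \<rhd> la R ?V)"
          by (simp add: m)
        also have "\<dots> = evW ?V \<cdot> (ra L (r \<otimes> ?V) \<cdot> l \<rhd> mu (btgt R) (r \<otimes> ?V))"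
          by (simp add: m la_la)
        finally show ?thesis .
      qed
      show "l \<rhd> coW W \<cdot> (ra L W \<cdot> ra L (T \<otimes> W))
        = (ra L (r \<otimes> (l \<otimes> W)) \<cdot> ra L (T \<otimes> (r \<otimes> (l \<otimes> W)))) \<cdot> l \<rhd> T \<rhd> T \<rhd> coW W"
        by (simp add: naturals)
      show "l \<rhd> coW W \<cdot> (ra L W \<cdot> l \<rhd> mu (btgt R) W)
        = (ra L (r \<otimes> (l \<otimes> W)) \<cdot> l \<rhd> mu (btgt R) (r \<otimes> (l \<otimes> W))) \<cdot> l \<rhd> T \<rhd> T \<rhd> coW W"
        using lwhisker_eq[OF mu_push[of "btgt R" "coW W" W], of l] by (simp add: naturals)
    qed simp_all
    show "ra L W \<cdot> l \<rhd> eta (btgt R) W = \<one> (l \<otimes> W)"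
    proof (rule mate_cancel_L)
      show "evW (l \<otimes> W) \<cdot> (ra L (r \<otimes> (l \<otimes> W)) \<cdot> l \<rhd> eta (btgt R) (r \<otimes> (l \<otimes> W)))
        = evW (l \<otimes> W) \<cdot> \<one> (l \<otimes> (r \<otimes> (l \<otimes> W)))"
        using lwhisker_eq[OF la_eta[of R "l \<otimes> W"], of l]
        by (simp add: m)
      show "l \<rhd> coW W \<cdot> (ra L W \<cdot> l \<rhd> eta (btgt R) W)
        = (ra L (r \<otimes> (l \<otimes> W)) \<cdot> l \<rhd> eta (btgt R) (r \<otimes> (l \<otimes> W))) \<cdot> l \<rhd> coW W"
        using lwhisker_eq[OF eta_push[of "btgt R" "coW W" W], of l] by (simp add: naturals)
    qed simp_all
    show "la L W \<cdot> A \<rhd> ra L W = ra L W \<cdot> la L (T \<otimes> W)"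
    proof (rule mate_cancel_L)
      show "evW (l \<otimes> W) \<cdot> (la L (r \<otimes> (l \<otimes> W)) \<cdot> A \<rhd> ra L (r \<otimes> (l \<otimes> W)))
        = evW (l \<otimes> W) \<cdot> (ra L (r \<otimes> (l \<otimes> W)) \<cdot> la L (T \<otimes> (r \<otimes> (l \<otimes> W))))"
        using lwhisker_eq[OF e0_ra[of "l \<otimes> W"], of A]
        by (simp add: m naturals)
      show "l \<rhd> coW W \<cdot> (la L W \<cdot> A \<rhd> ra L W)
        = (la L (r \<otimes> (l \<otimes> W)) \<cdot> A \<rhd> ra L (r \<otimes> (l \<otimes> W))) \<cdot> A \<rhd> l \<rhd> T \<rhd> coW W"
        using lwhisker_eq[OF ra_push[of L "coW W" W], of A] by (simp add: naturals)
      show "l \<rhd> coW W \<cdot> (ra L W \<cdot> la L (T \<otimes> W))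
        = (ra L (r \<otimes> (l \<otimes> W)) \<cdot> la L (T \<otimes> (r \<otimes> (l \<otimes> W)))) \<cdot> A \<rhd> l \<rhd> T \<rhd> coW W"
        by (simp add: naturals)
    qed simp_all
  qed
qed

text \<open>Now \<open>L\<close> is the known bimodule. The pairing is applied to its left coaction,
  and \<open>mate_cancel_R\<close> tests the laws of \<open>R\<close>.\<close>

lemma mate_bimodule_R:
  assumes L [simp]: "bim L"
    and balanced: "\<And>W. \<lbrakk>W \<in> Mor1 B; tgt B W = fst (bsrc R)\<rbrakk> \<Longrightarrow>
      evW W \<cdot> l \<rhd> la R W = evW W \<cdot> ra L (r \<otimes> W)"
    and right_mate: "\<And>W. \<lbrakk>W \<in> Mor1 B; tgt B W = fst (bsrc R)\<rbrakk> \<Longrightarrow>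
      evW W \<cdot> l \<rhd> ra R W = pairing (bsrc R) W \<cdot> A \<rhd> evW (A \<otimes> W) \<cdot> cl L (r \<otimes> (A \<otimes> W))"
  shows "bim R"
    and "\<And>W. \<lbrakk>W \<in> Mor1 B; tgt B W = fst (bsrc R)\<rbrakk> \<Longrightarrow>
      evW (A \<otimes> W) \<cdot> l \<rhd> cr R W = A \<rhd> evW W \<cdot> cl L (r \<otimes> W)"
proof -
  define e0 where "e0 W = A \<rhd> evW W \<cdot> cl L (r \<otimes> W)" for W
  have e0_cell [simp]: "e0 W \<in> Mor2 B" "dom2 B (e0 W) = l \<otimes> (r \<otimes> W)" "cod2 B (e0 W) = A \<otimes> W"
    if "W \<in> Mor1 B" "tgt B W = fst (bsrc R)" for W
    using that by (simp_all add: e0_def)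
  have mate: "evW W \<cdot> l \<rhd> ra R W = pairing (bsrc R) W \<cdot> e0 (A \<otimes> W)"
    if "W \<in> Mor1 B" "tgt B W = fst (bsrc R)" for W
    using that right_mate by (simp add: e0_def)
  note naturals = act_push[of L, simplified] act_push'[of L, simplified]
  have cl_natural_L: "cl L V \<cdot> l \<rhd> g = A \<rhd> l \<rhd> g \<cdot> cl L (dom2 B g)"
    if "g \<in> Mor2 B" "cod2 B g = V" "tgt B (dom2 B g) = fst (btgt R)" for g V
    using that cl_natural[of L g V] by simp
  have e0_natural: "e0 V \<cdot> l \<rhd> r \<rhd> g = A \<rhd> g \<cdot> e0 (dom2 B g)"
    if "g \<in> Mor2 B" "cod2 B g = V" "tgt B (dom2 B g) = fst (bsrc R)" for g V
  proof -
    have "V \<in> Mor1 B" "tgt B V = fst (bsrc R)" using that by auto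
    note [simp] = that(1,3) this
    have "e0 V \<cdot> l \<rhd> r \<rhd> g = A \<rhd> (evW V \<cdot> l \<rhd> r \<rhd> g) \<cdot> cl L (r \<otimes> dom2 B g)"
      using that(2) by (simp add: e0_def cl_natural_L)
    also have "\<dots> = A \<rhd> g \<cdot> e0 (dom2 B g)"
      using that(2) by (simp add: e0_def evW_natural)
    finally show ?thesis .
  qed
  have dl_e0: "A \<rhd> e0 W \<cdot> cl L (r \<otimes> W) = delta (bsrc R) W \<cdot> e0 W"
    if [simp]: "W \<in> Mor1 B" "tgt B W = fst (bsrc R)" for W
    using cl_cl[of L "r \<otimes> W"]
    by (simp add: e0_def delta_push[THEN vcomp_reassoc])
  have e0_ra: "e0 W \<cdot> l \<rhd> ra R W = mu (bsrc R) W \<cdot> e0 (A \<otimes> W)"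
    if [simp]: "W \<in> Mor1 B" "tgt B W = fst (bsrc R)" for W
  proof -
    have "e0 W \<cdot> l \<rhd> ra R W = A \<rhd> (evW W \<cdot> l \<rhd> ra R W) \<cdot> cl L (r \<otimes> (A \<otimes> W))"
      by (simp add: e0_def cl_natural_L)
    also have "\<dots> = A \<rhd> pairing (bsrc R) W \<cdot> (A \<rhd> e0 (A \<otimes> W) \<cdot> cl L (r \<otimes> (A \<otimes> W)))"
      by (simp add: mate)
    also have "\<dots> = mu (bsrc R) W \<cdot> e0 (A \<otimes> W)"
      by (simp add: dl_e0 pr_dl(2)[THEN vcomp_reassoc])
    finally show ?thesis .
  qed
  have e0_la: "e0 W \<cdot> l \<rhd> la R W = e0 W \<cdot> ra L (r \<otimes> W)"
    if [simp]: "W \<in> Mor1 B" "tgt B W = fst (bsrc R)" for W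
  proof -
    have "e0 W \<cdot> l \<rhd> la R W = A \<rhd> (evW W \<cdot> l \<rhd> la R W) \<cdot> cl L (T \<otimes> (r \<otimes> W))"
      by (simp add: e0_def cl_natural_L)
    also have "\<dots> = A \<rhd> evW W \<cdot> (A \<rhd> ra L (r \<otimes> W) \<cdot> cl L (T \<otimes> (r \<otimes> W)))"
      by (simp add: balanced)
    also have "\<dots> = e0 W \<cdot> ra L (r \<otimes> W)"
      using cl_ra[of L "r \<otimes> W"] by (simp add: e0_def)
    finally show ?thesis .
  qed
  have coact: "evW (A \<otimes> W) \<cdot> l \<rhd> cr R W = e0 W"
    if [simp]: "W \<in> Mor1 B" "tgt B W = fst (bsrc R)" for W
    by (simp add: cr_def mate[THEN vcomp_reassoc] e0_natural pr_cp(1)[THEN vcomp_reassoc])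
  then show "evW (A \<otimes> W) \<cdot> l \<rhd> cr R W = A \<rhd> evW W \<cdot> cl L (r \<otimes> W)"
    if "W \<in> Mor1 B" "tgt B W = fst (bsrc R)" for W
    using that by (simp add: e0_def)
  have ep_e0: "eps (bsrc R) W \<cdot> e0 W = evW W"
    if [simp]: "W \<in> Mor1 B" "tgt B W = fst (bsrc R)" for W
    using ep_cl[of L "r \<otimes> W"] by (simp add: e0_def ep_natural[THEN vcomp_reassoc])
  show "bim R"
  proof (rule bimI, simp_all)
    fix W assume [simp]: "W \<in> Mor1 B" "tgt B W = fst (bsrc R)"
    show "la R W \<cdot> T \<rhd> la R W = la R W \<cdot> mu (btgt R) (r \<otimes> W)"
    proof (rule mate_cancel_R)
      have "evW W \<cdot> l \<rhd> (la R W \<cdot> T \<rhd> la R W) = evW W \<cdot> (ra L (r \<otimes> W) \<cdot> l \<rhd> T \<rhd> la R W)"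
        by (simp add: balanced[THEN vcomp_reassoc])
      also have "\<dots> = (evW W \<cdot> l \<rhd> la R W) \<cdot> ra L (T \<otimes> (r \<otimes> W))"
        by (simp add: naturals)
      also have "\<dots> = evW W \<cdot> (ra L (r \<otimes> W) \<cdot> ra L (T \<otimes> (r \<otimes> W)))"
        by (simp add: balanced)
      also have "\<dots> = evW W \<cdot> l \<rhd> (la R W \<cdot> mu (btgt R) (r \<otimes> W))"
        using ra_ra[of L "r \<otimes> W"] by (simp add: balanced[THEN vcomp_reassoc])
      finally show "evW W \<cdot> l \<rhd> (la R W \<cdot> T \<rhd> la R W) = evW W \<cdot> l \<rhd> (la R W \<cdot> mu (btgt R) (r \<otimes> W))" .
    qed simp_all
    show "la R W \<cdot> eta (btgt R) (r \<otimes> W) = \<one> (r \<otimes> W)"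
    proof (rule mate_cancel_R)
      show "evW W \<cdot> l \<rhd> (la R W \<cdot> eta (btgt R) (r \<otimes> W)) = evW W \<cdot> l \<rhd> \<one> (r \<otimes> W)"
        using ra_eta[of L "r \<otimes> W"] by (simp add: balanced[THEN vcomp_reassoc])
    qed simp_all
    show "ra R W \<cdot> ra R (A \<otimes> W) = ra R W \<cdot> r \<rhd> mu (bsrc R) W"
    proof (rule mate_cancel_R)
      show "evW W \<cdot> l \<rhd> (ra R W \<cdot> ra R (A \<otimes> W)) = evW W \<cdot> l \<rhd> (ra R W \<cdot> r \<rhd> mu (bsrc R) W)"
        by (simp add: mate[THEN vcomp_reassoc] e0_ra e0_natural pr_mu[THEN vcomp_reassoc])
    qed simp_all
    show "ra R W \<cdot> r \<rhd> eta (bsrc R) W = \<one> (r \<otimes> W)"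
    proof (rule mate_cancel_R)
      show "evW W \<cdot> l \<rhd> (ra R W \<cdot> r \<rhd> eta (bsrc R) W) = evW W \<cdot> l \<rhd> \<one> (r \<otimes> W)"
        by (simp add: mate[THEN vcomp_reassoc] e0_natural pr_eta(2)[THEN vcomp_reassoc] ep_e0)
    qed simp_all
    show "la R W \<cdot> T \<rhd> ra R W = ra R W \<cdot> la R (A \<otimes> W)"
    proof (rule mate_cancel_R)
      have "evW W \<cdot> l \<rhd> (la R W \<cdot> T \<rhd> ra R W) = evW W \<cdot> (ra L (r \<otimes> W) \<cdot> l \<rhd> T \<rhd> ra R W)"
        by (simp add: balanced[THEN vcomp_reassoc])
      also have "\<dots> = (evW W \<cdot> l \<rhd> ra R W) \<cdot> ra L (r \<otimes> (A \<otimes> W))"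
        by (simp add: naturals)
      also have "\<dots> = evW W \<cdot> l \<rhd> (ra R W \<cdot> la R (A \<otimes> W))"
        by (simp add: mate mate[THEN vcomp_reassoc] e0_la)
      finally show "evW W \<cdot> l \<rhd> (la R W \<cdot> T \<rhd> ra R W) = evW W \<cdot> l \<rhd> (ra R W \<cdot> la R (A \<otimes> W))" .
    qed simp_all
  qed
qed

end

section \<open>Pivotal duality and Nakayama automorphisms\<close>

context bicategory
begin

lemma transpose_right:
  assumes "V \<in> Mor1 B" "W \<in> Mor1 B" "src B W = tgt B D" "tgt B V = src B D" "src B V = tgt B D"
    "tgt B W = src B D"
    "\<phi> \<in> Mor2 B" "dom2 B \<phi> = D" "cod2 B \<phi> = C"
    "c \<in> Mor2 B" "dom2 B c = I (src B D)" "cod2 B c = W \<otimes> D"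
    "e \<in> Mor2 B" "dom2 B e = C \<otimes> V" "cod2 B e = I (tgt B D)"
  shows "transpose_right B V W c \<phi> e \<in> Mor2 B" "dom2 B (transpose_right B V W c \<phi> e) = V"
    "cod2 B (transpose_right B V W c \<phi> e) = W"
    "\<lbrakk>U \<in> Mor1 B; tgt B U = tgt B D\<rbrakk> \<Longrightarrow> transpose_right B V W c \<phi> e \<lhd> U
      = W \<rhd> hat20 C V e U \<cdot> W \<rhd> (\<phi> \<lhd> (V \<otimes> U)) \<cdot> hat02 W D c (V \<otimes> U)"
proof -
  note [simp] = assms
  have [simp]: "D \<in> Mor1 B" "C \<in> Mor1 B" "src B C = src B D" "tgt B C = tgt B D"
    using assms(7-9) cell1(9-12)[of \<phi>] by simp_all
  show "transpose_right B V W c \<phi> e \<in> Mor2 B" "dom2 B (transpose_right B V W c \<phi> e) = V"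
    "cod2 B (transpose_right B V W c \<phi> e) = W"
    by (simp_all add: transpose_right_def)
  show "transpose_right B V W c \<phi> e \<lhd> U
      = W \<rhd> hat20 C V e U \<cdot> W \<rhd> (\<phi> \<lhd> (V \<otimes> U)) \<cdot> hat02 W D c (V \<otimes> U)"
    if "U \<in> Mor1 B" "tgt B U = tgt B D"
    using that by (simp add: transpose_right_def unwhisker hat20_unfold[of e C V]
        hat02_unfold[of c W D] hat20_cell hat02_cell)
qed

lemma transpose_left:
  assumes "V \<in> Mor1 B" "W \<in> Mor1 B" "src B W = tgt B D" "tgt B V = src B D" "src B V = tgt B D"
    "tgt B W = src B D"
    "\<phi> \<in> Mor2 B" "dom2 B \<phi> = D" "cod2 B \<phi> = C"
    "c \<in> Mor2 B" "dom2 B c = I (tgt B D)" "cod2 B c = D \<otimes> W"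
    "e \<in> Mor2 B" "dom2 B e = V \<otimes> C" "cod2 B e = I (src B D)"
  shows "transpose_left B V W c \<phi> e \<in> Mor2 B" "dom2 B (transpose_left B V W c \<phi> e) = V"
    "cod2 B (transpose_left B V W c \<phi> e) = W"
    "\<lbrakk>U \<in> Mor1 B; tgt B U = tgt B D\<rbrakk> \<Longrightarrow> transpose_left B V W c \<phi> e \<lhd> U
      = hat20 V C e (W \<otimes> U) \<cdot> V \<rhd> (\<phi> \<lhd> (W \<otimes> U)) \<cdot> V \<rhd> hat02 D W c U"
proof -
  note [simp] = assms
  have [simp]: "D \<in> Mor1 B" "C \<in> Mor1 B" "src B C = src B D" "tgt B C = tgt B D"
    using assms(7-9) cell1(9-12)[of \<phi>] by simp_all
  show "transpose_left B V W c \<phi> e \<in> Mor2 B" "dom2 B (transpose_left B V W c \<phi> e) = V"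
    "cod2 B (transpose_left B V W c \<phi> e) = W"
    by (simp_all add: transpose_left_def)
  show "transpose_left B V W c \<phi> e \<lhd> U
      = hat20 V C e (W \<otimes> U) \<cdot> V \<rhd> (\<phi> \<lhd> (W \<otimes> U)) \<cdot> V \<rhd> hat02 D W c U"
    if "U \<in> Mor1 B" "tgt B U = tgt B D"
    using that by (simp add: transpose_left_def unwhisker hat20_unfold[of e V C]
        hat02_unfold[of c D W] hat20_cell hat02_cell hat02_unfold hat20_unfold)
qed

lemma nest_units:
  assumes "P \<in> Mor1 B" "Q \<in> Mor1 B" "R \<in> Mor1 B" "S \<in> Mor1 B"
    "src B P = tgt B Q" "tgt B P = src B Q" "src B R = tgt B S" "tgt B R = src B S" "src B S = tgt B Q"
    "p \<in> Mor2 B" "dom2 B p = I (src B Q)" "cod2 B p = P \<otimes> Q"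
    "q \<in> Mor2 B" "dom2 B q = I (src B S)" "cod2 B q = R \<otimes> S"
  shows "nest_units B P Q p R S q \<in> Mor2 B" "dom2 B (nest_units B P Q p R S q) = I (src B Q)"
    "cod2 B (nest_units B P Q p R S q) = (P \<otimes> R) \<otimes> (S \<otimes> Q)"
    "\<lbrakk>U \<in> Mor1 B; tgt B U = src B Q\<rbrakk> \<Longrightarrow> hat02 (P \<otimes> R) (S \<otimes> Q) (nest_units B P Q p R S q) U
      = \<a>\<^sup>- P R ((S \<otimes> Q) \<otimes> U) \<cdot> P \<rhd> R \<rhd> \<a>\<^sup>- S Q U \<cdot> P \<rhd> hat02 R S q (Q \<otimes> U) \<cdot> hat02 P Q p U"
proof -
  note [simp] = assms
  show "nest_units B P Q p R S q \<in> Mor2 B" "dom2 B (nest_units B P Q p R S q) = I (src B Q)"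
    "cod2 B (nest_units B P Q p R S q) = (P \<otimes> R) \<otimes> (S \<otimes> Q)"
    by (simp_all add: nest_units_def)
  show "hat02 (P \<otimes> R) (S \<otimes> Q) (nest_units B P Q p R S q) U
      = \<a>\<^sup>- P R ((S \<otimes> Q) \<otimes> U) \<cdot> P \<rhd> R \<rhd> \<a>\<^sup>- S Q U \<cdot> P \<rhd> hat02 R S q (Q \<otimes> U) \<cdot> hat02 P Q p U"
    if "U \<in> Mor1 B" "tgt B U = src B Q"
    using that by (simp add: hat02_def[of "P \<otimes> R"] nest_units_def unwhisker hat02_unfold[of p P Q]
        hat02_unfold[of q R S] hat02_cell assoc_natural_right)
qed

end

section \<open>Duality maps and rotations of 2-cells\<close>

context pivotal_bicategory
begin

lemma dagger_cell [simp]: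
  assumes "X \<in> Mor1 B"
  shows "X\<^sup>\<dagger> \<in> Mor1 B" "src B (X\<^sup>\<dagger>) = tgt B X" "tgt B (X\<^sup>\<dagger>) = src B X"
    "ev B X \<in> Mor2 B" "dom2 B (ev B X) = X\<^sup>\<dagger> \<otimes> X" "cod2 B (ev B X) = I (src B X)"
    "coev B X \<in> Mor2 B" "dom2 B (coev B X) = I (tgt B X)" "cod2 B (coev B X) = X \<otimes> X\<^sup>\<dagger>"
    "evt B X \<in> Mor2 B" "dom2 B (evt B X) = X \<otimes> X\<^sup>\<dagger>" "cod2 B (evt B X) = I (tgt B X)"
    "coevt B X \<in> Mor2 B" "dom2 B (coevt B X) = I (src B X)" "cod2 B (coevt B X) = X\<^sup>\<dagger> \<otimes> X"
  using dagger_left_adjoint[OF assms] dagger_right_adjoint[OF assms]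
  by (auto simp: is_adjunction_def hom1_iff hom2_iff)

abbreviation "evh X \<equiv> hat20 (X\<^sup>\<dagger>) X (ev B X)"
abbreviation "coevh X \<equiv> hat02 X (X\<^sup>\<dagger>) (coev B X)"
abbreviation "evth X \<equiv> hat20 X (X\<^sup>\<dagger>) (evt B X)"
abbreviation "coevth X \<equiv> hat02 (X\<^sup>\<dagger>) X (coevt B X)"

lemma duality_cell [simp]:
  assumes "X \<in> Mor1 B" "W \<in> Mor1 B"
  shows "tgt B W = src B X \<Longrightarrow> evh X W \<in> Mor2 B"
    "tgt B W = src B X \<Longrightarrow> dom2 B (evh X W) = X\<^sup>\<dagger> \<otimes> (X \<otimes> W)"
    "tgt B W = src B X \<Longrightarrow> cod2 B (evh X W) = W"
    "tgt B W = tgt B X \<Longrightarrow> coevh X W \<in> Mor2 B"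
    "tgt B W = tgt B X \<Longrightarrow> dom2 B (coevh X W) = W"
    "tgt B W = tgt B X \<Longrightarrow> cod2 B (coevh X W) = X \<otimes> (X\<^sup>\<dagger> \<otimes> W)"
    "tgt B W = tgt B X \<Longrightarrow> evth X W \<in> Mor2 B"
    "tgt B W = tgt B X \<Longrightarrow> dom2 B (evth X W) = X \<otimes> (X\<^sup>\<dagger> \<otimes> W)"
    "tgt B W = tgt B X \<Longrightarrow> cod2 B (evth X W) = W"
    "tgt B W = src B X \<Longrightarrow> coevth X W \<in> Mor2 B"
    "tgt B W = src B X \<Longrightarrow> dom2 B (coevth X W) = W"
    "tgt B W = src B X \<Longrightarrow> cod2 B (coevth X W) = X\<^sup>\<dagger> \<otimes> (X \<otimes> W)"
  using assms by (simp_all add: hat20_cell hat02_cell)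

lemma duality_zigzag:
  assumes "X \<in> Mor1 B" "W \<in> Mor1 B"
  shows "tgt B W = src B X \<Longrightarrow> X \<rhd> evh X W \<cdot> coevh X (X \<otimes> W) = \<one> (X \<otimes> W)"
    "tgt B W = tgt B X \<Longrightarrow> evh X (X\<^sup>\<dagger> \<otimes> W) \<cdot> X\<^sup>\<dagger> \<rhd> coevh X W = \<one> (X\<^sup>\<dagger> \<otimes> W)"
    "tgt B W = tgt B X \<Longrightarrow> X\<^sup>\<dagger> \<rhd> evth X W \<cdot> coevth X (X\<^sup>\<dagger> \<otimes> W) = \<one> (X\<^sup>\<dagger> \<otimes> W)"
    "tgt B W = src B X \<Longrightarrow> evth X (X \<otimes> W) \<cdot> X \<rhd> coevth X W = \<one> (X \<otimes> W)"
  using assms adjunction_hats(9,10)[OF dagger_left_adjoint[OF assms(1)]]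
    adjunction_hats(9,10)[OF dagger_right_adjoint[OF assms(1)]] by simp_all

lemma duality_pull:
  assumes [simp]: "X \<in> Mor1 B" "g \<in> Mor2 B" and V: "cod2 B g = V"
  shows evh_pull: "tgt B (dom2 B g) = src B X \<Longrightarrow> evh X V \<cdot> X\<^sup>\<dagger> \<rhd> X \<rhd> g = g \<cdot> evh X (dom2 B g)"
    and coevh_pull: "tgt B (dom2 B g) = tgt B X \<Longrightarrow> coevh X V \<cdot> g = X \<rhd> X\<^sup>\<dagger> \<rhd> g \<cdot> coevh X (dom2 B g)"
    and evth_pull: "tgt B (dom2 B g) = tgt B X \<Longrightarrow> evth X V \<cdot> X \<rhd> X\<^sup>\<dagger> \<rhd> g = g \<cdot> evth X (dom2 B g)"
    and coevth_pull: "tgt B (dom2 B g) = src B X \<Longrightarrow> coevth X V \<cdot> g = X\<^sup>\<dagger> \<rhd> X \<rhd> g \<cdot> coevth X (dom2 B g)"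
proof -
  show "evh X V \<cdot> X\<^sup>\<dagger> \<rhd> X \<rhd> g = g \<cdot> evh X (dom2 B g)" if "tgt B (dom2 B g) = src B X"
    unfolding V[symmetric] by (rule hat20_natural) (simp_all add: that)
  show "coevh X V \<cdot> g = X \<rhd> X\<^sup>\<dagger> \<rhd> g \<cdot> coevh X (dom2 B g)" if "tgt B (dom2 B g) = tgt B X"
    unfolding V[symmetric] by (rule hat02_natural[symmetric]) (simp_all add: that)
  show "evth X V \<cdot> X \<rhd> X\<^sup>\<dagger> \<rhd> g = g \<cdot> evth X (dom2 B g)" if "tgt B (dom2 B g) = tgt B X"
    unfolding V[symmetric] by (rule hat20_natural) (simp_all add: that)
  show "coevth X V \<cdot> g = X\<^sup>\<dagger> \<rhd> X \<rhd> g \<cdot> coevth X (dom2 B g)" if "tgt B (dom2 B g) = src B X"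
    unfolding V[symmetric] by (rule hat02_natural[symmetric]) (simp_all add: that)
qed

lemma duality_push:
  assumes "X \<in> Mor1 B" "g \<in> Mor2 B" "dom2 B g = W"
  shows evh_push: "tgt B W = src B X \<Longrightarrow> g \<cdot> evh X W = evh X (cod2 B g) \<cdot> X\<^sup>\<dagger> \<rhd> X \<rhd> g"
    and coevh_push: "tgt B W = tgt B X \<Longrightarrow> X \<rhd> X\<^sup>\<dagger> \<rhd> g \<cdot> coevh X W = coevh X (cod2 B g) \<cdot> g"
    and evth_push: "tgt B W = tgt B X \<Longrightarrow> g \<cdot> evth X W = evth X (cod2 B g) \<cdot> X \<rhd> X\<^sup>\<dagger> \<rhd> g"
    and coevth_push: "tgt B W = src B X \<Longrightarrow> X\<^sup>\<dagger> \<rhd> X \<rhd> g \<cdot> coevth X W = coevth X (cod2 B g) \<cdot> g"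
  using duality_pull[OF assms(1,2) refl] assms(3) by simp_all

text \<open>Both pivotal axioms together: rotating \<open>\<phi> : X \<otimes> A \<rightarrow> Z\<close> into \<open>Z\<^sup>\<dagger> \<rightarrow> A\<^sup>\<dagger> \<otimes> X\<^sup>\<dagger>\<close> in either
  direction gives the same 2-cell.\<close>

lemma transpose_eq:
  assumes X: "X \<in> Mor1 B" "A \<in> Mor1 B" "src B X = tgt B A"
    and \<phi>: "\<phi> \<in> Mor2 B" "dom2 B \<phi> = X \<otimes> A" "cod2 B \<phi> = Z"
    and W: "W \<in> Mor1 B" "tgt B W = tgt B X"
  shows "A\<^sup>\<dagger> \<rhd> X\<^sup>\<dagger> \<rhd> evth Z W \<cdot> A\<^sup>\<dagger> \<rhd> X\<^sup>\<dagger> \<rhd> hat21 X A \<phi> (Z\<^sup>\<dagger> \<otimes> W) \<cdot>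
      A\<^sup>\<dagger> \<rhd> coevth X (A \<otimes> (Z\<^sup>\<dagger> \<otimes> W)) \<cdot> coevth A (Z\<^sup>\<dagger> \<otimes> W)
    = evh Z (A\<^sup>\<dagger> \<otimes> (X\<^sup>\<dagger> \<otimes> W)) \<cdot> Z\<^sup>\<dagger> \<rhd> hat21 X A \<phi> (A\<^sup>\<dagger> \<otimes> (X\<^sup>\<dagger> \<otimes> W)) \<cdot>
      Z\<^sup>\<dagger> \<rhd> X \<rhd> coevh A (X\<^sup>\<dagger> \<otimes> W) \<cdot> Z\<^sup>\<dagger> \<rhd> coevh X W"
proof -
  have [simp]: "Z \<in> Mor1 B" "src B Z = src B A" "tgt B Z = tgt B X"
    using assms cell1(10-12)[of \<phi>] by simp_all
  note [simp] = X W \<phi>(1,3)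
  \<comment> \<open>The two composites are kept as single 1-cells while the axioms for them are
    applied; they are taken apart only when the sides are compared at the end.\<close>
  define P where "P = X \<otimes> A"
  define Q where "Q = A\<^sup>\<dagger> \<otimes> X\<^sup>\<dagger>"
  have [simp]: "P \<in> Mor1 B" "src B P = src B A" "tgt B P = tgt B X"
    "Q \<in> Mor1 B" "src B Q = tgt B X" "tgt B Q = src B A"
    by (simp_all add: P_def Q_def)
  have [simp]: "dom2 B \<phi> = P" using \<phi>(2) by (simp add: P_def)
  define N where "N = nest_units B (A\<^sup>\<dagger>) A (coevt B A) (X\<^sup>\<dagger>) X (coevt B X)"
  define N' where "N' = nest_units B X (X\<^sup>\<dagger>) (coev B X) A (A\<^sup>\<dagger>) (coev B A)"
  have [simp]: "N \<in> Mor2 B" "dom2 B N = I (src B A)" "cod2 B N = Q \<otimes> P"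
    "N' \<in> Mor2 B" "dom2 B N' = I (tgt B X)" "cod2 B N' = P \<otimes> Q"
    unfolding N_def N'_def P_def Q_def by (subst nest_units; simp)+
  have N_hat: "hat02 Q P N U = \<a>\<^sup>- (A\<^sup>\<dagger>) (X\<^sup>\<dagger>) (P \<otimes> U) \<cdot> A\<^sup>\<dagger> \<rhd> X\<^sup>\<dagger> \<rhd> \<a>\<^sup>- X A U
      \<cdot> A\<^sup>\<dagger> \<rhd> coevth X (A \<otimes> U) \<cdot> coevth A U" if "U \<in> Mor1 B" "tgt B U = src B A" for U
    unfolding N_def P_def Q_def by (rule nest_units(4)) (simp_all add: that)
  have N'_hat: "hat02 P Q N' U = \<a>\<^sup>- X A (Q \<otimes> U) \<cdot> X \<rhd> A \<rhd> \<a>\<^sup>- (A\<^sup>\<dagger>) (X\<^sup>\<dagger>) U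
      \<cdot> X \<rhd> coevh A (X\<^sup>\<dagger> \<otimes> U) \<cdot> coevh X U" if "U \<in> Mor1 B" "tgt B U = tgt B X" for U
    unfolding N'_def P_def Q_def by (rule nest_units(4)) (simp_all add: that)
  \<comment> \<open>\<open>pivotal_hcomp\<close> compares the two maps from
    \<open>P\<^sup>\<dagger>\<close> to \<open>Q\<close>, and \<open>pivotal_2cell\<close> the two
    duals of \<phi> from \<open>Z\<^sup>\<dagger>\<close> to \<open>P\<^sup>\<dagger>\<close>.
    Composing them gives the two rotations of \<phi>.\<close>
  have "transpose_right B (P\<^sup>\<dagger>) Q N (\<one> P) (evt B P) = transpose_left B (P\<^sup>\<dagger>) Q N' (\<one> P) (ev B P)"
    using pivotal_hcomp[of A "src B A" "tgt B A" X "tgt B X"]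
    by (simp add: hom1_iff N_def N'_def P_def Q_def)
  moreover have "transpose_right B (Z\<^sup>\<dagger>) (P\<^sup>\<dagger>) (coevt B P) \<phi> (evt B Z)
      = transpose_left B (Z\<^sup>\<dagger>) (P\<^sup>\<dagger>) (coev B P) \<phi> (ev B Z)"
    by (rule pivotal_2cell) (simp_all add: hom2_iff)
  ultimately have eq: "transpose_right B (P\<^sup>\<dagger>) Q N (\<one> P) (evt B P) \<lhd> W \<cdot>
      transpose_right B (Z\<^sup>\<dagger>) (P\<^sup>\<dagger>) (coevt B P) \<phi> (evt B Z) \<lhd> W
    = transpose_left B (P\<^sup>\<dagger>) Q N' (\<one> P) (ev B P) \<lhd> W \<cdot>
      transpose_left B (Z\<^sup>\<dagger>) (P\<^sup>\<dagger>) (coev B P) \<phi> (ev B Z) \<lhd> W" by simp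
  define f where "f = evth Z W \<cdot> \<phi> \<lhd> (Z\<^sup>\<dagger> \<otimes> W)"
  have f [simp]: "f \<in> Mor2 B" "dom2 B f = P \<otimes> (Z\<^sup>\<dagger> \<otimes> W)" "cod2 B f = W"
    by (simp_all add: f_def)
  define g where "g = P\<^sup>\<dagger> \<rhd> f \<cdot> coevth P (Z\<^sup>\<dagger> \<otimes> W)"
  have g [simp]: "g \<in> Mor2 B" "dom2 B g = Z\<^sup>\<dagger> \<otimes> W" "cod2 B g = P\<^sup>\<dagger> \<otimes> W"
    by (simp_all add: g_def)
  \<comment> \<open>The intermediate dual \<open>P\<^sup>\<dagger>\<close> disappears by a zigzag
    identity, here the one for \<open>evt\<close>; the computation of \<open>rhs\<close> uses the
    one for \<open>ev\<close>.\<close>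
  have "evth P W \<cdot> P \<rhd> g = f"
    by (simp add: g_def evth_pull[THEN vcomp_reassoc] duality_zigzag)
  then have Pg: "Q \<rhd> evth P W \<cdot> Q \<rhd> P \<rhd> g = Q \<rhd> f"
    using lwhisker_eq[of "evth P W" "P \<rhd> g" f Q] by simp
  have "transpose_right B (P\<^sup>\<dagger>) Q N (\<one> P) (evt B P) \<lhd> W \<cdot>
      transpose_right B (Z\<^sup>\<dagger>) (P\<^sup>\<dagger>) (coevt B P) \<phi> (evt B Z) \<lhd> W
    = Q \<rhd> evth P W \<cdot> (hat02 Q P N (P\<^sup>\<dagger> \<otimes> W) \<cdot> g)"
    by (simp add: transpose_right(4)[of _ _ P] g_def f_def hat02_cell)
  also have "\<dots> = Q \<rhd> f \<cdot> hat02 Q P N (Z\<^sup>\<dagger> \<otimes> W)"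
    using hat02_natural[of N Q P g] by (simp add: hat02_cell Pg[THEN vcomp_reassoc, symmetric])
  finally have lhs: "transpose_right B (P\<^sup>\<dagger>) Q N (\<one> P) (evt B P) \<lhd> W \<cdot>
      transpose_right B (Z\<^sup>\<dagger>) (P\<^sup>\<dagger>) (coevt B P) \<phi> (evt B Z) \<lhd> W
    = Q \<rhd> f \<cdot> hat02 Q P N (Z\<^sup>\<dagger> \<otimes> W)" .
  define h where "h = hat02 P Q N' W"
  have h [simp]: "h \<in> Mor2 B" "dom2 B h = W" "cod2 B h = P \<otimes> (Q \<otimes> W)"
    by (simp_all add: h_def hat02_cell)
  define k where "k = evh P (Q \<otimes> W) \<cdot> P\<^sup>\<dagger> \<rhd> h"
  have k [simp]: "k \<in> Mor2 B" "dom2 B k = P\<^sup>\<dagger> \<otimes> W" "cod2 B k = Q \<otimes> W"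
    by (simp_all add: k_def)
  have "P \<rhd> k \<cdot> coevh P W = h"
    by (simp add: k_def coevh_push duality_zigzag(1)[THEN vcomp_reassoc])
  then have Pk: "Z\<^sup>\<dagger> \<rhd> P \<rhd> k \<cdot> Z\<^sup>\<dagger> \<rhd> coevh P W = Z\<^sup>\<dagger> \<rhd> h"
    using lwhisker_eq[of "P \<rhd> k" "coevh P W" h "Z\<^sup>\<dagger>"] by simp
  have \<phi>k: "Z\<^sup>\<dagger> \<rhd> Z \<rhd> k \<cdot> Z\<^sup>\<dagger> \<rhd> (\<phi> \<lhd> (P\<^sup>\<dagger> \<otimes> W)) = Z\<^sup>\<dagger> \<rhd> (\<phi> \<lhd> (Q \<otimes> W)) \<cdot> Z\<^sup>\<dagger> \<rhd> P \<rhd> k"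
    using lwhisker_eq[OF rwhisker_push[of \<phi> k "P\<^sup>\<dagger> \<otimes> W"], of "Z\<^sup>\<dagger>"] by simp
  have "transpose_left B (P\<^sup>\<dagger>) Q N' (\<one> P) (ev B P) \<lhd> W \<cdot>
      transpose_left B (Z\<^sup>\<dagger>) (P\<^sup>\<dagger>) (coev B P) \<phi> (ev B Z) \<lhd> W
    = k \<cdot> evh Z (P\<^sup>\<dagger> \<otimes> W) \<cdot> Z\<^sup>\<dagger> \<rhd> (\<phi> \<lhd> (P\<^sup>\<dagger> \<otimes> W)) \<cdot> Z\<^sup>\<dagger> \<rhd> coevh P W"
    by (simp add: transpose_left(4)[of _ _ P] k_def h_def hat02_cell)
  also have "\<dots> = evh Z (Q \<otimes> W) \<cdot> Z\<^sup>\<dagger> \<rhd> (\<phi> \<lhd> (Q \<otimes> W)) \<cdot> Z\<^sup>\<dagger> \<rhd> h"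
    by (simp add: evh_push[THEN vcomp_reassoc] \<phi>k[THEN vcomp_reassoc] Pk)
  finally have rhs: "transpose_left B (P\<^sup>\<dagger>) Q N' (\<one> P) (ev B P) \<lhd> W \<cdot>
      transpose_left B (Z\<^sup>\<dagger>) (P\<^sup>\<dagger>) (coev B P) \<phi> (ev B Z) \<lhd> W
    = evh Z (Q \<otimes> W) \<cdot> Z\<^sup>\<dagger> \<rhd> (\<phi> \<lhd> (Q \<otimes> W)) \<cdot> Z\<^sup>\<dagger> \<rhd> h" .
  let ?\<alpha> = "\<a>\<^sup>- (A\<^sup>\<dagger>) (X\<^sup>\<dagger>) W"
  let ?l = "A\<^sup>\<dagger> \<rhd> X\<^sup>\<dagger> \<rhd> evth Z W \<cdot> A\<^sup>\<dagger> \<rhd> X\<^sup>\<dagger> \<rhd> hat21 X A \<phi> (Z\<^sup>\<dagger> \<otimes> W) \<cdot>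
      A\<^sup>\<dagger> \<rhd> coevth X (A \<otimes> (Z\<^sup>\<dagger> \<otimes> W)) \<cdot> coevth A (Z\<^sup>\<dagger> \<otimes> W)"
  let ?r = "evh Z (A\<^sup>\<dagger> \<otimes> (X\<^sup>\<dagger> \<otimes> W)) \<cdot> Z\<^sup>\<dagger> \<rhd> hat21 X A \<phi> (A\<^sup>\<dagger> \<otimes> (X\<^sup>\<dagger> \<otimes> W)) \<cdot>
      Z\<^sup>\<dagger> \<rhd> X \<rhd> coevh A (X\<^sup>\<dagger> \<otimes> W) \<cdot> Z\<^sup>\<dagger> \<rhd> coevh X W"
  have \<phi>_cell [simp]: "hat21 X A \<phi> V \<in> Mor2 B" "dom2 B (hat21 X A \<phi> V) = X \<otimes> (A \<otimes> V)"
    "cod2 B (hat21 X A \<phi> V) = Z \<otimes> V" if "V \<in> Mor1 B" "tgt B V = src B A" for V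
    using that by (simp_all add: hat21_cell flip: P_def)
  have Qf: "Q \<rhd> f = ?\<alpha> \<cdot> A\<^sup>\<dagger> \<rhd> X\<^sup>\<dagger> \<rhd> f \<cdot> \<a> (A\<^sup>\<dagger>) (X\<^sup>\<dagger>) (P \<otimes> (Z\<^sup>\<dagger> \<otimes> W))"
    by (simp add: Q_def assoc_natural_right)
  have "hat02 Q P N (Z\<^sup>\<dagger> \<otimes> W) = \<a>\<^sup>- (A\<^sup>\<dagger>) (X\<^sup>\<dagger>) (P \<otimes> (Z\<^sup>\<dagger> \<otimes> W)) \<cdot> A\<^sup>\<dagger> \<rhd> X\<^sup>\<dagger> \<rhd> \<a>\<^sup>- X A (Z\<^sup>\<dagger> \<otimes> W)
      \<cdot> A\<^sup>\<dagger> \<rhd> coevth X (A \<otimes> (Z\<^sup>\<dagger> \<otimes> W)) \<cdot> coevth A (Z\<^sup>\<dagger> \<otimes> W)"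
    by (rule N_hat) simp_all
  then have "Q \<rhd> f \<cdot> hat02 Q P N (Z\<^sup>\<dagger> \<otimes> W) = ?\<alpha> \<cdot> ?l"
    unfolding Qf by (simp add: f_def P_def hat21_def[of X A \<phi>])
  moreover have "evh Z (Q \<otimes> W) \<cdot> Z\<^sup>\<dagger> \<rhd> (\<phi> \<lhd> (Q \<otimes> W)) \<cdot> Z\<^sup>\<dagger> \<rhd> h = ?\<alpha> \<cdot> ?r"
  proof -
    have h': "h = \<a>\<^sup>- X A (Q \<otimes> W) \<cdot> X \<rhd> A \<rhd> ?\<alpha> \<cdot> X \<rhd> coevh A (X\<^sup>\<dagger> \<otimes> W) \<cdot> coevh X W"
      unfolding h_def by (rule N'_hat) simp_all
    have "\<phi> \<lhd> (Q \<otimes> W) \<cdot> h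
      = (hat21 X A \<phi> (Q \<otimes> W) \<cdot> X \<rhd> A \<rhd> ?\<alpha>) \<cdot> X \<rhd> coevh A (X\<^sup>\<dagger> \<otimes> W) \<cdot> coevh X W"
      unfolding h' by (simp add: hat21_def[of X A \<phi>] P_def Q_def)
    also have "\<dots> = Z \<rhd> ?\<alpha> \<cdot> hat21 X A \<phi> (A\<^sup>\<dagger> \<otimes> (X\<^sup>\<dagger> \<otimes> W)) \<cdot> X \<rhd> coevh A (X\<^sup>\<dagger> \<otimes> W) \<cdot> coevh X W"
      using hat21_natural[of \<phi> X A ?\<alpha>] by (simp add: P_def Q_def)
    finally have "Z\<^sup>\<dagger> \<rhd> (\<phi> \<lhd> (Q \<otimes> W)) \<cdot> Z\<^sup>\<dagger> \<rhd> h
      = Z\<^sup>\<dagger> \<rhd> (Z \<rhd> ?\<alpha> \<cdot> hat21 X A \<phi> (A\<^sup>\<dagger> \<otimes> (X\<^sup>\<dagger> \<otimes> W)) \<cdot> X \<rhd> coevh A (X\<^sup>\<dagger> \<otimes> W) \<cdot> coevh X W)"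
      by (rule lwhisker_eq) simp_all
    then show ?thesis
      by (simp add: evh_push[THEN vcomp_reassoc] Q_def)
  qed
  ultimately have "?\<alpha> \<cdot> ?l = ?\<alpha> \<cdot> ?r"
    using eq lhs rhs by simp
  then have "\<a> (A\<^sup>\<dagger>) (X\<^sup>\<dagger>) W \<cdot> (?\<alpha> \<cdot> ?l) = \<a> (A\<^sup>\<dagger>) (X\<^sup>\<dagger>) W \<cdot> (?\<alpha> \<cdot> ?r)" by simp
  then show ?thesis
    by simp
qed

text \<open>Applied to the unitor \<open>I \<otimes> I \<rightarrow> I\<close>, the pivotal axioms identify the two
  trivialisations of \<open>I\<^sup>\<dagger>\<close>.\<close>

lemma evt_unit_eq_ev_unit:
  assumes a: "a \<in> Obj B" and W: "W \<in> Mor1 B" "tgt B W = a"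
  shows "evth (I a) W \<cdot> \<l>\<^sup>- ((I a)\<^sup>\<dagger> \<otimes> W) = evh (I a) W \<cdot> (I a)\<^sup>\<dagger> \<rhd> \<l>\<^sup>- W"
    and "\<exists>k. k \<in> hom2 B W ((I a)\<^sup>\<dagger> \<otimes> W) \<and> evh (I a) W \<cdot> (I a)\<^sup>\<dagger> \<rhd> \<l>\<^sup>- W \<cdot> k = \<one> W"
proof -
  note [simp] = a
  let ?J = "I a"
  let ?K = "(I a)\<^sup>\<dagger>"
  define et where "et V = evth ?J V \<cdot> \<l>\<^sup>- (?K \<otimes> V)" for V
  define ct where "ct V = ?K \<rhd> \<l> V \<cdot> coevth ?J V" for V
  define e where "e V = evh ?J V \<cdot> ?K \<rhd> \<l>\<^sup>- V" for V
  define c where "c V = \<l> (?K \<otimes> V) \<cdot> coevh ?J V" for V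
  have ln: "\<l> V \<cdot> ?J \<rhd> g = g \<cdot> \<l> (dom2 B g)" if "g \<in> Mor2 B" "cod2 B g = V" "tgt B (dom2 B g) = a" for g V
    using that lunit_naturality[of g V a] by simp
  have ln': "?J \<rhd> g \<cdot> \<l>\<^sup>- V = \<l>\<^sup>- (cod2 B g) \<cdot> g" if "g \<in> Mor2 B" "dom2 B g = V" "tgt B V = a" for g V
    using that lunit_inv_naturality[of g] by simp
  have cells [simp]: "et V \<in> Mor2 B" "dom2 B (et V) = ?K \<otimes> V" "cod2 B (et V) = V"
    "ct V \<in> Mor2 B" "dom2 B (ct V) = V" "cod2 B (ct V) = ?K \<otimes> V"
    "e V \<in> Mor2 B" "dom2 B (e V) = ?K \<otimes> V" "cod2 B (e V) = V"
    "c V \<in> Mor2 B" "dom2 B (c V) = V" "cod2 B (c V) = ?K \<otimes> V"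
    if "V \<in> Mor1 B" "tgt B V = a" for V
    using that by (simp_all add: et_def ct_def e_def c_def)
  have nat: "ct V \<cdot> g = ?K \<rhd> g \<cdot> ct (dom2 B g)" "e V \<cdot> ?K \<rhd> g = g \<cdot> e (dom2 B g)"
    "c V \<cdot> g = ?K \<rhd> g \<cdot> c (dom2 B g)"
    if g: "g \<in> Mor2 B" "cod2 B g = V" "tgt B (dom2 B g) = a" for g V
  proof -
    have V: "V \<in> Mor1 B" "tgt B V = a" using g by auto
    note [simp] = g(1,3) V
    have "ct V \<cdot> g = ?K \<rhd> (\<l> V \<cdot> ?J \<rhd> g) \<cdot> coevth ?J (dom2 B g)"
      using g(2) by (simp add: ct_def coevth_pull)
    also have "\<dots> = ?K \<rhd> g \<cdot> ct (dom2 B g)"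
      using g(2) by (simp add: ct_def ln)
    finally show "ct V \<cdot> g = ?K \<rhd> g \<cdot> ct (dom2 B g)" .
    have "e V \<cdot> ?K \<rhd> g = evh ?J V \<cdot> ?K \<rhd> (?J \<rhd> g \<cdot> \<l>\<^sup>- (dom2 B g))"
      unfolding ln'[OF g(1) refl g(3)] using g(2) by (simp add: e_def)
    also have "\<dots> = g \<cdot> e (dom2 B g)"
      using g(2) by (simp add: e_def evh_pull[THEN vcomp_reassoc])
    finally show "e V \<cdot> ?K \<rhd> g = g \<cdot> e (dom2 B g)" .
    have "c V \<cdot> g = (\<l> (?K \<otimes> V) \<cdot> ?J \<rhd> ?K \<rhd> g) \<cdot> coevh ?J (dom2 B g)"
      using g(2) by (simp add: c_def coevh_pull)
    also have "\<dots> = ?K \<rhd> g \<cdot> c (dom2 B g)"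
      using g(2) by (simp add: c_def ln)
    finally show "c V \<cdot> g = ?K \<rhd> g \<cdot> c (dom2 B g)" .
  qed
  have unfolds: "evth ?J V = et V \<cdot> \<l> (?K \<otimes> V)" "coevth ?J V = ?K \<rhd> \<l>\<^sup>- V \<cdot> ct V"
    "evh ?J V = e V \<cdot> ?K \<rhd> \<l> V" "coevh ?J V = \<l>\<^sup>- (?K \<otimes> V) \<cdot> c V"
    if "V \<in> Mor1 B" "tgt B V = a" for V
    using that by (simp_all add: et_def ct_def e_def c_def)
  have z1: "ct V \<cdot> et V = \<one> (?K \<otimes> V)" if "V \<in> Mor1 B" "tgt B V = a" for V
    using that duality_zigzag(3)[of ?J V] nat(1)[of "et V" V] by (simp add: unfolds)
  have z2: "e (?K \<otimes> V) \<cdot> ?K \<rhd> c V = \<one> (?K \<otimes> V)" if "V \<in> Mor1 B" "tgt B V = a" for V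
    using that duality_zigzag(2)[of ?J V] by (simp add: unfolds)
  have z3: "e V \<cdot> c V = \<one> V" if [simp]: "V \<in> Mor1 B" "tgt B V = a" for V
  proof -
    have "\<l> V \<cdot> (?J \<rhd> evh ?J V \<cdot> coevh ?J (?J \<otimes> V)) \<cdot> \<l>\<^sup>- V = \<one> V"
      by (simp add: duality_zigzag(1))
    moreover have "\<l> V \<cdot> (?J \<rhd> evh ?J V \<cdot> coevh ?J (?J \<otimes> V)) \<cdot> \<l>\<^sup>- V
      = (\<l> V \<cdot> ?J \<rhd> evh ?J V) \<cdot> (\<l>\<^sup>- (?K \<otimes> (?J \<otimes> V)) \<cdot> (c (?J \<otimes> V) \<cdot> \<l>\<^sup>- V))"
      by (simp add: unfolds(4))
    moreover have "\<dots> = evh ?J V \<cdot> (c (?J \<otimes> V) \<cdot> \<l>\<^sup>- V)"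
      by (simp add: ln)
    moreover have "c (?J \<otimes> V) \<cdot> \<l>\<^sup>- V = ?K \<rhd> \<l>\<^sup>- V \<cdot> c V"
      by (simp add: nat(3))
    ultimately show ?thesis by (simp add: e_def)
  qed
  \<comment> \<open>Here pivotality enters. The left side of \<open>transpose_eq\<close> for the
    unitor collapses to \<open>ct\<close> by \<open>z1\<close>, the right side to the whiskered
    \<open>c\<close> by a zigzag identity.\<close>
  have ct_K: "ct (?K \<otimes> V) = ?K \<rhd> c V" if [simp]: "V \<in> Mor1 B" "tgt B V = a" for V
  proof -
    have \<phi>: "hat21 ?J ?J (\<l> ?J) U = \<l> (?J \<otimes> U)" if "U \<in> Mor1 B" "tgt B U = a" for U
      using that by (simp add: hat21_def lunit_rwhisker)
    have "?K \<rhd> (evth ?J V \<cdot> \<l> (?J \<otimes> (?K \<otimes> V))) \<cdot> coevth ?J (?J \<otimes> (?K \<otimes> V))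
      = ?K \<rhd> (et V \<cdot> \<l> (?K \<otimes> V)) \<cdot> ct (?J \<otimes> (?K \<otimes> V))"
      by (simp add: unfolds)
    also have "\<dots> = ct V \<cdot> (et V \<cdot> \<l> (?K \<otimes> V))"
      using nat(1)[of "et V \<cdot> \<l> (?K \<otimes> V)" V] by simp
    also have "\<dots> = \<l> (?K \<otimes> V)"
      by (simp add: z1[THEN vcomp_reassoc])
    finally have "?K \<rhd> (?K \<rhd> (evth ?J V \<cdot> \<l> (?J \<otimes> (?K \<otimes> V))) \<cdot> coevth ?J (?J \<otimes> (?K \<otimes> V)))
      \<cdot> coevth ?J (?K \<otimes> V) = ct (?K \<otimes> V)"
      by (simp only: ct_def)
    moreover have "\<l> (?J \<otimes> (?K \<otimes> (?K \<otimes> V))) \<cdot> ?J \<rhd> coevh ?J (?K \<otimes> V) \<cdot> coevh ?J V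
      = coevh ?J (?K \<otimes> V) \<cdot> c V"
      by (simp add: ln[THEN vcomp_reassoc] c_def)
    then have "evh ?J (?K \<otimes> (?K \<otimes> V)) \<cdot> ?K \<rhd> (\<l> (?J \<otimes> (?K \<otimes> (?K \<otimes> V))) \<cdot> ?J \<rhd> coevh ?J (?K \<otimes> V) \<cdot> coevh ?J V)
      = ?K \<rhd> c V"
      by (simp add: duality_zigzag(2)[THEN vcomp_reassoc] del: lwhisker_vcomp)
        (simp add: duality_zigzag(2)[THEN vcomp_reassoc])
    ultimately show ?thesis
      using transpose_eq[of ?J ?J "\<l> ?J" ?J V] by (simp add: \<phi>)
  qed
  \<comment> \<open>Naturality of \<open>ct\<close> creates an instance of \<open>ct_K\<close>, and
    \<open>z2\<close> then cancels the whiskered \<open>c\<close>.\<close>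
  have ct_c: "ct V = c V" if [simp]: "V \<in> Mor1 B" "tgt B V = a" for V
  proof -
    have "?K \<rhd> c V \<cdot> ct V = ?K \<rhd> c V \<cdot> c V"
      using nat(1)[of "c V" "?K \<otimes> V"] by (simp add: ct_K)
    then have "e (?K \<otimes> V) \<cdot> (?K \<rhd> c V \<cdot> ct V) = e (?K \<otimes> V) \<cdot> (?K \<rhd> c V \<cdot> c V)" by simp
    then show ?thesis by (simp add: z2[THEN vcomp_reassoc])
  qed
  \<comment> \<open>\<open>e\<close> is left inverse to \<open>c\<close>, which equals
    \<open>ct\<close>, and \<open>ct\<close> is left inverse to \<open>et\<close>.\<close>
  have "et W = e W \<cdot> (ct W \<cdot> et W)"
    using W by (simp add: ct_c z3[THEN vcomp_reassoc])
  then have ete: "et W = e W" using W by (simp add: z1)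
  show "evth ?J W \<cdot> \<l>\<^sup>- (?K \<otimes> W) = evh ?J W \<cdot> ?K \<rhd> \<l>\<^sup>- W"
    using ete by (simp add: et_def e_def)
  \<comment> \<open>The witness \<open>c W\<close> is a section of the trivialisation; its purpose
    is to cancel the trivialisation later.\<close>
  show "\<exists>k. k \<in> hom2 B W (?K \<otimes> W) \<and> evh ?J W \<cdot> ?K \<rhd> \<l>\<^sup>- W \<cdot> k = \<one> W"
    using z3[of W] W by (intro exI[of _ "c W"]) (simp add: e_def hom2_iff)
qed

end

lemma (in bicategory) cp_push:
  "\<lbrakk>frob_obj p; g \<in> Mor2 B; dom2 B g = W; tgt B W = fst p\<rbrakk>
    \<Longrightarrow> alg p \<rhd> alg p \<rhd> g \<cdot> copairing p W = copairing p (cod2 B g) \<cdot> g"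
  using cp_natural[of p g "cod2 B g"] by simp

lemma (in bicategory) pr_push:
  "\<lbrakk>frob_obj p; g \<in> Mor2 B; dom2 B g = W; tgt B W = fst p\<rbrakk>
    \<Longrightarrow> g \<cdot> pairing p W = pairing p (cod2 B g) \<cdot> alg p \<rhd> alg p \<rhd> g"
  using pr_natural[of p g "cod2 B g"] by simp

section \<open>The two self-dualities of a Frobenius algebra\<close>

context pivotal_bicategory
begin

text \<open>\<open>sg\<close> and \<open>sg'\<close> are the two identifications \<open>A \<rightarrow> A\<^sup>\<dagger>\<close> given by the pairing \<open>\<epsilon>\<mu>\<close>; their inverses
  are \<open>ta'\<close> and \<open>ta\<close>. The Nakayama automorphism is \<open>ta' \<cdot> sg'\<close>, its inverse is \<open>ta \<cdot> sg\<close>.\<close>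

definition sg :: "'o \<times> ('m, 'c) frob \<Rightarrow> 'm \<Rightarrow> 'c" where
  "sg p W = pairing p ((alg p)\<^sup>\<dagger> \<otimes> W) \<cdot> alg p \<rhd> coevh (alg p) W"

definition sg' :: "'o \<times> ('m, 'c) frob \<Rightarrow> 'm \<Rightarrow> 'c" where
  "sg' p W = (alg p)\<^sup>\<dagger> \<rhd> pairing p W \<cdot> coevth (alg p) (alg p \<otimes> W)"

definition ta :: "'o \<times> ('m, 'c) frob \<Rightarrow> 'm \<Rightarrow> 'c" where
  "ta p W = alg p \<rhd> evth (alg p) W \<cdot> copairing p ((alg p)\<^sup>\<dagger> \<otimes> W)"

definition ta' :: "'o \<times> ('m, 'c) frob \<Rightarrow> 'm \<Rightarrow> 'c" where
  "ta' p W = evh (alg p) (alg p \<otimes> W) \<cdot> (alg p)\<^sup>\<dagger> \<rhd> copairing p W"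

lemma sg_ta_cell [simp]:
  assumes "frob_obj p" "W \<in> Mor1 B" "tgt B W = fst p"
  shows "sg p W \<in> Mor2 B" "dom2 B (sg p W) = alg p \<otimes> W" "cod2 B (sg p W) = (alg p)\<^sup>\<dagger> \<otimes> W"
    "sg' p W \<in> Mor2 B" "dom2 B (sg' p W) = alg p \<otimes> W" "cod2 B (sg' p W) = (alg p)\<^sup>\<dagger> \<otimes> W"
    "ta p W \<in> Mor2 B" "dom2 B (ta p W) = (alg p)\<^sup>\<dagger> \<otimes> W" "cod2 B (ta p W) = alg p \<otimes> W"
    "ta' p W \<in> Mor2 B" "dom2 B (ta' p W) = (alg p)\<^sup>\<dagger> \<otimes> W" "cod2 B (ta' p W) = alg p \<otimes> W"
  using assms by (simp_all add: sg_def sg'_def ta_def ta'_def)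

lemma nakayama_cell [simp]:
  assumes "frob_obj p"
  shows "nakayama B (snd p) \<in> Mor2 B" "dom2 B (nakayama B (snd p)) = alg p"
    "cod2 B (nakayama B (snd p)) = alg p"
    "nakayama_inv B (snd p) \<in> Mor2 B" "dom2 B (nakayama_inv B (snd p)) = alg p"
    "cod2 B (nakayama_inv B (snd p)) = alg p"
  using assms by (simp_all add: nakayama_def nakayama_inv_def Let_def)

lemma nakayama_unfold:
  assumes "frob_obj p" "W \<in> Mor1 B" "tgt B W = fst p"
  shows "nakayama B (snd p) \<lhd> W = ta' p W \<cdot> sg' p W"
    "nakayama_inv B (snd p) \<lhd> W = ta p W \<cdot> sg p W"
  using assms
  by (simp_all add: nakayama_def nakayama_inv_def Let_def unwhisker frob_hat_unfold
      hat20_unfold[of "ev B (alg p)" "(alg p)\<^sup>\<dagger>" "alg p"] hat20_unfold[of "evt B (alg p)" "alg p" "(alg p)\<^sup>\<dagger>"]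
      hat02_unfold[of "coev B (alg p)" "alg p" "(alg p)\<^sup>\<dagger>"] hat02_unfold[of "coevt B (alg p)" "(alg p)\<^sup>\<dagger>" "alg p"]
      sg_def sg'_def ta_def ta'_def copairing_def pairing_def)

text \<open>Each identity pairs a zigzag of the algebra and its dual with a snake of the pairing.
  Evaluation matched with the identification from the same adjunction gives back \<epsilon>\<mu>;
  the mismatched combination is the subject of \<open>evth_sg_eq\<close>.\<close>

lemma sg_ta_laws:
  assumes p: "frob_obj p" and W: "W \<in> Mor1 B" "tgt B W = fst p"
  shows sg'_ta: "sg' p W \<cdot> ta p W = \<one> ((alg p)\<^sup>\<dagger> \<otimes> W)"
    and sg_ta': "sg p W \<cdot> ta' p W = \<one> ((alg p)\<^sup>\<dagger> \<otimes> W)"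
    and evh_sg: "evh (alg p) W \<cdot> sg p (alg p \<otimes> W) = pairing p W"
    and evth_sg': "evth (alg p) W \<cdot> alg p \<rhd> sg' p W = pairing p W"
proof -
  note [simp] = p W
  let ?A = "alg p"
  let ?D = "?A\<^sup>\<dagger>"
  have "sg' p W \<cdot> ta p W = ?D \<rhd> (pairing p W \<cdot> (?A \<rhd> ?A \<rhd> evth ?A W \<cdot> ?A \<rhd> copairing p (?D \<otimes> W))) \<cdot> coevth ?A (?D \<otimes> W)"
    by (simp add: sg'_def ta_def coevth_pull coevth_pull[THEN vcomp_reassoc])
  also have "pairing p W \<cdot> (?A \<rhd> ?A \<rhd> evth ?A W \<cdot> ?A \<rhd> copairing p (?D \<otimes> W)) = evth ?A W"
    by (simp add: pr_natural[THEN vcomp_reassoc] pr_cp)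
  finally show "sg' p W \<cdot> ta p W = \<one> (?D \<otimes> W)"
    by (simp add: duality_zigzag)
  have "sg p W \<cdot> ta' p W = evh ?A (?D \<otimes> W) \<cdot> ?D \<rhd> (?A \<rhd> pairing p (?D \<otimes> W) \<cdot> (?A \<rhd> ?A \<rhd> coevh ?A W \<cdot> copairing p W))"
    by (simp add: sg_def ta'_def evh_push evh_push[THEN vcomp_reassoc])
  also have "?A \<rhd> pairing p (?D \<otimes> W) \<cdot> (?A \<rhd> ?A \<rhd> coevh ?A W \<cdot> copairing p W) = coevh ?A W"
    by (simp add: cp_push pr_cp(2)[THEN vcomp_reassoc])
  finally show "sg p W \<cdot> ta' p W = \<one> (?D \<otimes> W)"
    by (simp add: duality_zigzag)
  have "evh ?A W \<cdot> sg p (?A \<otimes> W) = pairing p W \<cdot> ?A \<rhd> (?A \<rhd> evh ?A W \<cdot> coevh ?A (?A \<otimes> W))"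
    by (simp add: sg_def pr_natural[THEN vcomp_reassoc])
  then show "evh ?A W \<cdot> sg p (?A \<otimes> W) = pairing p W"
    by (simp add: duality_zigzag)
  show "evth ?A W \<cdot> ?A \<rhd> sg' p W = pairing p W"
    by (simp add: sg'_def evth_pull[THEN vcomp_reassoc] duality_zigzag)
qed

text \<open>The pivotal axioms for the pairing \<open>\<epsilon>\<mu> : A \<otimes> A \<rightarrow> I\<close>: its two full
  rotations agree.\<close>

lemma sg_coevh_eq:
  assumes p: "frob_obj p" and W: "W \<in> Mor1 B" "tgt B W = fst p"
  shows "(alg p)\<^sup>\<dagger> \<rhd> sg' p W \<cdot> coevth (alg p) W = sg p ((alg p)\<^sup>\<dagger> \<otimes> W) \<cdot> coevh (alg p) W"
proof -
  note [simp] = p W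
  let ?A = "alg p" and ?J = "I (fst p)"
  let ?D = "?A\<^sup>\<dagger>" and ?K = "?J\<^sup>\<dagger>"
  define \<beta> where "\<beta> = counit (snd p) \<cdot> mult (snd p)"
  have [simp]: "\<beta> \<in> Mor2 B" "dom2 B \<beta> = ?A \<otimes> ?A" "cod2 B \<beta> = ?J"
    by (simp_all add: \<beta>_def)
  have \<beta>: "hat21 ?A ?A \<beta> V = \<l>\<^sup>- V \<cdot> pairing p V" if "V \<in> Mor1 B" "tgt B V = fst p" for V
    using that by (simp add: hat21_def \<beta>_def unwhisker frob_hat_unfold pairing_def)
  define w where "w V = ?D \<rhd> sg' p V \<cdot> coevth ?A V" for V
  define w' where "w' V = sg p (?D \<otimes> V) \<cdot> coevh ?A V" for V
  \<comment> \<open>A 2-cell with codomain \<open>?J\<close> is rotated into a map out of the dual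
    of \<open>?J\<close>. The map \<open>e\<close> trivialises this factor, equally well by either
    adjunction, and its section \<open>k\<close> removes it at the end.\<close>
  define e where "e = evh ?J W \<cdot> ?K \<rhd> \<l>\<^sup>- W"
  have [simp]: "e \<in> Mor2 B" "dom2 B e = ?K \<otimes> W" "cod2 B e = W"
    by (simp_all add: e_def)
  have e: "e = evth ?J W \<cdot> \<l>\<^sup>- (?K \<otimes> W)"
    using evt_unit_eq_ev_unit(1)[of "fst p" W] by (simp add: e_def)
  obtain k where k: "k \<in> Mor2 B" "dom2 B k = W" "cod2 B k = ?K \<otimes> W" "e \<cdot> k = \<one> W"
    using evt_unit_eq_ev_unit(2)[of "fst p" W] by (auto simp: e_def hom2_iff)
  have [simp]: "w V \<in> Mor2 B" "dom2 B (w V) = V" "cod2 B (w V) = ?D \<otimes> (?D \<otimes> V)"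
    "w' V \<in> Mor2 B" "dom2 B (w' V) = V" "cod2 B (w' V) = ?D \<otimes> (?D \<otimes> V)"
    if "V \<in> Mor1 B" "tgt B V = fst p" for V
    using that by (simp_all add: w_def w'_def)
  have "?D \<rhd> ?D \<rhd> (evth ?J W \<cdot> hat21 ?A ?A \<beta> (?K \<otimes> W)) \<cdot> ?D \<rhd> coevth ?A (?A \<otimes> (?K \<otimes> W)) \<cdot> coevth ?A (?K \<otimes> W)
    = ?D \<rhd> ?D \<rhd> e \<cdot> w (?K \<otimes> W)"
    by (simp add: \<beta> e w_def sg'_def)
  also have "\<dots> = ?D \<rhd> (?D \<rhd> (pairing p W \<cdot> ?A \<rhd> ?A \<rhd> e) \<cdot> coevth ?A (?A \<otimes> (?K \<otimes> W))) \<cdot> coevth ?A (?K \<otimes> W)"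
    by (simp add: w_def sg'_def pr_natural)
  also have "\<dots> = w W \<cdot> e"
    using lwhisker_eq[OF coevth_push[of ?A "?A \<rhd> e" "?A \<otimes> (?K \<otimes> W)"], of ?D, THEN vcomp_reassoc]
    by (simp add: w_def sg'_def coevth_push)
  finally have l: "?D \<rhd> ?D \<rhd> (evth ?J W \<cdot> hat21 ?A ?A \<beta> (?K \<otimes> W)) \<cdot> ?D \<rhd> coevth ?A (?A \<otimes> (?K \<otimes> W)) \<cdot> coevth ?A (?K \<otimes> W)
    = w W \<cdot> e" .
  have n: "?K \<rhd> \<l>\<^sup>- (?D \<otimes> (?D \<otimes> W)) \<cdot> ?K \<rhd> w' W = ?K \<rhd> (?J \<rhd> w' W \<cdot> \<l>\<^sup>- W)"
    using lunit_inv_naturality[of "w' W"] by (intro lwhisker_eq) simp_all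
  have "evh ?J (?D \<otimes> (?D \<otimes> W)) \<cdot> ?K \<rhd> hat21 ?A ?A \<beta> (?D \<otimes> (?D \<otimes> W)) \<cdot> ?K \<rhd> ?A \<rhd> coevh ?A (?D \<otimes> W) \<cdot> ?K \<rhd> coevh ?A W
    = evh ?J (?D \<otimes> (?D \<otimes> W)) \<cdot> (?K \<rhd> \<l>\<^sup>- (?D \<otimes> (?D \<otimes> W)) \<cdot> ?K \<rhd> w' W)"
    by (simp add: \<beta> w'_def sg_def)
  also have "\<dots> = w' W \<cdot> e"
    unfolding n by (simp add: e_def evh_pull[THEN vcomp_reassoc])
  finally have "w W \<cdot> e = w' W \<cdot> e"
    using transpose_eq[of ?A ?A \<beta> ?J W] l by (simp add: hat21_cell)
  then have "(w W \<cdot> e) \<cdot> k = (w' W \<cdot> e) \<cdot> k" by simp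
  then have "w W = w' W" using k by simp
  then show ?thesis by (simp add: w_def w'_def)
qed

text \<open>This is \<open>sg_coevh_eq\<close> with both legs bent: one by \<open>evt\<close>, which
  recovers \<open>sg'\<close> from the mismatched pairing \<delta>, the other by
  \<open>ev\<close>.\<close>

lemma evth_sg_eq:
  assumes p: "frob_obj p" and W: "W \<in> Mor1 B" "tgt B W = fst p"
  shows "evth (alg p) W \<cdot> alg p \<rhd> sg p W = evh (alg p) W \<cdot> sg' p (alg p \<otimes> W)"
proof -
  note [simp] = p W
  let ?A = "alg p"
  let ?D = "?A\<^sup>\<dagger>"
  define \<delta> where "\<delta> V = evth ?A V \<cdot> ?A \<rhd> sg p V" for V
  have [simp]: "\<delta> V \<in> Mor2 B" "dom2 B (\<delta> V) = ?A \<otimes> (?A \<otimes> V)" "cod2 B (\<delta> V) = V"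
    if "V \<in> Mor1 B" "tgt B V = fst p" for V
    using that by (simp_all add: \<delta>_def)
  have sg_pull: "?D \<rhd> g \<cdot> sg p (dom2 B g) = sg p V \<cdot> ?A \<rhd> g"
    if g: "g \<in> Mor2 B" "cod2 B g = V" "tgt B (dom2 B g) = fst p" for g V
  proof -
    have V: "V \<in> Mor1 B" "tgt B V = fst p" using g by auto
    note [simp] = g(1,3) V
    have "?D \<rhd> g \<cdot> sg p (dom2 B g) = pairing p (?D \<otimes> V) \<cdot> ?A \<rhd> (?A \<rhd> ?D \<rhd> g \<cdot> coevh ?A (dom2 B g))"
      using g(2) by (simp add: sg_def pr_push[THEN vcomp_reassoc])
    also have "\<dots> = sg p V \<cdot> ?A \<rhd> g"
      using g(2) by (simp add: sg_def coevh_push)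
    finally show ?thesis .
  qed
  have \<delta>_natural: "\<delta> V \<cdot> ?A \<rhd> ?A \<rhd> g = g \<cdot> \<delta> (dom2 B g)"
    if g: "g \<in> Mor2 B" "cod2 B g = V" "tgt B (dom2 B g) = fst p" for g V
  proof -
    have V: "V \<in> Mor1 B" "tgt B V = fst p" using g by auto
    note [simp] = g(1,3) V
    have "\<delta> V \<cdot> ?A \<rhd> ?A \<rhd> g = evth ?A V \<cdot> ?A \<rhd> (?D \<rhd> g \<cdot> sg p (dom2 B g))"
      unfolding sg_pull[OF g] using g(2) by (simp add: \<delta>_def)
    also have "\<dots> = g \<cdot> \<delta> (dom2 B g)"
      using g(2) by (simp add: \<delta>_def evth_pull[THEN vcomp_reassoc])
    finally show ?thesis .
  qed
  have sg': "sg' p V = \<delta> (?D \<otimes> V) \<cdot> ?A \<rhd> coevh ?A V" if [simp]: "V \<in> Mor1 B" "tgt B V = fst p" for V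
  proof -
    have "\<delta> (?D \<otimes> V) \<cdot> ?A \<rhd> coevh ?A V = evth ?A (?D \<otimes> V) \<cdot> ?A \<rhd> (sg p (?D \<otimes> V) \<cdot> coevh ?A V)"
      by (simp add: \<delta>_def)
    also have "\<dots> = evth ?A (?D \<otimes> V) \<cdot> ?A \<rhd> (?D \<rhd> sg' p V \<cdot> coevth ?A V)"
      by (simp add: sg_coevh_eq)
    also have "\<dots> = sg' p V"
      by (simp add: evth_pull[THEN vcomp_reassoc] duality_zigzag)
    finally show ?thesis ..
  qed
  have "evh ?A W \<cdot> sg' p (?A \<otimes> W) = \<delta> W \<cdot> ?A \<rhd> (?A \<rhd> evh ?A W \<cdot> coevh ?A (?A \<otimes> W))"
    by (simp add: sg' \<delta>_natural[symmetric, of "evh ?A W" W, simplified, THEN vcomp_reassoc])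
  also have "\<dots> = \<delta> W" by (simp add: duality_zigzag)
  finally show ?thesis by (simp add: \<delta>_def)
qed

text \<open>The mismatched pairing differs from \<epsilon>\<mu> by the Nakayama automorphism, and
  either its inverse in the first slot or the automorphism itself in the second slot corrects it.
  This dictates the twists in \<open>left_star\<close> and \<open>right_star\<close>.\<close>

lemma nakayama_pairing:
  assumes p: "frob_obj p" and W: "W \<in> Mor1 B" "tgt B W = fst p"
  shows "evth (alg p) W \<cdot> alg p \<rhd> sg p W \<cdot> nakayama_inv B (snd p) \<lhd> (alg p \<otimes> W) = pairing p W"
    "evth (alg p) W \<cdot> alg p \<rhd> sg p W \<cdot> alg p \<rhd> (nakayama B (snd p) \<lhd> W) = pairing p W"
proof -
  note [simp] = p W
  let ?A = "alg p"
  have "(evth ?A W \<cdot> ?A \<rhd> sg p W) \<cdot> nakayama_inv B (snd p) \<lhd> (?A \<otimes> W) = pairing p W"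
    unfolding evth_sg_eq[OF p W]
    by (simp add: nakayama_unfold sg'_ta[THEN vcomp_reassoc] evh_sg)
  then show "evth ?A W \<cdot> ?A \<rhd> sg p W \<cdot> nakayama_inv B (snd p) \<lhd> (?A \<otimes> W) = pairing p W" by simp
  have "?A \<rhd> sg p W \<cdot> ?A \<rhd> (nakayama B (snd p) \<lhd> W) = ?A \<rhd> sg' p W"
    using sg_ta'[of p W, THEN vcomp_reassoc, of "sg' p W"]
    by (intro lwhisker_eq) (simp_all add: nakayama_unfold)
  then show "evth ?A W \<cdot> ?A \<rhd> sg p W \<cdot> ?A \<rhd> (nakayama B (snd p) \<lhd> W) = pairing p W"
    by (simp add: evth_sg')
qed

section \<open>The adjoints of a bimodule\<close>

lemma dual_bimod_sel [simp]:
  "bsrc (dual_bimod B M) = btgt M" "btgt (dual_bimod B M) = bsrc M" "bcarr (dual_bimod B M) = (bcarr M)\<^sup>\<dagger>"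
  by (simp_all add: dual_bimod_def Let_def)

lemma star_sel [simp]:
  "bsrc (left_star B M) = btgt M" "btgt (left_star B M) = bsrc M" "bcarr (left_star B M) = (bcarr M)\<^sup>\<dagger>"
  "ract (left_star B M) = ract (dual_bimod B M)"
  "lact (left_star B M) = lact (dual_bimod B M) \<cdot> (nakayama_inv B (src_alg M) \<star> \<one> ((bcarr M)\<^sup>\<dagger>))"
  "bsrc (right_star B M) = btgt M" "btgt (right_star B M) = bsrc M" "bcarr (right_star B M) = (bcarr M)\<^sup>\<dagger>"
  "lact (right_star B M) = lact (dual_bimod B M)"
  "ract (right_star B M) = ract (dual_bimod B M) \<cdot> (\<one> ((bcarr M)\<^sup>\<dagger>) \<star> nakayama B (tgt_alg M))"
  by (simp_all add: left_star_def right_star_def twist_left_def twist_right_def)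

lemma dual_bimod_act:
  "lact (dual_bimod B M) = \<r> ((bcarr M)\<^sup>\<dagger>) \<cdot> (\<one> ((bcarr M)\<^sup>\<dagger>) \<star> evt B (bcarr M)) \<cdot>
     (\<one> ((bcarr M)\<^sup>\<dagger>) \<star> (ract M \<star> \<one> ((bcarr M)\<^sup>\<dagger>))) \<cdot>
     (\<one> ((bcarr M)\<^sup>\<dagger>) \<star> \<a>\<^sup>- (bcarr M) (alg (bsrc M)) ((bcarr M)\<^sup>\<dagger>)) \<cdot>
     \<a> ((bcarr M)\<^sup>\<dagger>) (bcarr M) (alg (bsrc M) \<otimes> (bcarr M)\<^sup>\<dagger>) \<cdot>
     (coevt B (bcarr M) \<star> \<one> (alg (bsrc M) \<otimes> (bcarr M)\<^sup>\<dagger>)) \<cdot> \<l>\<^sup>- (alg (bsrc M) \<otimes> (bcarr M)\<^sup>\<dagger>)"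
  "ract (dual_bimod B M) = \<l> ((bcarr M)\<^sup>\<dagger>) \<cdot> (ev B (bcarr M) \<star> \<one> ((bcarr M)\<^sup>\<dagger>)) \<cdot>
     \<a>\<^sup>- ((bcarr M)\<^sup>\<dagger>) (bcarr M) ((bcarr M)\<^sup>\<dagger>) \<cdot>
     (\<one> ((bcarr M)\<^sup>\<dagger>) \<star> (lact M \<star> \<one> ((bcarr M)\<^sup>\<dagger>))) \<cdot>
     (\<one> ((bcarr M)\<^sup>\<dagger>) \<star> \<a>\<^sup>- (alg (btgt M)) (bcarr M) ((bcarr M)\<^sup>\<dagger>)) \<cdot>
     \<a> ((bcarr M)\<^sup>\<dagger>) (alg (btgt M)) (bcarr M \<otimes> (bcarr M)\<^sup>\<dagger>) \<cdot>
     (\<one> ((bcarr M)\<^sup>\<dagger> \<otimes> alg (btgt M)) \<star> coev B (bcarr M)) \<cdot> \<r>\<^sup>- ((bcarr M)\<^sup>\<dagger> \<otimes> alg (btgt M))"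
  by (simp_all only: dual_bimod_def Let_def bimod.simps)

lemma dual_prebim [simp]:
  assumes [simp]: "prebim M"
  shows "prebim (dual_bimod B M)"
proof -
  have "lact (dual_bimod B M) \<in> hom2 B (alg (bsrc M) \<otimes> (bcarr M)\<^sup>\<dagger>) ((bcarr M)\<^sup>\<dagger>)"
    "ract (dual_bimod B M) \<in> hom2 B ((bcarr M)\<^sup>\<dagger> \<otimes> alg (btgt M)) ((bcarr M)\<^sup>\<dagger>)"
    unfolding dual_bimod_act by (simp_all add: hom2_iff)
  then show ?thesis unfolding prebim_def[of "dual_bimod B M"] by (simp add: hom1_iff)
qed

lemma dual_act:
  assumes [simp]: "prebim M" "W \<in> Mor1 B" "tgt B W = fst (btgt M)"
  shows "la (dual_bimod B M) W
      = (bcarr M)\<^sup>\<dagger> \<rhd> evth (bcarr M) W \<cdot> (bcarr M)\<^sup>\<dagger> \<rhd> ra M ((bcarr M)\<^sup>\<dagger> \<otimes> W)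
        \<cdot> coevth (bcarr M) (alg (bsrc M) \<otimes> ((bcarr M)\<^sup>\<dagger> \<otimes> W))"
    and "ra (dual_bimod B M) W
      = evh (bcarr M) ((bcarr M)\<^sup>\<dagger> \<otimes> W) \<cdot> (bcarr M)\<^sup>\<dagger> \<rhd> la M ((bcarr M)\<^sup>\<dagger> \<otimes> W)
        \<cdot> (bcarr M)\<^sup>\<dagger> \<rhd> alg (btgt M) \<rhd> coevh (bcarr M) W"
proof -
  let ?X = "bcarr M" and ?D = "(bcarr M)\<^sup>\<dagger>" and ?S = "alg (bsrc M)" and ?T = "alg (btgt M)"
  note s = unwhisker assoc_natural_right act_unfold
    hat20_unfold[of "ev B ?X" ?D ?X] hat20_unfold[of "evt B ?X" ?X ?D]
    hat02_unfold[of "coev B ?X" ?X ?D] hat02_unfold[of "coevt B ?X" ?D ?X]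
  have "lact (dual_bimod B M) \<lhd> W \<cdot> \<a>\<^sup>- ?S ?D W
    = ?D \<rhd> evth ?X W \<cdot> ?D \<rhd> ra M (?D \<otimes> W) \<cdot> coevth ?X (?S \<otimes> (?D \<otimes> W))"
    by (simp add: dual_bimod_act s) (simp add: coevth_push[THEN vcomp_reassoc])
  then show "la (dual_bimod B M) W
      = ?D \<rhd> evth ?X W \<cdot> ?D \<rhd> ra M (?D \<otimes> W) \<cdot> coevth ?X (?S \<otimes> (?D \<otimes> W))"
    by (simp add: la_def[of "dual_bimod B M"] hat21_def[of ?S])
  have "ract (dual_bimod B M) \<lhd> W \<cdot> \<a>\<^sup>- ?D ?T W
    = evh ?X (?D \<otimes> W) \<cdot> ?D \<rhd> la M (?D \<otimes> W) \<cdot> ?D \<rhd> ?T \<rhd> coevh ?X W"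
    by (simp add: dual_bimod_act s)
  then show "ra (dual_bimod B M) W
      = evh ?X (?D \<otimes> W) \<cdot> ?D \<rhd> la M (?D \<otimes> W) \<cdot> ?D \<rhd> ?T \<rhd> coevh ?X W"
    by (simp add: ra_def[of "dual_bimod B M"] hat21_def[of ?D])
qed

lemma star_prebim [simp]:
  assumes [simp]: "prebim M"
  shows "prebim (left_star B M)" "prebim (right_star B M)"
  unfolding prebim_def[of "left_star B M"] prebim_def[of "right_star B M"]
  using prebim_cell[of "dual_bimod B M"] nakayama_cell[of "bsrc M"] nakayama_cell[of "btgt M"]
  by (simp_all add: hom1_iff hom2_iff)

lemma star_act:
  assumes [simp]: "prebim M" "W \<in> Mor1 B" "tgt B W = fst (btgt M)"
  shows "la (left_star B M) W
      = la (dual_bimod B M) W \<cdot> nakayama_inv B (src_alg M) \<lhd> ((bcarr M)\<^sup>\<dagger> \<otimes> W)"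
    "ra (left_star B M) W = ra (dual_bimod B M) W"
    "la (right_star B M) W = la (dual_bimod B M) W"
    "ra (right_star B M) W
      = ra (dual_bimod B M) W \<cdot> (bcarr M)\<^sup>\<dagger> \<rhd> (nakayama B (tgt_alg M) \<lhd> W)"
proof -
  note [simp] = prebim_cell[of "dual_bimod B M", simplified]
  show "ra (left_star B M) W = ra (dual_bimod B M) W" "la (right_star B M) W = la (dual_bimod B M) W"
    by (simp_all add: la_def ra_def)
  have "lact (left_star B M) \<lhd> W \<cdot> \<a>\<^sup>- (alg (bsrc M)) ((bcarr M)\<^sup>\<dagger>) W
    = la (dual_bimod B M) W \<cdot> nakayama_inv B (src_alg M) \<lhd> ((bcarr M)\<^sup>\<dagger> \<otimes> W)"
    using act_unfold(1)[of "dual_bimod B M" W] act_cell[of "dual_bimod B M" W]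
    by (simp add: unwhisker)
  then show "la (left_star B M) W
      = la (dual_bimod B M) W \<cdot> nakayama_inv B (src_alg M) \<lhd> ((bcarr M)\<^sup>\<dagger> \<otimes> W)"
    by (simp add: la_def[of "left_star B M"] hat21_def[of _ "(bcarr M)\<^sup>\<dagger>"] del: star_sel(5))
  have "ract (right_star B M) \<lhd> W \<cdot> \<a>\<^sup>- ((bcarr M)\<^sup>\<dagger>) (alg (btgt M)) W
    = ra (dual_bimod B M) W \<cdot> (bcarr M)\<^sup>\<dagger> \<rhd> (nakayama B (tgt_alg M) \<lhd> W)"
    using act_unfold(2)[of "dual_bimod B M" W] act_cell[of "dual_bimod B M" W]
    by (simp add: unwhisker)
  then show "ra (right_star B M) W
      = ra (dual_bimod B M) W \<cdot> (bcarr M)\<^sup>\<dagger> \<rhd> (nakayama B (tgt_alg M) \<lhd> W)"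
    by (simp add: ra_def[of "right_star B M"] hat21_def[of "(bcarr M)\<^sup>\<dagger>"] del: star_sel(10))
qed

text \<open>The right action on the dual is built from \<open>ev\<close> and \<open>coev\<close>, so
  against \<open>ev\<close> it is a mate by a zigzag and naturality. The analogous case for
  \<open>evt\<close> is \<open>evth_la_dual\<close>.\<close>

lemma evh_ra_dual:
  assumes M [simp]: "prebim M" "W \<in> Mor1 B" "tgt B W = fst (bsrc M)"
  shows "evh (bcarr M) W \<cdot> (bcarr M)\<^sup>\<dagger> \<rhd> la M W = evh (bcarr M) W \<cdot> ra (dual_bimod B M) (bcarr M \<otimes> W)"
proof -
  let ?X = "bcarr M" and ?T = "alg (btgt M)"
  let ?D = "?X\<^sup>\<dagger>"
  have l: "?D \<rhd> la M W \<cdot> ?D \<rhd> ?T \<rhd> ?X \<rhd> evh ?X W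
    = ?D \<rhd> ?X \<rhd> evh ?X W \<cdot> ?D \<rhd> la M (?D \<otimes> (?X \<otimes> W))"
    by (rule lwhisker_eq[OF la_natural, of _ _ W, THEN trans]) simp_all
  have z: "?D \<rhd> ?T \<rhd> ?X \<rhd> evh ?X W \<cdot> ?D \<rhd> ?T \<rhd> coevh ?X (?X \<otimes> W) = \<one> (?D \<otimes> (?T \<otimes> (?X \<otimes> W)))"
    by (subst lwhisker_eq[OF lwhisker_eq[OF duality_zigzag(1)]]) simp_all
  have "evh ?X W \<cdot> ?D \<rhd> la M W
    = evh ?X W \<cdot> ((?D \<rhd> la M W \<cdot> ?D \<rhd> ?T \<rhd> ?X \<rhd> evh ?X W) \<cdot> ?D \<rhd> ?T \<rhd> coevh ?X (?X \<otimes> W))"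
    using z by simp
  also have "\<dots> = (evh ?X W \<cdot> ?D \<rhd> ?X \<rhd> evh ?X W) \<cdot> ?D \<rhd> la M (?D \<otimes> (?X \<otimes> W)) \<cdot> ?D \<rhd> ?T \<rhd> coevh ?X (?X \<otimes> W)"
    unfolding l by simp
  also have "\<dots> = evh ?X W \<cdot> ra (dual_bimod B M) (?X \<otimes> W)"
    using evh_pull[of ?X "evh ?X W" W] by (simp add: dual_act(2))
  finally show ?thesis .
qed

lemma evth_la_dual:
  assumes M [simp]: "prebim M" "W \<in> Mor1 B" "tgt B W = fst (btgt M)"
  shows "evth (bcarr M) W \<cdot> bcarr M \<rhd> la (dual_bimod B M) W = evth (bcarr M) W \<cdot> ra M ((bcarr M)\<^sup>\<dagger> \<otimes> W)"
proof -
  let ?X = "bcarr M" and ?S = "alg (bsrc M)"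
  let ?D = "?X\<^sup>\<dagger>"
  let ?f = "evth ?X W \<cdot> ra M (?D \<otimes> W)"
  have "evth ?X W \<cdot> ?X \<rhd> la (dual_bimod B M) W
    = (evth ?X W \<cdot> ?X \<rhd> ?D \<rhd> ?f) \<cdot> ?X \<rhd> coevth ?X (?S \<otimes> (?D \<otimes> W))"
    by (simp add: dual_act(1))
  also have "evth ?X W \<cdot> ?X \<rhd> ?D \<rhd> ?f = ?f \<cdot> evth ?X (?X \<otimes> (?S \<otimes> (?D \<otimes> W)))"
    by (subst evth_pull) simp_all
  also have "\<dots> \<cdot> ?X \<rhd> coevth ?X (?S \<otimes> (?D \<otimes> W)) = ?f"
    by (simp add: duality_zigzag)
  finally show ?thesis .
qed

text \<open>The pairing contracts with the copairing inside the coaction and leaves the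
  action.\<close>

lemma pr_cr:
  assumes M [simp]: "bim M" "V \<in> Mor1 B" "tgt B V = fst (bsrc M)"
  shows "bcarr M \<rhd> pairing (bsrc M) V \<cdot> cr M (alg (bsrc M) \<otimes> V) = ra M V"
proof -
  have "bcarr M \<rhd> alg (bsrc M) \<rhd> pairing (bsrc M) V \<cdot> bcarr M \<rhd> copairing (bsrc M) (alg (bsrc M) \<otimes> V)
    = \<one> (bcarr M \<otimes> (alg (bsrc M) \<otimes> V))"
    using lwhisker_eq[OF pr_cp(2)[of "bsrc M" V], of "bcarr M"] by simp
  then show ?thesis by (simp add: cr_def act_push')
qed

lemma pr_cl:
  assumes M [simp]: "bim M" "V \<in> Mor1 B" "tgt B V = fst (bsrc M)"
  shows "pairing (btgt M) (bcarr M \<otimes> V) \<cdot> alg (btgt M) \<rhd> cl M V = la M V"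
  by (simp add: cl_def pr_natural[THEN vcomp_reassoc] pr_cp)

text \<open>The mixed case: the left action on the dual is built from \<open>evt\<close> and
  \<open>coevt\<close> but evaluated by \<open>ev\<close>. Rotating the right action of
  \<open>M\<close> moves the mismatch from \<open>X\<close> to the algebra, where it becomes the
  mismatched pairing of \<open>evth_sg_eq\<close>.\<close>

lemma evh_la_dual:
  assumes M [simp]: "bim M" and W [simp]: "W \<in> Mor1 B" "tgt B W = fst (bsrc M)"
  defines "p \<equiv> bsrc M"
  shows "evh (bcarr M) W \<cdot> la (dual_bimod B M) (bcarr M \<otimes> W)
    = evth (alg p) W \<cdot> alg p \<rhd> sg p W \<cdot> alg p \<rhd> evh (bcarr M) (alg p \<otimes> W)
      \<cdot> alg p \<rhd> (bcarr M)\<^sup>\<dagger> \<rhd> cr M W"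
proof -
  let ?X = "bcarr M" and ?A = "alg (bsrc M)"
  let ?D = "?X\<^sup>\<dagger>" and ?E = "?A\<^sup>\<dagger>"
  let ?V = "?X \<otimes> W"
  \<comment> \<open>\<open>u\<close> is the rotated right action as on the right side of
    \<open>transpose_eq\<close>; the left side is the bent left action of the dual, which is
    \<open>u_eq\<close>.\<close>
  define u where "u = evh ?X (?E \<otimes> (?D \<otimes> ?V)) \<cdot> ?D \<rhd> ra M (?E \<otimes> (?D \<otimes> ?V)) \<cdot>
      ?D \<rhd> ?X \<rhd> coevh ?A (?D \<otimes> ?V) \<cdot> ?D \<rhd> coevh ?X ?V"
  have u [simp]: "u \<in> Mor2 B" "dom2 B u = ?D \<otimes> ?V" "cod2 B u = ?E \<otimes> (?D \<otimes> ?V)"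
    by (simp_all add: u_def)
  have D [simp]: "la (dual_bimod B M) ?V \<in> Mor2 B" "dom2 B (la (dual_bimod B M) ?V) = ?A \<otimes> (?D \<otimes> ?V)"
    "cod2 B (la (dual_bimod B M) ?V) = ?D \<otimes> ?V"
    using act_cell[of "dual_bimod B M" ?V] by simp_all
  have u_eq: "u = ?E \<rhd> la (dual_bimod B M) ?V \<cdot> coevth ?A (?D \<otimes> ?V)"
    unfolding dual_act(1)[of M ?V, simplified]
    using transpose_eq[of ?X ?A "ract M" ?X ?V] by (simp add: u_def ra_def[symmetric])
  have la: "la (dual_bimod B M) ?V = evth ?A (?D \<otimes> ?V) \<cdot> ?A \<rhd> u"
    unfolding u_eq by (simp add: evth_pull[THEN vcomp_reassoc] duality_zigzag)
  have z: "?D \<rhd> ?X \<rhd> evh ?X W \<cdot> ?D \<rhd> coevh ?X ?V = \<one> (?D \<otimes> ?V)"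
    by (subst lwhisker_eq[OF duality_zigzag(1)]) simp_all
  have n1: "?X \<rhd> ?E \<rhd> evh ?X W \<cdot> ra M (?E \<otimes> (?D \<otimes> ?V)) = ra M (?E \<otimes> W) \<cdot> ?X \<rhd> ?A \<rhd> ?E \<rhd> evh ?X W"
    by (subst ra_push) simp_all
  have n2: "?A \<rhd> ?E \<rhd> evh ?X W \<cdot> coevh ?A (?D \<otimes> ?V) = coevh ?A W \<cdot> evh ?X W"
    by (subst coevh_push) simp_all
  \<comment> \<open>Evaluating the dual of \<open>X\<close> against \<open>X\<close> contracts the
    loop created by the coevaluation of \<open>X\<close>; only the duality of the algebra
    survives.\<close>
  have "?E \<rhd> evh ?X W \<cdot> u = evh ?X (?E \<otimes> W) \<cdot> ?D \<rhd> (?X \<rhd> ?E \<rhd> evh ?X W \<cdot> ra M (?E \<otimes> (?D \<otimes> ?V))) \<cdot>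
      ?D \<rhd> ?X \<rhd> coevh ?A (?D \<otimes> ?V) \<cdot> ?D \<rhd> coevh ?X ?V"
    by (simp add: u_def evh_push[THEN vcomp_reassoc])
  also have "\<dots> = evh ?X (?E \<otimes> W) \<cdot> ?D \<rhd> ra M (?E \<otimes> W) \<cdot>
      ?D \<rhd> ?X \<rhd> (?A \<rhd> ?E \<rhd> evh ?X W \<cdot> coevh ?A (?D \<otimes> ?V)) \<cdot> ?D \<rhd> coevh ?X ?V"
    unfolding n1 by simp
  also have "\<dots> = evh ?X (?E \<otimes> W) \<cdot> ?D \<rhd> ra M (?E \<otimes> W) \<cdot> ?D \<rhd> ?X \<rhd> coevh ?A W"
    unfolding n2 using z by simp
  finally have Eu: "?E \<rhd> evh ?X W \<cdot> u = evh ?X (?E \<otimes> W) \<cdot> ?D \<rhd> (ra M (?E \<otimes> W) \<cdot> ?X \<rhd> coevh ?A W)"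
    by simp
  \<comment> \<open>Under \<open>sg\<close> the coaction becomes the transposed action, because the
    pairing in \<open>sg\<close> undoes the copairing in \<open>cr\<close>.\<close>
  have "?X \<rhd> sg p W \<cdot> cr M W = ?X \<rhd> pairing p (?E \<otimes> W) \<cdot> (?X \<rhd> ?A \<rhd> coevh ?A W \<cdot> cr M W)"
    by (simp add: sg_def p_def)
  also have "\<dots> = (?X \<rhd> pairing p (?E \<otimes> W) \<cdot> cr M (?A \<otimes> (?E \<otimes> W))) \<cdot> ?X \<rhd> coevh ?A W"
    by (subst cr_push) (simp_all add: p_def)
  also have "\<dots> = ra M (?E \<otimes> W) \<cdot> ?X \<rhd> coevh ?A W"
    unfolding p_def by (subst pr_cr) simp_all
  finally have sgcr: "?X \<rhd> sg p W \<cdot> cr M W = ra M (?E \<otimes> W) \<cdot> ?X \<rhd> coevh ?A W" .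
  have "sg p W \<cdot> evh ?X (?A \<otimes> W) \<cdot> ?D \<rhd> cr M W = evh ?X (?E \<otimes> W) \<cdot> ?D \<rhd> (?X \<rhd> sg p W \<cdot> cr M W)"
    by (simp add: p_def evh_push[THEN vcomp_reassoc])
  then have Eu': "?E \<rhd> evh ?X W \<cdot> u = sg p W \<cdot> evh ?X (?A \<otimes> W) \<cdot> ?D \<rhd> cr M W"
    unfolding sgcr Eu ..
  have "evh ?X W \<cdot> la (dual_bimod B M) ?V = evth ?A W \<cdot> ?A \<rhd> (?E \<rhd> evh ?X W \<cdot> u)"
    unfolding la by (simp add: evth_push[THEN vcomp_reassoc])
  also have "\<dots> = evth ?A W \<cdot> ?A \<rhd> sg p W \<cdot> ?A \<rhd> evh ?X (?A \<otimes> W) \<cdot> ?A \<rhd> ?D \<rhd> cr M W"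
    unfolding Eu' by (simp add: p_def)
  finally show ?thesis by (simp only: p_def)
qed

text \<open>The other mixed case: the right action on the dual, built from \<open>ev\<close>, is
  evaluated by \<open>evt\<close>. Rotating the left action of \<open>M\<close> first produces
  \<open>sg'\<close> followed by \<open>ev\<close>, which \<open>evth_sg_eq\<close> turns into the
  form that \<open>nakayama_pairing\<close> can cancel.\<close>

lemma evth_ra_dual:
  assumes M [simp]: "bim M" and W [simp]: "W \<in> Mor1 B" "tgt B W = fst (btgt M)"
  defines "p \<equiv> btgt M"
  shows "evth (bcarr M) W \<cdot> bcarr M \<rhd> ra (dual_bimod B M) W
    = evth (alg p) W \<cdot> alg p \<rhd> sg p W \<cdot> alg p \<rhd> evth (bcarr M) (alg p \<otimes> W)
      \<cdot> cl M ((bcarr M)\<^sup>\<dagger> \<otimes> (alg p \<otimes> W))"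
proof -
  let ?X = "bcarr M" and ?T = "alg (btgt M)"
  let ?D = "?X\<^sup>\<dagger>" and ?E = "?T\<^sup>\<dagger>"
  let ?V = "?T \<otimes> W"
  have D [simp]: "ra (dual_bimod B M) U \<in> Mor2 B" "dom2 B (ra (dual_bimod B M) U) = ?D \<otimes> (?T \<otimes> U)"
    "cod2 B (ra (dual_bimod B M) U) = ?D \<otimes> U" if "U \<in> Mor1 B" "tgt B U = fst (btgt M)" for U
    using act_cell[of "dual_bimod B M" U] that by simp_all
  define v where "v = ra (dual_bimod B M) (?E \<otimes> ?V) \<cdot> ?D \<rhd> coevh ?T ?V"
  have v [simp]: "v \<in> Mor2 B" "dom2 B v = ?D \<otimes> ?V" "cod2 B v = ?D \<otimes> (?E \<otimes> ?V)"
    by (simp_all add: v_def)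
  define f where "f = ?E \<rhd> (evth ?X ?V \<cdot> la M (?D \<otimes> ?V)) \<cdot> coevth ?T (?X \<otimes> (?D \<otimes> ?V))"
  have f [simp]: "f \<in> Mor2 B" "dom2 B f = ?X \<otimes> (?D \<otimes> ?V)" "cod2 B f = ?E \<otimes> ?V"
    by (simp_all add: f_def)
  \<comment> \<open>Pivotality for the left action, with the algebra and \<open>X\<close> exchanging
    their roles in \<open>transpose_eq\<close>.\<close>
  have v_eq: "v = ?D \<rhd> f \<cdot> coevth ?X (?D \<otimes> ?V)"
    unfolding v_def dual_act(2)[of M "?E \<otimes> ?V", simplified]
    using transpose_eq[of ?T ?X "lact M" ?X ?V] by (simp add: f_def la_def[symmetric])
  have "evth ?X (?E \<otimes> ?V) \<cdot> ?X \<rhd> v = f"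
    unfolding v_eq by (simp add: evth_pull[THEN vcomp_reassoc] duality_zigzag)
  moreover have "f = sg' p ?V \<cdot> ?T \<rhd> evth ?X ?V \<cdot> cl M (?D \<otimes> ?V)"
  proof -
    have "evth ?X ?V \<cdot> la M (?D \<otimes> ?V) = evth ?X ?V \<cdot> pairing p (?X \<otimes> (?D \<otimes> ?V)) \<cdot> ?T \<rhd> cl M (?D \<otimes> ?V)"
      unfolding p_def by (subst pr_cl) simp_all
    also have "\<dots> = pairing p ?V \<cdot> ?T \<rhd> (?T \<rhd> evth ?X ?V \<cdot> cl M (?D \<otimes> ?V))"
      by (simp add: p_def pr_natural[THEN vcomp_reassoc])
    finally have "f = ?E \<rhd> pairing p ?V \<cdot> (?E \<rhd> ?T \<rhd> (?T \<rhd> evth ?X ?V \<cdot> cl M (?D \<otimes> ?V))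
        \<cdot> coevth ?T (?X \<otimes> (?D \<otimes> ?V)))"
      by (simp add: f_def p_def)
    also have "\<dots> = sg' p ?V \<cdot> ?T \<rhd> evth ?X ?V \<cdot> cl M (?D \<otimes> ?V)"
      by (subst coevth_push) (simp_all add: sg'_def p_def)
    finally show ?thesis .
  qed
  ultimately have Xv: "evth ?X (?E \<otimes> ?V) \<cdot> ?X \<rhd> v = sg' p ?V \<cdot> ?T \<rhd> evth ?X ?V \<cdot> cl M (?D \<otimes> ?V)" by simp
  have z: "?D \<rhd> ?T \<rhd> evh ?T W \<cdot> ?D \<rhd> coevh ?T ?V = \<one> (?D \<otimes> ?V)"
    by (subst lwhisker_eq[OF duality_zigzag(1)]) simp_all
  have n: "?D \<rhd> evh ?T W \<cdot> ra (dual_bimod B M) (?E \<otimes> ?V) = ra (dual_bimod B M) W \<cdot> ?D \<rhd> ?T \<rhd> evh ?T W"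
    using ra_push[of "dual_bimod B M" "evh ?T W"] by simp
  have "?D \<rhd> evh ?T W \<cdot> v = (?D \<rhd> evh ?T W \<cdot> ra (dual_bimod B M) (?E \<otimes> ?V)) \<cdot> ?D \<rhd> coevh ?T ?V"
    by (simp add: v_def)
  also have "\<dots> = ra (dual_bimod B M) W"
    unfolding n using z by simp
  finally have ra: "ra (dual_bimod B M) W = ?D \<rhd> evh ?T W \<cdot> v" ..
  have "evth ?X W \<cdot> ?X \<rhd> ra (dual_bimod B M) W = evh ?T W \<cdot> (evth ?X (?E \<otimes> ?V) \<cdot> ?X \<rhd> v)"
    unfolding ra by (simp add: evth_pull[THEN vcomp_reassoc])
  also have "\<dots> = (evh ?T W \<cdot> sg' p ?V) \<cdot> ?T \<rhd> evth ?X ?V \<cdot> cl M (?D \<otimes> ?V)"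
    unfolding Xv by (simp add: p_def)
  also have "evh ?T W \<cdot> sg' p ?V = evth ?T W \<cdot> ?T \<rhd> sg p W"
    unfolding p_def by (rule evth_sg_eq[symmetric]) simp_all
  finally show ?thesis by (simp add: p_def)
qed

end

section \<open>Adjointness of the twisted duals\<close>

locale idempotent_complete_pivotal_bicategory =
  pivotal_bicategory B + idempotent_complete_bicategory B
  for B :: "('o, 'm, 'c, 'z) pivotal_bicat_scheme" (structure)
begin

text \<open>With \<open>ev\<close> and \<open>coev\<close> the right action of the dual is already
  the mate. The left action produces the mismatched pairing, which the twist by the inverse Nakayama
  automorphism in its first slot turns into \<epsilon>\<mu>.\<close>

lemma left_star_adjoint:
  assumes M [simp]: "bim M"
  shows "is_left_adjoint_of Beq (left_star B M) M"
proof -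
  let ?L = "left_star B M" and ?A = "alg (bsrc M)"
  interpret prebimodule_adjunction B ?L M "ev B (bcarr M)" "coev B (bcarr M)"
    by unfold_locales (simp_all add: dagger_left_adjoint)
  have bal: "evh (bcarr M) W \<cdot> (bcarr M)\<^sup>\<dagger> \<rhd> la M W = evh (bcarr M) W \<cdot> ra ?L (bcarr M \<otimes> W)"
    if "W \<in> Mor1 B" "tgt B W = fst (bsrc M)" for W
    using that evh_ra_dual[of M W] by (simp add: star_act)
  have mate: "evh (bcarr M) W \<cdot> la ?L (bcarr M \<otimes> W) = pairing (bsrc M) W \<cdot>
      ?A \<rhd> evh (bcarr M) (?A \<otimes> W) \<cdot> ?A \<rhd> (bcarr M)\<^sup>\<dagger> \<rhd> cr M W"
    if W [simp]: "W \<in> Mor1 B" "tgt B W = fst (bsrc M)" for W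
  proof -
    let ?\<gamma> = "nakayama_inv B (src_alg M)"
      and ?e = "evh (bcarr M) (?A \<otimes> W) \<cdot> (bcarr M)\<^sup>\<dagger> \<rhd> cr M W"
    have "evh (bcarr M) W \<cdot> la ?L (bcarr M \<otimes> W)
      = (evh (bcarr M) W \<cdot> la (dual_bimod B M) (bcarr M \<otimes> W)) \<cdot> ?\<gamma> \<lhd> ((bcarr M)\<^sup>\<dagger> \<otimes> (bcarr M \<otimes> W))"
      using act_cell[of "dual_bimod B M" "bcarr M \<otimes> W"] by (simp add: star_act(1))
    also have "\<dots> = evth ?A W \<cdot> ?A \<rhd> sg (bsrc M) W \<cdot>
        (?A \<rhd> ?e \<cdot> ?\<gamma> \<lhd> ((bcarr M)\<^sup>\<dagger> \<otimes> (bcarr M \<otimes> W)))"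
      unfolding evh_la_dual[OF M W] by simp
    \<comment> \<open>The twist acts on the algebra factor and \<open>?e\<close> on the remaining
      ones, so they exchange and the twist reaches the pairing.\<close>
    also have "?A \<rhd> ?e \<cdot> ?\<gamma> \<lhd> ((bcarr M)\<^sup>\<dagger> \<otimes> (bcarr M \<otimes> W)) = ?\<gamma> \<lhd> (?A \<otimes> W) \<cdot> ?A \<rhd> ?e"
      using rwhisker_push[of ?\<gamma> ?e "(bcarr M)\<^sup>\<dagger> \<otimes> (bcarr M \<otimes> W)"] by simp
    also have "evth ?A W \<cdot> ?A \<rhd> sg (bsrc M) W \<cdot> (?\<gamma> \<lhd> (?A \<otimes> W) \<cdot> ?A \<rhd> ?e)
      = (evth ?A W \<cdot> ?A \<rhd> sg (bsrc M) W \<cdot> ?\<gamma> \<lhd> (?A \<otimes> W)) \<cdot> ?A \<rhd> ?e"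
      by simp
    also have "\<dots> = pairing (bsrc M) W \<cdot> ?A \<rhd> ?e"
      by (subst nakayama_pairing(1)) simp_all
    finally show ?thesis by simp
  qed
  interpret bimodule_adjunction B ?L M "ev B (bcarr M)" "coev B (bcarr M)"
    by unfold_locales (use mate_bimodule_L[OF M] bal mate in simp_all)
  show ?thesis
    unfolding is_left_adjoint_of_def using Beq_adjunction by blast
qed

text \<open>Now \<open>M\<close> is the left adjoint and the adjunction is that of
  \<open>evt\<close> and \<open>coevt\<close>. The algebra identified with its dual is the target
  algebra of \<open>M\<close>, and the twist enters the second slot of the pairing.\<close>

lemma right_star_adjoint:
  assumes M [simp]: "bim M"
  shows "is_right_adjoint_of Beq (right_star B M) M"
proof -
  let ?R = "right_star B M" and ?T = "alg (btgt M)"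
  have bal: "evth (bcarr M) W \<cdot> bcarr M \<rhd> la ?R W = evth (bcarr M) W \<cdot> ra M ((bcarr M)\<^sup>\<dagger> \<otimes> W)"
    if "W \<in> Mor1 B" "tgt B W = fst (btgt M)" for W
    using that evth_la_dual[of M W] by (simp add: star_act)
  have mate: "evth (bcarr M) W \<cdot> bcarr M \<rhd> ra ?R W = pairing (btgt M) W \<cdot>
      ?T \<rhd> evth (bcarr M) (?T \<otimes> W) \<cdot> cl M ((bcarr M)\<^sup>\<dagger> \<otimes> (?T \<otimes> W))"
    if W [simp]: "W \<in> Mor1 B" "tgt B W = fst (btgt M)" for W
  proof -
    let ?g = "nakayama B (tgt_alg M) \<lhd> W"
      and ?e = "\<lambda>V. ?T \<rhd> evth (bcarr M) V \<cdot> cl M ((bcarr M)\<^sup>\<dagger> \<otimes> V)"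
    have "evth (bcarr M) W \<cdot> bcarr M \<rhd> ra ?R W
      = (evth (bcarr M) W \<cdot> bcarr M \<rhd> ra (dual_bimod B M) W) \<cdot> bcarr M \<rhd> (bcarr M)\<^sup>\<dagger> \<rhd> ?g"
      using act_cell[of "dual_bimod B M" W] by (simp add: star_act(4))
    also have "\<dots> = evth ?T W \<cdot> ?T \<rhd> sg (btgt M) W \<cdot>
        (?e (?T \<otimes> W) \<cdot> bcarr M \<rhd> (bcarr M)\<^sup>\<dagger> \<rhd> ?g)"
      unfolding evth_ra_dual[OF M W] by simp
    \<comment> \<open>Naturality of the coaction and of the evaluation carries the twist from the
      far right of the dual to the second slot of the pairing.\<close>
    also have "?e (?T \<otimes> W) \<cdot> bcarr M \<rhd> (bcarr M)\<^sup>\<dagger> \<rhd> ?g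
      = ?T \<rhd> (evth (bcarr M) (?T \<otimes> W) \<cdot> bcarr M \<rhd> (bcarr M)\<^sup>\<dagger> \<rhd> ?g) \<cdot> cl M ((bcarr M)\<^sup>\<dagger> \<otimes> (?T \<otimes> W))"
      using cl_natural[of M "(bcarr M)\<^sup>\<dagger> \<rhd> ?g"] by simp
    also have "\<dots> = ?T \<rhd> ?g \<cdot> ?e (?T \<otimes> W)"
      by (subst evth_pull) simp_all
    also have "evth ?T W \<cdot> ?T \<rhd> sg (btgt M) W \<cdot> (?T \<rhd> ?g \<cdot> ?e (?T \<otimes> W))
      = (evth ?T W \<cdot> ?T \<rhd> sg (btgt M) W \<cdot> ?T \<rhd> ?g) \<cdot> ?e (?T \<otimes> W)"
      by simp
    also have "\<dots> = pairing (btgt M) W \<cdot> ?e (?T \<otimes> W)"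
      by (subst nakayama_pairing(2)) simp_all
    finally show ?thesis .
  qed
  interpret prebimodule_adjunction B M ?R "evt B (bcarr M)" "coevt B (bcarr M)"
    by unfold_locales (simp_all add: dagger_right_adjoint)
  \<comment> \<open>In this instance these rules rewrite \<open>bsrc M\<close> and
    \<open>btgt M\<close> to the boundaries of \<open>right_star B M\<close>, which
    \<open>star_sel\<close> rewrites back; together they would loop.\<close>
  note [simp del] = bsrc_L btgt_L
  interpret bimodule_adjunction B M ?R "evt B (bcarr M)" "coevt B (bcarr M)"
    by unfold_locales (use mate_bimodule_R[OF M] bal mate in simp_all)
  show ?thesis
    unfolding is_right_adjoint_of_def using Beq_adjunction by blast
qed

end

theorem proposition4p7:
  fixes B :: "('o, 'm, 'c) pivotal_bicat"
  assumes "pivotal_bicategory B"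
    and "idempotent_complete_homs B"
  shows "has_adjoints (equivariant_completion B) \<and>
    (\<forall>X \<in> Mor1 (equivariant_completion B).
       is_left_adjoint_of (equivariant_completion B) (left_star B X) X \<and>
       is_right_adjoint_of (equivariant_completion B) (right_star B X) X)"
proof -
  interpret pivotal_bicategory B by fact
  interpret idempotent_complete_pivotal_bicategory B
    by unfold_locales fact
  have "is_left_adjoint_of Beq (left_star B X) X \<and> is_right_adjoint_of Beq (right_star B X) X"
    if "X \<in> Mor1 Beq" for X
    using that by (simp add: left_star_adjoint right_star_adjoint)
  then show ?thesis unfolding has_adjoints_def by blast
qed

end
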